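(* Let $w$ be a real-valued function on $\Omega$ such that $w(\Phi^{-1}(z))$, as a function of $z\in B_{r_0}$, belongs to $M$. Then there exists a unique solution $\mathbf{v}$ of the problem $$\operatorname{div}\mathbf{v}=0,\quad \operatorname{curl}\mathbf{v}=w\ \text{ in }\Omega,\qquad \mathbf{v}=0\ \text{ on }\partial\Omega,\qquad \mathbf{v}(\mathbf{x})\to\mathbf{v}_\infty\ \text{ as }|\mathbf{x}|\to\infty,\qquad \lim_{R\to\infty}\oint_{|\mathbf{x}|=R}\mathbf{v}\cdot d\mathbf{l}=0 .$$ The Fourier coefficients $v_{r,k},v_{\varphi,k}$, $k\in\mathbb{Z}$, of the polar components of the vector field $\mathbf{v}(\Phi^{-1}(z))$ on $B_{r_0}$ belong to $L_\infty(r_0,\infty)$ and are given by $$v_{r,k}(r)=\operatorname{sign}(k)\frac{ir^{-|k|-1}}{2}\int_{r_0}^r s^{|k|+1}\big(q_k-i\operatorname{sign}(k)r_k\big)ds+\operatorname{sign}(k)\frac{ir^{|k|-1}}{2}\int_r^\infty s^{-|k|+1}\big(q_k+i\operatorname{sign}(k)r_k\big)ds+v_{\infty,r,k},$$ $$v_{\varphi,k}(r)=\frac{r^{-|k|-1}}{2}\int_{r_0}^r s^{|k|+1}\big(q_k-i\operatorname{sign}(k)r_k\big)ds-\frac{r^{|k|-1}}{2}\int_r^\infty s^{-|k|+1}\big(q_k+i\operatorname{sign}(k)r_k\big)ds+v_{\infty,\phi,k},$$ where $q_k=q_k(s)$, $r_k=r_k(s)$ under the integrals.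
   Context: Points $\mathbf{x}=(x_1,x_2)\in\mathbb{R}^2$ are identified with $z=x_1+ix_2=re^{i\varphi}\in\mathbb{C}$; for $\mathbf{v}=(v_1,v_2)$, $\operatorname{curl}\mathbf{v}=\partial_{x_1}v_2-\partial_{x_2}v_1$. Let $r_0>0$ and $B_{r_0}=\{\mathbf{x}\in\mathbb{R}^2:|\mathbf{x}|>r_0\}$. Let $\Omega=\mathbb{R}^2\setminus B$, where $B$ is a bounded simply connected domain with piecewise smooth boundary, and let $\Phi$ be a Riemann (conformal) mapping of $\Omega$ onto $B_{r_0}$ such that $\Phi(z)=z+O(1/z)$ and $\Phi'(z)=1+O(1/z^2)$ as $z\to\infty$. A vector field $\mathbf{v}$ and a function $w$ on $\Omega$ define the vector field $\mathbf{v}(\Phi^{-1}(z))$ and the function $w(\Phi^{-1}(z))$ on $B_{r_0}$. For a function $f$ on $B_{r_0}$, $[f]_k(r)=\frac1{2\pi}\int_0^{2\pi}f(r,\varphi)e^{-ik\varphi}\,d\varphi$. For the vector field $\mathbf{v}(\Phi^{-1}(z))=(v_1,v_2)$ at $z=re^{i\varphi}$, the polar components are $v_r=v_1\cos\varphi+v_2\sin\varphi$ and $v_\varphi=v_2\cos\varphi-v_1\sin\varphi$, with Fourier coefficients $v_{r,k}=[v_r]_k$, $v_{\varphi,k}=[v_\varphi]_k$. Further, for $k\in\mathbb{Z}$, $$r_k(r)=\big[\operatorname{Im}\overline{(\Phi^{-1})'(z)}\;w(\Phi^{-1}(z))\big]_k,\qquad q_k(r)=\big[\operatorname{Re}\overline{(\Phi^{-1})'(z)}\;w(\Phi^{-1}(z))\big]_k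 .$$ The constant $\mathbf{v}_\infty=(v_{\infty,x},v_{\infty,y})\in\mathbb{R}^2$ is given, and $$v_{\infty,r,k}=\frac{\delta_{|k|,1}}{2}(v_{\infty,x}-ik\,v_{\infty,y}),\qquad v_{\infty,\phi,k}=\frac{\delta_{|k|,1}}{2}(v_{\infty,y}+ik\,v_{\infty,x}).$$ Convention: $\operatorname{sign}(k)=1$ for $k\ge0$ and $\operatorname{sign}(k)=-1$ for $k<0$. The affine subspace $M$ is $$M=\Big\{f\in L_1(B_{r_0})\ \Big|\ \int_{B_{r_0}}\overline{(\Phi^{-1})'(z)}\,\frac{f(\mathbf{x})}{z^k}\,d\mathbf{x}=4\pi ik\,v_{\infty,r,k},\ k\ge0,\ k\in\mathbb{Z}\Big\}.$$
   Formalization: As w∘Φ^{-1} is only in L_1, solutions are meant weakly: div and curl as distributions, v=0 on ∂Ω as zero L_1 trace along |Φ|=r, v→v_∞ in means over unit discs, circulation limit over a.e. R, uniqueness and formulas a.e.; pointwise convergence can fail for w in M. *)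

theory Defs
  imports "HOL-Complex_Analysis.Complex_Analysis" "HOL-Library.Landau_Symbols"
begin

text \<open>The plane is identified with \<^typ>\<open>complex\<close>, for points and for vectors: a field
  $(v_1,v_2)$ is the function $v_1 + i v_2$, so that \<open>\<bullet>\<close> is the Euclidean
  scalar product. ``Measurable'' and ``integrable'' refer to the completed Lebesgue measure.\<close>

section \<open>The domain and the conformal map\<close>

text \<open>Piecewise smooth in the usual sense: finitely many arcs, each regular and $C^1$ up to
  its end points.\<close>

definition piecewise_smooth_path :: "(real \<Rightarrow> complex) \<Rightarrow> bool" where
  "piecewise_smooth_path \<gamma> \<longleftrightarrow>
     path \<gamma> \<and>
     (\<exists>S. finite S \<and> {0, 1} \<subseteq> S \<and> S \<subseteq> {0..1} \<and>
        (\<forall>a\<in>S. \<forall>b\<in>S. a < b \<and> {a<..<b} \<inter> S = {} \<longrightarrow>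
           (\<exists>\<gamma>'. continuous_on {a..b} \<gamma>' \<and>
              (\<forall>t\<in>{a..b}. \<gamma>' t \<noteq> 0 \<and>
                 (\<gamma> has_vector_derivative \<gamma>' t) (at t within {a..b})))))"

definition sc_domain_piecewise_smooth :: "complex set \<Rightarrow> bool" where
  "sc_domain_piecewise_smooth B \<longleftrightarrow>
     open B \<and> connected B \<and> B \<noteq> {} \<and> bounded B \<and> simply_connected B \<and>
     (\<exists>\<gamma>. simple_path \<gamma> \<and> pathfinish \<gamma> = pathstart \<gamma> \<and> piecewise_smooth_path \<gamma> \<and>
          frontier B = path_image \<gamma>)"

definition disc_exterior :: "real \<Rightarrow> complex set" where
  "disc_exterior r0 = {z. r0 < cmod z}"

definition exterior_riemann_map :: "complex set \<Rightarrow> real \<Rightarrow> (complex \<Rightarrow> complex) \<Rightarrow> bool" where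
  "exterior_riemann_map \<Omega> r0 \<Phi> \<longleftrightarrow>
     \<Phi> holomorphic_on \<Omega> \<and> inj_on \<Phi> \<Omega> \<and> \<Phi> ` \<Omega> = disc_exterior r0 \<and>
     (\<lambda>z. \<Phi> z - z) \<in> O[at_infinity](\<lambda>z. 1 / z) \<and>
     (\<lambda>z. deriv \<Phi> z - 1) \<in> O[at_infinity](\<lambda>z. 1 / z ^ 2)"

section \<open>The system with integrable vorticity\<close>

text \<open>The vorticity is only integrable, so div and curl are taken in the sense of distributions.
  \<open>test_function \<Omega> \<eta> g\<close>: \<open>\<eta>\<close> is a $C^1$ function with compact support in \<open>\<Omega>\<close>
  and gradient \<open>g\<close>.\<close>

definition test_function ::
    "complex set \<Rightarrow> (complex \<Rightarrow> real) \<Rightarrow> (complex \<Rightarrow> complex) \<Rightarrow> bool" where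
  "test_function \<Omega> \<eta> g \<longleftrightarrow>
     (\<forall>x. GDERIV \<eta> x :> g x) \<and> continuous_on UNIV g \<and>
     (\<exists>K. compact K \<and> K \<subseteq> \<Omega> \<and> (\<forall>x. x \<notin> K \<longrightarrow> \<eta> x = 0))"

definition locally_integrable :: "complex set \<Rightarrow> (complex \<Rightarrow> complex) \<Rightarrow> bool" where
  "locally_integrable \<Omega> v \<longleftrightarrow>
     (\<forall>K. compact K \<and> K \<subseteq> \<Omega> \<longrightarrow> set_integrable lebesgue K v)"

definition has_weak_div ::
    "complex set \<Rightarrow> (complex \<Rightarrow> complex) \<Rightarrow> (complex \<Rightarrow> real) \<Rightarrow> bool" where
  "has_weak_div \<Omega> v d \<longleftrightarrow>
     (\<forall>\<eta> g. test_function \<Omega> \<eta> g \<longrightarrow>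
        (LINT x:\<Omega>|lebesgue. Re (v x) * Re (g x) + Im (v x) * Im (g x))
          = - (LINT x:\<Omega>|lebesgue. d x * \<eta> x))"

definition has_weak_curl ::
    "complex set \<Rightarrow> (complex \<Rightarrow> complex) \<Rightarrow> (complex \<Rightarrow> real) \<Rightarrow> bool" where
  "has_weak_curl \<Omega> v c \<longleftrightarrow>
     (\<forall>\<eta> g. test_function \<Omega> \<eta> g \<longrightarrow>
        (LINT x:\<Omega>|lebesgue. Im (v x) * Re (g x) - Re (v x) * Im (g x))
          = - (LINT x:\<Omega>|lebesgue. c x * \<eta> x))"

text \<open>A solution of the system with integrable vorticity is in general neither continuous up to
  the boundary nor pointwise convergent at infinity; both conditions are imposed on local means.
  The boundary condition is the vanishing of the $L_1$ trace, taken along the images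
  $|\Phi(x)| = r$, $r \to r_0$, of circles. With \<open>\<Psi>\<close> $= \Phi^{-1}$, a field \<open>v\<close> that is
  continuous up to the boundary satisfies it iff $v = 0$ on the boundary. The lower integrals
  (with values in \<^typ>\<open>ennreal\<close>) also force the means to be finite.\<close>

definition zero_boundary_trace ::
    "real \<Rightarrow> (complex \<Rightarrow> complex) \<Rightarrow> (complex \<Rightarrow> complex) \<Rightarrow> bool" where
  "zero_boundary_trace r0 \<Psi> v \<longleftrightarrow>
     ((\<lambda>\<delta>. (\<integral>\<^sup>+z\<in>{z. r0 < cmod z \<and> cmod z < r0 + \<delta>}. ennreal (cmod (v (\<Psi> z))) \<partial>lebesgue)
            / ennreal \<delta>) \<longlongrightarrow> 0) (at_right 0)"

definition tends_at_infinity :: "(complex \<Rightarrow> complex) \<Rightarrow> complex \<Rightarrow> bool" where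
  "tends_at_infinity v v_inf \<longleftrightarrow>
     ((\<lambda>x. \<integral>\<^sup>+y\<in>ball x 1. ennreal (cmod (v y - v_inf)) \<partial>lebesgue) \<longlongrightarrow> 0) at_infinity"

text \<open>For a locally integrable field the circulation is defined for almost every radius, so its
  limit is an essential limit.\<close>

definition circulation :: "(complex \<Rightarrow> complex) \<Rightarrow> real \<Rightarrow> real" where
  "circulation v R = (LINT \<phi>:{0..2 * pi}|lebesgue. v (rcis R \<phi>) \<bullet> (\<i> * rcis R \<phi>))"

definition zero_circulation_at_infinity :: "(complex \<Rightarrow> complex) \<Rightarrow> bool" where
  "zero_circulation_at_infinity v \<longleftrightarrow>
     (circulation v \<longlongrightarrow> 0) (inf at_top (ae_filter lebesgue))"

definition is_solution ::
    "complex set \<Rightarrow> real \<Rightarrow> (complex \<Rightarrow> complex) \<Rightarrow> (complex \<Rightarrow> real) \<Rightarrow> complex \<Rightarrow>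
     (complex \<Rightarrow> complex) \<Rightarrow> bool" where
  "is_solution \<Omega> r0 \<Psi> w v_inf v \<longleftrightarrow>
     locally_integrable \<Omega> v \<and>
     has_weak_div \<Omega> v (\<lambda>_. 0) \<and>
     has_weak_curl \<Omega> v w \<and>
     zero_boundary_trace r0 \<Psi> v \<and>
     tends_at_infinity v v_inf \<and>
     zero_circulation_at_infinity v"

section \<open>Fourier coefficients\<close>

definition fourier_coeff :: "(complex \<Rightarrow> complex) \<Rightarrow> int \<Rightarrow> real \<Rightarrow> complex" where
  "fourier_coeff f k r =
     1 / (2 * pi) * (LINT \<phi>:{0..2 * pi}|lebesgue. f (rcis r \<phi>) * exp (- \<i> * of_int k * of_real \<phi>))"

definition radial_part :: "(complex \<Rightarrow> complex) \<Rightarrow> complex \<Rightarrow> real" where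
  "radial_part u z = Re (u z) * cos (Arg z) + Im (u z) * sin (Arg z)"

definition angular_part :: "(complex \<Rightarrow> complex) \<Rightarrow> complex \<Rightarrow> real" where
  "angular_part u z = Im (u z) * cos (Arg z) - Re (u z) * sin (Arg z)"

definition v_r :: "(complex \<Rightarrow> complex) \<Rightarrow> (complex \<Rightarrow> complex) \<Rightarrow> int \<Rightarrow> real \<Rightarrow> complex" where
  "v_r \<Psi> v k = fourier_coeff (\<lambda>z. of_real (radial_part (\<lambda>\<zeta>. v (\<Psi> \<zeta>)) z)) k"

definition v_phi :: "(complex \<Rightarrow> complex) \<Rightarrow> (complex \<Rightarrow> complex) \<Rightarrow> int \<Rightarrow> real \<Rightarrow> complex" where
  "v_phi \<Psi> v k = fourier_coeff (\<lambda>z. of_real (angular_part (\<lambda>\<zeta>. v (\<Psi> \<zeta>)) z)) k"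

definition r_coeff :: "(complex \<Rightarrow> complex) \<Rightarrow> (complex \<Rightarrow> real) \<Rightarrow> int \<Rightarrow> real \<Rightarrow> complex" where
  "r_coeff \<Psi> w k = fourier_coeff (\<lambda>z. of_real (Im (cnj (deriv \<Psi> z)) * w (\<Psi> z))) k"

definition q_coeff :: "(complex \<Rightarrow> complex) \<Rightarrow> (complex \<Rightarrow> real) \<Rightarrow> int \<Rightarrow> real \<Rightarrow> complex" where
  "q_coeff \<Psi> w k = fourier_coeff (\<lambda>z. of_real (Re (cnj (deriv \<Psi> z)) * w (\<Psi> z))) k"

definition v_inf_r :: "complex \<Rightarrow> int \<Rightarrow> complex" where
  "v_inf_r v_inf k = of_bool (\<bar>k\<bar> = 1) / 2 * (of_real (Re v_inf) - \<i> * of_int k * of_real (Im v_inf))"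

definition v_inf_phi :: "complex \<Rightarrow> int \<Rightarrow> complex" where
  "v_inf_phi v_inf k = of_bool (\<bar>k\<bar> = 1) / 2 * (of_real (Im v_inf) + \<i> * of_int k * of_real (Re v_inf))"

text \<open>Unlike \<^const>\<open>sgn\<close>, this sign is $1$ at $0$.\<close>

definition sign1 :: "int \<Rightarrow> complex" where
  "sign1 k = (if k \<ge> 0 then 1 else - 1)"

definition L_infinity :: "real \<Rightarrow> (real \<Rightarrow> complex) \<Rightarrow> bool" where
  "L_infinity r0 f \<longleftrightarrow>
     f \<in> borel_measurable (lebesgue_on {r0<..}) \<and>
     (\<exists>C. AE r in lebesgue_on {r0<..}. cmod (f r) \<le> C)"

section \<open>The affine space of vorticities\<close>

text \<open>\<open>deriv \<Psi>\<close> may be unbounded at corners, so the existence of the moment integrals does not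
  follow from the integrability of \<open>f\<close> and is part of the condition. As it includes \<open>k = 0\<close>, it
  also gives the absolute convergence of the radial integrals of \<^const>\<open>q_coeff\<close> and
  \<^const>\<open>r_coeff\<close> in the theorem.\<close>

definition M_space :: "real \<Rightarrow> (complex \<Rightarrow> complex) \<Rightarrow> complex \<Rightarrow> (complex \<Rightarrow> complex) set" where
  "M_space r0 \<Psi> v_inf =
     {f. set_integrable lebesgue (disc_exterior r0) f \<and>
         (\<forall>k::nat.
            set_integrable lebesgue (disc_exterior r0) (\<lambda>z. cnj (deriv \<Psi> z) * (f z / z ^ k)) \<and>
            (LINT z:disc_exterior r0|lebesgue. cnj (deriv \<Psi> z) * (f z / z ^ k))
              = 4 * of_real pi * \<i> * of_nat k * v_inf_r v_inf (int k))}"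

end

theory Submission
  imports Defs
begin

text \<open>
Write a field as a complex function \<open>v = v\<^sub>1 + i v\<^sub>2\<close> and pass to its conjugate. The two equations
div \<open>v = 0\<close>, curl \<open>v = w\<close> then become the single equation \<open>dbar (cnj v) = - (i/2) w\<close>, where
\<open>dbar\<close> is the Wirtinger derivative with respect to \<open>cnj z\<close>. This equation transforms well under
conformal maps: \<open>U = (cnj v) o \<Psi>\<close> satisfies \<open>dbar U = - (i/2) w_star = \<pi> * source\<close> on \<open>|\<zeta>| > r0\<close>, with
\<open>w_star = cnj \<Psi>' * (w o \<Psi>)\<close>, the function whose Fourier coefficients are \<open>q\<^sub>k + i r\<^sub>k\<close> and whose
moments are prescribed by the affine space \<open>M\<close>. A particular solution is the Cauchy transform
\<open>C(\<zeta>)\<close>, the integral of \<open>source(\<xi>) / (\<zeta> - \<xi>)\<close>; that it solves the equation is the Cauchy-Pompeiu formula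
and Fubini (\<open>cauchy_pompeiu\<close>, \<open>cauchy_transform_weak_dbar\<close>).

Existence. For \<open>|\<zeta>| < r0\<close> expand \<open>1/(\<zeta> - \<xi>)\<close> into a geometric series in \<open>\<zeta>/\<xi>\<close>: the Taylor
coefficients of \<open>C\<close> in the disc are the moments of the source, and membership in \<open>M\<close> says that
\<open>C\<close> equals the constant \<open>- cnj v_inf\<close> there (\<open>cauchy_transform_inside_disc\<close>, \<open>source_moment\<close>). Hence
\<open>U = C + cnj v_inf\<close> vanishes inside the disc. No continuity across the circle is available for an
integrable source, but the \<open>L\<^sub>1\<close> trace still vanishes: compare \<open>C(\<zeta>)\<close> with its value at the mirror
point \<open>\<zeta>' = r0\<^sup>2 / cnj \<zeta>\<close>. The difference of the two kernels, averaged over the annulus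
\<open>r0 < |\<zeta>| < r0 + \<delta>\<close>, is bounded uniformly in \<open>\<xi>\<close> and tends to \<open>0\<close> with \<open>\<delta>\<close> for each \<open>\<xi>\<close>, so
dominated convergence applies (\<open>cauchy_transform_boundary_trace\<close>). At infinity the local means of \<open>C\<close>
tend to \<open>0\<close>, again by dominated convergence. The circulation along \<open>|z| = R\<close> tends to a multiple of
the moment of order \<open>0\<close> of the source, which is \<open>0\<close> (\<open>solution_circulation\<close>).

Uniqueness. The difference of two solutions gives a locally integrable \<open>U\<close> with \<open>dbar U = 0\<close> and vanishing
trace. Testing the equation with functions \<open>G(|z|) z\<^sup>m\<close> shows that the
Fourier coefficients of \<open>U\<close> on circles are constant multiples of \<open>r\<^sup>k\<close>, and the trace condition makes
the constants \<open>0\<close>. A function on the circle with vanishing Fourier coefficients is \<open>0\<close> almost everywhere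
(\<open>fourier_uniqueness\<close>), hence \<open>U = 0\<close> (\<open>dbar_zero_trace_uniqueness\<close>).

Formulas. The polar components of \<open>v o \<Psi>\<close> are the real part and minus the imaginary part of
\<open>U(\<zeta>) e\<^sup>i\<^sup>\<phi>\<close>, so their coefficients of order \<open>k\<close> are combinations of the coefficients of \<open>U\<close> of order
\<open>k - 1\<close> and \<open>- k - 1\<close> (\<open>polar_coefficients\<close>). The Fourier coefficients of the kernel \<open>1/(\<zeta> - \<xi>)\<close> on
\<open>|\<zeta>| = r\<close> are \<open>- r\<^sup>j / \<xi>\<^sup>j\<^sup>+\<^sup>1\<close> with \<open>j \<ge> 0\<close> if \<open>|\<xi>| > r\<close>, and \<open>r\<^sup>j / \<xi>\<^sup>j\<^sup>+\<^sup>1\<close> with \<open>j < 0\<close> if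
\<open>|\<xi>| < r\<close>; polar coordinates in \<open>\<xi>\<close> turn the resulting plane integrals into the radial ones of the theorem
(\<open>cauchy_transform_circle_coeff\<close>). The same expression bounds all coefficients by a multiple
of the \<open>L\<^sub>1\<close> norm of the source.
\<close>

section \<open>Change of variables and polar coordinates in the complex plane\<close>

lemma borel_measurable_Complex:
  "(\<lambda>(x, y). Complex x y) \<in> borel_measurable (lborel \<Otimes>\<^sub>M lborel)"
  unfolding lborel_prod case_prod_beta' Complex_eq
  by (auto intro!: borel_measurable_continuous_onI continuous_intros)

lemma distr_Complex_lborel:
  "distr (lborel \<Otimes>\<^sub>M lborel) borel (\<lambda>(x, y). Complex x y) = lborel"
proof (rule lborel_eqI[symmetric])
  fix l u :: complex
  assume lu: "\<And>b. b \<in> Basis \<Longrightarrow> l \<bullet> b \<le> u \<bullet> b"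
  have "(\<lambda>(x, y). Complex x y) -` box l u \<inter> space (lborel \<Otimes>\<^sub>M lborel)
      = {Re l<..<Re u} \<times> {Im l<..<Im u}"
    by (auto simp: box_def Basis_complex_def inner_complex_def space_pair_measure)
  then have "emeasure (distr (lborel \<Otimes>\<^sub>M lborel) borel (\<lambda>(x, y). Complex x y)) (box l u)
      = emeasure (lborel \<Otimes>\<^sub>M lborel) ({Re l<..<Re u} \<times> {Im l<..<Im u})"
    by (subst emeasure_distr[OF borel_measurable_Complex]) auto
  also have "\<dots> = ennreal (Re u - Re l) * ennreal (Im u - Im l)"
    using lu[of 1] lu[of \<i>] by (subst lborel.emeasure_pair_measure_Times) (auto simp: Basis_complex_def)
  also have "\<dots> = (\<Prod>b\<in>Basis. (u - l) \<bullet> b)"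
    using lu[of 1] lu[of \<i>] by (auto simp: Basis_complex_def ennreal_mult)
  finally show "emeasure (distr (lborel \<Otimes>\<^sub>M lborel) borel (\<lambda>(x, y). Complex x y)) (box l u)
      = (\<Prod>b\<in>Basis. (u - l) \<bullet> b)" .
qed simp

text \<open>The change of variables theorem is formulated with matrices on \<open>real ^ 2\<close>; the isometry with the
complex plane carries it over to complex functions.\<close>

definition vec2c :: "real ^ 2 \<Rightarrow> complex" where "vec2c x = Complex (x $ 1) (x $ 2)"
definition c2vec :: "complex \<Rightarrow> real ^ 2" where "c2vec z = vector [Re z, Im z]"

lemma c2vec_vec2c [simp]: "c2vec (vec2c x) = x"
  by (simp add: c2vec_def vec2c_def vec_eq_iff forall_2)
lemma vec2c_c2vec [simp]: "vec2c (c2vec z) = z"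
  by (simp add: c2vec_def vec2c_def)

lemma mem_image_vec2c: "z \<in> vec2c ` A \<longleftrightarrow> c2vec z \<in> A"
  by (auto intro: image_eqI[of _ _ "c2vec z"])
lemma mem_image_c2vec: "x \<in> c2vec ` A \<longleftrightarrow> vec2c x \<in> A"
  by (auto intro: image_eqI[of _ _ "vec2c x"])

lemma bounded_linear_c2vec: "bounded_linear c2vec"
  by (rule linear_conv_bounded_linear[THEN iffD1], rule linearI)
     (auto simp: c2vec_def vec_eq_iff forall_2)

lemma bounded_linear_vec2c: "bounded_linear vec2c"
  by (rule linear_conv_bounded_linear[THEN iffD1], rule linearI)
     (auto simp: vec2c_def complex_eq_iff)

text \<open>Both Lebesgue measures give a coordinate box the product of its side lengths, and boxes
determine the measure.\<close>

lemma distr_vec2c_lborel: "distr lborel borel vec2c = lborel"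
proof (rule lborel_eqI[symmetric])
  have m: "vec2c \<in> borel_measurable lborel"
    using bounded_linear_vec2c by (simp add: borel_measurable_continuous_onI linear_continuous_on)
  fix l u :: complex
  assume lu: "\<And>b. b \<in> Basis \<Longrightarrow> l \<bullet> b \<le> u \<bullet> b"
  have B2: "(Basis :: (real^2) set) = {axis 1 1, axis 2 1}"
    by (auto simp: Basis_vec_def) (metis exhaust_2)
  have B2_neq: "axis 1 1 \<noteq> (axis 2 1 :: real^2)" by (simp add: axis_eq_axis)
  have "vec2c -` box l u \<inter> space lborel = box (c2vec l) (c2vec u)"
    by (auto simp: box_def Basis_complex_def inner_complex_def vec2c_def c2vec_def B2 inner_axis)
  then have "emeasure (distr lborel borel vec2c) (box l u) = emeasure lborel (box (c2vec l) (c2vec u))"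
    by (subst emeasure_distr[OF m]) auto
  also have "\<dots> = (\<Prod>b\<in>Basis. (c2vec u - c2vec l) \<bullet> b)"
    by (subst emeasure_lborel_box) (use lu[of 1] lu[of \<i>] in \<open>auto simp: B2 inner_axis c2vec_def Basis_complex_def\<close>)
  also have "\<dots> = (\<Prod>b\<in>Basis. (u - l) \<bullet> b)"
    using B2_neq by (auto simp: B2 Basis_complex_def inner_axis c2vec_def)
  finally show "emeasure (distr lborel borel vec2c) (box l u) = (\<Prod>b\<in>Basis. (u - l) \<bullet> b)" .
qed simp

lemma vec2c_lebesgue: "vec2c \<in> lebesgue \<rightarrow>\<^sub>M lebesgue"
  and distr_vec2c_lebesgue: "distr lebesgue lebesgue vec2c = lebesgue"
proof -
  have m: "vec2c \<in> borel_measurable lborel"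
    using bounded_linear_vec2c by (simp add: borel_measurable_continuous_onI linear_continuous_on)
  then have m': "vec2c \<in> lborel \<rightarrow>\<^sub>M lborel" by simp
  have eq: "distr lebesgue lborel vec2c = lborel"
    using distr_completion[OF m'] distr_vec2c_lborel by (simp cong: distr_cong)
  show *: "vec2c \<in> lebesgue \<rightarrow>\<^sub>M lebesgue"
    by (rule completion.measurable_completion2) (use m' eq in \<open>auto simp: measurable_completion\<close>)
  show "distr lebesgue lebesgue vec2c = lebesgue"
    using completion.completion_distr_eq[of vec2c lborel lborel] m' eq by (simp add: measurable_completion)
qed

lemma measure_preserving_integral_vec2c:
  fixes f :: "complex \<Rightarrow> 'a::euclidean_space"
  shows "integrable lebesgue (\<lambda>x. f (vec2c x)) \<longleftrightarrow> integrable lebesgue f"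
    and "(LINT x|lebesgue. f (vec2c x)) = (LINT z|lebesgue. f z)"
proof -
  have c2: "c2vec \<in> lebesgue \<rightarrow>\<^sub>M lebesgue"
  proof (rule measurableI)
    fix A :: "(real^2) set" assume A: "A \<in> sets lebesgue"
    have "c2vec -` A \<inter> space lebesgue = vec2c ` A" by (auto simp: mem_image_vec2c)
    moreover have "vec2c ` A \<in> sets lebesgue"
      by (rule differentiable_image_in_sets_lebesgue[OF A])
         (auto simp: bounded_linear_vec2c bounded_linear_imp_differentiable_on)
    ultimately show "c2vec -` A \<inter> space lebesgue \<in> sets lebesgue" by simp
  qed simp
  show *: "integrable lebesgue (\<lambda>x. f (vec2c x)) \<longleftrightarrow> integrable lebesgue f"
  proof
    assume "integrable lebesgue f"
    then show "integrable lebesgue (\<lambda>x. f (vec2c x))"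
      by (subst (asm) distr_vec2c_lebesgue[symmetric], subst (asm) integrable_distr_eq) (auto simp: vec2c_lebesgue)
  next
    assume i: "integrable lebesgue (\<lambda>x. f (vec2c x))"
    then have "(\<lambda>x. f (vec2c (c2vec x))) \<in> borel_measurable lebesgue"
      using measurable_compose[OF c2 borel_measurable_integrable[OF i]] by simp
    then have "f \<in> borel_measurable lebesgue" by simp
    with i show "integrable lebesgue f"
      by (subst distr_vec2c_lebesgue[symmetric], subst integrable_distr_eq) (auto simp: vec2c_lebesgue)
  qed
  show "(LINT x|lebesgue. f (vec2c x)) = (LINT z|lebesgue. f z)"
  proof (cases "integrable lebesgue f")
    case True
    then show ?thesis
      using integral_distr[OF vec2c_lebesgue borel_measurable_integrable[OF True]]
      by (simp add: distr_vec2c_lebesgue)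
  qed (use * in \<open>simp add: not_integrable_integral_eq\<close>)
qed

text \<open>The real linear map \<open>h \<mapsto> a h + b (cnj h)\<close> has determinant \<open>|a|\<^sup>2 - |b|\<^sup>2\<close>. For polar coordinates both
\<open>a\<close> and \<open>b\<close> occur; for a conformal map \<open>b = 0\<close>.\<close>

lemma set_integral_change_of_variables_complex:
  fixes f g a b :: "complex \<Rightarrow> complex"
  assumes S: "S \<in> sets lebesgue"
    and der: "\<And>z. z \<in> S \<Longrightarrow> (g has_derivative (\<lambda>h. a z * h + b z * cnj h)) (at z within S)"
    and inj: "inj_on g S"
  shows "set_integrable lebesgue S (\<lambda>z. \<bar>(cmod (a z))\<^sup>2 - (cmod (b z))\<^sup>2\<bar> *\<^sub>R f (g z))
      \<longleftrightarrow> set_integrable lebesgue (g ` S) f"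
    and "(LINT z:S|lebesgue. \<bar>(cmod (a z))\<^sup>2 - (cmod (b z))\<^sup>2\<bar> *\<^sub>R f (g z))
      = (LINT z:g ` S|lebesgue. f z)"
proof -
  define S' where "S' = c2vec ` S"
  define g' where "g' = (\<lambda>x. c2vec (g (vec2c x)))"
  define f' where "f' = (\<lambda>x. c2vec (f (vec2c x)))"
  define D where "D = (\<lambda>x h. c2vec (a (vec2c x) * vec2c h + b (vec2c x) * cnj (vec2c h)))"
  define j where "j = (\<lambda>z. \<bar>(cmod (a z))\<^sup>2 - (cmod (b z))\<^sup>2\<bar>)"
  interpret c: bounded_linear c2vec by (rule bounded_linear_c2vec)
  interpret v: bounded_linear vec2c by (rule bounded_linear_vec2c)
  have S': "S' \<in> sets lebesgue"
    unfolding S'_def by (rule differentiable_image_in_sets_lebesgue[OF S])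
         (auto simp: bounded_linear_c2vec bounded_linear_imp_differentiable_on)
  have vS: "vec2c ` S' = S" by (auto simp: S'_def image_image)
  have der': "(g' has_derivative D x) (at x within S')" if "x \<in> S'" for x
  proof -
    have d: "(g has_derivative (\<lambda>h. a (vec2c x) * h + b (vec2c x) * cnj h)) (at (vec2c x) within vec2c ` S')"
      unfolding vS by (rule der) (use that in \<open>auto simp: S'_def\<close>)
    have "((\<lambda>x. g (vec2c x)) has_derivative (\<lambda>h. a (vec2c x) * vec2c h + b (vec2c x) * cnj (vec2c h))) (at x within S')"
      by (rule has_derivative_in_compose[OF v.has_derivative[OF has_derivative_ident] d])
    from c.has_derivative[OF this] show ?thesis by (simp add: g'_def D_def)
  qed
  have inj': "inj_on g' S'"
  proof (rule inj_onI)
    fix x y assume xy: "x \<in> S'" "y \<in> S'" "g' x = g' y"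
    have "vec2c (g' x) = vec2c (g' y)" using xy by simp
    then have "g (vec2c x) = g (vec2c y)" by (simp add: g'_def)
    with inj have "vec2c x = vec2c y" by (rule inj_onD) (use xy in \<open>auto simp: S'_def\<close>)
    then have "c2vec (vec2c x) = c2vec (vec2c y)" by (rule arg_cong)
    then show "x = y" by simp
  qed
  have det: "\<bar>det (matrix (D x))\<bar> = j (vec2c x)" for x
  proof -
    have "det (matrix (D x)) = (cmod (a (vec2c x)))\<^sup>2 - (cmod (b (vec2c x)))\<^sup>2"
      by (simp add: det_2 matrix_def D_def c2vec_def vec2c_def axis_def cmod_def power2_eq_square algebra_simps)
    then show ?thesis by (simp add: j_def)
  qed
  have gS: "g' ` S' = c2vec ` (g ` S)" by (auto simp: S'_def g'_def image_image)
  have A: "set_integrable lebesgue (c2vec ` T) (\<lambda>x. c2vec (h (vec2c x))) \<longleftrightarrow> set_integrable lebesgue T h" (is ?A)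
    and B: "set_integrable lebesgue T h \<Longrightarrow> (LINT x:c2vec ` T|lebesgue. c2vec (h (vec2c x))) = c2vec (LINT z:T|lebesgue. h z)"
    for T and h :: "complex \<Rightarrow> complex"
  proof -
    have i: "indicator (c2vec ` T) x = (indicator T (vec2c x) :: real)" for x
      by (simp add: indicator_def mem_image_c2vec)
    have eq: "indicator (c2vec ` T) x *\<^sub>R c2vec (h (vec2c x)) = c2vec (indicator T (vec2c x) *\<^sub>R h (vec2c x))" for x
      by (simp add: i c.scaleR)
    have "integrable lebesgue (\<lambda>x. c2vec (indicator T (vec2c x) *\<^sub>R h (vec2c x)))
       \<longleftrightarrow> integrable lebesgue (\<lambda>x. indicator T (vec2c x) *\<^sub>R h (vec2c x))"
    proof
      assume "integrable lebesgue (\<lambda>x. c2vec (indicator T (vec2c x) *\<^sub>R h (vec2c x)))"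
      from integrable_bounded_linear[OF bounded_linear_vec2c this]
      show "integrable lebesgue (\<lambda>x. indicator T (vec2c x) *\<^sub>R h (vec2c x))" by simp
    qed (rule integrable_bounded_linear[OF bounded_linear_c2vec])
    then show ?A
      unfolding set_integrable_def eq
      using measure_preserving_integral_vec2c(1)[of "\<lambda>z. indicator T z *\<^sub>R h z"] by blast
    assume "set_integrable lebesgue T h"
    then have "integrable lebesgue (\<lambda>x. indicator T (vec2c x) *\<^sub>R h (vec2c x))"
      unfolding set_integrable_def using measure_preserving_integral_vec2c(1)[of "\<lambda>z. indicator T z *\<^sub>R h z"] by blast
    from integral_bounded_linear[OF bounded_linear_c2vec this]
    show "(LINT x:c2vec ` T|lebesgue. c2vec (h (vec2c x))) = c2vec (LINT z:T|lebesgue. h z)"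
      unfolding set_lebesgue_integral_def eq
      using measure_preserving_integral_vec2c(2)[of "\<lambda>z. indicator T z *\<^sub>R h z"] by simp
  qed
  have jf: "(\<lambda>x. \<bar>det (matrix (D x))\<bar> *\<^sub>R f' (g' x)) = (\<lambda>x. c2vec (j (vec2c x) *\<^sub>R f (g (vec2c x))))"
    by (simp add: det f'_def g'_def c.scaleR)
  define G where "G = (\<lambda>x. c2vec (j (vec2c x) *\<^sub>R f (g (vec2c x))))"
  define T where "T = c2vec ` g ` S"
  note cov = has_absolute_integral_change_of_variables[OF S' der' inj', of f', unfolded jf gS, folded G_def T_def]
  have cov1: "G absolutely_integrable_on S' \<longleftrightarrow> f' absolutely_integrable_on T"
    using cov[of "integral S' G"] cov[of "integral T f'"] by blast
  have cov2: "integral S' G = integral T f'" if "f' absolutely_integrable_on T"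
    using cov[of "integral T f'"] that by blast
  have AS: "G absolutely_integrable_on S' \<longleftrightarrow> set_integrable lebesgue S (\<lambda>z. j z *\<^sub>R f (g z))"
    unfolding S'_def G_def using A[of S "\<lambda>z. j z *\<^sub>R f (g z)"] by simp
  have AT: "f' absolutely_integrable_on T \<longleftrightarrow> set_integrable lebesgue (g ` S) f"
    unfolding T_def f'_def using A[of "g ` S" f] by simp
  have I: "set_integrable lebesgue S (\<lambda>z. j z *\<^sub>R f (g z)) \<longleftrightarrow> set_integrable lebesgue (g ` S) f"
    using cov1 AS AT by simp
  then show "set_integrable lebesgue S (\<lambda>z. \<bar>(cmod (a z))\<^sup>2 - (cmod (b z))\<^sup>2\<bar> *\<^sub>R f (g z))
      \<longleftrightarrow> set_integrable lebesgue (g ` S) f" by (simp add: j_def)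
  have "(LINT z:S|lebesgue. j z *\<^sub>R f (g z)) = (LINT z:g ` S|lebesgue. f z)"
  proof (cases "set_integrable lebesgue (g ` S) f")
    case True
    then have 1: "set_integrable lebesgue S (\<lambda>z. j z *\<^sub>R f (g z))" using I by simp
    have "c2vec (LINT z:S|lebesgue. j z *\<^sub>R f (g z)) = (LINT x:S'|lebesgue. G x)"
      using B[OF 1] unfolding S'_def G_def by simp
    also have "\<dots> = integral S' G"
      by (rule set_lebesgue_integral_eq_integral(2)) (use AS 1 in simp)
    also have "\<dots> = integral T f'" by (rule cov2) (use AT True in simp)
    also have "\<dots> = (LINT x:T|lebesgue. f' x)"
      by (rule set_lebesgue_integral_eq_integral(2)[symmetric]) (use AT True in simp)
    also have "\<dots> = c2vec (LINT z:g ` S|lebesgue. f z)"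
      using B[OF True] unfolding T_def f'_def by simp
    finally have "c2vec (LINT z:S|lebesgue. j z *\<^sub>R f (g z)) = c2vec (LINT z:g ` S|lebesgue. f z)" .
    then show ?thesis by (metis vec2c_c2vec)
  next
    case False
    then show ?thesis using I unfolding set_integrable_def set_lebesgue_integral_def
      by (simp add: not_integrable_integral_eq)
  qed
  then show "(LINT z:S|lebesgue. \<bar>(cmod (a z))\<^sup>2 - (cmod (b z))\<^sup>2\<bar> *\<^sub>R f (g z))
      = (LINT z:g ` S|lebesgue. f z)" by (simp add: j_def)
qed

text \<open>The argument runs over the open interval, so that the map is injective; the price is the
positive half line, a null set.\<close>

lemma rcis_image_strip:
  "(\<lambda>z. rcis (Re z) (Im z)) ` {z. 0 < Re z \<and> 0 < Im z \<and> Im z < 2 * pi} = - \<real>\<^sub>\<ge>\<^sub>0"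
proof (rule antisym)
  show "(\<lambda>z. rcis (Re z) (Im z)) ` {z. 0 < Re z \<and> 0 < Im z \<and> Im z < 2 * pi} \<subseteq> - \<real>\<^sub>\<ge>\<^sub>0"
  proof clarify
    fix z :: complex assume z: "0 < Re z" "0 < Im z" "Im z < 2 * pi" "rcis (Re z) (Im z) \<in> \<real>\<^sub>\<ge>\<^sub>0"
    then have "sin (Im z) = 0" "cos (Im z) \<ge> 0"
      by (auto simp: complex_nonneg_Reals_iff rcis_def zero_le_mult_iff)
    moreover have "cos (Im z) \<noteq> 1"
    proof
      assume "cos (Im z) = 1"
      then obtain n :: int where n: "Im z = n * 2 * pi" by (auto simp: cos_one_2pi_int)
      with z have "0 < real_of_int n" "real_of_int n < 1" by (auto simp: zero_less_mult_iff)
      then show False by simp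
    qed
    moreover have "(sin (Im z))\<^sup>2 + (cos (Im z))\<^sup>2 = 1" by simp
    ultimately show False by (auto simp: power2_eq_1_iff)
  qed
  show "- \<real>\<^sub>\<ge>\<^sub>0 \<subseteq> (\<lambda>z. rcis (Re z) (Im z)) ` {z. 0 < Re z \<and> 0 < Im z \<and> Im z < 2 * pi}"
  proof
    fix w :: complex assume w: "w \<in> - \<real>\<^sub>\<ge>\<^sub>0"
    then have w0: "w \<noteq> 0" by auto
    have "Arg2pi w \<noteq> 0" using w by (auto simp: Arg2pi_eq_0 complex_nonneg_Reals_iff complex_is_Real_iff)
    then have "0 < Arg2pi w" "Arg2pi w < 2 * pi" using Arg2pi_ge_0[of w] Arg2pi_lt_2pi[of w] by auto
    moreover have "w = rcis (cmod w) (Arg2pi w)"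
      using Arg2pi_eq[of w] by (simp add: rcis_def cis_conv_exp)
    ultimately show "w \<in> (\<lambda>z. rcis (Re z) (Im z)) ` {z. 0 < Re z \<and> 0 < Im z \<and> Im z < 2 * pi}"
      using w0 by (intro image_eqI[of _ _ "Complex (cmod w) (Arg2pi w)"]) auto
  qed
qed

lemma inj_on_rcis_strip:
  "inj_on (\<lambda>z. rcis (Re z) (Im z)) {z. 0 < Re z \<and> 0 < Im z \<and> Im z < 2 * pi}"
proof (rule inj_onI)
  fix z w assume *: "z \<in> {z. 0 < Re z \<and> 0 < Im z \<and> Im z < 2 * pi}" "w \<in> {z. 0 < Re z \<and> 0 < Im z \<and> Im z < 2 * pi}"
    "rcis (Re z) (Im z) = rcis (Re w) (Im w)"
  have "Re z = cmod (rcis (Re z) (Im z))" "Re w = cmod (rcis (Re w) (Im w))" using *(1,2) by auto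
  then have R: "Re z = Re w" using *(3) by metis
  have "Arg2pi (rcis (Re z) (Im z)) = Im z"
    by (rule Arg2pi_unique[of "Re z"]) (use *(1) in \<open>auto simp: rcis_def cis_conv_exp\<close>)
  moreover have "Arg2pi (rcis (Re w) (Im w)) = Im w"
    by (rule Arg2pi_unique[of "Re w"]) (use *(2) in \<open>auto simp: rcis_def cis_conv_exp\<close>)
  ultimately have "Im z = Im w" using *(3) by simp
  then show "z = w" using R by (simp add: complex_eq_iff)
qed

lemma continuous_on_rcis [continuous_intros]:
  "continuous_on A f \<Longrightarrow> continuous_on A g \<Longrightarrow> continuous_on A (\<lambda>x. rcis (f x) (g x))"
  unfolding rcis_def by (intro continuous_intros)

lemma borel_measurable_rcis [measurable]:
  "f \<in> borel_measurable M \<Longrightarrow> g \<in> borel_measurable M \<Longrightarrow> (\<lambda>x. rcis (f x) (g x)) \<in> borel_measurable M"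
  unfolding rcis_def cis_conv_exp
  by (intro borel_measurable_times borel_measurable_of_real borel_measurable_continuous_on[of exp]) (auto intro!: continuous_intros)

text \<open>The Jacobian \<open>r\<close>, restricted to the closed strip \<open>r > 0\<close>, \<open>0 \<le> \<phi> \<le> 2 \<pi>\<close>. The closed interval
of angles is the one over which Fourier coefficients are integrated.\<close>

definition polar_density :: "real \<times> real \<Rightarrow> real" where
  "polar_density p = indicator ({0<..} \<times> {0..2 * pi}) p * fst p"

lemma polar_density_measurable [measurable]: "polar_density \<in> borel_measurable (lborel \<Otimes>\<^sub>M lborel)"
proof -
  have "{0::real<..} \<times> {0..2 * pi} \<in> sets (lborel \<Otimes>\<^sub>M (lborel :: real measure))" by (rule pair_measureI) auto
  then show ?thesis unfolding polar_density_def[abs_def] by (intro borel_measurable_times) auto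
qed

lemma polar_density_nonneg: "0 \<le> polar_density p"
  by (auto simp: polar_density_def indicator_def)

lemma rcis_measurable_pair [measurable]: "(\<lambda>(r, \<phi>). rcis r \<phi>) \<in> borel_measurable (lborel \<Otimes>\<^sub>M lborel)"
  unfolding case_prod_beta' by (intro borel_measurable_rcis) auto

text \<open>It suffices to compare both measures on boxes. The preimage of a box in the open strip is open,
and the change of variables theorem computes its weighted area.\<close>

lemma polar_coordinates_lborel:
  "distr (density (lborel \<Otimes>\<^sub>M lborel) polar_density) borel (\<lambda>(r, \<phi>). rcis r \<phi>) = lborel" (is "?D = _")
proof (rule lborel_eqI[symmetric])
  fix l u :: complex
  assume lu: "\<And>b. b \<in> Basis \<Longrightarrow> l \<bullet> b \<le> u \<bullet> b"
  define T where "T = {z. 0 < Re z \<and> 0 < Im z \<and> Im z < 2 * pi}"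
  define g where "g = (\<lambda>z. rcis (Re z) (Im z))"
  define S where "S = T \<inter> g -` box l u"
  have contg: "continuous_on UNIV g" unfolding g_def by (intro continuous_intros)
  have "open T" unfolding T_def by (intro open_Collect_conj open_Collect_less continuous_intros)
  then have "open S" unfolding S_def
    using continuous_open_vimage[OF open_box] contg by (auto simp: continuous_on_eq_continuous_at)
  then have S: "S \<in> sets borel" by auto
  have gS: "g ` S = box l u - \<real>\<^sub>\<ge>\<^sub>0"
  proof -
    have "g ` S = g ` T \<inter> box l u" by (auto simp: S_def)
    also have "g ` T = - \<real>\<^sub>\<ge>\<^sub>0" unfolding g_def T_def by (rule rcis_image_strip)
    finally show ?thesis by auto
  qed
  have neg: "(\<real>\<^sub>\<ge>\<^sub>0 :: complex set) \<in> null_sets lborel"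
  proof -
    have "negligible {z. z \<bullet> \<i> = 0}" by (rule negligible_standard_hyperplane) (simp add: Basis_complex_def)
    then have "negligible (\<real>\<^sub>\<ge>\<^sub>0 :: complex set)"
      by (rule negligible_subset) (auto simp: inner_complex_def complex_nonneg_Reals_iff)
    then show ?thesis
      by (simp add: negligible_iff_null_sets null_sets_completion_iff borel_closed)
  qed
  have der: "(g has_derivative (\<lambda>h. (cis (Im z) * (1 + Re z) / 2) * h + (cis (Im z) * (1 - Re z) / 2) * cnj h)) (at z within S)" for z
  proof -
    have "(g has_derivative (\<lambda>h. Re h * cis (Im z) + Re z * (\<i> * cis (Im z) * Im h))) (at z within S)"
    proof -
      have "g = (\<lambda>z. of_real (Re z * cos (Im z)) + \<i> * of_real (Re z * sin (Im z)))"
        by (auto simp: g_def complex_eq_iff)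
      moreover have "((\<lambda>z. of_real (Re z * cos (Im z)) + \<i> * of_real (Re z * sin (Im z))) has_derivative
          (\<lambda>h. of_real (Re h * cos (Im z) - Re z * (sin (Im z) * Im h)) + \<i> * of_real (Re h * sin (Im z) + Re z * (cos (Im z) * Im h)))) (at z within S)"
        by (auto intro!: derivative_eq_intros simp: algebra_simps)
      moreover have "(\<lambda>h. of_real (Re h * cos (Im z) - Re z * (sin (Im z) * Im h)) + \<i> * of_real (Re h * sin (Im z) + Re z * (cos (Im z) * Im h)))
         = (\<lambda>h. Re h * cis (Im z) + Re z * (\<i> * cis (Im z) * Im h))"
        by (rule ext) (simp add: complex_eq_iff)
      ultimately show ?thesis by simp
    qed
    moreover have "(\<lambda>h. Re h * cis (Im z) + Re z * (\<i> * cis (Im z) * Im h))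
      = (\<lambda>h. (cis (Im z) * (1 + Re z) / 2) * h + (cis (Im z) * (1 - Re z) / 2) * cnj h)"
      by (rule ext) (simp add: complex_eq_iff algebra_simps add_divide_distrib diff_divide_distrib)
    ultimately show ?thesis by simp
  qed
  have J: "\<bar>(cmod (cis (Im z) * (1 + Re z) / 2))\<^sup>2 - (cmod (cis (Im z) * (1 - Re z) / 2))\<^sup>2\<bar> = Re z" if "z \<in> S" for z
  proof -
    have 1: "cmod (1 + complex_of_real (Re z)) = \<bar>1 + Re z\<bar>" "cmod (1 - complex_of_real (Re z)) = \<bar>1 - Re z\<bar>"
      by (metis norm_of_real of_real_1 of_real_add of_real_diff)+
    have "(cmod (cis (Im z) * (1 + Re z) / 2))\<^sup>2 - (cmod (cis (Im z) * (1 - Re z) / 2))\<^sup>2 = Re z"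
      by (simp add: norm_mult norm_divide 1 power_divide) (simp add: power2_eq_square field_simps)
    then show ?thesis using that by (simp add: S_def T_def)
  qed
  have Jc: "\<bar>(cmod (cis (Im z) * (1 + Re z) / 2))\<^sup>2 - (cmod (cis (Im z) * (1 - Re z) / 2))\<^sup>2\<bar> *\<^sub>R (1::complex) = of_real (Re z)" if "z \<in> S" for z
    unfolding J[OF that] by (simp add: scaleR_conv_of_real)
  have inj: "inj_on g S" using inj_on_rcis_strip unfolding g_def S_def T_def by (rule inj_on_subset) auto
  have meq: "emeasure lborel (g ` S) = emeasure lborel (box l u)"
    unfolding gS using neg by (rule emeasure_Diff_null_set) simp
  have I: "set_integrable lebesgue (g ` S) (\<lambda>z. 1 :: complex)"
  proof -
    have "g ` S \<in> sets lebesgue" unfolding gS using neg by (auto simp: null_sets_def)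
    moreover have "emeasure lebesgue (g ` S) < \<infinity>" using calculation meq emeasure_bounded_finite[OF bounded_box, of l u] unfolding gS using neg by (auto simp: null_sets_def)
    ultimately show ?thesis unfolding set_integrable_def by (simp add: integrable_indicator_iff)
  qed
  note cov = set_integral_change_of_variables_complex[OF _ der inj, of "\<lambda>_. 1"]
  have Sl: "S \<in> sets lebesgue" using S by simp
  have i1: "set_integrable lebesgue S (\<lambda>z. complex_of_real (Re z))"
  proof -
    have "set_integrable lebesgue S (\<lambda>z. \<bar>(cmod (cis (Im z) * (1 + Re z) / 2))\<^sup>2 - (cmod (cis (Im z) * (1 - Re z) / 2))\<^sup>2\<bar> *\<^sub>R (1::complex))"
      using cov(1)[OF Sl] I by blast
    moreover have "indicator S z *\<^sub>R (\<bar>(cmod (cis (Im z) * (1 + Re z) / 2))\<^sup>2 - (cmod (cis (Im z) * (1 - Re z) / 2))\<^sup>2\<bar> *\<^sub>R (1::complex))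
        = indicator S z *\<^sub>R complex_of_real (Re z)" for z
      by (cases "z \<in> S") (simp only: Jc, simp)
    ultimately show ?thesis unfolding set_integrable_def by simp
  qed
  have i2: "(LINT z:S|lebesgue. complex_of_real (Re z)) = measure lborel (box l u)"
  proof -
    have "(LINT z:S|lebesgue. complex_of_real (Re z)) = (LINT z:S|lebesgue. \<bar>(cmod (cis (Im z) * (1 + Re z) / 2))\<^sup>2 - (cmod (cis (Im z) * (1 - Re z) / 2))\<^sup>2\<bar> *\<^sub>R (1::complex))"
      using Sl by (intro set_lebesgue_integral_cong) (use Jc in auto)
    also have "\<dots> = (LINT z:g ` S|lebesgue. 1)" using cov(2)[OF Sl] .
    also have "\<dots> = measure lebesgue (g ` S)"
      using I unfolding set_lebesgue_integral_def set_integrable_def by (simp add: scaleR_conv_of_real)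
    also have "\<dots> = measure lborel (box l u)"
      using meq neg by (simp add: measure_def gS null_sets_def)
    finally show ?thesis .
  qed
  have i3: "integrable lborel (\<lambda>z. indicator S z * Re z)"
    and i4: "(LINT z|lborel. indicator S z * Re z) = measure lborel (box l u)"
  proof -
    have m: "(\<lambda>z. indicator S z * Re z) \<in> borel_measurable lborel" using S by simp
    have "integrable lebesgue (\<lambda>z. Re (indicator S z *\<^sub>R complex_of_real (Re z)))"
      using i1 unfolding set_integrable_def by (rule integrable_Re)
    then have i: "integrable lebesgue (\<lambda>z. indicator S z * Re z)" by simp
    then show "integrable lborel (\<lambda>z. indicator S z * Re z)" using m integrable_completion by blast
    have "(LINT z|lborel. indicator S z * Re z) = (LINT z|lebesgue. indicator S z * Re z)"
      using m by (simp add: integral_completion)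
    also have "\<dots> = Re (LINT z:S|lebesgue. complex_of_real (Re z))"
      using i1 unfolding set_lebesgue_integral_def set_integrable_def by (subst integral_Re[symmetric]) auto
    finally show "(LINT z|lborel. indicator S z * Re z) = measure lborel (box l u)" using i2 by simp
  qed
  have nn: "(\<integral>\<^sup>+z. ennreal (indicator S z * Re z) \<partial>lborel) = emeasure lborel (box l u)"
  proof -
    have "(\<integral>\<^sup>+z. ennreal (indicator S z * Re z) \<partial>lborel) = ennreal (LINT z|lborel. indicator S z * Re z)"
      by (rule nn_integral_eq_integral[OF i3]) (auto simp: S_def T_def indicator_def)
    also have "\<dots> = emeasure lborel (box l u)"
      unfolding i4 using emeasure_bounded_finite[OF bounded_box, of l u]
      by (intro emeasure_eq_ennreal_measure[symmetric]) simp
    finally show ?thesis .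
  qed
  have ae: "AE p in (lborel :: real measure) \<Otimes>\<^sub>M lborel. snd p \<noteq> 0 \<and> snd p \<noteq> 2 * pi"
  proof -
    have "AE y in lborel. y \<noteq> (0::real)" "AE y in lborel. y \<noteq> (2 * pi::real)" by (rule AE_lborel_singleton)+
    then have "AE y in lborel. y \<noteq> (0::real) \<and> y \<noteq> 2 * pi" by eventually_elim simp
    then have "AE x in lborel. AE y in lborel. y \<noteq> (0::real) \<and> y \<noteq> 2 * pi" by (rule AE_I2)
    then show ?thesis
    proof (intro lborel_pair.AE_pair_measure)
      have "open {p :: real \<times> real. snd p \<noteq> 0 \<and> snd p \<noteq> 2 * pi}"
        by (intro open_Collect_conj open_Collect_neq continuous_intros)
      then show "{p \<in> space (lborel \<Otimes>\<^sub>M lborel). snd p \<noteq> 0 \<and> snd p \<noteq> 2 * pi} \<in> sets ((lborel :: real measure) \<Otimes>\<^sub>M lborel)"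
        unfolding lborel_prod by (simp add: borel_open)
    qed simp
  qed
  have "emeasure ?D (box l u) = (\<integral>\<^sup>+p. ennreal (polar_density p) * indicator (box l u) (rcis (fst p) (snd p)) \<partial>(lborel \<Otimes>\<^sub>M lborel))"
  proof -
    have B: "(\<lambda>(r, \<phi>). rcis r \<phi>) -` box l u \<inter> space (density (lborel \<Otimes>\<^sub>M lborel) polar_density) \<in> sets (lborel \<Otimes>\<^sub>M lborel)"
      using measurable_sets[OF rcis_measurable_pair, of "box l u"] by (simp add: space_pair_measure)
    show ?thesis
      by (subst emeasure_distr, simp, simp, subst emeasure_density, simp, rule B)
        (auto intro!: nn_integral_cong simp: indicator_def)
  qed
  also have "\<dots> = (\<integral>\<^sup>+p. (\<lambda>z. ennreal (indicator S z * Re z)) (case p of (x, y) \<Rightarrow> Complex x y) \<partial>(lborel \<Otimes>\<^sub>M lborel))"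
    by (rule nn_integral_cong_AE, use ae in eventually_elim)
      (auto simp: polar_density_def indicator_def S_def T_def g_def split: prod.splits)
  also have "\<dots> = (\<integral>\<^sup>+z. ennreal (indicator S z * Re z) \<partial>lborel)"
    using S by (subst distr_Complex_lborel[symmetric], subst nn_integral_distr) (auto simp: borel_measurable_Complex)
  also have "\<dots> = (\<Prod>b\<in>Basis. (u - l) \<bullet> b)" unfolding nn using lu by (rule emeasure_lborel_box)
  finally show "emeasure ?D (box l u) = (\<Prod>b\<in>Basis. (u - l) \<bullet> b)" .
qed simp

lemma nn_integral_polar:
  fixes f :: "complex \<Rightarrow> ennreal"
  assumes [measurable]: "f \<in> borel_measurable borel"
  shows "(\<integral>\<^sup>+z. f z \<partial>lborel)
    = (\<integral>\<^sup>+r\<in>{0<..}. ennreal r * (\<integral>\<^sup>+\<phi>\<in>{0..2*pi}. f (rcis r \<phi>) \<partial>lborel) \<partial>lborel)"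
proof -
  have "(\<integral>\<^sup>+z. f z \<partial>lborel) = (\<integral>\<^sup>+p. ennreal (polar_density p) * f (case p of (r, \<phi>) \<Rightarrow> rcis r \<phi>) \<partial>(lborel \<Otimes>\<^sub>M lborel))"
    by (subst polar_coordinates_lborel[symmetric], subst nn_integral_distr, simp, simp, subst nn_integral_density) auto
  also have "\<dots> = (\<integral>\<^sup>+r. \<integral>\<^sup>+\<phi>. ennreal (polar_density (r, \<phi>)) * f (rcis r \<phi>) \<partial>lborel \<partial>lborel)"
    by (subst lborel.nn_integral_fst[symmetric]) auto
  also have "\<dots> = (\<integral>\<^sup>+r\<in>{0<..}. ennreal r * (\<integral>\<^sup>+\<phi>\<in>{0..2*pi}. f (rcis r \<phi>) \<partial>lborel) \<partial>lborel)"
  proof (rule nn_integral_cong)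
    fix r :: real
    have "(\<integral>\<^sup>+\<phi>. ennreal (polar_density (r, \<phi>)) * f (rcis r \<phi>) \<partial>lborel)
      = (\<integral>\<^sup>+\<phi>. (ennreal r * indicator {0<..} r) * (f (rcis r \<phi>) * indicator {0..2*pi} \<phi>) \<partial>lborel)"
      by (rule nn_integral_cong) (auto simp: polar_density_def indicator_def)
    also have "\<dots> = ennreal r * indicator {0<..} r * (\<integral>\<^sup>+\<phi>\<in>{0..2*pi}. f (rcis r \<phi>) \<partial>lborel)"
      by (rule nn_integral_cmult) simp
    finally show "(\<integral>\<^sup>+\<phi>. ennreal (polar_density (r, \<phi>)) * f (rcis r \<phi>) \<partial>lborel) = ennreal r * (\<integral>\<^sup>+\<phi>\<in>{0..2*pi}. f (rcis r \<phi>) \<partial>lborel) * indicator {0<..} r"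
      by (simp add: mult_ac)
  qed
  finally show ?thesis .
qed

lemma integral_polar_pair:
  fixes f :: "complex \<Rightarrow> complex"
  assumes [measurable]: "f \<in> borel_measurable borel"
  shows "integrable lborel f \<longleftrightarrow> integrable (lborel \<Otimes>\<^sub>M lborel) (\<lambda>(r, \<phi>). polar_density (r, \<phi>) *\<^sub>R f (rcis r \<phi>))"
    and "(LINT z|lborel. f z) = (LINT (r, \<phi>)|(lborel \<Otimes>\<^sub>M lborel). polar_density (r, \<phi>) *\<^sub>R f (rcis r \<phi>))"
  by (subst (1) polar_coordinates_lborel[symmetric], subst integrable_distr_eq, simp, simp,
      subst integrable_density, simp, simp, simp add: polar_density_nonneg, simp add: case_prod_beta')
     (subst (1) polar_coordinates_lborel[symmetric], subst integral_distr, simp, simp,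
      subst integral_density, simp, simp, simp add: polar_density_nonneg, simp add: case_prod_beta')

lemma integral_polar:
  fixes f :: "complex \<Rightarrow> complex"
  assumes [measurable]: "f \<in> borel_measurable borel" and f: "integrable lborel f"
  shows "AE r in lborel. 0 < r \<longrightarrow> set_integrable lborel {0..2*pi} (\<lambda>\<phi>. f (rcis r \<phi>))"
    and "set_integrable lborel {0<..} (\<lambda>r. r *\<^sub>R (LINT \<phi>:{0..2*pi}|lborel. f (rcis r \<phi>)))"
    and "(LINT z|lborel. f z) = (LINT r:{0<..}|lborel. r *\<^sub>R (LINT \<phi>:{0..2*pi}|lborel. f (rcis r \<phi>)))"
proof -
  have i: "integrable (lborel \<Otimes>\<^sub>M lborel) (\<lambda>(r, \<phi>). polar_density (r, \<phi>) *\<^sub>R f (rcis r \<phi>))"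
    using f integral_polar_pair(1) by simp
  have eq: "(\<lambda>\<phi>. polar_density (r, \<phi>) *\<^sub>R f (rcis r \<phi>)) = (\<lambda>\<phi>. (indicator {0<..} r * r) *\<^sub>R (indicator {0..2*pi} \<phi> *\<^sub>R f (rcis r \<phi>)))" for r
    by (auto simp: polar_density_def indicator_def)
  have eq2: "(LINT \<phi>|lborel. polar_density (r, \<phi>) *\<^sub>R f (rcis r \<phi>)) = indicator {0<..} r *\<^sub>R r *\<^sub>R (LINT \<phi>:{0..2*pi}|lborel. f (rcis r \<phi>))" for r
    unfolding eq set_lebesgue_integral_def by (subst integral_scaleR_right) simp
  show "AE r in lborel. 0 < r \<longrightarrow> set_integrable lborel {0..2*pi} (\<lambda>\<phi>. f (rcis r \<phi>))"
    using lborel_pair.AE_integrable_fst'[OF i]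
  proof eventually_elim
    case (elim r)
    show ?case
    proof
      assume r: "0 < r"
      with elim have "integrable lborel (\<lambda>\<phi>. r *\<^sub>R (indicator {0..2*pi} \<phi> *\<^sub>R f (rcis r \<phi>)))"
        by (simp add: eq)
      then have "integrable lborel (\<lambda>\<phi>. (1 / r) *\<^sub>R (r *\<^sub>R (indicator {0..2*pi} \<phi> *\<^sub>R f (rcis r \<phi>))))"
        by (rule integrable_scaleR_right)
      with r show "set_integrable lborel {0..2*pi} (\<lambda>\<phi>. f (rcis r \<phi>))"
        by (simp add: set_integrable_def)
    qed
  qed
  show "set_integrable lborel {0<..} (\<lambda>r. r *\<^sub>R (LINT \<phi>:{0..2*pi}|lborel. f (rcis r \<phi>)))"
    using lborel_pair.integrable_fst'[OF i] unfolding set_integrable_def by (simp add: eq2)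
  show "(LINT z|lborel. f z) = (LINT r:{0<..}|lborel. r *\<^sub>R (LINT \<phi>:{0..2*pi}|lborel. f (rcis r \<phi>)))"
    unfolding integral_polar_pair(2)[OF assms(1)] set_lebesgue_integral_def[of lborel "{0<..}"]
    using lborel_pair.integral_fst'[OF i] by (simp add: eq2)
qed

lemma AE_polar:
  assumes "AE z in lborel. P z"
  shows "AE r in lborel. 0 < r \<longrightarrow> (AE \<phi> in lborel. \<phi> \<in> {0..2*pi} \<longrightarrow> P (rcis r \<phi>))"
proof -
  from assms obtain N where N: "{z \<in> space lborel. \<not> P z} \<subseteq> N" "emeasure lborel N = 0" "N \<in> sets lborel" by (rule AE_E)
  then have N': "N \<in> sets borel" by simp
  have "(\<integral>\<^sup>+r\<in>{0<..}. ennreal r * (\<integral>\<^sup>+\<phi>\<in>{0..2*pi}. indicator N (rcis r \<phi>) \<partial>lborel) \<partial>lborel) = 0"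
    using nn_integral_polar[of "indicator N"] N' N(2) by simp
  then have "AE r in lborel. ennreal r * (\<integral>\<^sup>+\<phi>\<in>{0..2*pi}. indicator N (rcis r \<phi>) \<partial>lborel) * indicator {0<..} r = 0"
    by (subst (asm) nn_integral_0_iff_AE) (use N' in measurable)
  then show ?thesis
  proof eventually_elim
    case (elim r)
    show ?case
    proof
      assume "0 < r"
      with elim have "(\<integral>\<^sup>+\<phi>\<in>{0..2*pi}. indicator N (rcis r \<phi>) \<partial>lborel) = 0" by simp
      then have "AE \<phi> in lborel. indicator N (rcis r \<phi>) * indicator {0..2*pi} \<phi> = (0::ennreal)"
        by (subst (asm) nn_integral_0_iff_AE) (use N' in measurable)
      then show "AE \<phi> in lborel. \<phi> \<in> {0..2*pi} \<longrightarrow> P (rcis r \<phi>)"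
        by eventually_elim (use N(1) in \<open>auto simp: indicator_def split: if_splits\<close>)
    qed
  qed
qed

lemma AE_polarI:
  assumes ae: "AE r in lborel. 0 < r \<longrightarrow> (AE \<phi> in lborel. \<phi> \<in> {0..2*pi} \<longrightarrow> P (rcis r \<phi>))"
    and P: "{z. \<not> P z} \<in> sets borel"
  shows "AE z in lborel. P z"
proof -
  let ?N = "{z. \<not> P z}"
  have "emeasure lborel ?N = (\<integral>\<^sup>+z. indicator ?N z \<partial>lborel)" using P by simp
  also have "\<dots> = (\<integral>\<^sup>+r\<in>{0<..}. ennreal r * (\<integral>\<^sup>+\<phi>\<in>{0..2*pi}. indicator ?N (rcis r \<phi>) \<partial>lborel) \<partial>lborel)"
    by (rule nn_integral_polar) (use P in simp)
  also have "\<dots> = (\<integral>\<^sup>+r. 0 \<partial>(lborel :: real measure))"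
  proof (rule nn_integral_cong_AE, use ae in eventually_elim)
    case (elim r)
    have "(\<integral>\<^sup>+\<phi>\<in>{0..2*pi}. indicator ?N (rcis r \<phi>) \<partial>lborel) = (\<integral>\<^sup>+\<phi>. 0 \<partial>(lborel :: real measure))" if "0 < r"
      by (rule nn_integral_cong_AE, use elim[rule_format, OF that] in eventually_elim) (auto simp: indicator_def)
    then show ?case by (auto simp: indicator_def)
  qed
  finally have "emeasure lborel ?N = 0" by simp
  then show ?thesis using P by (intro AE_I'[of ?N]) (auto simp: null_sets_def)
qed

section \<open>Wirtinger derivatives and the Cauchy-Pompeiu formula\<close>

text \<open>A complex test function \<open>\<eta>\<close> together with its Wirtinger derivatives: \<open>a\<close> with respect to \<open>z\<close> and \<open>b\<close>
with respect to \<open>cnj z\<close>.\<close>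

definition wirtinger_test ::
  "complex set \<Rightarrow> (complex \<Rightarrow> complex) \<Rightarrow> (complex \<Rightarrow> complex) \<Rightarrow> (complex \<Rightarrow> complex) \<Rightarrow> bool" where
  "wirtinger_test S \<eta> a b \<longleftrightarrow>
     (\<forall>x. (\<eta> has_derivative (\<lambda>h. a x * h + b x * cnj h)) (at x)) \<and>
     continuous_on UNIV a \<and> continuous_on UNIV b \<and>
     (\<exists>K. compact K \<and> K \<subseteq> S \<and> (\<forall>x. x \<notin> K \<longrightarrow> \<eta> x = 0))"

lemma wirtinger_coeff_eq_0:
  assumes "((\<lambda>x. 0) has_derivative (\<lambda>h. a * h + b * cnj h)) (at x)"
  shows "a = 0" "b = 0"
proof -
  have "(\<lambda>h. a * h + b * cnj h) = (\<lambda>h. 0)"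
    by (rule has_derivative_unique[OF assms]) simp
  from fun_cong[OF this, of 1] fun_cong[OF this, of \<i>]
  have "a + b = 0" "a * \<i> = b * \<i>" by simp_all
  then show "a = 0" "b = 0" by auto
qed

lemma wirtinger_test_vanish:
  assumes t: "wirtinger_test S \<eta> a b" and K: "compact K" "\<And>x. x \<notin> K \<Longrightarrow> \<eta> x = 0" and x: "x \<notin> K"
  shows "a x = 0" "b x = 0"
proof -
  have "open (- K)" using K(1) by (simp add: compact_imp_closed open_Compl)
  moreover have "(\<eta> has_derivative (\<lambda>h. a x * h + b x * cnj h)) (at x)"
    using t by (simp add: wirtinger_test_def)
  ultimately have "((\<lambda>x. 0) has_derivative (\<lambda>h. a x * h + b x * cnj h)) (at x)"
    using K(2) x by (auto intro: has_derivative_transform_within_open)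
  from wirtinger_coeff_eq_0[OF this] show "a x = 0" "b x = 0" by auto
qed

lemma wirtinger_test_continuous: "wirtinger_test S \<eta> a b \<Longrightarrow> continuous_on T \<eta>"
  unfolding wirtinger_test_def by (meson continuous_at_imp_continuous_on has_derivative_continuous)

lemma wirtinger_test_chain:
  assumes t: "wirtinger_test S \<eta> a b" and d: "(\<gamma> has_vector_derivative \<gamma>') (at t within T)"
  shows "((\<lambda>t. \<eta> (\<gamma> t)) has_vector_derivative (a (\<gamma> t) * \<gamma>' + b (\<gamma> t) * cnj \<gamma>')) (at t within T)"
proof -
  have "(\<eta> has_derivative (\<lambda>h. a (\<gamma> t) * h + b (\<gamma> t) * cnj h)) (at (\<gamma> t))"
    using t by (simp add: wirtinger_test_def)
  from has_derivative_compose[OF d[unfolded has_vector_derivative_def] this]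
  show ?thesis unfolding has_vector_derivative_def by (simp add: algebra_simps scaleR_conv_of_real)
qed

lemma nn_integral_translate:
  fixes f :: "'a::euclidean_space \<Rightarrow> ennreal"
  assumes [measurable]: "f \<in> borel_measurable borel"
  shows "(\<integral>\<^sup>+z. f (c + z) \<partial>lborel) = (\<integral>\<^sup>+z. f z \<partial>lborel)"
  by (subst (2) lborel_distr_plus[symmetric, of c], subst nn_integral_distr) auto

lemma integral_translate:
  fixes f :: "'a::euclidean_space \<Rightarrow> 'b::{banach,second_countable_topology}"
  assumes [measurable]: "f \<in> borel_measurable borel"
  shows "(LINT z|lborel. f (c + z)) = (LINT z|lborel. f z)"
    and "integrable lborel (\<lambda>z. f (c + z)) \<longleftrightarrow> integrable lborel f"
   apply (subst (2) lborel_distr_plus[symmetric, of c], subst integral_distr) apply auto[3]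
   apply (subst (2) lborel_distr_plus[symmetric, of c], subst integrable_distr_eq) apply auto
  done

lemma nn_integral_inverse_norm_ball:
  assumes "e > 0"
  shows "(\<integral>\<^sup>+z\<in>ball 0 e. ennreal (1 / cmod z) \<partial>lborel) = ennreal (2 * pi * e)"
proof -
  have [measurable]: "ball (0::complex) e \<in> sets borel" by simp
  have "(\<integral>\<^sup>+z\<in>ball 0 e. ennreal (1 / cmod z) \<partial>lborel)
     = (\<integral>\<^sup>+r\<in>{0<..}. ennreal r * (\<integral>\<^sup>+\<phi>\<in>{0..2*pi}. (ennreal (1 / cmod (rcis r \<phi>)) * indicator (ball 0 e) (rcis r \<phi>)) \<partial>lborel) \<partial>lborel)"
    by (rule nn_integral_polar) measurable
  also have "\<dots> = (\<integral>\<^sup>+r\<in>{0<..<e}. ennreal (2 * pi) \<partial>lborel)"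
  proof (rule nn_integral_cong)
    fix r :: real
    show "ennreal r * (\<integral>\<^sup>+\<phi>\<in>{0..2*pi}. (ennreal (1 / cmod (rcis r \<phi>)) * indicator (ball 0 e) (rcis r \<phi>)) \<partial>lborel) * indicator {0<..} r
      = ennreal (2 * pi) * indicator {0<..<e} r"
    proof (cases "0 < r \<and> r < e")
      case True
      then have "(\<integral>\<^sup>+\<phi>\<in>{0..2*pi}. (ennreal (1 / cmod (rcis r \<phi>)) * indicator (ball 0 e) (rcis r \<phi>)) \<partial>lborel)
        = (\<integral>\<^sup>+\<phi>. ennreal (1 / r) * indicator {0..2*pi} \<phi> \<partial>lborel)"
        by (intro nn_integral_cong) (auto simp: indicator_def)
      also have "\<dots> = ennreal (1 / r) * ennreal (2 * pi)" by (subst nn_integral_cmult) auto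
      finally show ?thesis using True by (simp add: ennreal_mult[symmetric] indicator_def)
    next
      case False
      then show ?thesis by (auto simp: indicator_def)
    qed
  qed
  also have "\<dots> = ennreal (2 * pi) * ennreal e" using assms by (subst nn_integral_cmult) auto
  finally show ?thesis using assms by (simp add: ennreal_mult)
qed

text \<open>Split \<open>A\<close> at distance \<open>e\<close> from the pole: inside, polar coordinates give \<open>2 \<pi> e\<close>, uniformly in \<open>\<xi>\<close>;
outside, the kernel is at most \<open>1/e\<close>.\<close>

lemma nn_integral_cauchy_kernel_le:
  assumes e: "e > 0" and A: "A \<in> sets borel"
  shows "(\<integral>\<^sup>+z\<in>A. ennreal (1 / cmod (z - \<xi>)) \<partial>lborel) \<le> ennreal (2 * pi * e) + ennreal (1 / e) * emeasure lborel A"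
proof -
  have [measurable]: "ball (0::complex) e \<in> sets borel" by simp
  note A [measurable]
  have "(\<integral>\<^sup>+z\<in>A. ennreal (1 / cmod (z - \<xi>)) \<partial>lborel)
     \<le> (\<integral>\<^sup>+z. ennreal (1 / cmod (z - \<xi>)) * indicator (ball 0 e) (z - \<xi>) + ennreal (1 / e) * indicator A z \<partial>lborel)"
  proof (rule nn_integral_mono)
    fix z
    show "ennreal (1 / cmod (z - \<xi>)) * indicator A z \<le> ennreal (1 / cmod (z - \<xi>)) * indicator (ball 0 e) (z - \<xi>) + ennreal (1 / e) * indicator A z"
    proof (cases "cmod (z - \<xi>) < e")
      case True
      then have "ennreal (1 / cmod (z - \<xi>)) * indicator A z \<le> ennreal (1 / cmod (z - \<xi>)) * indicator (ball 0 e) (z - \<xi>)"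
        by (auto simp: indicator_def)
      then show ?thesis by (simp add: add_increasing2)
    next
      case False
      then have "ennreal (1 / cmod (z - \<xi>)) \<le> ennreal (1 / e)" using e by (auto intro!: ennreal_leI divide_left_mono mult_pos_pos)
      then show ?thesis by (auto simp: indicator_def intro: add_increasing)
    qed
  qed
  also have "\<dots> = (\<integral>\<^sup>+z. ennreal (1 / cmod (z - \<xi>)) * indicator (ball 0 e) (z - \<xi>) \<partial>lborel) + ennreal (1 / e) * emeasure lborel A"
    by (subst nn_integral_add) (simp_all add: nn_integral_cmult)
  also have "(\<integral>\<^sup>+z. ennreal (1 / cmod (z - \<xi>)) * indicator (ball 0 e) (z - \<xi>) \<partial>lborel)
     = (\<integral>\<^sup>+z. ennreal (1 / cmod z) * indicator (ball 0 e) z \<partial>lborel)"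
    using nn_integral_translate[of "\<lambda>z. ennreal (1 / cmod z) * indicator (ball 0 e) z" "- \<xi>"] by simp
  also have "\<dots> = ennreal (2 * pi * e)" by (rule nn_integral_inverse_norm_ball[OF e])
  finally show ?thesis .
qed

lemma cauchy_kernel_integrable_compact_support:
  fixes f :: "complex \<Rightarrow> complex"
  assumes f: "continuous_on UNIV f" and K: "compact K" "\<And>x. x \<notin> K \<Longrightarrow> f x = 0"
  shows "integrable lborel (\<lambda>z. f z / (z - \<xi>))"
proof -
  have [measurable]: "f \<in> borel_measurable borel" using f by (rule borel_measurable_continuous_onI)
  have "bounded (f ` K)" using f K(1) by (meson compact_continuous_image compact_imp_bounded continuous_on_subset subset_UNIV)
  then obtain M where M: "\<And>x. x \<in> K \<Longrightarrow> cmod (f x) \<le> M" "M > 0" by (auto simp: bounded_pos)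
  have K' [measurable]: "K \<in> sets borel" using K(1) by (simp add: borel_compact)
  have fin: "emeasure lborel K < \<infinity>" by (rule emeasure_bounded_finite[OF compact_imp_bounded[OF K(1)]])
  show ?thesis
  proof (rule integrableI_bounded)
    have "(\<integral>\<^sup>+z. ennreal (cmod (f z / (z - \<xi>))) \<partial>lborel) \<le> (\<integral>\<^sup>+z. ennreal M * (ennreal (1 / cmod (z - \<xi>)) * indicator K z) \<partial>lborel)"
    proof (rule nn_integral_mono)
      fix z show "ennreal (cmod (f z / (z - \<xi>))) \<le> ennreal M * (ennreal (1 / cmod (z - \<xi>)) * indicator K z)"
        using M K(2)[of z] by (cases "z \<in> K") (auto simp: norm_divide ennreal_mult[symmetric] intro!: ennreal_leI divide_right_mono)
    qed
    also have "\<dots> = ennreal M * (\<integral>\<^sup>+z\<in>K. ennreal (1 / cmod (z - \<xi>)) \<partial>lborel)"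
      by (intro nn_integral_cmult) measurable
    also have "\<dots> \<le> ennreal M * (ennreal (2 * pi * 1) + ennreal (1 / 1) * emeasure lborel K)"
      by (intro mult_left_mono nn_integral_cauchy_kernel_le) (use K' in auto)
    also have "\<dots> < \<infinity>" using fin by (simp add: ennreal_mult_less_top)
    finally show "(\<integral>\<^sup>+z. ennreal (cmod (f z / (z - \<xi>))) \<partial>lborel) < \<infinity>" .
  qed measurable
qed

text \<open>In polar coordinates around \<open>\<xi>\<close> the factor \<open>r\<close> cancels the pole, and the integrand becomes
\<open>q = b * exp (- i \<phi>)\<close>. Up to the tangential derivative of \<open>\<eta>\<close>, whose integral over a circle is \<open>0\<close>, this is half the
radial derivative \<open>p\<close>, and the radial derivative integrates to \<open>- \<eta> \<xi>\<close> along each ray.\<close>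

theorem cauchy_pompeiu:
  fixes \<eta> a b :: "complex \<Rightarrow> complex"
  assumes t: "wirtinger_test S \<eta> a b"
  shows "integrable lborel (\<lambda>z. b z / (z - \<xi>))"
    and "(LINT z|lborel. b z / (z - \<xi>)) = - pi * \<eta> \<xi>"
proof -
  obtain K where K: "compact K" "\<And>x. x \<notin> K \<Longrightarrow> \<eta> x = 0" using t by (auto simp: wirtinger_test_def)
  have ca: "continuous_on UNIV a" and cb: "continuous_on UNIV b" using t by (auto simp: wirtinger_test_def)
  have va: "a x = 0" and vb: "b x = 0" if "x \<notin> K" for x
    using wirtinger_test_vanish[OF t K(1), of x] K(2) that by auto
  show int: "integrable lborel (\<lambda>z. b z / (z - \<xi>))"
    by (rule cauchy_kernel_integrable_compact_support[OF cb K(1) vb])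
  have [measurable]: "b \<in> borel_measurable borel" using cb by (rule borel_measurable_continuous_onI)
  define f where "f z = b (\<xi> + z) / z" for z
  have fm [measurable]: "f \<in> borel_measurable borel" unfolding f_def[abs_def] by measurable
  have fi: "integrable lborel f"
    using int integral_translate(2)[of "\<lambda>z. b z / (z - \<xi>)" \<xi>] by (simp add: f_def[abs_def])
  have fe: "(LINT z|lborel. b z / (z - \<xi>)) = (LINT z|lborel. f z)"
    using integral_translate(1)[of "\<lambda>z. b z / (z - \<xi>)" \<xi>] by (simp add: f_def[abs_def])
  obtain R where R: "R > 0" "\<And>z. z \<in> K \<Longrightarrow> cmod (z - \<xi>) < R"
  proof -
    have "bounded ((\<lambda>z. z - \<xi>) ` K)" using K(1) by (intro compact_imp_bounded compact_continuous_image continuous_intros)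
    then obtain R where "R > 0" "\<And>z. z \<in> K \<Longrightarrow> cmod (z - \<xi>) \<le> R" by (auto simp: bounded_pos)
    then show ?thesis by (intro that[of "R + 1"]) force+
  qed
  have out: "\<xi> + rcis r \<phi> \<notin> K" if "r \<ge> R" for r \<phi>
    using R(2)[of "\<xi> + rcis r \<phi>"] R(1) that by auto
  define p where "p r \<phi> = a (\<xi> + rcis r \<phi>) * cis \<phi> + b (\<xi> + rcis r \<phi>) * cis (- \<phi>)" for r \<phi>
  define q where "q r \<phi> = b (\<xi> + rcis r \<phi>) * cis (- \<phi>)" for r \<phi>
  have cis': "((\<lambda>\<phi>. \<xi> + rcis r \<phi>) has_vector_derivative \<i> * rcis r \<phi>) (at \<phi> within T)" for r \<phi> T
    unfolding rcis_def cis_conv_exp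
    by (rule has_vector_derivative_real_field[THEN has_vector_derivative_at_within]) (auto intro!: derivative_eq_intros)
  have ccis: "continuous_on T (\<lambda>x. cis (h x))" if "continuous_on T h" for h T using that by (intro continuous_intros)
  have cq: "continuous_on T (\<lambda>x. q (h x) (k x))" if "continuous_on T h" "continuous_on T k" for h k :: "'x::topological_space \<Rightarrow> real" and T
    unfolding q_def using that by (intro continuous_intros continuous_on_compose2[OF cb]) auto
  have cp: "continuous_on T (\<lambda>x. p (h x) (k x))" if "continuous_on T h" "continuous_on T k" for h k :: "'x::topological_space \<Rightarrow> real" and T
    unfolding p_def using that by (intro continuous_intros continuous_on_compose2[OF cb] continuous_on_compose2[OF ca]) auto
  (* q is half of p plus a multiple of the tangential derivative, which integrates to 0 *)
  have inner: "integral {0..2*pi} (q r) = 1/2 * integral {0..2*pi} (p r)" if "r > 0" for r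
  proof -
    have "((\<lambda>\<phi>. a (\<xi> + rcis r \<phi>) * (\<i> * rcis r \<phi>) + b (\<xi> + rcis r \<phi>) * cnj (\<i> * rcis r \<phi>)) has_integral
        (\<eta> (\<xi> + rcis r (2*pi)) - \<eta> (\<xi> + rcis r 0))) {0..2*pi}"
      by (rule fundamental_theorem_of_calculus, simp, rule wirtinger_test_chain[OF t cis'])
    then have 0: "((\<lambda>\<phi>. a (\<xi> + rcis r \<phi>) * (\<i> * rcis r \<phi>) + b (\<xi> + rcis r \<phi>) * cnj (\<i> * rcis r \<phi>)) has_integral 0) {0..2*pi}"
      by (simp add: rcis_def)
    have eq: "q r \<phi> = 1/2 * p r \<phi> + \<i> / (2 * r) * (a (\<xi> + rcis r \<phi>) * (\<i> * rcis r \<phi>) + b (\<xi> + rcis r \<phi>) * cnj (\<i> * rcis r \<phi>))" for \<phi>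
      using that unfolding q_def p_def rcis_def by (simp add: cis_cnj field_simps)
    have "((\<lambda>\<phi>. 1/2 * p r \<phi> + \<i> / (2 * r) * (a (\<xi> + rcis r \<phi>) * (\<i> * rcis r \<phi>) + b (\<xi> + rcis r \<phi>) * cnj (\<i> * rcis r \<phi>))) has_integral
       (1/2 * integral {0..2*pi} (p r) + \<i> / (2 * r) * 0)) {0..2*pi}"
      by (intro has_integral_add has_integral_mult_right 0 integrable_integral integrable_continuous_real cp continuous_intros)
    then show ?thesis by (subst eq[abs_def]) (simp add: integral_unique)
  qed
  have outer: "integral {0..R} (\<lambda>r. p r \<phi>) = - \<eta> \<xi>" for \<phi>
  proof -
    have d: "((\<lambda>r. \<xi> + rcis r \<phi>) has_vector_derivative cis \<phi>) (at r within T)" for r T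
      unfolding rcis_def by (auto intro!: derivative_eq_intros has_vector_derivative_of_real simp: has_vector_derivative_def scaleR_conv_of_real)
    have "((\<lambda>r. a (\<xi> + rcis r \<phi>) * cis \<phi> + b (\<xi> + rcis r \<phi>) * cnj (cis \<phi>)) has_integral
        (\<eta> (\<xi> + rcis R \<phi>) - \<eta> (\<xi> + rcis 0 \<phi>))) {0..R}"
      by (rule fundamental_theorem_of_calculus, use R(1) in simp, rule wirtinger_test_chain[OF t d])
    moreover have "\<eta> (\<xi> + rcis R \<phi>) = 0" by (rule K(2), rule out) simp
    ultimately show ?thesis by (simp add: p_def cis_cnj integral_unique)
  qed
  have p0: "p r \<phi> = 0" "q r \<phi> = 0" if "r \<ge> R" for r \<phi>
    using va[OF out[OF that, of \<phi>]] vb[OF out[OF that, of \<phi>]] by (simp_all add: p_def q_def)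
  have fr: "r *\<^sub>R f (rcis r \<phi>) = q r \<phi>" if "r > 0" for r \<phi>
    using that by (simp add: f_def q_def rcis_def scaleR_conv_of_real cis_inverse[symmetric] field_simps)
  have inn: "r *\<^sub>R (LINT \<phi>:{0..2*pi}|lborel. f (rcis r \<phi>)) = 1/2 * integral {0..2*pi} (p r)" if "r > 0" for r
  proof -
    have "r *\<^sub>R (LINT \<phi>:{0..2*pi}|lborel. f (rcis r \<phi>)) = (LINT \<phi>:{0..2*pi}|lborel. r *\<^sub>R f (rcis r \<phi>))"
      by (simp add: set_integral_scaleR_right)
    also have "\<dots> = (LINT \<phi>:{0..2*pi}|lborel. q r \<phi>)" using that by (simp add: fr)
    also have "\<dots> = integral {0..2*pi} (q r)"
      by (rule set_borel_integral_eq_integral(2), rule borel_integrable_atLeastAtMost', rule cq) (intro continuous_intros)+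
    finally show ?thesis using inner[OF that] by simp
  qed
  have "(LINT z|lborel. f z) = (LINT r:{0<..}|lborel. r *\<^sub>R (LINT \<phi>:{0..2*pi}|lborel. f (rcis r \<phi>)))"
    by (rule integral_polar(3)[OF fm fi])
  also have "\<dots> = integral {0<..} (\<lambda>r. r *\<^sub>R (LINT \<phi>:{0..2*pi}|lborel. f (rcis r \<phi>)))"
    by (rule set_borel_integral_eq_integral(2)[OF integral_polar(2)[OF fm fi]])
  also have "\<dots> = integral {0<..} (\<lambda>r. 1/2 * integral {0..2*pi} (p r))"
    by (rule integral_cong) (simp add: inn)
  also have "\<dots> = integral {0..R} (\<lambda>r. 1/2 * integral {0..2*pi} (p r))"
  proof (rule integral_spike_set)
    have "integral {0..2*pi} (p r) = 0" if "r \<ge> R" for r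
      using p0(1)[OF that] by (simp add: fun_eq_iff[of "p r" "\<lambda>_. 0"] cong: integral_cong)
    then have "{r \<in> {0<..} - {0..R}. 1/2 * integral {0..2*pi} (p r) \<noteq> 0} = {}" by auto (metis linorder_le_cases)
    then show "negligible {r \<in> {0<..} - {0..R}. 1/2 * integral {0..2*pi} (p r) \<noteq> 0}" by (simp only: negligible_empty)
  qed (auto intro: negligible_subset[of "{0}"])
  also have "\<dots> = 1/2 * integral {0..R} (\<lambda>r. integral {0..2*pi} (p r))" by simp
  also have "integral {0..R} (\<lambda>r. integral {0..2*pi} (p r)) = integral {0..2*pi} (\<lambda>\<phi>. integral {0..R} (\<lambda>r. p r \<phi>))"
    using integral_swap_continuous[of 0 0 R "2*pi" p] cp[of UNIV fst snd]
    by (simp add: case_prod_beta' continuous_on_fst continuous_on_snd continuous_on_id continuous_on_subset)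
  also have "\<dots> = - 2 * pi * \<eta> \<xi>" by (simp add: outer scaleR_conv_of_real)
  finally show "(LINT z|lborel. b z / (z - \<xi>)) = - pi * \<eta> \<xi>" using fe by simp
qed

section \<open>Integrals over circles\<close>

lemma circle_mean_value:
  fixes f :: "complex \<Rightarrow> complex"
  assumes r: "r > 0" and c: "continuous_on (cball 0 r) f" and h: "f holomorphic_on ball 0 r"
  shows "(LINT \<phi>:{0..2*pi}|lborel. f (rcis r \<phi>)) = 2 * pi * f 0"
proof -
  have "((\<lambda>u. f u / (u - 0)) has_contour_integral (2 * of_real pi * \<i> * f 0)) (circlepath 0 r)"
    by (rule Cauchy_integral_circlepath[OF c h]) (use r in simp)
  then have "((\<lambda>t. f (0 + r * cis t) / (0 + r * cis t - 0) * r * \<i> * cis t) has_integral (2 * of_real pi * \<i> * f 0)) {0..2*pi}"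
    unfolding circlepath_def by (subst (asm) has_contour_integral_part_circlepath_iff) simp_all
  then have "((\<lambda>t. - \<i> * (f (0 + r * cis t) / (0 + r * cis t - 0) * r * \<i> * cis t)) has_integral - \<i> * (2 * of_real pi * \<i> * f 0)) {0..2*pi}"
    by (rule has_integral_mult_right)
  then have "((\<lambda>t. f (rcis r t)) has_integral (2 * pi * f 0)) {0..2*pi}"
    by (rule has_integral_eq_rhs[OF has_integral_eq, rotated]) (use r in \<open>auto simp: rcis_def mult_ac\<close>)
  moreover have "continuous_on {0..2*pi} (\<lambda>t. f (rcis r t))"
    by (rule continuous_on_compose2[OF c]) (use r in \<open>auto intro!: continuous_intros\<close>)
  then have "set_integrable lborel {0..2*pi} (\<lambda>t. f (rcis r t))" by (rule borel_integrable_atLeastAtMost')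
  ultimately show ?thesis by (simp add: set_borel_integral_eq_integral(2) integral_unique)
qed

lemma circle_integral_reflect:
  fixes f :: "real \<Rightarrow> complex"
  shows "(LINT \<phi>:{0..2*pi}|lborel. f \<phi>) = (LINT \<phi>:{0..2*pi}|lborel. f (2*pi - \<phi>))"
proof -
  have "(LINT \<phi>:{0..2*pi}|lborel. f \<phi>) = \<bar>-1::real\<bar> *\<^sub>R (LINT x|lborel. indicator {0..2*pi} (2*pi + (-1) * x) *\<^sub>R f (2*pi + (-1) * x))"
    unfolding set_lebesgue_integral_def by (rule lborel_integral_real_affine) simp
  also have "\<dots> = (LINT \<phi>:{0..2*pi}|lborel. f (2*pi - \<phi>))"
    unfolding set_lebesgue_integral_def by (auto intro!: Bochner_Integration.integral_cong simp: indicator_def)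
  finally show ?thesis .
qed

lemma rcis_2pi_minus: "rcis r (2 * pi - \<phi>) = cnj (rcis r \<phi>)"
  by (simp add: complex_eq_iff cos_diff sin_diff)

text \<open>The substitution \<open>u = 1/z\<close> turns this into the mean value property in a disc: \<open>z h(z)\<close> becomes a
function with a removable singularity at \<open>0\<close> and value \<open>c\<close> there.\<close>

lemma circle_integral_exterior:
  fixes h :: "complex \<Rightarrow> complex" and c :: complex
  assumes h: "h holomorphic_on {z. R\<^sub>1 < cmod z}" and R1: "0 < R\<^sub>1" and R: "R\<^sub>1 < R"
    and lim: "((\<lambda>z. z * h z) \<longlongrightarrow> c) at_infinity"
  shows "(LINT \<phi>:{0..2*pi}|lborel. h (rcis R \<phi>) * rcis R \<phi>) = 2 * pi * c"
proof -
  (* k extends h(1/u)/u holomorphically to 0 *)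
  define k where "k u = (if u = 0 then c else h (inverse u) * inverse u)" for u
  have R0: "R > 0" using R1 R by simp
  have "open {z::complex. R\<^sub>1 < cmod z}" by (intro open_Collect_less continuous_intros)
  have "(\<lambda>u. h (inverse u) * inverse u) holomorphic_on ball 0 (1 / R\<^sub>1) - {0}"
    by (intro holomorphic_intros holomorphic_on_compose_gen[OF _ h, unfolded o_def])
       (use R1 in \<open>auto simp: norm_divide field_simps\<close>)
  then have hol: "k holomorphic_on ball 0 (1 / R\<^sub>1) - {0}"
    by (rule holomorphic_transform) (auto simp: k_def)
  have lim0: "(k \<longlongrightarrow> k 0) (at 0)"
  proof -
    have "((\<lambda>z. inverse z * h (inverse z)) \<longlongrightarrow> c) (at 0)"
      by (rule filterlim_compose[OF lim filterlim_inverse_at_infinity])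
    then have "(k \<longlongrightarrow> c) (at 0)"
      by (rule Lim_transform_eventually) (auto simp: k_def eventually_at_filter mult.commute)
    moreover have "k 0 = c" by (simp add: k_def)
    ultimately show ?thesis by simp
  qed
  have hol': "k holomorphic_on ball 0 (1 / R\<^sub>1)"
    by (rule no_isolated_singularity'[of "{0}"]) (use hol tendsto_within_subset[OF lim0] R1 in auto)
  have "1 / R < 1 / R\<^sub>1" using R1 R by (simp add: frac_less2)
  then have sub: "cball 0 (1 / R) \<subseteq> ball 0 (1 / R\<^sub>1)" by auto
  have "(LINT \<phi>:{0..2*pi}|lborel. k (rcis (1/R) \<phi>)) = 2 * pi * k 0"
    using R1 R sub by (intro circle_mean_value holomorphic_on_imp_continuous_on holomorphic_on_subset[OF hol']) auto
  moreover have "(LINT \<phi>:{0..2*pi}|lborel. h (rcis R \<phi>) * rcis R \<phi>)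
    = (LINT \<phi>:{0..2*pi}|lborel. h (rcis R (2*pi - \<phi>)) * rcis R (2*pi - \<phi>))"
    by (rule circle_integral_reflect)
  moreover have "h (rcis R (2*pi - \<phi>)) * rcis R (2*pi - \<phi>) = k (rcis (1/R) \<phi>)" for \<phi>
  proof -
    have "inverse (rcis (1/R) \<phi>) = rcis R (2*pi - \<phi>)"
      using R0 by (simp add: rcis_2pi_minus) (simp add: rcis_def cis_cnj field_simps flip: cis_inverse)
    then show ?thesis using R0 by (simp add: k_def)
  qed
  ultimately show ?thesis by (simp add: k_def)
qed

lemma integral_exp_int:
  "(LINT \<phi>:{0..2*pi}|lborel. exp (- \<i> * of_int k * of_real \<phi>)) = (if k = 0 then 2 * pi else 0 :: complex)"
proof (cases "k = 0")
  case False
  have "((\<lambda>\<phi>. exp (- \<i> * of_int k * of_real \<phi>)) has_integral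
     (exp (- \<i> * of_int k * of_real (2*pi)) / (- \<i> * of_int k) - exp (- \<i> * of_int k * of_real 0) / (- \<i> * of_int k))) {0..2*pi}"
    by (rule fundamental_theorem_of_calculus, simp, rule has_vector_derivative_real_field)
       (use False in \<open>auto intro!: derivative_eq_intros\<close>)
  moreover have "exp (- \<i> * of_int k * of_real (2*pi)) = 1"
    by (subst exp_eq_1) (auto intro!: exI[of _ "- k"])
  moreover have "set_integrable lborel {0..2*pi} (\<lambda>\<phi>. exp (- \<i> * of_int k * of_real \<phi>))"
    by (rule borel_integrable_atLeastAtMost') (intro continuous_intros)
  ultimately show ?thesis using False by (simp add: set_borel_integral_eq_integral(2) integral_unique)
next
  case True
  then show ?thesis by (simp add: set_lebesgue_integral_def scaleR_conv_of_real)
qed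

context
  fixes r :: real and \<xi> :: complex
  assumes r: "r > 0" and \<xi>: "\<xi> \<noteq> 0" and neq: "cmod \<xi> \<noteq> r"
begin

private definition I :: "int \<Rightarrow> complex" where
  "I k = (LINT \<phi>:{0..2*pi}|lborel. exp (- \<i> * of_int k * of_real \<phi>) / (rcis r \<phi> - \<xi>))"

lemma circle_ne: "rcis r \<phi> - \<xi> \<noteq> 0"
  using neq r by (metis abs_of_pos complex_mod_rcis right_minus_eq)

private lemma int: "set_integrable lborel {0..2*pi} (\<lambda>\<phi>. exp (- \<i> * of_int k * of_real \<phi>) / (rcis r \<phi> - \<xi>))"
  by (rule borel_integrable_atLeastAtMost') (intro continuous_intros ballI circle_ne)

text \<open>The identity \<open>\<zeta>/(\<zeta> - \<xi>) = 1 + \<xi>/(\<zeta> - \<xi>)\<close> on the circle links neighbouring coefficients; one known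
coefficient then determines all of them.\<close>

private lemma rec: "r * I (k - 1) = (if k = 0 then 2 * pi else 0) + \<xi> * I k"
proof -
  have eq: "r * (exp (- \<i> * of_int (k - 1) * of_real \<phi>) / (rcis r \<phi> - \<xi>))
     = exp (- \<i> * of_int k * of_real \<phi>) + \<xi> * (exp (- \<i> * of_int k * of_real \<phi>) / (rcis r \<phi> - \<xi>))" for \<phi>
  proof -
    have "exp (- \<i> * of_int (k - 1) * of_real \<phi>) = exp (- \<i> * of_int k * of_real \<phi>) * cis \<phi>"
      by (simp add: cis_conv_exp exp_add[symmetric] algebra_simps)
    then have "r * (exp (- \<i> * of_int (k - 1) * of_real \<phi>) / (rcis r \<phi> - \<xi>)) = exp (- \<i> * of_int k * of_real \<phi>) * (rcis r \<phi> / (rcis r \<phi> - \<xi>))"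
      by (simp add: rcis_def)
    also have "rcis r \<phi> / (rcis r \<phi> - \<xi>) = 1 + \<xi> / (rcis r \<phi> - \<xi>)"
      using circle_ne[of \<phi>] by (simp add: field_simps)
    finally show ?thesis by (simp add: algebra_simps)
  qed
  have "r * I (k - 1) = (LINT \<phi>:{0..2*pi}|lborel. r * (exp (- \<i> * of_int (k - 1) * of_real \<phi>) / (rcis r \<phi> - \<xi>)))"
    unfolding I_def by (rule set_integral_mult_right[symmetric])
  also have "\<dots> = (LINT \<phi>:{0..2*pi}|lborel. exp (- \<i> * of_int k * of_real \<phi>)) + (LINT \<phi>:{0..2*pi}|lborel. \<xi> * (exp (- \<i> * of_int k * of_real \<phi>) / (rcis r \<phi> - \<xi>)))"
    unfolding eq by (intro set_integral_add borel_integrable_atLeastAtMost' set_integrable_mult_right int continuous_intros)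
  also have "\<dots> = (if k = 0 then 2 * pi else 0) + \<xi> * I k"
    unfolding I_def integral_exp_int set_integral_mult_right ..
  finally show ?thesis .
qed

text \<open>For a pole outside the circle, the coefficient of order \<open>-1\<close> vanishes by the mean value property,
since \<open>z/(z - \<xi>)\<close> is holomorphic in the disc and \<open>0\<close> at its centre; the recursion does the rest.\<close>

lemma circle_integral_cauchy_kernel_outside:
  assumes out: "r < cmod \<xi>"
  shows "(LINT \<phi>:{0..2*pi}|lborel. exp (- \<i> * of_int k * of_real \<phi>) / (rcis r \<phi> - \<xi>))
    = (if 0 \<le> k then - 2 * pi * of_real (r powi k) * \<xi> powi (- k - 1) else 0)"
proof -
  have base: "I (-1) = 0"
  proof -
    have "(LINT \<phi>:{0..2*pi}|lborel. rcis r \<phi> / (rcis r \<phi> - \<xi>)) = 2 * pi * (0 / (0 - \<xi>))"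
      by (rule circle_mean_value[OF r]) (use out in \<open>auto intro!: continuous_intros holomorphic_intros\<close>)
    moreover have "rcis r \<phi> / (rcis r \<phi> - \<xi>) = r * (exp (- \<i> * of_int (-1) * of_real \<phi>) / (rcis r \<phi> - \<xi>))" for \<phi>
      by (simp add: rcis_def cis_conv_exp)
    ultimately have "(LINT \<phi>:{0..2*pi}|lborel. r * (exp (- \<i> * of_int (-1) * of_real \<phi>) / (rcis r \<phi> - \<xi>))) = 0"
      by simp
    then have "r * I (-1) = 0" unfolding I_def using set_integral_mult_right by metis
    then show ?thesis using r by simp
  qed
  have neg: "I (-1 - int n) = 0" for n
  proof (induction n)
    case (Suc n)
    have "-1 - int (Suc n) = (-1 - int n) - 1" by simp
    then show ?case using rec[of "-1 - int n"] Suc r by simp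
  qed (use base in simp)
  have pos: "I (int n) = - 2 * pi * r ^ n / \<xi> ^ (n + 1)" for n
  proof (induction n)
    case 0 then show ?case using rec[of 0] base \<xi> by (simp add: field_simps eq_neg_iff_add_eq_0)
  next
    case (Suc n)
    have "r * I (int n) = \<xi> * I (int (Suc n))" using rec[of "int (Suc n)"] by simp
    then have "I (int (Suc n)) = r * I (int n) / \<xi>" using \<xi> by (simp add: field_simps)
    then show ?case unfolding Suc.IH using \<xi> by (simp add: field_simps)
  qed
  show ?thesis
  proof (cases "0 \<le> k")
    case True
    then obtain n where n: "k = int n" using zero_le_imp_eq_int by blast
    have "\<xi> powi (- int n - 1) = 1 / \<xi> ^ (n + 1)"
      by (simp add: power_int_minus power_int_of_nat[symmetric] inverse_eq_divide flip: power_int_minus_divide)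
         (metis add.commute inverse_eq_divide minus_diff_commute minus_diff_eq diff_minus_eq_add of_nat_Suc plus_1_eq_Suc power_int_minus power_int_of_nat power_Suc uminus_add_conv_diff)
    then show ?thesis using pos[of n] n by (simp add: I_def)
  next
    case False
    then have "k = -1 - int (nat (-1 - k))" by simp
    then show ?thesis using neg[of "nat (-1 - k)"] False by (simp add: I_def)
  qed
qed

text \<open>For a pole inside the circle, the coefficient of order \<open>0\<close> vanishes: after the reflection
\<open>\<phi> \<mapsto> 2 \<pi> - \<phi>\<close> the integrand \<open>z/(r - \<xi> z)\<close> is holomorphic in the unit disc and \<open>0\<close> at its centre.\<close>

lemma circle_integral_cauchy_kernel_inside:
  assumes inn: "cmod \<xi> < r"
  shows "(LINT \<phi>:{0..2*pi}|lborel. exp (- \<i> * of_int k * of_real \<phi>) / (rcis r \<phi> - \<xi>))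
    = (if k < 0 then 2 * pi * of_real (r powi k) * \<xi> powi (- k - 1) else 0)"
proof -
  have base: "I 0 = 0"
  proof -
    have ne: "of_real r \<noteq> \<xi> * z" if "cmod z \<le> 1" for z
    proof
      assume "of_real r = \<xi> * z"
      then have "r = cmod \<xi> * cmod z" using r by (metis abs_of_pos norm_mult norm_of_real)
      also have "\<dots> \<le> cmod \<xi> * 1" using that by (intro mult_left_mono) auto
      finally show False using inn by simp
    qed
    have "(LINT \<phi>:{0..2*pi}|lborel. rcis 1 \<phi> / (r - \<xi> * rcis 1 \<phi>)) = 2 * pi * (0 / (r - \<xi> * 0))"
      by (rule circle_mean_value) (use ne in \<open>auto intro!: continuous_intros holomorphic_intros\<close>)
    moreover have "I 0 = (LINT \<phi>:{0..2*pi}|lborel. 1 / (rcis r (2*pi - \<phi>) - \<xi>))"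
      unfolding I_def using circle_integral_reflect[of "\<lambda>\<phi>. 1 / (rcis r \<phi> - \<xi>)"] by simp
    moreover have "1 / (rcis r (2*pi - \<phi>) - \<xi>) = rcis 1 \<phi> / (r - \<xi> * rcis 1 \<phi>)" for \<phi>
    proof -
      have "r - \<xi> * rcis 1 \<phi> = (rcis r (2*pi - \<phi>) - \<xi>) * rcis 1 \<phi>"
        by (simp add: left_diff_distrib rcis_mult) (simp add: rcis_def)
      then show ?thesis by (simp add: rcis_def)
    qed
    ultimately show ?thesis by simp
  qed
  have pos: "I (int n) = 0" for n
  proof (induction n)
    case (Suc n)
    then show ?case using rec[of "int (Suc n)"] \<xi> by simp
  qed (use base in simp)
  have neg: "I (-1 - int n) = 2 * pi * \<xi> ^ n / r ^ (n + 1)" for n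
  proof (induction n)
    case 0 then show ?case using rec[of 0] base r by (simp add: field_simps)
  next
    case (Suc n)
    have "-1 - int (Suc n) = (-1 - int n) - 1" by simp
    then have "r * I (-1 - int (Suc n)) = \<xi> * I (-1 - int n)" using rec[of "-1 - int n"] by simp
    then have "I (-1 - int (Suc n)) = \<xi> * I (-1 - int n) / r" using r by (simp add: field_simps)
    then show ?case unfolding Suc.IH using r by (simp add: field_simps)
  qed
  show ?thesis
  proof (cases "k < 0")
    case False
    then obtain n where n: "k = int n" using zero_le_imp_eq_int by (metis not_less)
    then show ?thesis using pos[of n] by (simp add: I_def)
  next
    case True
    define n where "n = nat (-1 - k)"
    have k: "k = -1 - int n" using True by (simp add: n_def)
    have "of_real (r powi k) = (1 / r ^ (n + 1) :: complex)"
    proof -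
      have "k = - int (n + 1)" using k by simp
      then have "r powi k = inverse (r ^ (n + 1))" by (simp only: power_int_minus power_int_of_nat)
      then show ?thesis by (simp add: inverse_eq_divide)
    qed
    moreover have "\<xi> powi (- k - 1) = \<xi> ^ n" using k by simp
    ultimately show ?thesis using neg[of n] k True by (simp add: I_def)
  qed
qed

end

section \<open>The Cauchy transform of an integrable function\<close>

definition cauchy_transform :: "(complex \<Rightarrow> complex) \<Rightarrow> complex \<Rightarrow> complex" where
  "cauchy_transform f \<zeta> = (LINT \<xi>|lborel. f \<xi> / (\<zeta> - \<xi>))"

text \<open>For an integrable \<open>f\<close> the integral defining the Cauchy transform converges for almost every \<open>\<zeta>\<close>
only, and has the default value \<open>0\<close> elsewhere. The majorant, with values in \<open>ennreal\<close>, keeps track of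
the convergence and is what all estimates and applications of Fubini are based on.\<close>

definition cauchy_majorant :: "(complex \<Rightarrow> complex) \<Rightarrow> complex \<Rightarrow> ennreal" where
  "cauchy_majorant f \<zeta> = (\<integral>\<^sup>+\<xi>. ennreal (cmod (f \<xi> / (\<zeta> - \<xi>))) \<partial>lborel)"

lemma cauchy_majorant_measurable [measurable]:
  assumes [measurable]: "f \<in> borel_measurable borel"
  shows "cauchy_majorant f \<in> borel_measurable borel"
  unfolding cauchy_majorant_def[abs_def] by measurable

lemma cauchy_transform_measurable [measurable]:
  assumes [measurable]: "f \<in> borel_measurable borel"
  shows "cauchy_transform f \<in> borel_measurable borel"
  unfolding cauchy_transform_def[abs_def] by measurable

lemma cauchy_transform_le_majorant: "ennreal (cmod (cauchy_transform f \<zeta>)) \<le> cauchy_majorant f \<zeta>"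
proof (cases "integrable lborel (\<lambda>\<xi>. f \<xi> / (\<zeta> - \<xi>))")
  case True
  then show ?thesis unfolding cauchy_transform_def cauchy_majorant_def by (rule integral_norm_bound_ennreal)
next
  case False
  then show ?thesis unfolding cauchy_transform_def by (simp add: not_integrable_integral_eq)
qed

lemma cauchy_majorant_finite_iff:
  assumes [measurable]: "f \<in> borel_measurable borel"
  shows "cauchy_majorant f \<zeta> < \<infinity> \<longleftrightarrow> integrable lborel (\<lambda>\<xi>. f \<xi> / (\<zeta> - \<xi>))"
  unfolding cauchy_majorant_def integrable_iff_bounded by (simp add: less_top)

text \<open>Tonelli: the weight \<open>g\<close> is moved onto the kernel, so that estimates of the majorant reduce to
estimates of the kernel that are uniform in \<open>\<xi>\<close>.\<close>

lemma nn_integral_cauchy_majorant: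
  fixes f :: "complex \<Rightarrow> complex" and g :: "complex \<Rightarrow> ennreal"
  assumes [measurable]: "f \<in> borel_measurable borel" "g \<in> borel_measurable borel"
  shows "(\<integral>\<^sup>+\<zeta>. g \<zeta> * cauchy_majorant f \<zeta> \<partial>lborel)
     = (\<integral>\<^sup>+\<xi>. ennreal (cmod (f \<xi>)) * (\<integral>\<^sup>+\<zeta>. g \<zeta> * ennreal (1 / cmod (\<zeta> - \<xi>)) \<partial>lborel) \<partial>lborel)"
proof -
  have "(\<integral>\<^sup>+\<zeta>. g \<zeta> * cauchy_majorant f \<zeta> \<partial>lborel) = (\<integral>\<^sup>+\<zeta>. (\<integral>\<^sup>+\<xi>. g \<zeta> * ennreal (cmod (f \<xi> / (\<zeta> - \<xi>))) \<partial>lborel) \<partial>lborel)"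
    unfolding cauchy_majorant_def by (intro nn_integral_cong nn_integral_cmult[symmetric]) measurable
  also have "\<dots> = (\<integral>\<^sup>+\<xi>. (\<integral>\<^sup>+\<zeta>. g \<zeta> * ennreal (cmod (f \<xi> / (\<zeta> - \<xi>))) \<partial>lborel) \<partial>lborel)"
    by (rule lborel_pair.Fubini') measurable
  also have "\<dots> = (\<integral>\<^sup>+\<xi>. (\<integral>\<^sup>+\<zeta>. ennreal (cmod (f \<xi>)) * (g \<zeta> * ennreal (1 / cmod (\<zeta> - \<xi>))) \<partial>lborel) \<partial>lborel)"
  proof (intro nn_integral_cong)
    fix \<xi> \<zeta>
    have "ennreal (cmod (f \<xi> / (\<zeta> - \<xi>))) = ennreal (cmod (f \<xi>)) * ennreal (1 / cmod (\<zeta> - \<xi>))"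
      by (simp add: norm_divide ennreal_mult[symmetric])
    then show "g \<zeta> * ennreal (cmod (f \<xi> / (\<zeta> - \<xi>))) = ennreal (cmod (f \<xi>)) * (g \<zeta> * ennreal (1 / cmod (\<zeta> - \<xi>)))"
      by (simp add: mult_ac)
  qed
  also have "\<dots> = (\<integral>\<^sup>+\<xi>. ennreal (cmod (f \<xi>)) * (\<integral>\<^sup>+\<zeta>. g \<zeta> * ennreal (1 / cmod (\<zeta> - \<xi>)) \<partial>lborel) \<partial>lborel)"
    by (intro nn_integral_cong nn_integral_cmult) measurable
  finally show ?thesis .
qed

lemma nn_integral_cauchy_majorant_le:
  fixes f :: "complex \<Rightarrow> complex"
  assumes [measurable]: "f \<in> borel_measurable borel" "A \<in> sets borel" and e: "e > 0"
  shows "(\<integral>\<^sup>+\<zeta>\<in>A. cauchy_majorant f \<zeta> \<partial>lborel)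
     \<le> (\<integral>\<^sup>+\<xi>. ennreal (cmod (f \<xi>)) \<partial>lborel) * (ennreal (2 * pi * e) + ennreal (1 / e) * emeasure lborel A)"
proof -
  have "(\<integral>\<^sup>+\<zeta>\<in>A. cauchy_majorant f \<zeta> \<partial>lborel) = (\<integral>\<^sup>+\<zeta>. indicator A \<zeta> * cauchy_majorant f \<zeta> \<partial>lborel)"
    by (simp add: mult.commute)
  also have "\<dots> = (\<integral>\<^sup>+\<xi>. ennreal (cmod (f \<xi>)) * (\<integral>\<^sup>+\<zeta>. indicator A \<zeta> * ennreal (1 / cmod (\<zeta> - \<xi>)) \<partial>lborel) \<partial>lborel)"
    by (rule nn_integral_cauchy_majorant) measurable
  also have "\<dots> \<le> (\<integral>\<^sup>+\<xi>. ennreal (cmod (f \<xi>)) * (ennreal (2 * pi * e) + ennreal (1 / e) * emeasure lborel A) \<partial>lborel)"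
    by (intro nn_integral_mono mult_left_mono) (use nn_integral_cauchy_kernel_le[OF e assms(2)] in \<open>simp_all add: mult.commute\<close>)
  also have "\<dots> = (\<integral>\<^sup>+\<xi>. ennreal (cmod (f \<xi>)) \<partial>lborel) * (ennreal (2 * pi * e) + ennreal (1 / e) * emeasure lborel A)"
    by (rule nn_integral_multc) measurable
  finally show ?thesis .
qed

lemma nn_integral_cauchy_majorant_bounded:
  fixes f :: "complex \<Rightarrow> complex"
  assumes f: "integrable lborel f" and A: "A \<in> sets borel" "bounded A"
  shows "(\<integral>\<^sup>+\<zeta>\<in>A. cauchy_majorant f \<zeta> \<partial>lborel) < \<infinity>"
proof -
  have fm: "f \<in> borel_measurable borel" using borel_measurable_integrable[OF f] by simp
  have "(\<integral>\<^sup>+\<xi>. ennreal (cmod (f \<xi>)) \<partial>lborel) * (ennreal (2 * pi * 1) + ennreal (1 / 1) * emeasure lborel A) < \<infinity>"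
    using f emeasure_bounded_finite[OF A(2)] unfolding integrable_iff_bounded by (simp add: ennreal_mult_less_top)
  with nn_integral_cauchy_majorant_le[OF fm A(1), of 1] show ?thesis by (simp add: order_le_less_trans)
qed

lemma cauchy_majorant_AE_finite:
  fixes f :: "complex \<Rightarrow> complex"
  assumes f: "integrable lborel f"
  shows "AE \<zeta> in lborel. cauchy_majorant f \<zeta> < \<infinity>"
proof -
  have [measurable]: "f \<in> borel_measurable borel" using borel_measurable_integrable[OF f] by simp
  have "AE \<zeta> in lborel. cauchy_majorant f \<zeta> * indicator (ball 0 (real n)) \<zeta> \<noteq> \<infinity>" for n
    by (rule nn_integral_PInf_AE) (use nn_integral_cauchy_majorant_bounded[OF f, of "ball 0 (real n)"] in \<open>auto intro!: borel_measurable_times_ennreal borel_measurable_indicator\<close>)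
  then have "AE \<zeta> in lborel. \<forall>n. cauchy_majorant f \<zeta> * indicator (ball 0 (real n)) \<zeta> \<noteq> \<infinity>"
    by (simp add: AE_all_countable)
  then show ?thesis
  proof eventually_elim
    case (elim \<zeta>)
    obtain n :: nat where "cmod \<zeta> < real n" using reals_Archimedean2 by blast
    with elim[rule_format, of n] show ?case by (simp add: less_top)
  qed
qed

lemma cauchy_transform_set_integrable:
  fixes f :: "complex \<Rightarrow> complex"
  assumes f: "integrable lborel f" and A: "A \<in> sets borel" "bounded A"
  shows "set_integrable lborel A (cauchy_transform f)"
proof -
  have [measurable]: "f \<in> borel_measurable borel" using borel_measurable_integrable[OF f] by simp
  note A(1) [measurable]
  show ?thesis unfolding set_integrable_def
  proof (rule integrableI_bounded)
    have "(\<integral>\<^sup>+x. ennreal (norm (indicator A x *\<^sub>R cauchy_transform f x)) \<partial>lborel) \<le> (\<integral>\<^sup>+\<zeta>\<in>A. cauchy_majorant f \<zeta> \<partial>lborel)"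
      by (intro nn_integral_mono) (auto simp: indicator_def cauchy_transform_le_majorant)
    also have "\<dots> < \<infinity>" by (rule nn_integral_cauchy_majorant_bounded[OF f A])
    finally show "(\<integral>\<^sup>+x. ennreal (norm (indicator A x *\<^sub>R cauchy_transform f x)) \<partial>lborel) < \<infinity>" .
  qed measurable
qed

text \<open>Stated for an arbitrary measure and curve \<open>\<gamma>\<close> because it is applied both to plane integrals
and to integrals over circles and their images.\<close>

lemma cauchy_transform_Fubini:
  fixes f :: "complex \<Rightarrow> complex" and M :: "'a measure" and k \<gamma> :: "'a \<Rightarrow> complex"
  assumes [measurable]: "f \<in> borel_measurable borel" "k \<in> borel_measurable M" "\<gamma> \<in> borel_measurable M"
    and M: "sigma_finite_measure M"
    and fin: "(\<integral>\<^sup>+x. ennreal (cmod (k x)) * cauchy_majorant f (\<gamma> x) \<partial>M) < \<infinity>"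
  shows "integrable M (\<lambda>x. k x * cauchy_transform f (\<gamma> x))"
    and "(LINT x|M. k x * cauchy_transform f (\<gamma> x)) = (LINT \<xi>|lborel. f \<xi> * (LINT x|M. k x / (\<gamma> x - \<xi>)))"
proof -
  interpret sigma_finite_measure M by (rule M)
  interpret P: pair_sigma_finite M lborel ..
  have m: "(\<lambda>(x, \<xi>). k x * (f \<xi> / (\<gamma> x - \<xi>))) \<in> borel_measurable (M \<Otimes>\<^sub>M lborel)" by measurable
  have i: "integrable (M \<Otimes>\<^sub>M lborel) (\<lambda>(x, \<xi>). k x * (f \<xi> / (\<gamma> x - \<xi>)))"
  proof (rule integrableI_bounded[OF m])
    have "(\<integral>\<^sup>+p. ennreal (norm (case p of (x, \<xi>) \<Rightarrow> k x * (f \<xi> / (\<gamma> x - \<xi>)))) \<partial>(M \<Otimes>\<^sub>M lborel))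
       = (\<integral>\<^sup>+x. \<integral>\<^sup>+\<xi>. ennreal (cmod (k x * (f \<xi> / (\<gamma> x - \<xi>)))) \<partial>lborel \<partial>M)"
      by (subst lborel.nn_integral_fst[symmetric]) auto
    also have "\<dots> = (\<integral>\<^sup>+x. ennreal (cmod (k x)) * cauchy_majorant f (\<gamma> x) \<partial>M)"
      unfolding cauchy_majorant_def
      by (intro nn_integral_cong, subst nn_integral_cmult[symmetric], measurable)
         (auto intro!: nn_integral_cong simp: norm_mult norm_divide ennreal_mult[symmetric])
    finally show "(\<integral>\<^sup>+p. ennreal (norm (case p of (x, \<xi>) \<Rightarrow> k x * (f \<xi> / (\<gamma> x - \<xi>)))) \<partial>(M \<Otimes>\<^sub>M lborel)) < \<infinity>"
      using fin by simp
  qed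
  have 1: "(LINT \<xi>|lborel. k x * (f \<xi> / (\<gamma> x - \<xi>))) = k x * cauchy_transform f (\<gamma> x)" for x
    unfolding cauchy_transform_def by (rule integral_mult_right_zero)
  have 2: "(LINT x|M. k x * (f \<xi> / (\<gamma> x - \<xi>))) = f \<xi> * (LINT x|M. k x / (\<gamma> x - \<xi>))" for \<xi>
  proof -
    have "k x * (f \<xi> / (\<gamma> x - \<xi>)) = f \<xi> * (k x / (\<gamma> x - \<xi>))" for x by simp
    then show ?thesis by (simp only: integral_mult_right_zero)
  qed
  show "integrable M (\<lambda>x. k x * cauchy_transform f (\<gamma> x))"
    using P.integrable_fst'[OF i] by (simp only: split 1)
  show "(LINT x|M. k x * cauchy_transform f (\<gamma> x)) = (LINT \<xi>|lborel. f \<xi> * (LINT x|M. k x / (\<gamma> x - \<xi>)))"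
    using P.Fubini_integral[OF i] by (simp only: 1 2)
qed

text \<open>The Cauchy transform solves \<open>dbar C = \<pi> f\<close> in the sense of distributions: by Fubini the
test function is convolved with the Cauchy kernel, and Cauchy-Pompeiu gives it back.\<close>

theorem cauchy_transform_weak_dbar:
  fixes f \<eta> a b :: "complex \<Rightarrow> complex"
  assumes f: "integrable lborel f" and t: "wirtinger_test S \<eta> a b"
  shows "integrable lborel (\<lambda>z. b z * cauchy_transform f z)"
    and "(LINT z|lborel. b z * cauchy_transform f z) = - pi * (LINT z|lborel. f z * \<eta> z)"
proof -
  have fm [measurable]: "f \<in> borel_measurable borel" using borel_measurable_integrable[OF f] by simp
  obtain K where K: "compact K" "\<And>x. x \<notin> K \<Longrightarrow> \<eta> x = 0" using t by (auto simp: wirtinger_test_def)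
  have cb: "continuous_on UNIV b" using t by (auto simp: wirtinger_test_def)
  then have bm [measurable]: "b \<in> borel_measurable borel" by (rule borel_measurable_continuous_onI)
  have vb: "b x = 0" if "x \<notin> K" for x
    using wirtinger_test_vanish[OF t K(1), of x] K(2) that by auto
  have "bounded (b ` K)" using cb K(1) by (meson compact_continuous_image compact_imp_bounded continuous_on_subset subset_UNIV)
  then obtain B where B: "\<And>x. x \<in> K \<Longrightarrow> cmod (b x) \<le> B" "B > 0" by (auto simp: bounded_pos)
  have K' [measurable]: "K \<in> sets borel" using K(1) by (simp add: borel_compact)
  have "(\<integral>\<^sup>+x. ennreal (cmod (b x)) * cauchy_majorant f x \<partial>lborel) \<le> (\<integral>\<^sup>+x. ennreal B * (cauchy_majorant f x * indicator K x) \<partial>lborel)"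
    by (rule nn_integral_mono) (use B vb in \<open>auto simp: indicator_def intro!: mult_right_mono ennreal_leI\<close>)
  also have "\<dots> = ennreal B * (\<integral>\<^sup>+x\<in>K. cauchy_majorant f x \<partial>lborel)"
    by (rule nn_integral_cmult) measurable
  also have "\<dots> < \<infinity>"
    using nn_integral_cauchy_majorant_bounded[OF f K' compact_imp_bounded[OF K(1)]] by (simp add: ennreal_mult_less_top)
  finally have fin: "(\<integral>\<^sup>+x. ennreal (cmod (b x)) * cauchy_majorant f x \<partial>lborel) < \<infinity>" .
  note F = cauchy_transform_Fubini[of f b lborel "\<lambda>x. x", OF fm _ _ sigma_finite_lborel fin]
  show "integrable lborel (\<lambda>z. b z * cauchy_transform f z)" by (rule F) auto
  show "(LINT z|lborel. b z * cauchy_transform f z) = - pi * (LINT z|lborel. f z * \<eta> z)"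
  proof -
    have "(LINT z|lborel. b z * cauchy_transform f z) = (LINT z|lborel. f z * (LINT x|lborel. b x / (x - z)))"
      by (rule F) auto
    also have "\<dots> = (LINT z|lborel. - pi * (f z * \<eta> z))"
      unfolding cauchy_pompeiu(2)[OF t] by (simp add: mult.left_commute)
    also have "\<dots> = - pi * (LINT z|lborel. f z * \<eta> z)" by (rule integral_mult_right_zero)
    finally show ?thesis .
  qed
qed

text \<open>Iterating \<open>1/(\<zeta> - \<xi>) = - 1/\<xi> + (\<zeta>/\<xi>)/(\<zeta> - \<xi>)\<close> produces the moments of \<open>f\<close> and a remainder that
decays geometrically, because \<open>|\<zeta>| < r0 < |\<xi>|\<close> on the support. If the moments of order at least \<open>2\<close>
vanish, only the constant term survives.\<close>

lemma cauchy_transform_inside_disc: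
  fixes f :: "complex \<Rightarrow> complex"
  assumes f: "integrable lborel f" and r0: "r0 > 0" and supp: "\<And>\<xi>. cmod \<xi> \<le> r0 \<Longrightarrow> f \<xi> = 0"
    and mom: "\<And>k::nat. k \<ge> 2 \<Longrightarrow> (LINT \<xi>|lborel. f \<xi> / \<xi> ^ k) = 0" and z: "cmod \<zeta> < r0"
  shows "integrable lborel (\<lambda>\<xi>. f \<xi> / (\<zeta> - \<xi>))" "cauchy_transform f \<zeta> = - (LINT \<xi>|lborel. f \<xi> / \<xi>)"
proof -
  have fm [measurable]: "f \<in> borel_measurable borel" using borel_measurable_integrable[OF f] by simp
  define d where "d = r0 - cmod \<zeta>"
  have d: "d > 0" using z by (simp add: d_def)
  have bnd: "cmod (f \<xi> * (\<zeta> / \<xi>) ^ n / (\<zeta> - \<xi>)) \<le> (cmod \<zeta> / r0) ^ n / d * cmod (f \<xi>)" for \<xi> n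
  proof (cases "cmod \<xi> \<le> r0")
    case False
    then have "d \<le> cmod (\<zeta> - \<xi>)" using norm_triangle_ineq2[of \<xi> \<zeta>] by (simp add: d_def norm_minus_commute)
    moreover have "(cmod \<zeta> / cmod \<xi>) ^ n \<le> (cmod \<zeta> / r0) ^ n"
      using False r0 by (intro power_mono divide_left_mono) (auto intro!: mult_pos_pos)
    ultimately have "(cmod \<zeta> / cmod \<xi>) ^ n / cmod (\<zeta> - \<xi>) \<le> (cmod \<zeta> / r0) ^ n / d"
      using d r0 by (intro frac_le) auto
    then have "cmod (f \<xi>) * ((cmod \<zeta> / cmod \<xi>) ^ n / cmod (\<zeta> - \<xi>)) \<le> cmod (f \<xi>) * ((cmod \<zeta> / r0) ^ n / d)"
      by (rule mult_left_mono) simp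
    then show ?thesis by (simp add: norm_mult norm_divide norm_power mult_ac)
  qed (simp add: supp)
  have int_rem: "integrable lborel (\<lambda>\<xi>. f \<xi> * (\<zeta> / \<xi>) ^ n / (\<zeta> - \<xi>))" for n
    by (rule Bochner_Integration.integrable_bound[of _ "\<lambda>\<xi>. (cmod \<zeta> / r0) ^ n / d * cmod (f \<xi>)"])
       (use f bnd[of _ n] d r0 in \<open>auto intro!: integrable_mult_right integrable_norm\<close>)
  then show int: "integrable lborel (\<lambda>\<xi>. f \<xi> / (\<zeta> - \<xi>))" using int_rem[of 0] by simp
  have int_mom: "integrable lborel (\<lambda>\<xi>. f \<xi> / \<xi> ^ k)" for k
  proof (rule Bochner_Integration.integrable_bound[of _ "\<lambda>\<xi>. cmod (f \<xi>) / r0 ^ k"])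
    have "cmod (f \<xi>) / cmod \<xi> ^ k \<le> cmod (f \<xi>) / r0 ^ k" for \<xi>
    proof (cases "cmod \<xi> \<le> r0")
      case False
      then have "0 < cmod \<xi>" using r0 by linarith
      then show ?thesis using False r0 by (intro divide_left_mono power_mono) (auto intro!: mult_pos_pos)
    qed (simp add: supp)
    then show "AE \<xi> in lborel. cmod (f \<xi> / \<xi> ^ k) \<le> norm (cmod (f \<xi>) / r0 ^ k)"
      using r0 by (auto simp: norm_divide norm_power)
  qed (use f in \<open>auto intro!: integrable_divide\<close>)
  define m where "m = (LINT \<xi>|lborel. f \<xi> / \<xi>)"
  have rep: "cauchy_transform f \<zeta> = - m + (LINT \<xi>|lborel. f \<xi> * (\<zeta> / \<xi>) ^ Suc n / (\<zeta> - \<xi>))" for n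
  proof (induction n)
    case 0
    have "f \<xi> / (\<zeta> - \<xi>) = - (f \<xi> / \<xi> ^ 1) + f \<xi> * (\<zeta> / \<xi>) ^ Suc 0 / (\<zeta> - \<xi>)" for \<xi>
    proof (cases "cmod \<xi> \<le> r0")
      case False
      then have "\<xi> \<noteq> 0" "\<zeta> - \<xi> \<noteq> 0" using r0 z by auto
      then show ?thesis by (simp add: divide_simps) (simp add: algebra_simps)
    qed (simp add: supp)
    then have "cauchy_transform f \<zeta> = (LINT \<xi>|lborel. - (f \<xi> / \<xi> ^ 1) + f \<xi> * (\<zeta> / \<xi>) ^ Suc 0 / (\<zeta> - \<xi>))"
      unfolding cauchy_transform_def by presburger
    also have "\<dots> = - m + (LINT \<xi>|lborel. f \<xi> * (\<zeta> / \<xi>) ^ Suc 0 / (\<zeta> - \<xi>))"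
      using int_mom[of 1] int_rem[of "Suc 0"] by (subst Bochner_Integration.integral_add) (auto simp: m_def)
    finally show ?case .
  next
    case (Suc n)
    have eq: "f \<xi> * (\<zeta> / \<xi>) ^ Suc n / (\<zeta> - \<xi>) = - (\<zeta> ^ Suc n) * (f \<xi> / \<xi> ^ (n + 2)) + f \<xi> * (\<zeta> / \<xi>) ^ Suc (Suc n) / (\<zeta> - \<xi>)" for \<xi>
    proof (cases "cmod \<xi> \<le> r0")
      case False
      then have "\<xi> \<noteq> 0" "\<zeta> - \<xi> \<noteq> 0" using r0 z by auto
      then have "1 / (\<zeta> - \<xi>) = - 1 / \<xi> + (\<zeta> / \<xi>) / (\<zeta> - \<xi>)"
        by (simp add: divide_simps)
      then have "f \<xi> * (\<zeta> / \<xi>) ^ Suc n * (1 / (\<zeta> - \<xi>))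
        = f \<xi> * (\<zeta> / \<xi>) ^ Suc n * (- 1 / \<xi>) + f \<xi> * (\<zeta> / \<xi>) ^ Suc n * ((\<zeta> / \<xi>) / (\<zeta> - \<xi>))"
        by (simp only: distrib_left)
      moreover have "f \<xi> * (\<zeta> / \<xi>) ^ Suc n * (- 1 / \<xi>) = - (\<zeta> ^ Suc n) * (f \<xi> / \<xi> ^ (n + 2))"
        by (simp add: power_divide mult_ac)
      moreover have "f \<xi> * (\<zeta> / \<xi>) ^ Suc n * ((\<zeta> / \<xi>) / (\<zeta> - \<xi>)) = f \<xi> * (\<zeta> / \<xi>) ^ Suc (Suc n) / (\<zeta> - \<xi>)"
        by (simp add: power_divide mult_ac)
      ultimately show ?thesis by simp
    qed (simp add: supp)
    have "(LINT \<xi>|lborel. f \<xi> * (\<zeta> / \<xi>) ^ Suc n / (\<zeta> - \<xi>))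
       = (LINT \<xi>|lborel. - (\<zeta> ^ Suc n) * (f \<xi> / \<xi> ^ (n + 2))) + (LINT \<xi>|lborel. f \<xi> * (\<zeta> / \<xi>) ^ Suc (Suc n) / (\<zeta> - \<xi>))"
      unfolding eq by (rule Bochner_Integration.integral_add[OF integrable_mult_right[OF int_mom] int_rem])
    also have "(LINT \<xi>|lborel. - (\<zeta> ^ Suc n) * (f \<xi> / \<xi> ^ (n + 2))) = 0"
      using mom[of "n + 2"] by (subst integral_mult_right_zero) simp
    finally show ?case using Suc.IH by simp
  qed
  have "(\<lambda>n. (LINT \<xi>|lborel. f \<xi> * (\<zeta> / \<xi>) ^ Suc n / (\<zeta> - \<xi>))) \<longlonglongrightarrow> 0"
  proof (rule Lim_null_comparison)
    show "\<forall>\<^sub>F n in sequentially. norm (LINT \<xi>|lborel. f \<xi> * (\<zeta> / \<xi>) ^ Suc n / (\<zeta> - \<xi>))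
        \<le> (cmod \<zeta> / r0) ^ Suc n / d * (LINT \<xi>|lborel. cmod (f \<xi>))"
    proof (rule always_eventually, rule allI)
      fix n
      have "norm (LINT \<xi>|lborel. f \<xi> * (\<zeta> / \<xi>) ^ Suc n / (\<zeta> - \<xi>)) \<le> (LINT \<xi>|lborel. (cmod \<zeta> / r0) ^ Suc n / d * cmod (f \<xi>))"
        by (rule Bochner_Integration.integral_norm_bound_integral[OF int_rem]) (use f bnd[of _ "Suc n"] in \<open>auto intro!: integrable_mult_right\<close>)
      then show "norm (LINT \<xi>|lborel. f \<xi> * (\<zeta> / \<xi>) ^ Suc n / (\<zeta> - \<xi>)) \<le> (cmod \<zeta> / r0) ^ Suc n / d * (LINT \<xi>|lborel. cmod (f \<xi>))"
        by simp
    qed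
    have "(\<lambda>n. (cmod \<zeta> / r0) ^ Suc n) \<longlonglongrightarrow> 0"
      using z r0 by (intro LIMSEQ_Suc LIMSEQ_power_zero) auto
    then show "(\<lambda>n. (cmod \<zeta> / r0) ^ Suc n / d * (LINT \<xi>|lborel. cmod (f \<xi>))) \<longlonglongrightarrow> 0"
      by (intro tendsto_mult_left_zero tendsto_divide_zero)
  qed
  then have "(\<lambda>n. - m + (LINT \<xi>|lborel. f \<xi> * (\<zeta> / \<xi>) ^ Suc n / (\<zeta> - \<xi>))) \<longlonglongrightarrow> - m + 0"
    by (intro tendsto_intros)
  then have "(\<lambda>n::nat. cauchy_transform f \<zeta>) \<longlonglongrightarrow> - m" by (simp only: rep[symmetric] add_0_right)
  then show "cauchy_transform f \<zeta> = - (LINT \<xi>|lborel. f \<xi> / \<xi>)"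
    using LIMSEQ_unique tendsto_const unfolding m_def by blast
qed

text \<open>The integral of the kernel over a ball of radius \<open>2\<close> is bounded, and tends to \<open>0\<close> as the ball
moves away from the pole; dominated convergence with respect to \<open>|f|\<close> gives the limit. The radius
\<open>2\<close> leaves room for images of unit balls under maps that move points by at most \<open>1\<close>.\<close>

lemma cauchy_majorant_tendsto_0_at_infinity:
  fixes f :: "complex \<Rightarrow> complex"
  assumes f: "integrable lborel f"
  shows "((\<lambda>p. \<integral>\<^sup>+\<zeta>\<in>ball p 2. cauchy_majorant f \<zeta> \<partial>lborel) \<longlongrightarrow> 0) at_infinity"
proof -
  have [measurable]: "f \<in> borel_measurable borel" using borel_measurable_integrable[OF f] by simp
  define D where "D = measure lborel (ball (0::complex) 2)"
  have D: "emeasure lborel (ball p 2) = ennreal D" for p :: complex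
  proof -
    have "emeasure lborel (ball p 2) = emeasure lborel (ball (0::complex) 2)"
      by (simp add: emeasure_ball)
    also have "\<dots> = ennreal D" unfolding D_def
      using emeasure_bounded_finite[OF bounded_ball, of "0::complex" 2] by (intro emeasure_eq_ennreal_measure) simp
    finally show ?thesis .
  qed
  have D0: "D \<ge> 0" by (simp add: D_def)
  define C where "C = 2 * pi + D"
  define k where "k t \<xi> = (if t > 2 + cmod \<xi> then min C (D / (t - 2 - cmod \<xi>)) else C)" for t \<xi>
  have C0: "C \<ge> 0" using D0 by (simp add: C_def)
  have k0: "0 \<le> k t \<xi>" "k t \<xi> \<le> C" for t \<xi> using D0 C0 by (auto simp: k_def)
  have km [measurable]: "(\<lambda>\<xi>. k t \<xi>) \<in> borel_measurable borel" for t
    unfolding k_def by measurable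
  have ker: "(\<integral>\<^sup>+\<zeta>. indicator (ball p 2) \<zeta> * ennreal (1 / cmod (\<zeta> - \<xi>)) \<partial>lborel) \<le> ennreal (k (cmod p) \<xi>)" for p \<xi>
  proof -
    have le_C: "(\<integral>\<^sup>+\<zeta>. indicator (ball p 2) \<zeta> * ennreal (1 / cmod (\<zeta> - \<xi>)) \<partial>lborel) \<le> ennreal C"
      using nn_integral_cauchy_kernel_le[of 1 "ball p 2" \<xi>] D0 by (simp add: D C_def mult.commute)
    show ?thesis
    proof (cases "cmod p > 2 + cmod \<xi>")
      case True
      let ?e = "cmod p - 2 - cmod \<xi>"
      have "(\<integral>\<^sup>+\<zeta>. indicator (ball p 2) \<zeta> * ennreal (1 / cmod (\<zeta> - \<xi>)) \<partial>lborel) \<le> (\<integral>\<^sup>+\<zeta>. ennreal (1 / ?e) * indicator (ball p 2) \<zeta> \<partial>lborel)"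
      proof (rule nn_integral_mono)
        fix \<zeta>
        show "indicator (ball p 2) \<zeta> * ennreal (1 / cmod (\<zeta> - \<xi>)) \<le> ennreal (1 / ?e) * indicator (ball p 2) \<zeta>"
        proof (cases "\<zeta> \<in> ball p 2")
          case z: True
          have "cmod p \<le> cmod (p - \<zeta>) + (cmod (\<zeta> - \<xi>) + cmod \<xi>)"
            using norm_triangle_ineq[of "p - \<zeta>" \<zeta>] norm_triangle_ineq[of "\<zeta> - \<xi>" \<xi>] by simp
          then have "?e \<le> cmod (\<zeta> - \<xi>)" using z by (simp add: dist_norm)
          then have "1 / cmod (\<zeta> - \<xi>) \<le> 1 / ?e" using True by (intro divide_left_mono) (auto intro!: mult_pos_pos)
          then show ?thesis using z by (auto intro!: ennreal_leI)
        qed simp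
      qed
      also have "\<dots> = ennreal (1 / ?e) * ennreal D" by (subst nn_integral_cmult_indicator) (auto simp: D)
      also have "\<dots> = ennreal (D / ?e)" using D0 True by (simp add: ennreal_mult[symmetric])
      finally show ?thesis using le_C True by (simp add: k_def min_def)
    qed (use le_C in \<open>simp add: k_def\<close>)
  qed
  define G where "G t = (LINT \<xi>|lborel. k t \<xi> * cmod (f \<xi>))" for t
  have int: "integrable lborel (\<lambda>\<xi>. k t \<xi> * cmod (f \<xi>))" for t
    by (rule Bochner_Integration.integrable_bound[of _ "\<lambda>\<xi>. C * cmod (f \<xi>)"])
       (use f k0 C0 in \<open>auto intro!: integrable_mult_right mult_right_mono simp: abs_mult\<close>)
  have le: "(\<integral>\<^sup>+\<zeta>\<in>ball p 2. cauchy_majorant f \<zeta> \<partial>lborel) \<le> ennreal (G (cmod p))" for p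
  proof -
    have "(\<integral>\<^sup>+\<zeta>\<in>ball p 2. cauchy_majorant f \<zeta> \<partial>lborel) = (\<integral>\<^sup>+\<zeta>. indicator (ball p 2) \<zeta> * cauchy_majorant f \<zeta> \<partial>lborel)"
      by (simp add: mult.commute)
    also have "\<dots> = (\<integral>\<^sup>+\<xi>. ennreal (cmod (f \<xi>)) * (\<integral>\<^sup>+\<zeta>. indicator (ball p 2) \<zeta> * ennreal (1 / cmod (\<zeta> - \<xi>)) \<partial>lborel) \<partial>lborel)"
      by (rule nn_integral_cauchy_majorant) (auto intro!: borel_measurable_indicator)
    also have "\<dots> \<le> (\<integral>\<^sup>+\<xi>. ennreal (k (cmod p) \<xi> * cmod (f \<xi>)) \<partial>lborel)"
    proof (rule nn_integral_mono)
      fix \<xi>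
      have "ennreal (cmod (f \<xi>)) * (\<integral>\<^sup>+\<zeta>. indicator (ball p 2) \<zeta> * ennreal (1 / cmod (\<zeta> - \<xi>)) \<partial>lborel)
        \<le> ennreal (cmod (f \<xi>)) * ennreal (k (cmod p) \<xi>)" by (intro mult_left_mono ker) simp
      then show "ennreal (cmod (f \<xi>)) * (\<integral>\<^sup>+\<zeta>. indicator (ball p 2) \<zeta> * ennreal (1 / cmod (\<zeta> - \<xi>)) \<partial>lborel)
        \<le> ennreal (k (cmod p) \<xi> * cmod (f \<xi>))" by (simp add: ennreal_mult k0 mult.commute)
    qed
    also have "\<dots> = ennreal (G (cmod p))"
      unfolding G_def by (rule nn_integral_eq_integral[OF int]) (simp add: k0)
    finally show ?thesis .
  qed
  have "(G \<longlongrightarrow> (LINT \<xi>|(lborel :: complex measure). 0 :: real)) at_top"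
    unfolding G_def
  proof (rule integral_dominated_convergence_at_top[where s = "\<lambda>t \<xi>. k t \<xi> * cmod (f \<xi>)" and f = "\<lambda>_. 0" and M = lborel and w = "\<lambda>\<xi>. C * cmod (f \<xi>)"])
    show "integrable lborel (\<lambda>\<xi>. C * cmod (f \<xi>))" using f by auto
    show "\<forall>\<^sub>F t in at_top. AE \<xi> in lborel. norm (k t \<xi> * cmod (f \<xi>)) \<le> C * cmod (f \<xi>)"
      using k0 by (auto intro!: always_eventually AE_I2 mult_right_mono simp: abs_mult)
    show "AE \<xi> in lborel. ((\<lambda>t. k t \<xi> * cmod (f \<xi>)) \<longlongrightarrow> 0) at_top"
    proof (rule AE_I2)
      fix \<xi>
      have "((\<lambda>t. k t \<xi>) \<longlongrightarrow> 0) at_top"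
      proof (rule tendsto_sandwich[where f = "\<lambda>_. 0" and h = "\<lambda>t. D / (t - 2 - cmod \<xi>)"])
        show "\<forall>\<^sub>F t in at_top. k t \<xi> \<le> D / (t - 2 - cmod \<xi>)"
          using eventually_gt_at_top[of "2 + cmod \<xi>"] by eventually_elim (simp add: k_def)
        have "filterlim (\<lambda>t. t - 2 - cmod \<xi>) at_top at_top"
          using filterlim_tendsto_add_at_top[OF tendsto_const[of "- 2 - cmod \<xi>"] filterlim_ident] by (simp add: algebra_simps)
        then show "((\<lambda>t. D / (t - 2 - cmod \<xi>)) \<longlongrightarrow> 0) at_top"
          by (intro tendsto_divide_0[OF tendsto_const] filterlim_at_top_imp_at_infinity)
      qed (use k0 in auto)
      then show "((\<lambda>t. k t \<xi> * cmod (f \<xi>)) \<longlongrightarrow> 0) at_top" by (rule tendsto_mult_left_zero)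
    qed
  qed measurable
  then have "((\<lambda>p. G (cmod p)) \<longlongrightarrow> 0) (at_infinity :: complex filter)"
    by (simp add: filterlim_compose[OF _ filterlim_norm_at_top])
  then have lim: "((\<lambda>p. ennreal (G (cmod p))) \<longlongrightarrow> 0) (at_infinity :: complex filter)"
    using tendsto_ennrealI[of "\<lambda>p. G (cmod p)" 0] by simp
  show ?thesis
    by (rule tendsto_sandwich[OF _ _ tendsto_const lim]) (auto intro!: always_eventually le)
qed

text \<open>The integrand is the Poisson kernel up to the factor \<open>|\<xi>|\<^sup>2 - r\<^sup>2\<close>, that is, the real part of
\<open>(\<xi> + z)/(\<xi> - z)\<close>, which has mean value \<open>1\<close>.\<close>

lemma poisson_circle_integral:
  assumes r: "0 < r" and s: "r < cmod \<xi>"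
  shows "(\<integral>\<^sup>+\<phi>\<in>{0..2*pi}. ennreal (1 / (cmod (rcis r \<phi> - \<xi>))\<^sup>2) \<partial>lborel) = ennreal (2 * pi / ((cmod \<xi>)\<^sup>2 - r\<^sup>2))"
proof -
  define d where "d = (cmod \<xi>)\<^sup>2 - r\<^sup>2"
  have d: "d > 0" using r s by (simp add: d_def power_strict_mono)
  have ne: "\<xi> - rcis r \<phi> \<noteq> 0" for \<phi> using r s by (metis abs_of_pos complex_mod_rcis less_irrefl right_minus_eq)
  have eq: "Re ((\<xi> + rcis r \<phi>) / (\<xi> - rcis r \<phi>)) / d = 1 / (cmod (rcis r \<phi> - \<xi>))\<^sup>2" for \<phi>
  proof -
    have "(\<xi> + rcis r \<phi>) / (\<xi> - rcis r \<phi>) = (\<xi> + rcis r \<phi>) * cnj (\<xi> - rcis r \<phi>) / (cmod (\<xi> - rcis r \<phi>))\<^sup>2"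
      by (rule complex_div_cnj)
    then have "Re ((\<xi> + rcis r \<phi>) / (\<xi> - rcis r \<phi>)) = Re ((\<xi> + rcis r \<phi>) * cnj (\<xi> - rcis r \<phi>)) / (cmod (\<xi> - rcis r \<phi>))\<^sup>2"
      by (metis Re_divide_of_real)
    also have "Re ((\<xi> + rcis r \<phi>) * cnj (\<xi> - rcis r \<phi>)) = (cmod \<xi>)\<^sup>2 - (cmod (rcis r \<phi>))\<^sup>2"
      unfolding cmod_power2 by (simp add: algebra_simps power2_eq_square)
    also have "\<dots> = d" by (simp add: d_def)
    finally show ?thesis using d ne[of \<phi>] by (simp add: norm_minus_commute)
  qed
  have mv: "(LINT \<phi>:{0..2*pi}|lborel. (\<xi> + rcis r \<phi>) / (\<xi> - rcis r \<phi>)) = 2 * pi * ((\<xi> + 0) / (\<xi> - 0))"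
    by (rule circle_mean_value[OF r]) (use s in \<open>auto intro!: continuous_intros holomorphic_intros\<close>)
  have "\<xi> \<noteq> 0" using r s by auto
  have i1: "set_integrable lborel {0..2*pi} (\<lambda>\<phi>. (\<xi> + rcis r \<phi>) / (\<xi> - rcis r \<phi>))"
    by (rule borel_integrable_atLeastAtMost') (intro continuous_intros ballI ne)
  have i2: "integrable lborel (\<lambda>\<phi>. Re (indicator {0..2*pi} \<phi> *\<^sub>R ((\<xi> + rcis r \<phi>) / (\<xi> - rcis r \<phi>))) / d)"
    using i1 unfolding set_integrable_def by (intro integrable_divide integrable_Re)
  have e: "Re (indicator {0..2*pi} \<phi> *\<^sub>R ((\<xi> + rcis r \<phi>) / (\<xi> - rcis r \<phi>))) / d = indicator {0..2*pi} \<phi> * (1 / (cmod (rcis r \<phi> - \<xi>))\<^sup>2)" for \<phi>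
    using eq[of \<phi>] by (simp add: indicator_def)
  have "(\<integral>\<^sup>+\<phi>\<in>{0..2*pi}. ennreal (1 / (cmod (rcis r \<phi> - \<xi>))\<^sup>2) \<partial>lborel)
    = (\<integral>\<^sup>+\<phi>. ennreal (Re (indicator {0..2*pi} \<phi> *\<^sub>R ((\<xi> + rcis r \<phi>) / (\<xi> - rcis r \<phi>))) / d) \<partial>lborel)"
    unfolding e by (intro nn_integral_cong) (simp add: indicator_def)
  also have "\<dots> = ennreal (LINT \<phi>|lborel. Re (indicator {0..2*pi} \<phi> *\<^sub>R ((\<xi> + rcis r \<phi>) / (\<xi> - rcis r \<phi>))) / d)"
    by (rule nn_integral_eq_integral[OF i2], rule AE_I2, simp only: e, simp)
  also have "(LINT \<phi>|lborel. Re (indicator {0..2*pi} \<phi> *\<^sub>R ((\<xi> + rcis r \<phi>) / (\<xi> - rcis r \<phi>))) / d)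
    = Re (LINT \<phi>:{0..2*pi}|lborel. (\<xi> + rcis r \<phi>) / (\<xi> - rcis r \<phi>)) / d"
    using i1 unfolding set_lebesgue_integral_def set_integrable_def by (simp only: integral_divide_zero integral_Re)
  also have "\<dots> = 2 * pi / d" unfolding mv using \<open>\<xi> \<noteq> 0\<close> by simp
  finally show ?thesis unfolding d_def .
qed

definition annulus :: "real \<Rightarrow> real \<Rightarrow> complex set" where
  "annulus r R = {z. r < cmod z \<and> cmod z < R}"

lemma annulus_borel [measurable, simp]: "annulus r R \<in> sets borel"
  unfolding annulus_def by (intro borel_open open_Collect_conj open_Collect_less continuous_intros)

lemma emeasure_annulus_le:
  assumes "0 < r0" "0 < \<delta>" "\<delta> \<le> r0"
  shows "emeasure lborel (annulus r0 (r0 + \<delta>)) \<le> ennreal (4 * pi * r0 * \<delta>)"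
proof -
  have "emeasure lborel (annulus r0 (r0 + \<delta>)) = (\<integral>\<^sup>+z. indicator (annulus r0 (r0 + \<delta>)) z \<partial>lborel)" by simp
  also have "\<dots> = (\<integral>\<^sup>+r\<in>{0<..}. ennreal r * (\<integral>\<^sup>+\<phi>\<in>{0..2*pi}. indicator (annulus r0 (r0 + \<delta>)) (rcis r \<phi>) \<partial>lborel) \<partial>lborel)"
    by (rule nn_integral_polar) measurable
  also have "\<dots> \<le> (\<integral>\<^sup>+r. ennreal (4 * pi * r0) * indicator {r0<..<r0 + \<delta>} r \<partial>lborel)"
  proof (rule nn_integral_mono)
    fix r
    show "ennreal r * (\<integral>\<^sup>+\<phi>\<in>{0..2*pi}. indicator (annulus r0 (r0 + \<delta>)) (rcis r \<phi>) \<partial>lborel) * indicator {0<..} r \<le> ennreal (4 * pi * r0) * indicator {r0<..<r0 + \<delta>} r"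
    proof (cases "r0 < r \<and> r < r0 + \<delta>")
      case True
      then have "(\<integral>\<^sup>+\<phi>\<in>{0..2*pi}. indicator (annulus r0 (r0 + \<delta>)) (rcis r \<phi>) \<partial>lborel) = (\<integral>\<^sup>+\<phi>. indicator {0..2*pi} \<phi> \<partial>lborel)"
        using assms by (intro nn_integral_cong) (auto simp: annulus_def)
      then show ?thesis using True assms by (auto simp: ennreal_mult[symmetric] intro!: ennreal_leI)
    next
      case False
      then show ?thesis using assms by (auto simp: annulus_def indicator_def)
    qed
  qed
  also have "\<dots> = ennreal (4 * pi * r0) * ennreal \<delta>" using assms by (subst nn_integral_cmult) auto
  also have "\<dots> = ennreal (4 * pi * r0 * \<delta>)" using assms by (simp add: ennreal_mult)
  finally show ?thesis .
qed

text \<open>The mirror point \<open>\<zeta>'\<close> lies in the disc, at most twice as far from \<open>\<zeta>\<close> as the circle is, and its distance from points outside the disc is at least half that of \<open>\<zeta>\<close>. The last fact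
follows from \<open>r\<^sup>2 |\<zeta>' - \<xi>|\<^sup>2 - r0\<^sup>2 |\<zeta> - \<xi>|\<^sup>2 = (|\<xi>|\<^sup>2 - r0\<^sup>2) (r\<^sup>2 - r0\<^sup>2) \<ge> 0\<close> for \<open>r = |\<zeta>|\<close>.\<close>

lemma reflection_kernel_bounds:
  fixes \<zeta> \<xi> :: complex
  assumes r0: "0 < r0" and z: "r0 < cmod \<zeta>" "cmod \<zeta> \<le> 2 * r0" and x: "r0 < cmod \<xi>"
  defines "\<zeta>' \<equiv> of_real (r0\<^sup>2) / cnj \<zeta>"
  shows "cmod \<zeta>' < r0" "cmod (\<zeta> - \<xi>) \<le> 2 * cmod (\<zeta>' - \<xi>)" "cmod (\<zeta> - \<zeta>') \<le> 2 * (cmod \<zeta> - r0)"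
proof -
  define r where "r = cmod \<zeta>"
  have r: "r0 < r" "r \<le> 2 * r0" "0 < r" using assms by (auto simp: r_def)
  have zc: "\<zeta> * cnj \<zeta> = of_real (r\<^sup>2)" unfolding r_def by (rule complex_norm_square[symmetric])
  have nz: "\<zeta> \<noteq> 0" using r by (auto simp: r_def)
  have z': "\<zeta>' = of_real (r0\<^sup>2 / r\<^sup>2) * \<zeta>"
    unfolding \<zeta>'_def using zc nz r(3) by (simp add: field_simps)
  have n': "cmod \<zeta>' = r0\<^sup>2 / r" unfolding \<zeta>'_def r_def by (simp add: norm_divide norm_power)
  have "r0\<^sup>2 < r0 * r" using r r0 by (simp add: power2_eq_square)
  then show "cmod \<zeta>' < r0" using r by (simp add: n' field_simps)
  have "\<zeta> - \<zeta>' = of_real (1 - r0\<^sup>2 / r\<^sup>2) * \<zeta>" by (simp add: z' algebra_simps)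
  then have "cmod (\<zeta> - \<zeta>') = \<bar>1 - r0\<^sup>2 / r\<^sup>2\<bar> * r" by (simp only: norm_mult norm_of_real r_def)
  also have "1 - r0\<^sup>2 / r\<^sup>2 = (r - r0) * (r + r0) / r\<^sup>2" using r by (simp add: field_simps power2_eq_square)
  also have "\<bar>(r - r0) * (r + r0) / r\<^sup>2\<bar> * r = (r - r0) * ((r + r0) / r)" using r r0 by (simp add: power2_eq_square abs_mult)
  also have "\<dots> \<le> (r - r0) * 2" using r by (intro mult_left_mono) (auto simp: field_simps)
  finally show "cmod (\<zeta> - \<zeta>') \<le> 2 * (cmod \<zeta> - r0)" by (simp add: r_def)
  define s where "s = cmod \<xi>"
  define c where "c = Re (\<zeta> * cnj \<xi>)"
  have sq: "(cmod (u - \<xi>))\<^sup>2 = (cmod u)\<^sup>2 - 2 * Re (u * cnj \<xi>) + s\<^sup>2" for u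
    unfolding s_def cmod_power2 by (simp add: power2_eq_square algebra_simps)
  have "Re (\<zeta>' * cnj \<xi>) = r0\<^sup>2 / r\<^sup>2 * c" unfolding z' c_def
    by (simp add: algebra_simps)
  then have A: "(cmod (\<zeta>' - \<xi>))\<^sup>2 = (r0\<^sup>2 / r)\<^sup>2 - 2 * (r0\<^sup>2 / r\<^sup>2 * c) + s\<^sup>2" using sq[of \<zeta>'] n' by simp
  have B: "(cmod (\<zeta> - \<xi>))\<^sup>2 = r\<^sup>2 - 2 * c + s\<^sup>2" using sq[of \<zeta>] by (simp add: r_def c_def)
  have "r\<^sup>2 * (cmod (\<zeta>' - \<xi>))\<^sup>2 - r0\<^sup>2 * (cmod (\<zeta> - \<xi>))\<^sup>2 = (s\<^sup>2 - r0\<^sup>2) * (r\<^sup>2 - r0\<^sup>2)"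
    unfolding A B using r by (simp add: field_simps power2_eq_square)
  also have "\<dots> \<ge> 0" using r r0 x by (intro mult_nonneg_nonneg) (auto simp: s_def power_mono)
  finally have "r0\<^sup>2 * (cmod (\<zeta> - \<xi>))\<^sup>2 \<le> r\<^sup>2 * (cmod (\<zeta>' - \<xi>))\<^sup>2" by simp
  also have "\<dots> \<le> (2 * r0)\<^sup>2 * (cmod (\<zeta>' - \<xi>))\<^sup>2" using r by (intro mult_right_mono power_mono) auto
  finally have "r0\<^sup>2 * (cmod (\<zeta> - \<xi>))\<^sup>2 \<le> r0\<^sup>2 * (2 * cmod (\<zeta>' - \<xi>))\<^sup>2" by (simp add: power_mult_distrib)
  then have "(cmod (\<zeta> - \<xi>))\<^sup>2 \<le> (2 * cmod (\<zeta>' - \<xi>))\<^sup>2" using r0 by simp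
  then show "cmod (\<zeta> - \<xi>) \<le> 2 * cmod (\<zeta>' - \<xi>)" by (rule power2_le_imp_le) simp
qed

section \<open>The boundary trace of the Cauchy transform\<close>

text \<open>A bound for the difference of the Cauchy kernels at \<open>\<zeta>\<close> and at its mirror point. The singularity
\<open>1/|\<zeta> - \<xi>|\<close> is kept only at distance less than \<open>\<delta>\<close>; further away the difference decays quadratically.\<close>

definition reflection_bound :: "real \<Rightarrow> complex \<Rightarrow> complex \<Rightarrow> real" where
  "reflection_bound \<delta> \<zeta> \<xi> =
    (if cmod (\<zeta> - \<xi>) < \<delta> then 3 / cmod (\<zeta> - \<xi>) else 4 * \<delta> / (cmod (\<zeta> - \<xi>))\<^sup>2)"

lemma reflection_bound_nonneg: "\<delta> \<ge> 0 \<Longrightarrow> 0 \<le> reflection_bound \<delta> \<zeta> \<xi>"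
  by (simp add: reflection_bound_def)

lemma reflection_bound_measurable [measurable]:
  assumes [measurable]: "f \<in> borel_measurable M" "g \<in> borel_measurable M"
  shows "(\<lambda>x. reflection_bound \<delta> (f x) (g x)) \<in> borel_measurable M"
  unfolding reflection_bound_def by measurable

lemma cauchy_kernel_reflection_le:
  assumes r0: "0 < r0" and d: "\<delta> \<le> r0" and z: "\<zeta> \<in> annulus r0 (r0 + \<delta>)" and x: "r0 < cmod \<xi>" and ne: "\<zeta> \<noteq> \<xi>"
  defines "\<zeta>' \<equiv> of_real (r0\<^sup>2) / cnj \<zeta>"
  shows "cmod (1 / (\<zeta> - \<xi>) - 1 / (\<zeta>' - \<xi>)) \<le> reflection_bound \<delta> \<zeta> \<xi>"
proof -
  have z': "r0 < cmod \<zeta>" "cmod \<zeta> \<le> 2 * r0" "cmod \<zeta> - r0 \<le> \<delta>" using z d by (auto simp: annulus_def)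
  define p q where "p = cmod (\<zeta> - \<xi>)" and "q = cmod (\<zeta>' - \<xi>)"
  note b = reflection_kernel_bounds[OF r0 z'(1,2) x, folded \<zeta>'_def]
  have p: "p > 0" "p \<le> 2 * q" using ne b(2) by (auto simp: p_def q_def)
  then have q: "q > 0" by simp
  have ne': "\<zeta> - \<xi> \<noteq> 0" "\<zeta>' - \<xi> \<noteq> 0" using p q by (auto simp: p_def q_def)
  then have "1 / (\<zeta> - \<xi>) - 1 / (\<zeta>' - \<xi>) = (\<zeta>' - \<zeta>) / ((\<zeta> - \<xi>) * (\<zeta>' - \<xi>))" by (simp add: diff_frac_eq)
  then have e: "cmod (1 / (\<zeta> - \<xi>) - 1 / (\<zeta>' - \<xi>)) = cmod (\<zeta> - \<zeta>') / (p * q)"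
    by (simp add: norm_divide norm_mult p_def q_def norm_minus_commute)
  have "cmod (\<zeta> - \<zeta>') \<le> p + q" unfolding p_def q_def
    using norm_triangle_ineq4[of "\<zeta> - \<xi>" "\<zeta>' - \<xi>"] by simp
  then have "cmod (\<zeta> - \<zeta>') / (p * q) \<le> (3 * q) / (p * q)" using p q by (intro divide_right_mono) auto
  then have 1: "cmod (\<zeta> - \<zeta>') / (p * q) \<le> 3 / p" using q by simp
  have "cmod (\<zeta> - \<zeta>') / (p * q) \<le> (2 * \<delta>) / (p * (p / 2))"
    using b(3) z' p q r0 d by (intro frac_le) auto
  then have 2: "cmod (\<zeta> - \<zeta>') / (p * q) \<le> 4 * \<delta> / p\<^sup>2" by (simp add: power2_eq_square)
  show ?thesis unfolding e reflection_bound_def using 1 2 by (simp add: p_def)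
qed

text \<open>The inner part contributes \<open>6 \<pi> \<delta>\<close>. In the outer part the pole \<open>\<xi>\<close>, which may lie in the annulus,
is replaced by a point \<open>x\<close> on the same ray, further out by \<open>2 \<delta>\<close>; this costs a factor \<open>9\<close>, and the
Poisson integral bounds each circle of the annulus by a multiple of \<open>1/\<delta>\<close>. The total is a constant times
\<open>\<delta>\<close>, uniformly in \<open>\<xi>\<close>.\<close>

lemma nn_integral_reflection_bound_le:
  assumes r0: "0 < r0" and d: "0 < \<delta>" "\<delta> \<le> r0" and x: "r0 < cmod \<xi>"
  shows "(\<integral>\<^sup>+\<zeta>\<in>annulus r0 (r0 + \<delta>). ennreal (reflection_bound \<delta> \<zeta> \<xi>) \<partial>lborel) \<le> ennreal (\<delta> * (78 * pi))"
proof -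
  (* the pole is moved radially outwards by 2 * \<delta>, to a distance of at least \<delta> from the annulus *)
  define x where "x = of_real ((cmod \<xi> + 2 * \<delta>) / cmod \<xi>) * \<xi>"
  have xn: "cmod x = cmod \<xi> + 2 * \<delta>" using r0 x d unfolding x_def norm_mult norm_of_real by auto
  have "(cmod \<xi> + 2 * \<delta>) / cmod \<xi> = 1 + 2 * \<delta> / cmod \<xi>" using r0 x by (auto simp: add_divide_distrib)
  then have "x - \<xi> = of_real (2 * \<delta> / cmod \<xi>) * \<xi>" unfolding x_def by (simp add: distrib_right)
  then have xd: "cmod (x - \<xi>) = 2 * \<delta>" using r0 x d by (simp only: norm_mult norm_of_real) auto
  have [measurable]: "ball (0::complex) \<delta> \<in> sets borel" by simp
  have pw: "ennreal (reflection_bound \<delta> \<zeta> \<xi>) * indicator (annulus r0 (r0 + \<delta>)) \<zeta>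
      \<le> ennreal 3 * (ennreal (1 / cmod (\<zeta> - \<xi>)) * indicator (ball 0 \<delta>) (\<zeta> - \<xi>))
        + ennreal (36 * \<delta>) * (ennreal (1 / (cmod (\<zeta> - x))\<^sup>2) * indicator (annulus r0 (r0 + \<delta>)) \<zeta>)" for \<zeta>
  proof (cases "cmod (\<zeta> - \<xi>) < \<delta>")
    case True
    have "ennreal (reflection_bound \<delta> \<zeta> \<xi>) * indicator (annulus r0 (r0 + \<delta>)) \<zeta> \<le> ennreal (3 * (1 / cmod (\<zeta> - \<xi>)))"
      using True by (auto simp: reflection_bound_def indicator_def)
    also have "\<dots> = ennreal 3 * (ennreal (1 / cmod (\<zeta> - \<xi>)) * indicator (ball 0 \<delta>) (\<zeta> - \<xi>))"
      using True by (subst ennreal_mult) auto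
    finally show ?thesis by (rule add_increasing2[rotated]) simp
  next
    case False
    have "cmod (\<zeta> - x) \<le> cmod (\<zeta> - \<xi>) + cmod (x - \<xi>)"
      using norm_triangle_ineq4[of "\<zeta> - \<xi>" "x - \<xi>"] by simp
    then have "cmod (\<zeta> - x) \<le> 3 * cmod (\<zeta> - \<xi>)" using xd False by simp
    then have "(cmod (\<zeta> - x))\<^sup>2 \<le> 9 * (cmod (\<zeta> - \<xi>))\<^sup>2"
      using power_mono[of "cmod (\<zeta> - x)" "3 * cmod (\<zeta> - \<xi>)" 2] by (simp add: power_mult_distrib)
    moreover have "(cmod (\<zeta> - x))\<^sup>2 > 0" if "\<zeta> \<in> annulus r0 (r0 + \<delta>)"
      using that xn x d by (auto simp: annulus_def)
    ultimately have "4 * \<delta> / (cmod (\<zeta> - \<xi>))\<^sup>2 \<le> 36 * \<delta> * (1 / (cmod (\<zeta> - x))\<^sup>2)" if "\<zeta> \<in> annulus r0 (r0 + \<delta>)"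
      using that d False by (simp add: divide_simps)
    then have "ennreal (reflection_bound \<delta> \<zeta> \<xi>) * indicator (annulus r0 (r0 + \<delta>)) \<zeta> \<le> ennreal (36 * \<delta> * (1 / (cmod (\<zeta> - x))\<^sup>2)) * indicator (annulus r0 (r0 + \<delta>)) \<zeta>"
      using False by (auto simp: reflection_bound_def indicator_def intro!: ennreal_leI)
    also have "\<dots> = ennreal (36 * \<delta>) * (ennreal (1 / (cmod (\<zeta> - x))\<^sup>2) * indicator (annulus r0 (r0 + \<delta>)) \<zeta>)"
      using d by (subst ennreal_mult) (auto simp: mult.assoc)
    finally show ?thesis by (rule add_increasing[rotated]) simp
  qed
  have A: "(\<integral>\<^sup>+\<zeta>. ennreal (1 / cmod (\<zeta> - \<xi>)) * indicator (ball 0 \<delta>) (\<zeta> - \<xi>) \<partial>lborel) = ennreal (2 * pi * \<delta>)"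
    using nn_integral_translate[of "\<lambda>z. ennreal (1 / cmod z) * indicator (ball 0 \<delta>) z" "- \<xi>"]
      nn_integral_inverse_norm_ball[OF d(1)] by simp
  have B: "(\<integral>\<^sup>+\<zeta>. ennreal (1 / (cmod (\<zeta> - x))\<^sup>2) * indicator (annulus r0 (r0 + \<delta>)) \<zeta> \<partial>lborel) \<le> ennreal (2 * pi)"
  proof -
    have "(\<integral>\<^sup>+\<zeta>. ennreal (1 / (cmod (\<zeta> - x))\<^sup>2) * indicator (annulus r0 (r0 + \<delta>)) \<zeta> \<partial>lborel)
      = (\<integral>\<^sup>+r\<in>{0<..}. ennreal r * (\<integral>\<^sup>+\<phi>\<in>{0..2*pi}. (ennreal (1 / (cmod (rcis r \<phi> - x))\<^sup>2) * indicator (annulus r0 (r0 + \<delta>)) (rcis r \<phi>)) \<partial>lborel) \<partial>lborel)"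
      by (rule nn_integral_polar) measurable
    also have "\<dots> \<le> (\<integral>\<^sup>+r. ennreal (2 * pi / \<delta>) * indicator {r0<..<r0 + \<delta>} r \<partial>lborel)"
    proof (rule nn_integral_mono)
      fix r
      show "ennreal r * (\<integral>\<^sup>+\<phi>\<in>{0..2*pi}. (ennreal (1 / (cmod (rcis r \<phi> - x))\<^sup>2) * indicator (annulus r0 (r0 + \<delta>)) (rcis r \<phi>)) \<partial>lborel) * indicator {0<..} r
        \<le> ennreal (2 * pi / \<delta>) * indicator {r0<..<r0 + \<delta>} r"
      proof (cases "r0 < r \<and> r < r0 + \<delta>")
        case True
        have r: "0 < r" "r < cmod x" "r \<le> 2 * r0" using True r0 d xn x by auto
        have "(\<integral>\<^sup>+\<phi>\<in>{0..2*pi}. (ennreal (1 / (cmod (rcis r \<phi> - x))\<^sup>2) * indicator (annulus r0 (r0 + \<delta>)) (rcis r \<phi>)) \<partial>lborel)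
          = (\<integral>\<^sup>+\<phi>\<in>{0..2*pi}. ennreal (1 / (cmod (rcis r \<phi> - x))\<^sup>2) \<partial>lborel)"
          using True r by (intro nn_integral_cong) (auto simp: annulus_def)
        also have "\<dots> = ennreal (2 * pi / ((cmod x)\<^sup>2 - r\<^sup>2))" by (rule poisson_circle_integral[OF r(1,2)])
        also have "\<dots> \<le> ennreal (2 * pi / (\<delta> * (2 * r0)))"
        proof (rule ennreal_leI, rule divide_left_mono)
          have "\<delta> * (2 * r0) \<le> (cmod x - r) * (cmod x + r)"
            using True r0 d xn \<open>r0 < cmod \<xi>\<close> by (intro mult_mono) auto
          then show "\<delta> * (2 * r0) \<le> (cmod x)\<^sup>2 - r\<^sup>2" by (simp add: power2_eq_square algebra_simps)
          moreover have p: "0 < \<delta> * (2 * r0)" using d r0 by simp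
          ultimately have "0 < (cmod x)\<^sup>2 - r\<^sup>2" by linarith
          then show "0 < ((cmod x)\<^sup>2 - r\<^sup>2) * (\<delta> * (2 * r0))" using p by (rule mult_pos_pos)
        qed simp
        finally have "ennreal r * (\<integral>\<^sup>+\<phi>\<in>{0..2*pi}. (ennreal (1 / (cmod (rcis r \<phi> - x))\<^sup>2) * indicator (annulus r0 (r0 + \<delta>)) (rcis r \<phi>)) \<partial>lborel)
          \<le> ennreal (2 * r0) * ennreal (2 * pi / (\<delta> * (2 * r0)))" using r by (intro mult_mono ennreal_leI) auto
        also have "\<dots> = ennreal (2 * pi / \<delta>)" using r0 d by (simp add: ennreal_mult[symmetric])
        finally show ?thesis using True r by simp
      next
        case False
        then show ?thesis using r0 by (auto simp: annulus_def indicator_def)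
      qed
    qed
    also have "\<dots> = ennreal (2 * pi / \<delta>) * ennreal \<delta>" using d by (subst nn_integral_cmult) auto
    also have "\<dots> = ennreal (2 * pi)" using d by (simp add: ennreal_mult[symmetric])
    finally show ?thesis .
  qed
  have "(\<integral>\<^sup>+\<zeta>\<in>annulus r0 (r0 + \<delta>). ennreal (reflection_bound \<delta> \<zeta> \<xi>) \<partial>lborel)
      \<le> (\<integral>\<^sup>+\<zeta>. ennreal 3 * (ennreal (1 / cmod (\<zeta> - \<xi>)) * indicator (ball 0 \<delta>) (\<zeta> - \<xi>))
        + ennreal (36 * \<delta>) * (ennreal (1 / (cmod (\<zeta> - x))\<^sup>2) * indicator (annulus r0 (r0 + \<delta>)) \<zeta>) \<partial>lborel)"
    by (rule nn_integral_mono) (rule pw)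
  also have "\<dots> = ennreal 3 * ennreal (2 * pi * \<delta>) + ennreal (36 * \<delta>) * (\<integral>\<^sup>+\<zeta>. ennreal (1 / (cmod (\<zeta> - x))\<^sup>2) * indicator (annulus r0 (r0 + \<delta>)) \<zeta> \<partial>lborel)"
    by (subst nn_integral_add, measurable, subst nn_integral_cmult, measurable, subst nn_integral_cmult, measurable, simp only: A)
  also have "\<dots> \<le> ennreal 3 * ennreal (2 * pi * \<delta>) + ennreal (36 * \<delta>) * ennreal (2 * pi)"
    by (intro add_left_mono mult_left_mono B) simp
  also have "ennreal 3 * ennreal (2 * pi * \<delta>) = ennreal (3 * (2 * pi * \<delta>))" using d by (intro ennreal_mult[symmetric]) auto
  also have "ennreal (36 * \<delta>) * ennreal (2 * pi) = ennreal (36 * \<delta> * (2 * pi))" using d by (intro ennreal_mult[symmetric]) auto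
  also have "ennreal (3 * (2 * pi * \<delta>)) + ennreal (36 * \<delta> * (2 * pi)) = ennreal (3 * (2 * pi * \<delta>) + 36 * \<delta> * (2 * pi))"
    using d by (intro ennreal_plus[symmetric]) auto
  also have "3 * (2 * pi * \<delta>) + 36 * \<delta> * (2 * pi) = \<delta> * (78 * pi)" by simp
  finally show ?thesis .
qed

text \<open>Away from the annulus the bound gains another factor \<open>\<delta>\<close>, so that for fixed \<open>\<xi>\<close> the mean over the
annulus tends to \<open>0\<close>.\<close>

lemma nn_integral_reflection_bound_far:
  assumes r0: "0 < r0" and d: "0 < \<delta>" "\<delta> \<le> r0" and x: "2 * \<delta> < cmod \<xi> - r0"
  shows "(\<integral>\<^sup>+\<zeta>\<in>annulus r0 (r0 + \<delta>). ennreal (reflection_bound \<delta> \<zeta> \<xi>) \<partial>lborel)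
    \<le> ennreal (\<delta> * (64 * pi * r0 * \<delta> / (cmod \<xi> - r0)\<^sup>2))"
proof -
  have "(\<integral>\<^sup>+\<zeta>\<in>annulus r0 (r0 + \<delta>). ennreal (reflection_bound \<delta> \<zeta> \<xi>) \<partial>lborel)
    \<le> (\<integral>\<^sup>+\<zeta>. ennreal (16 * \<delta> / (cmod \<xi> - r0)\<^sup>2) * indicator (annulus r0 (r0 + \<delta>)) \<zeta> \<partial>lborel)"
  proof (rule nn_integral_mono)
    fix \<zeta>
    show "ennreal (reflection_bound \<delta> \<zeta> \<xi>) * indicator (annulus r0 (r0 + \<delta>)) \<zeta> \<le> ennreal (16 * \<delta> / (cmod \<xi> - r0)\<^sup>2) * indicator (annulus r0 (r0 + \<delta>)) \<zeta>"
    proof (cases "\<zeta> \<in> annulus r0 (r0 + \<delta>)")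
      case True
      have "cmod \<xi> \<le> cmod (\<zeta> - \<xi>) + cmod \<zeta>" using norm_triangle_ineq3[of \<zeta> \<xi>] norm_triangle_sub[of \<xi> \<zeta>] by (simp add: norm_minus_commute)
      then have p: "(cmod \<xi> - r0) / 2 \<le> cmod (\<zeta> - \<xi>)" using True x by (simp add: annulus_def)
      then have "\<not> cmod (\<zeta> - \<xi>) < \<delta>" using x by simp
      moreover have "((cmod \<xi> - r0) / 2)\<^sup>2 \<le> (cmod (\<zeta> - \<xi>))\<^sup>2" using p x d by (intro power_mono) auto
      then have "4 * \<delta> / (cmod (\<zeta> - \<xi>))\<^sup>2 \<le> 4 * \<delta> / ((cmod \<xi> - r0) / 2)\<^sup>2"
        using d x p by (intro divide_left_mono mult_pos_pos) auto
      ultimately show ?thesis using True by (auto simp: reflection_bound_def power_divide intro!: ennreal_leI)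
    qed simp
  qed
  also have "\<dots> = ennreal (16 * \<delta> / (cmod \<xi> - r0)\<^sup>2) * emeasure lborel (annulus r0 (r0 + \<delta>))"
    by (rule nn_integral_cmult_indicator) simp
  also have "\<dots> \<le> ennreal (16 * \<delta> / (cmod \<xi> - r0)\<^sup>2) * ennreal (4 * pi * r0 * \<delta>)"
    by (intro mult_left_mono emeasure_annulus_le r0 d) simp
  also have "\<dots> = ennreal (\<delta> * (64 * pi * r0 * \<delta> / (cmod \<xi> - r0)\<^sup>2))" using d r0 by (simp add: ennreal_mult[symmetric] field_simps)
  finally show ?thesis .
qed

text \<open>Since \<open>C\<close> is constant in the disc, \<open>C(\<zeta>) - c\<close> is the difference of \<open>C\<close> at \<open>\<zeta>\<close> and at its mirror
point. After Tonelli, the two preceding estimates provide the dominating function and the pointwise limit for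
dominated convergence with respect to \<open>|f|\<close>.\<close>

theorem cauchy_transform_boundary_trace:
  fixes f :: "complex \<Rightarrow> complex"
  assumes f: "integrable lborel f" and r0: "r0 > 0" and supp: "\<And>\<xi>. cmod \<xi> \<le> r0 \<Longrightarrow> f \<xi> = 0"
    and inner_int: "\<And>\<zeta>. cmod \<zeta> < r0 \<Longrightarrow> integrable lborel (\<lambda>\<xi>. f \<xi> / (\<zeta> - \<xi>))"
    and inner: "\<And>\<zeta>. cmod \<zeta> < r0 \<Longrightarrow> cauchy_transform f \<zeta> = c"
  shows "((\<lambda>\<delta>. (\<integral>\<^sup>+\<zeta>\<in>annulus r0 (r0 + \<delta>). ennreal (cmod (cauchy_transform f \<zeta> - c)) \<partial>lborel) / ennreal \<delta>) \<longlongrightarrow> 0) (at_right 0)"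
proof -
  have fm [measurable]: "f \<in> borel_measurable borel" using borel_measurable_integrable[OF f] by simp
  define C where "C = 78 * pi"
  define h where "h t \<xi> = (if 2 * t < cmod \<xi> - r0 then min C (64 * pi * r0 * t / (cmod \<xi> - r0)\<^sup>2) else C)" for t \<xi>
  have C0: "C \<ge> 0" by (simp add: C_def)
  have h0: "0 \<le> h t \<xi>" "h t \<xi> \<le> C" if "t \<ge> 0" for t \<xi> using that C0 r0 by (auto simp: h_def)
  have hm [measurable]: "(\<lambda>\<xi>. h t \<xi>) \<in> borel_measurable borel" for t unfolding h_def by measurable
  (* the substitution t = 1/\<delta> turns the one-sided limit at 0 into a limit at infinity *)
  define G where "G t = (LINT \<xi>|lborel. h (inverse t) \<xi> * cmod (f \<xi>))" for t
  have int: "integrable lborel (\<lambda>\<xi>. h t \<xi> * cmod (f \<xi>))" if "t \<ge> 0" for t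
    by (rule Bochner_Integration.integrable_bound[of _ "\<lambda>\<xi>. C * cmod (f \<xi>)"])
       (use f h0[OF that] C0 in \<open>auto intro!: integrable_mult_right mult_right_mono simp: abs_mult\<close>)
  have le: "(\<integral>\<^sup>+\<zeta>\<in>annulus r0 (r0 + \<delta>). ennreal (cmod (cauchy_transform f \<zeta> - c)) \<partial>lborel) / ennreal \<delta> \<le> ennreal (G (inverse \<delta>))"
    if d: "0 < \<delta>" "\<delta> \<le> r0" for \<delta>
  proof -
    have pw: "AE \<zeta> in lborel. ennreal (cmod (cauchy_transform f \<zeta> - c)) * indicator (annulus r0 (r0 + \<delta>)) \<zeta>
       \<le> (\<integral>\<^sup>+\<xi>. ennreal (cmod (f \<xi>)) * ennreal (reflection_bound \<delta> \<zeta> \<xi>) \<partial>lborel) * indicator (annulus r0 (r0 + \<delta>)) \<zeta>"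
      using cauchy_majorant_AE_finite[OF f]
    proof eventually_elim
      case (elim \<zeta>)
      show ?case
      proof (cases "\<zeta> \<in> annulus r0 (r0 + \<delta>)")
        case True
        define \<zeta>' where "\<zeta>' = of_real (r0\<^sup>2) / cnj \<zeta>"
        have z': "cmod \<zeta>' < r0"
          using reflection_kernel_bounds(1)[OF r0, of \<zeta> "of_real (r0 + 1)"] True d r0 unfolding \<zeta>'_def
          by (simp add: annulus_def del: of_real_add)
        have i1: "integrable lborel (\<lambda>\<xi>. f \<xi> / (\<zeta> - \<xi>))" using elim cauchy_majorant_finite_iff[OF fm] by blast
        note i2 = inner_int[OF z']
        have "cauchy_transform f \<zeta> - c = (LINT \<xi>|lborel. f \<xi> / (\<zeta> - \<xi>) - f \<xi> / (\<zeta>' - \<xi>))"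
          using inner[OF z'] i1 i2 by (simp add: cauchy_transform_def)
        also have "ennreal (cmod \<dots>) \<le> (\<integral>\<^sup>+\<xi>. ennreal (cmod (f \<xi> / (\<zeta> - \<xi>) - f \<xi> / (\<zeta>' - \<xi>))) \<partial>lborel)"
          by (rule integral_norm_bound_ennreal) (intro Bochner_Integration.integrable_diff i1 i2)
        also have "\<dots> \<le> (\<integral>\<^sup>+\<xi>. ennreal (cmod (f \<xi>)) * ennreal (reflection_bound \<delta> \<zeta> \<xi>) \<partial>lborel)"
        proof (rule nn_integral_mono_AE, use AE_lborel_singleton[of \<zeta>] in eventually_elim)
          case (elim \<xi>)
          show ?case
          proof (cases "cmod \<xi> \<le> r0")
            case False
            then have "cmod (1 / (\<zeta> - \<xi>) - 1 / (\<zeta>' - \<xi>)) \<le> reflection_bound \<delta> \<zeta> \<xi>"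
              unfolding \<zeta>'_def using cauchy_kernel_reflection_le[OF r0 d(2) True, of \<xi>] elim by auto
            then have "cmod (f \<xi>) * cmod (1 / (\<zeta> - \<xi>) - 1 / (\<zeta>' - \<xi>)) \<le> cmod (f \<xi>) * reflection_bound \<delta> \<zeta> \<xi>"
              by (rule mult_left_mono) simp
            moreover have "f \<xi> / (\<zeta> - \<xi>) - f \<xi> / (\<zeta>' - \<xi>) = f \<xi> * (1 / (\<zeta> - \<xi>) - 1 / (\<zeta>' - \<xi>))"
              by (simp add: right_diff_distrib)
            ultimately show ?thesis using d by (simp add: norm_mult ennreal_mult[symmetric] reflection_bound_nonneg ennreal_leI)
          qed (simp add: supp)
        qed
        finally show ?thesis using True by simp
      qed simp
    qed
    have "(\<integral>\<^sup>+\<zeta>\<in>annulus r0 (r0 + \<delta>). ennreal (cmod (cauchy_transform f \<zeta> - c)) \<partial>lborel)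
       \<le> (\<integral>\<^sup>+\<zeta>. (\<integral>\<^sup>+\<xi>. ennreal (cmod (f \<xi>)) * ennreal (reflection_bound \<delta> \<zeta> \<xi>) \<partial>lborel) * indicator (annulus r0 (r0 + \<delta>)) \<zeta> \<partial>lborel)"
      by (rule nn_integral_mono_AE[OF pw])
    also have "\<dots> = (\<integral>\<^sup>+\<zeta>. (\<integral>\<^sup>+\<xi>. ennreal (cmod (f \<xi>)) * ennreal (reflection_bound \<delta> \<zeta> \<xi>) * indicator (annulus r0 (r0 + \<delta>)) \<zeta> \<partial>lborel) \<partial>lborel)"
      by (intro nn_integral_cong nn_integral_multc[symmetric]) measurable
    also have "\<dots> = (\<integral>\<^sup>+\<xi>. (\<integral>\<^sup>+\<zeta>. ennreal (cmod (f \<xi>)) * ennreal (reflection_bound \<delta> \<zeta> \<xi>) * indicator (annulus r0 (r0 + \<delta>)) \<zeta> \<partial>lborel) \<partial>lborel)"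
      by (rule lborel_pair.Fubini') measurable
    also have "\<dots> = (\<integral>\<^sup>+\<xi>. ennreal (cmod (f \<xi>)) * (\<integral>\<^sup>+\<zeta>\<in>annulus r0 (r0 + \<delta>). ennreal (reflection_bound \<delta> \<zeta> \<xi>) \<partial>lborel) \<partial>lborel)"
      unfolding mult.assoc by (intro nn_integral_cong nn_integral_cmult) measurable
    also have "\<dots> \<le> (\<integral>\<^sup>+\<xi>. ennreal \<delta> * ennreal (h \<delta> \<xi> * cmod (f \<xi>)) \<partial>lborel)"
    proof (rule nn_integral_mono)
      fix \<xi>
      show "ennreal (cmod (f \<xi>)) * (\<integral>\<^sup>+\<zeta>\<in>annulus r0 (r0 + \<delta>). ennreal (reflection_bound \<delta> \<zeta> \<xi>) \<partial>lborel) \<le> ennreal \<delta> * ennreal (h \<delta> \<xi> * cmod (f \<xi>))"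
      proof (cases "cmod \<xi> \<le> r0")
        case False
        have "(\<integral>\<^sup>+\<zeta>\<in>annulus r0 (r0 + \<delta>). ennreal (reflection_bound \<delta> \<zeta> \<xi>) \<partial>lborel) \<le> ennreal (\<delta> * h \<delta> \<xi>)"
          using nn_integral_reflection_bound_le[OF r0 d, of \<xi>] nn_integral_reflection_bound_far[OF r0 d, of \<xi>] False
          by (auto simp: h_def C_def min_def)
        then have "ennreal (cmod (f \<xi>)) * (\<integral>\<^sup>+\<zeta>\<in>annulus r0 (r0 + \<delta>). ennreal (reflection_bound \<delta> \<zeta> \<xi>) \<partial>lborel) \<le> ennreal (cmod (f \<xi>)) * ennreal (\<delta> * h \<delta> \<xi>)"
          by (rule mult_left_mono) simp
        also have "\<dots> = ennreal \<delta> * ennreal (h \<delta> \<xi> * cmod (f \<xi>))" using d h0[of \<delta>] by (simp add: ennreal_mult[symmetric] mult_ac)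
        finally show ?thesis .
      qed (simp add: supp)
    qed
    also have "\<dots> = ennreal \<delta> * (\<integral>\<^sup>+\<xi>. ennreal (h \<delta> \<xi> * cmod (f \<xi>)) \<partial>lborel)"
      by (rule nn_integral_cmult) measurable
    also have "(\<integral>\<^sup>+\<xi>. ennreal (h \<delta> \<xi> * cmod (f \<xi>)) \<partial>lborel) = ennreal (G (inverse \<delta>))"
      unfolding G_def using d h0[of \<delta>] int[of \<delta>] by (simp add: nn_integral_eq_integral)
    finally have "(\<integral>\<^sup>+\<zeta>\<in>annulus r0 (r0 + \<delta>). ennreal (cmod (cauchy_transform f \<zeta> - c)) \<partial>lborel) / ennreal \<delta>
       \<le> ennreal \<delta> * ennreal (G (inverse \<delta>)) / ennreal \<delta>" by (rule divide_right_mono_ennreal)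
    also have "\<dots> = ennreal (G (inverse \<delta>))"
    proof -
      have "G (inverse \<delta>) \<ge> 0" unfolding G_def using d h0[of \<delta>] by (intro integral_nonneg_AE) auto
      then show ?thesis using d by (simp add: ennreal_mult[symmetric] divide_ennreal)
    qed
    finally show ?thesis .
  qed
  have "(G \<longlongrightarrow> (LINT \<xi>|(lborel :: complex measure). 0 :: real)) at_top"
    unfolding G_def
  proof (rule integral_dominated_convergence_at_top[where s = "\<lambda>t \<xi>. h (inverse t) \<xi> * cmod (f \<xi>)" and f = "\<lambda>_. 0" and M = lborel and w = "\<lambda>\<xi>. C * cmod (f \<xi>)"])
    show "integrable lborel (\<lambda>\<xi>. C * cmod (f \<xi>))" using f by auto
    show "\<forall>\<^sub>F t in at_top. AE \<xi> in lborel. norm (h (inverse t) \<xi> * cmod (f \<xi>)) \<le> C * cmod (f \<xi>)"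
      using eventually_gt_at_top[of 0]
    proof eventually_elim
      case (elim t)
      then have "h (inverse t) \<xi> \<le> C" "h (inverse t) \<xi> \<ge> 0" for \<xi> using h0[of "inverse t"] by auto
      then show ?case by (auto intro!: AE_I2 mult_right_mono simp: abs_mult)
    qed
    show "AE \<xi> in lborel. ((\<lambda>t. h (inverse t) \<xi> * cmod (f \<xi>)) \<longlongrightarrow> 0) at_top"
    proof (rule AE_I2)
      fix \<xi>
      show "((\<lambda>t. h (inverse t) \<xi> * cmod (f \<xi>)) \<longlongrightarrow> 0) at_top"
      proof (cases "cmod \<xi> \<le> r0")
        case False
        have lim: "((\<lambda>t::real. inverse t) \<longlongrightarrow> 0) at_top" by (rule tendsto_inverse_0_at_top[OF filterlim_ident])
        have "\<forall>\<^sub>F t in at_top. inverse t < (cmod \<xi> - r0) / 2"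
          using order_tendstoD(2)[OF lim, of "(cmod \<xi> - r0) / 2"] False by simp
        then have ev: "\<forall>\<^sub>F t in at_top. h (inverse t) \<xi> \<le> 64 * pi * r0 * inverse t / (cmod \<xi> - r0)\<^sup>2"
          by eventually_elim (simp add: h_def)
        have "((\<lambda>t. h (inverse t) \<xi>) \<longlongrightarrow> 0) at_top"
        proof (rule tendsto_sandwich[OF _ ev tendsto_const])
          show "\<forall>\<^sub>F t in at_top. 0 \<le> h (inverse t) \<xi>" using eventually_gt_at_top[of 0] by eventually_elim (simp add: h0)
          show "((\<lambda>t. 64 * pi * r0 * inverse t / (cmod \<xi> - r0)\<^sup>2) \<longlongrightarrow> 0) at_top"
            by (intro tendsto_divide_zero tendsto_mult_right_zero lim)
        qed
        then show ?thesis by (rule tendsto_mult_left_zero)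
      qed (simp add: supp)
    qed
  qed measurable
  then have "(G \<longlongrightarrow> 0) at_top" by simp
  then have "((\<lambda>\<delta>. G (inverse \<delta>)) \<longlongrightarrow> 0) (at_right 0)"
    by (rule filterlim_compose[OF _ filterlim_inverse_at_top_right])
  then have lim: "((\<lambda>\<delta>. ennreal (G (inverse \<delta>))) \<longlongrightarrow> 0) (at_right 0)"
    using tendsto_ennrealI[of "\<lambda>\<delta>. G (inverse \<delta>)" 0] by simp
  show ?thesis
  proof (rule tendsto_sandwich[OF _ _ tendsto_const lim])
    have "\<forall>\<^sub>F \<delta> in at_right 0. \<delta> \<in> {0<..<r0}" using r0 by (rule eventually_at_right_real)
    then show "\<forall>\<^sub>F \<delta> in at_right 0. (\<integral>\<^sup>+\<zeta>\<in>annulus r0 (r0 + \<delta>). ennreal (cmod (cauchy_transform f \<zeta> - c)) \<partial>lborel) / ennreal \<delta> \<le> ennreal (G (inverse \<delta>))"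
      by eventually_elim (rule le, auto)
  qed simp
qed

section \<open>Fourier coefficients of the Cauchy transform\<close>

lemma AE_circle_nn_integral_finite:
  assumes [measurable]: "g \<in> borel_measurable borel" and a: "0 \<le> a"
    and fin: "\<And>n::nat. (\<integral>\<^sup>+z\<in>annulus a (real n). g z \<partial>lborel) < \<infinity>"
  shows "AE r in lborel. a < r \<longrightarrow> (\<integral>\<^sup>+\<phi>\<in>{0..2*pi}. g (rcis r \<phi>) \<partial>lborel) < \<infinity>"
proof -
  have "AE r in lborel. ennreal r * (\<integral>\<^sup>+\<phi>\<in>{0..2*pi}. (g (rcis r \<phi>) * indicator (annulus a (real n)) (rcis r \<phi>)) \<partial>lborel) * indicator {0<..} r \<noteq> \<infinity>" for n :: nat
    by (rule nn_integral_PInf_AE, measurable)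
       (use fin[of n] nn_integral_polar[of "\<lambda>z. g z * indicator (annulus a (real n)) z"] in simp)
  then have "AE r in lborel. \<forall>n::nat. ennreal r * (\<integral>\<^sup>+\<phi>\<in>{0..2*pi}. (g (rcis r \<phi>) * indicator (annulus a (real n)) (rcis r \<phi>)) \<partial>lborel) * indicator {0<..} r \<noteq> \<infinity>"
    by (simp add: AE_all_countable)
  then show ?thesis
  proof eventually_elim
    case (elim r)
    show ?case
    proof
      assume r: "a < r"
      obtain n :: nat where n: "r < real n" using reals_Archimedean2 by blast
      have "(\<integral>\<^sup>+\<phi>\<in>{0..2*pi}. (g (rcis r \<phi>) * indicator (annulus a (real n)) (rcis r \<phi>)) \<partial>lborel) = (\<integral>\<^sup>+\<phi>\<in>{0..2*pi}. g (rcis r \<phi>) \<partial>lborel)"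
        using r n a by (intro nn_integral_cong) (auto simp: annulus_def)
      with elim[rule_format, of n] r a show "(\<integral>\<^sup>+\<phi>\<in>{0..2*pi}. g (rcis r \<phi>) \<partial>lborel) < \<infinity>"
        by (auto simp: ennreal_mult_eq_top_iff less_top)
    qed
  qed
qed

lemma AE_circle_cauchy_majorant_finite:
  fixes f :: "complex \<Rightarrow> complex"
  assumes f: "integrable lborel f"
  shows "AE r in lborel. 0 < r \<longrightarrow> (\<integral>\<^sup>+\<phi>\<in>{0..2*pi}. cauchy_majorant f (rcis r \<phi>) \<partial>lborel) < \<infinity>"
proof (rule AE_circle_nn_integral_finite)
  show "cauchy_majorant f \<in> borel_measurable borel"
    using borel_measurable_integrable[OF f] by (intro cauchy_majorant_measurable) simp
  have "bounded (annulus 0 (real n))" for n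
    by (rule bounded_subset[of "ball 0 (real n)"]) (auto simp: annulus_def)
  then show "(\<integral>\<^sup>+z\<in>annulus 0 (real n). cauchy_majorant f z \<partial>lborel) < \<infinity>" for n
    by (intro nn_integral_cauchy_majorant_bounded f) auto
qed simp

lemma AE_norm_neq: "AE \<xi>::complex in lborel. cmod \<xi> \<noteq> r"
proof -
  have "negligible (sphere (0::complex) r)" by (rule negligible_sphere)
  then have "sphere (0::complex) r \<in> null_sets lborel"
    by (simp add: negligible_iff_null_sets null_sets_completion_iff borel_closed)
  then show ?thesis by (rule AE_I') auto
qed

text \<open>The Fourier coefficient without its factor \<open>1/(2 \<pi>)\<close> and with the measure on the Borel sets, to which
Fubini applies.\<close>

definition circle_coeff :: "(complex \<Rightarrow> complex) \<Rightarrow> int \<Rightarrow> real \<Rightarrow> complex" where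
  "circle_coeff f k r = (LINT \<phi>:{0..2*pi}|lborel. f (rcis r \<phi>) * exp (- \<i> * of_int k * of_real \<phi>))"

lemma rcis_power_int: "r \<noteq> 0 \<Longrightarrow> rcis r \<phi> powi m = of_real (r powi m) * exp (\<i> * of_int m * of_real \<phi>)"
  by (simp add: rcis_def power_int_mult_distrib cis_power_int) (simp add: cis_conv_exp mult_ac)

text \<open>For almost every radius the majorant is integrable over the circle, so Fubini applies, and the
Fourier coefficients of the Cauchy kernel are known. The poles on the circle itself form a null set.\<close>

lemma cauchy_transform_circle_coeff_disc:
  fixes f :: "complex \<Rightarrow> complex"
  assumes f: "integrable lborel f"
  shows "AE r in lborel. 0 < r \<longrightarrow> (\<forall>k. circle_coeff (cauchy_transform f) k r =
     (if 0 \<le> k then - 2 * pi * of_real (r powi k) * (LINT \<xi>:{\<xi>. r < cmod \<xi>}|lborel. f \<xi> * \<xi> powi (- k - 1))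
      else 2 * pi * of_real (r powi k) * (LINT \<xi>:{\<xi>. cmod \<xi> < r}|lborel. f \<xi> * \<xi> powi (- k - 1))))"
proof -
  have fm [measurable]: "f \<in> borel_measurable borel" using borel_measurable_integrable[OF f] by simp
  show ?thesis
    using AE_circle_cauchy_majorant_finite[OF f]
  proof eventually_elim
    case (elim r)
    show ?case
    proof (intro impI allI)
      fix k :: int assume r: "0 < r"
      define e where "e \<phi> = indicator {0..2*pi} \<phi> *\<^sub>R exp (- \<i> * of_int k * of_real \<phi>)" for \<phi> :: real
      have em [measurable]: "e \<in> borel_measurable lborel" unfolding e_def[abs_def]
        by (intro borel_measurable_scaleR borel_measurable_indicator) (auto intro!: borel_measurable_continuous_onI continuous_intros)
      have ne: "cmod (e \<phi>) = indicator {0..2*pi} \<phi>" for \<phi> by (simp add: e_def indicator_def)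
      have "(\<integral>\<^sup>+\<phi>. ennreal (cmod (e \<phi>)) * cauchy_majorant f (rcis r \<phi>) \<partial>lborel) = (\<integral>\<^sup>+\<phi>\<in>{0..2*pi}. cauchy_majorant f (rcis r \<phi>) \<partial>lborel)"
        by (intro nn_integral_cong) (simp add: ne indicator_def)
      then have fin: "(\<integral>\<^sup>+\<phi>. ennreal (cmod (e \<phi>)) * cauchy_majorant f (rcis r \<phi>) \<partial>lborel) < \<infinity>"
        using elim r by simp
      have "circle_coeff (cauchy_transform f) k r = (LINT \<phi>|lborel. e \<phi> * cauchy_transform f (rcis r \<phi>))"
        unfolding circle_coeff_def set_lebesgue_integral_def e_def by (simp add: mult_ac)
      also have "\<dots> = (LINT \<xi>|lborel. f \<xi> * (LINT \<phi>|lborel. e \<phi> / (rcis r \<phi> - \<xi>)))"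
        by (rule cauchy_transform_Fubini(2)[OF fm em _ sigma_finite_lborel fin]) measurable
      also have "\<dots> = (LINT \<xi>|lborel. f \<xi> * (LINT \<phi>:{0..2*pi}|lborel. exp (- \<i> * of_int k * of_real \<phi>) / (rcis r \<phi> - \<xi>)))"
        unfolding set_lebesgue_integral_def e_def by (simp add: scaleR_conv_of_real)
      also have "\<dots>
        = (LINT \<xi>|lborel. (if 0 \<le> k then (- 2 * pi * of_real (r powi k)) * (indicator {\<xi>. r < cmod \<xi>} \<xi> *\<^sub>R (f \<xi> * \<xi> powi (- k - 1)))
            else (2 * pi * of_real (r powi k)) * (indicator {\<xi>. cmod \<xi> < r} \<xi> *\<^sub>R (f \<xi> * \<xi> powi (- k - 1)))))"
      proof (rule integral_cong_AE)
        show "(\<lambda>\<xi>. f \<xi> * (LINT \<phi>:{0..2*pi}|lborel. exp (- \<i> * of_int k * of_real \<phi>) / (rcis r \<phi> - \<xi>))) \<in> borel_measurable lborel"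
        proof -
          have "(\<lambda>\<xi>. f \<xi> * (LINT \<phi>|lborel. e \<phi> / (rcis r \<phi> - \<xi>))) \<in> borel_measurable lborel" by measurable
          then show ?thesis unfolding set_lebesgue_integral_def e_def by (simp add: scaleR_conv_of_real)
        qed
        have [measurable]: "{\<xi>::complex. r < cmod \<xi>} \<in> sets borel" "{\<xi>::complex. cmod \<xi> < r} \<in> sets borel"
          by (intro borel_open open_Collect_less continuous_intros)+
        have [measurable]: "(\<lambda>\<xi>::complex. \<xi> powi m) \<in> borel_measurable borel" for m
          unfolding power_int_def by measurable
        show "(\<lambda>\<xi>. (if 0 \<le> k then (- 2 * pi * of_real (r powi k)) * (indicator {\<xi>. r < cmod \<xi>} \<xi> *\<^sub>R (f \<xi> * \<xi> powi (- k - 1)))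
            else (2 * pi * of_real (r powi k)) * (indicator {\<xi>. cmod \<xi> < r} \<xi> *\<^sub>R (f \<xi> * \<xi> powi (- k - 1))))) \<in> borel_measurable lborel"
          by measurable
        show "AE \<xi> in lborel. f \<xi> * (LINT \<phi>:{0..2*pi}|lborel. exp (- \<i> * of_int k * of_real \<phi>) / (rcis r \<phi> - \<xi>)) = (if 0 \<le> k then (- 2 * pi * of_real (r powi k)) * (indicator {\<xi>. r < cmod \<xi>} \<xi> *\<^sub>R (f \<xi> * \<xi> powi (- k - 1)))
            else (2 * pi * of_real (r powi k)) * (indicator {\<xi>. cmod \<xi> < r} \<xi> *\<^sub>R (f \<xi> * \<xi> powi (- k - 1))))"
          using AE_norm_neq[of r] AE_norm_neq[of 0]
        proof eventually_elim
          case (elim \<xi>)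
          then have "\<xi> \<noteq> 0" by auto
          then show ?case
            using circle_integral_cauchy_kernel_outside[OF r, of \<xi> k] circle_integral_cauchy_kernel_inside[OF r, of \<xi> k] elim
            by (cases "r < cmod \<xi>") (auto simp: mult_ac)
        qed
      qed
      also have "\<dots> = (if 0 \<le> k then - 2 * pi * of_real (r powi k) * (LINT \<xi>:{\<xi>. r < cmod \<xi>}|lborel. f \<xi> * \<xi> powi (- k - 1))
         else 2 * pi * of_real (r powi k) * (LINT \<xi>:{\<xi>. cmod \<xi> < r}|lborel. f \<xi> * \<xi> powi (- k - 1)))"
        unfolding set_lebesgue_integral_def by (cases "0 \<le> k") (simp_all only: if_True if_False integral_mult_right_zero)
      finally show "circle_coeff (cauchy_transform f) k r = (if 0 \<le> k then - 2 * pi * of_real (r powi k) * (LINT \<xi>:{\<xi>. r < cmod \<xi>}|lborel. f \<xi> * \<xi> powi (- k - 1))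
         else 2 * pi * of_real (r powi k) * (LINT \<xi>:{\<xi>. cmod \<xi> < r}|lborel. f \<xi> * \<xi> powi (- k - 1)))" .
    qed
  qed
qed

lemma circle_coeff_power_int:
  assumes "r \<noteq> 0"
  shows "circle_coeff (\<lambda>z. f z * z powi m) k r = of_real (r powi m) * circle_coeff f (k - m) r"
proof -
  have "f (rcis r \<phi>) * (rcis r \<phi>) powi m * exp (- \<i> * of_int k * of_real \<phi>) = of_real (r powi m) * (f (rcis r \<phi>) * exp (- \<i> * of_int (k - m) * of_real \<phi>))" for \<phi>
    using assms by (simp add: rcis_power_int mult_ac mult_exp_exp[symmetric]) (simp add: exp_add[symmetric] algebra_simps flip: exp_minus)
  then show ?thesis unfolding circle_coeff_def by (simp only: set_integral_mult_right)
qed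

text \<open>On circles the factor \<open>\<xi>\<^sup>m\<close> shifts the Fourier coefficients of \<open>f\<close>; the Jacobian adds one power
of the radius. The bound on \<open>|\<xi>|\<^sup>m\<close> keeps the integrand integrable.\<close>

lemma radial_integral:
  fixes f :: "complex \<Rightarrow> complex"
  assumes f: "integrable lborel f" and S: "S \<in> sets borel" "S \<subseteq> {0<..}"
    and bd: "\<And>\<xi>. cmod \<xi> \<in> S \<Longrightarrow> cmod \<xi> powi m \<le> C"
  shows "(LINT \<xi>:{\<xi>. cmod \<xi> \<in> S}|lborel. f \<xi> * \<xi> powi m) = (LINT s:S|lborel. of_real (s powi (m + 1)) * circle_coeff f (- m) s)"
    and "set_integrable lborel S (\<lambda>s. of_real (s powi (m + 1)) * circle_coeff f (- m) s)"
proof -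
  have fm [measurable]: "f \<in> borel_measurable borel" using borel_measurable_integrable[OF f] by simp
  have pm [measurable]: "(\<lambda>\<xi>::complex. \<xi> powi m) \<in> borel_measurable borel"
    unfolding power_int_def by measurable
  note S(1) [measurable]
  define g where "g \<xi> = indicator {\<xi>. cmod \<xi> \<in> S} \<xi> *\<^sub>R (f \<xi> * \<xi> powi m)" for \<xi>
  have [measurable]: "{\<xi>. cmod \<xi> \<in> S} \<in> sets borel" by measurable
  have gm [measurable]: "g \<in> borel_measurable borel" unfolding g_def[abs_def] by measurable
  have gi: "integrable lborel g"
  proof (rule Bochner_Integration.integrable_bound[of _ "\<lambda>\<xi>. C * cmod (f \<xi>)"])
    show "AE \<xi> in lborel. norm (g \<xi>) \<le> norm (C * cmod (f \<xi>))"
    proof (rule AE_I2)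
      fix \<xi>
      show "norm (g \<xi>) \<le> norm (C * cmod (f \<xi>))"
      proof (cases "cmod \<xi> \<in> S")
        case True
        have "cmod (f \<xi>) * (cmod \<xi> powi m) \<le> cmod (f \<xi>) * C" using bd[OF True] by (rule mult_left_mono) simp
        also have "\<dots> \<le> norm (C * cmod (f \<xi>))" by (simp add: mult.commute)
        finally show ?thesis using True by (simp add: g_def norm_mult norm_power_int)
      qed (simp add: g_def)
    qed
  qed (use f in auto)
  have eq: "r *\<^sub>R (LINT \<phi>:{0..2*pi}|lborel. g (rcis r \<phi>)) = indicator S r *\<^sub>R (of_real (r powi (m + 1)) * circle_coeff f (- m) r)" if "0 < r" for r
  proof -
    have "(LINT \<phi>:{0..2*pi}|lborel. g (rcis r \<phi>)) = (LINT \<phi>:{0..2*pi}|lborel. indicator S r *\<^sub>R (f (rcis r \<phi>) * rcis r \<phi> powi m))"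
      using that by (simp add: g_def indicator_def)
    also have "\<dots> = indicator S r *\<^sub>R circle_coeff (\<lambda>z. f z * z powi m) 0 r"
      unfolding circle_coeff_def by simp
    also have "\<dots> = indicator S r *\<^sub>R (of_real (r powi m) * circle_coeff f (- m) r)" using that by (subst circle_coeff_power_int) auto
    finally show ?thesis using that by (simp add: power_int_add scaleR_conv_of_real mult_ac)
  qed
  have eq': "indicator {0<..} r *\<^sub>R r *\<^sub>R (LINT \<phi>:{0..2*pi}|lborel. g (rcis r \<phi>)) = indicator S r *\<^sub>R (of_real (r powi (m + 1)) * circle_coeff f (- m) r)" for r
    using eq[of r] S(2) by (cases "0 < r") (auto simp: indicator_def)
  have "(LINT \<xi>:{\<xi>. cmod \<xi> \<in> S}|lborel. f \<xi> * \<xi> powi m) = (LINT \<xi>|lborel. g \<xi>)" by (simp add: set_lebesgue_integral_def g_def)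
  also have "\<dots> = (LINT r:{0<..}|lborel. r *\<^sub>R (LINT \<phi>:{0..2*pi}|lborel. g (rcis r \<phi>)))" by (rule integral_polar(3)[OF gm gi])
  also have "\<dots> = (LINT s:S|lborel. of_real (s powi (m + 1)) * circle_coeff f (- m) s)"
    unfolding set_lebesgue_integral_def[of lborel "{0<..}"] eq' by (simp add: set_lebesgue_integral_def)
  finally show "(LINT \<xi>:{\<xi>. cmod \<xi> \<in> S}|lborel. f \<xi> * \<xi> powi m) = (LINT s:S|lborel. of_real (s powi (m + 1)) * circle_coeff f (- m) s)" .
  show "set_integrable lborel S (\<lambda>s. of_real (s powi (m + 1)) * circle_coeff f (- m) s)"
    using integral_polar(2)[OF gm gi] unfolding set_integrable_def eq' .
qed

theorem cauchy_transform_circle_coeff: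
  fixes f :: "complex \<Rightarrow> complex"
  assumes f: "integrable lborel f"
  shows "AE r in lborel. 0 < r \<longrightarrow> (\<forall>k. circle_coeff (cauchy_transform f) k r =
     (if 0 \<le> k then - 2 * pi * of_real (r powi k) * (LINT s:{r<..}|lborel. of_real (s powi (- k)) * circle_coeff f (k + 1) s)
      else 2 * pi * of_real (r powi k) * (LINT s:{0<..<r}|lborel. of_real (s powi (- k)) * circle_coeff f (k + 1) s)))"
  using cauchy_transform_circle_coeff_disc[OF f]
proof eventually_elim
  case (elim r)
  show ?case
  proof (intro impI allI)
    fix k assume r: "0 < r"
    have A: "(LINT \<xi>:{\<xi>. r < cmod \<xi>}|lborel. f \<xi> * \<xi> powi (- k - 1)) = (LINT s:{r<..}|lborel. of_real (s powi (- k)) * circle_coeff f (k + 1) s)" if "0 \<le> k"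
    proof -
      have "cmod \<xi> powi (- k - 1) \<le> r powi (- k - 1)" if "r < cmod \<xi>" for \<xi> :: complex
      proof -
        have "r powi (k + 1) \<le> cmod \<xi> powi (k + 1)" using that r \<open>0 \<le> k\<close> by (intro power_int_mono) auto
        moreover have "0 < r powi (k + 1)" using r by simp
        moreover have "- k - 1 = - (k + 1)" by simp
        ultimately show ?thesis by (simp only: power_int_minus) (rule le_imp_inverse_le)
      qed
      then show ?thesis using radial_integral(1)[OF f, of "{r<..}" "- k - 1" "r powi (- k - 1)"] r by (simp add: algebra_simps)
    qed
    have B: "(LINT \<xi>:{\<xi>. cmod \<xi> < r}|lborel. f \<xi> * \<xi> powi (- k - 1)) = (LINT s:{0<..<r}|lborel. of_real (s powi (- k)) * circle_coeff f (k + 1) s)" if k: "\<not> 0 \<le> k"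
    proof -
      have sub: "{0<..<r} \<subseteq> {0<..}" by auto
      have "cmod \<xi> powi (- k - 1) \<le> r powi (- k - 1)" if "cmod \<xi> < r" for \<xi> :: complex
        using that k by (intro power_int_mono) auto
      then have 1: "(LINT \<xi>:{\<xi>. cmod \<xi> \<in> {0<..<r}}|lborel. f \<xi> * \<xi> powi (- k - 1)) = (LINT s:{0<..<r}|lborel. of_real (s powi (- k)) * circle_coeff f (k + 1) s)"
        using radial_integral(1)[OF f _ sub, of "- k - 1" "r powi (- k - 1)"] by (simp add: algebra_simps)
      have fm [measurable]: "f \<in> borel_measurable borel" using borel_measurable_integrable[OF f] by simp
      have [measurable]: "(\<lambda>\<xi>::complex. \<xi> powi m) \<in> borel_measurable borel" for m
        unfolding power_int_def by measurable
      have [measurable]: "{\<xi>::complex. cmod \<xi> < r} \<in> sets borel" "{\<xi>::complex. cmod \<xi> \<in> {0<..<r}} \<in> sets borel" by measurable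
      have "(LINT \<xi>:{\<xi>. cmod \<xi> < r}|lborel. f \<xi> * \<xi> powi (- k - 1)) = (LINT \<xi>:{\<xi>. cmod \<xi> \<in> {0<..<r}}|lborel. f \<xi> * \<xi> powi (- k - 1))"
        unfolding set_lebesgue_integral_def
        by (rule integral_cong_AE, measurable, measurable, use AE_norm_neq[of 0] in eventually_elim) (auto simp: indicator_def)
      then show ?thesis using 1 by simp
    qed
    show "circle_coeff (cauchy_transform f) k r =
     (if 0 \<le> k then - 2 * pi * of_real (r powi k) * (LINT s:{r<..}|lborel. of_real (s powi (- k)) * circle_coeff f (k + 1) s)
      else 2 * pi * of_real (r powi k) * (LINT s:{0<..<r}|lborel. of_real (s powi (- k)) * circle_coeff f (k + 1) s))"
      using elim[rule_format, OF r, of k] A B by simp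
  qed
qed

section \<open>Exterior conformal maps\<close>

text \<open>With the factor \<open>deriv g\<close> the derivative of the new test function with respect to \<open>cnj z\<close> is the
old one times the Jacobian \<open>|deriv g|\<^sup>2\<close>, without further terms, since \<open>deriv g\<close> is holomorphic. This is why the
source in the new coordinates carries a factor \<open>cnj (deriv \<Psi>)\<close>.\<close>

lemma wirtinger_test_pullback:
  fixes g k \<eta> a b :: "complex \<Rightarrow> complex"
  assumes S: "open S" and g: "g holomorphic_on S" and k: "continuous_on T k" and kS: "\<And>w. w \<in> T \<Longrightarrow> k w \<in> S"
    and kg: "\<And>z. z \<in> S \<Longrightarrow> k (g z) = z"
    and t: "wirtinger_test T \<eta> a b"
  shows "wirtinger_test S (\<lambda>z. if z \<in> S then \<eta> (g z) * deriv g z else 0)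
     (\<lambda>z. if z \<in> S then a (g z) * (deriv g z)\<^sup>2 + \<eta> (g z) * deriv (deriv g) z else 0)
     (\<lambda>z. if z \<in> S then b (g z) * of_real ((cmod (deriv g z))\<^sup>2) else 0)"
    (is "wirtinger_test S ?\<eta> ?a ?b")
proof -
  obtain K where K: "compact K" "K \<subseteq> T" "\<And>x. x \<notin> K \<Longrightarrow> \<eta> x = 0" using t by (auto simp: wirtinger_test_def)
  have ca: "continuous_on UNIV a" and cb: "continuous_on UNIV b" using t by (auto simp: wirtinger_test_def)
  have ce: "continuous_on UNIV \<eta>" using t by (rule wirtinger_test_continuous)
  have va: "a x = 0" and vb: "b x = 0" if "x \<notin> K" for x
    using wirtinger_test_vanish[OF t K(1), of x] K(3) that by auto
  define K' where "K' = k ` K"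
  have K': "compact K'" "K' \<subseteq> S" unfolding K'_def
    using compact_continuous_image[OF continuous_on_subset[OF k K(2)] K(1)] kS K(2) by auto
  have out: "g z \<notin> K" if "z \<in> S" "z \<notin> K'" for z using that(2) kg[OF that(1)] by (metis K'_def imageI)
  have zero: "?\<eta> z = 0" "?a z = 0" "?b z = 0" if "z \<notin> K'" for z
    using that out[of z] K(3) va vb by auto
  have op: "open (- K')" using K'(1) by (simp add: compact_imp_closed open_Compl)
  have un: "S \<union> - K' = UNIV" using K'(2) by auto
  have g1: "deriv g holomorphic_on S" and g2: "deriv (deriv g) holomorphic_on S"
    using g S by (auto intro!: holomorphic_deriv)
  note cg = holomorphic_on_imp_continuous_on[OF g] and cg1 = holomorphic_on_imp_continuous_on[OF g1] and cg2 = holomorphic_on_imp_continuous_on[OF g2]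
  have cont: "continuous_on UNIV f" if "continuous_on S f" "\<And>z. z \<notin> K' \<Longrightarrow> f z = 0" for f :: "complex \<Rightarrow> complex"
  proof -
    have "continuous_on (- K') f" by (rule continuous_on_eq[OF continuous_on_const[of _ 0]]) (use that(2) in auto)
    from continuous_on_open_Un[OF S op that(1) this] un show ?thesis by simp
  qed
  have "continuous_on S ?a"
  proof -
    have "continuous_on S (\<lambda>z. a (g z) * (deriv g z)\<^sup>2 + \<eta> (g z) * deriv (deriv g) z)"
      by (intro continuous_intros cg cg1 cg2 continuous_on_compose2[OF ca] continuous_on_compose2[OF ce]) auto
    then show ?thesis by (simp cong: continuous_on_cong)
  qed
  moreover have "continuous_on S ?b"
  proof -
    have "continuous_on S (\<lambda>z. b (g z) * of_real ((cmod (deriv g z))\<^sup>2))"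
      by (intro continuous_intros cg cg1 continuous_on_compose2[OF cb]) auto
    then show ?thesis by (simp cong: continuous_on_cong)
  qed
  moreover have "(?\<eta> has_derivative (\<lambda>h. ?a x * h + ?b x * cnj h)) (at x)" for x
  proof (cases "x \<in> S")
    case True
    have dg: "(g has_derivative (\<lambda>h. deriv g x * h)) (at x)"
      using holomorphic_derivI[OF g S True] by (simp add: has_field_derivative_def)
    have dg1: "(deriv g has_derivative (\<lambda>h. deriv (deriv g) x * h)) (at x)"
      using holomorphic_derivI[OF g1 S True] by (simp add: has_field_derivative_def)
    have "(\<eta> has_derivative (\<lambda>h. a (g x) * h + b (g x) * cnj h)) (at (g x))"
      using t by (simp add: wirtinger_test_def)
    from has_derivative_compose[OF dg this]
    have "((\<lambda>x. \<eta> (g x)) has_derivative (\<lambda>h. a (g x) * (deriv g x * h) + b (g x) * cnj (deriv g x * h))) (at x)" .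
    from has_derivative_mult[OF this dg1]
    have "((\<lambda>x. \<eta> (g x) * deriv g x) has_derivative (\<lambda>h. \<eta> (g x) * (deriv (deriv g) x * h) + (a (g x) * (deriv g x * h) + b (g x) * cnj (deriv g x * h)) * deriv g x)) (at x)" .
    moreover have "(\<lambda>h. \<eta> (g x) * (deriv (deriv g) x * h) + (a (g x) * (deriv g x * h) + b (g x) * cnj (deriv g x * h)) * deriv g x)
      = (\<lambda>h. ?a x * h + ?b x * cnj h)"
      using True unfolding complex_norm_square by (auto simp: fun_eq_iff algebra_simps power2_eq_square)
    ultimately have "((\<lambda>x. \<eta> (g x) * deriv g x) has_derivative (\<lambda>h. ?a x * h + ?b x * cnj h)) (at x)" by simp
    then show ?thesis by (rule has_derivative_transform_within_open[OF _ S True]) simp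
  next
    case False
    then have x: "x \<in> - K'" using K'(2) by auto
    have "((\<lambda>_. 0) has_derivative (\<lambda>h. ?a x * h + ?b x * cnj h)) (at x)" using False by simp
    then show ?thesis by (rule has_derivative_transform_within_open[OF _ op x]) (use zero in auto)
  qed
  ultimately show ?thesis
    unfolding wirtinger_test_def using cont[of ?a] cont[of ?b] zero K' by blast
qed

lemma bigo_tendsto_0:
  fixes f g :: "'a \<Rightarrow> complex"
  assumes "f \<in> O[F](g)" "(g \<longlongrightarrow> 0) F"
  shows "(f \<longlongrightarrow> 0) F"
proof -
  obtain c where "\<forall>\<^sub>F x in F. norm (f x) \<le> c * norm (g x)" using landau_o.bigE[OF assms(1)] by blast
  moreover have "((\<lambda>x. c * norm (g x)) \<longlongrightarrow> 0) F" using assms(2) by (intro tendsto_mult_right_zero tendsto_norm_zero)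
  ultimately show ?thesis by (rule Lim_null_comparison)
qed

locale exterior_conformal_map =
  fixes \<Omega> :: "complex set" and r0 :: real and \<Phi> \<Psi> :: "complex \<Rightarrow> complex"
  assumes r0: "0 < r0" and \<Omega>: "open \<Omega>" "bounded (- \<Omega>)"
    and map: "exterior_riemann_map \<Omega> r0 \<Phi>" and \<Psi>: "\<Psi> = inv_into \<Omega> \<Phi>"
begin

abbreviation E :: "complex set" where "E \<equiv> disc_exterior r0"

lemma open_E: "open E" unfolding disc_exterior_def by (intro open_Collect_less continuous_intros)

lemma E_borel [measurable]: "E \<in> sets borel" using open_E by simp

lemma \<Phi>_holomorphic: "\<Phi> holomorphic_on \<Omega>" and \<Phi>_inj: "inj_on \<Phi> \<Omega>" and \<Phi>_image: "\<Phi> ` \<Omega> = E"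
  using map by (auto simp: exterior_riemann_map_def)

lemma \<Psi>_\<Phi> [simp]: "z \<in> \<Omega> \<Longrightarrow> \<Psi> (\<Phi> z) = z" unfolding \<Psi> by (rule inv_into_f_f[OF \<Phi>_inj])
lemma \<Phi>_\<Psi> [simp]: "\<zeta> \<in> E \<Longrightarrow> \<Phi> (\<Psi> \<zeta>) = \<zeta>" unfolding \<Psi> using \<Phi>_image by (simp add: f_inv_into_f)
lemma \<Phi>_in [simp]: "z \<in> \<Omega> \<Longrightarrow> \<Phi> z \<in> E" using \<Phi>_image by auto
lemma \<Psi>_in [simp]: "\<zeta> \<in> E \<Longrightarrow> \<Psi> \<zeta> \<in> \<Omega>" unfolding \<Psi> using \<Phi>_image by (metis inv_into_into)
lemma \<Psi>_image: "\<Psi> ` E = \<Omega>"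
proof
  show "\<Omega> \<subseteq> \<Psi> ` E"
  proof
    fix z assume "z \<in> \<Omega>"
    then show "z \<in> \<Psi> ` E" by (intro image_eqI[of _ _ "\<Phi> z"]) simp_all
  qed
qed auto
lemma \<Psi>_inj: "inj_on \<Psi> E" by (rule inj_on_inverseI[of _ \<Phi>]) simp

lemma \<Psi>_holomorphic: "\<Psi> holomorphic_on E"
  and deriv_mult: "z \<in> \<Omega> \<Longrightarrow> deriv \<Phi> z * deriv \<Psi> (\<Phi> z) = 1"
proof -
  obtain g where g: "g holomorphic_on (\<Phi> ` \<Omega>)" "\<And>z. z \<in> \<Omega> \<Longrightarrow> deriv \<Phi> z * deriv g (\<Phi> z) = 1" "\<And>z. z \<in> \<Omega> \<Longrightarrow> g (\<Phi> z) = z"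
    using holomorphic_has_inverse[OF \<Phi>_holomorphic \<Omega>(1) \<Phi>_inj] by metis
  have eq: "g \<zeta> = \<Psi> \<zeta>" if "\<zeta> \<in> E" for \<zeta> using g(3)[of "\<Psi> \<zeta>"] that by simp
  show "\<Psi> holomorphic_on E" using g(1) unfolding \<Phi>_image by (rule holomorphic_transform) (use eq in auto)
  assume z: "z \<in> \<Omega>"
  have "deriv g (\<Phi> z) = deriv \<Psi> (\<Phi> z)"
    by (rule complex_derivative_transform_within_open[OF _ _ open_E])
       (use g(1) z eq \<Phi>_image holomorphic_on_imp_differentiable_at open_E in \<open>auto intro!: \<open>\<Psi> holomorphic_on E\<close>\<close>)
  with g(2)[OF z] show "deriv \<Phi> z * deriv \<Psi> (\<Phi> z) = 1" by simp
qed

lemma deriv_\<Psi>_mult: "\<zeta> \<in> E \<Longrightarrow> deriv \<Phi> (\<Psi> \<zeta>) * deriv \<Psi> \<zeta> = 1"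
  using deriv_mult[of "\<Psi> \<zeta>"] by simp

lemma deriv_\<Psi>_nonzero: "\<zeta> \<in> E \<Longrightarrow> deriv \<Psi> \<zeta> \<noteq> 0" using deriv_\<Psi>_mult by fastforce
lemma deriv_\<Phi>_nonzero: "z \<in> \<Omega> \<Longrightarrow> deriv \<Phi> z \<noteq> 0" using deriv_mult by fastforce

lemma \<Psi>_continuous: "continuous_on E \<Psi>" and \<Phi>_continuous: "continuous_on \<Omega> \<Phi>"
  and deriv_\<Psi>_continuous: "continuous_on E (deriv \<Psi>)" and deriv_\<Phi>_continuous: "continuous_on \<Omega> (deriv \<Phi>)"
  using \<Psi>_holomorphic \<Phi>_holomorphic open_E \<Omega>(1)
  by (auto intro!: holomorphic_on_imp_continuous_on holomorphic_deriv)

lemma change_of_variables: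
  fixes h :: "complex \<Rightarrow> complex"
  assumes "A \<in> sets lebesgue" "A \<subseteq> E"
  shows "set_integrable lebesgue A (\<lambda>\<zeta>. of_real ((cmod (deriv \<Psi> \<zeta>))\<^sup>2) * h (\<Psi> \<zeta>)) \<longleftrightarrow> set_integrable lebesgue (\<Psi> ` A) h"
    and "(LINT \<zeta>:A|lebesgue. of_real ((cmod (deriv \<Psi> \<zeta>))\<^sup>2) * h (\<Psi> \<zeta>)) = (LINT z:\<Psi> ` A|lebesgue. h z)"
proof -
  have "(\<Psi> has_derivative (\<lambda>h. deriv \<Psi> z * h + 0 * cnj h)) (at z within A)" if "z \<in> A" for z
    using holomorphic_derivI[OF \<Psi>_holomorphic open_E, of z A] that assms(2) by (auto simp: has_field_derivative_def)
  from set_integral_change_of_variables_complex[OF assms(1) this inj_on_subset[OF \<Psi>_inj assms(2)], of h]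
  show "set_integrable lebesgue A (\<lambda>\<zeta>. of_real ((cmod (deriv \<Psi> \<zeta>))\<^sup>2) * h (\<Psi> \<zeta>)) \<longleftrightarrow> set_integrable lebesgue (\<Psi> ` A) h"
    and "(LINT \<zeta>:A|lebesgue. of_real ((cmod (deriv \<Psi> \<zeta>))\<^sup>2) * h (\<Psi> \<zeta>)) = (LINT z:\<Psi> ` A|lebesgue. h z)"
    by (simp_all add: scaleR_conv_of_real)
qed

lemma negligible_\<Psi>_image:
  assumes "negligible N" "N \<subseteq> E" shows "negligible (\<Psi> ` N)"
proof (rule negligible_differentiable_image_negligible[OF _ assms(1)])
  show "\<Psi> differentiable_on N"
    unfolding differentiable_on_def
  proof
    fix x assume "x \<in> N"
    then have "\<Psi> field_differentiable (at x)"
      using assms(2) by (intro holomorphic_on_imp_differentiable_at[OF \<Psi>_holomorphic open_E]) blast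
    then show "\<Psi> differentiable (at x within N)"
      by (rule differentiable_at_withinI[OF field_differentiable_imp_differentiable])
  qed
qed simp

lemma negligible_\<Phi>_image:
  assumes "negligible N" "N \<subseteq> \<Omega>" shows "negligible (\<Phi> ` N)"
proof (rule negligible_differentiable_image_negligible[OF _ assms(1)])
  show "\<Phi> differentiable_on N"
    unfolding differentiable_on_def
  proof
    fix x assume "x \<in> N"
    then have "\<Phi> field_differentiable (at x)"
      using assms(2) by (intro holomorphic_on_imp_differentiable_at[OF \<Phi>_holomorphic \<Omega>(1)]) blast
    then show "\<Phi> differentiable (at x within N)"
      by (rule differentiable_at_withinI[OF field_differentiable_imp_differentiable])
  qed
qed simp

text \<open>Null sets correspond to null sets, as both maps are differentiable.\<close>

lemma AE_transfer:
  "(AE z in lebesgue. z \<in> \<Omega> \<longrightarrow> P z) \<longleftrightarrow> (AE \<zeta> in lebesgue. \<zeta> \<in> E \<longrightarrow> P (\<Psi> \<zeta>))"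
proof -
  define A where "A = {z. z \<in> \<Omega> \<and> \<not> P z}"
  define B where "B = {\<zeta>. \<zeta> \<in> E \<and> \<not> P (\<Psi> \<zeta>)}"
  have ae: "(AE x in lebesgue. Q x) \<longleftrightarrow> negligible {x. \<not> Q x}" for Q :: "complex \<Rightarrow> bool"
    unfolding negligible_iff_null_sets by (subst completion.AE_iff_null_sets) simp
  have A: "(AE z in lebesgue. z \<in> \<Omega> \<longrightarrow> P z) \<longleftrightarrow> negligible A" unfolding ae A_def by simp
  have B: "(AE \<zeta> in lebesgue. \<zeta> \<in> E \<longrightarrow> P (\<Psi> \<zeta>)) \<longleftrightarrow> negligible B" unfolding ae B_def by simp
  have "\<Psi> ` B = A"
  proof
    show "A \<subseteq> \<Psi> ` B"
    proof
      fix z assume "z \<in> A"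
      then show "z \<in> \<Psi> ` B" by (intro image_eqI[of _ _ "\<Phi> z"]) (simp_all add: A_def B_def)
    qed
  qed (auto simp: A_def B_def)
  moreover have "\<Phi> ` A = B"
  proof
    show "B \<subseteq> \<Phi> ` A"
    proof
      fix \<zeta> assume "\<zeta> \<in> B"
      then show "\<zeta> \<in> \<Phi> ` A" by (intro image_eqI[of _ _ "\<Psi> \<zeta>"]) (simp_all add: A_def B_def)
    qed
  qed (auto simp: A_def B_def)
  moreover have "A \<subseteq> \<Omega>" "B \<subseteq> E" by (auto simp: A_def B_def)
  ultimately show ?thesis unfolding A B using negligible_\<Psi>_image[of B] negligible_\<Phi>_image[of A] by auto
qed

lemma test_pullback_\<Psi>:
  "wirtinger_test \<Omega> \<eta> a b \<Longrightarrow> wirtinger_test E (\<lambda>z. if z \<in> E then \<eta> (\<Psi> z) * deriv \<Psi> z else 0)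
     (\<lambda>z. if z \<in> E then a (\<Psi> z) * (deriv \<Psi> z)\<^sup>2 + \<eta> (\<Psi> z) * deriv (deriv \<Psi>) z else 0)
     (\<lambda>z. if z \<in> E then b (\<Psi> z) * of_real ((cmod (deriv \<Psi> z))\<^sup>2) else 0)"
  by (rule wirtinger_test_pullback[OF open_E \<Psi>_holomorphic \<Phi>_continuous]) auto

lemma test_pullback_\<Phi>:
  "wirtinger_test E \<eta> a b \<Longrightarrow> wirtinger_test \<Omega> (\<lambda>z. if z \<in> \<Omega> then \<eta> (\<Phi> z) * deriv \<Phi> z else 0)
     (\<lambda>z. if z \<in> \<Omega> then a (\<Phi> z) * (deriv \<Phi> z)\<^sup>2 + \<eta> (\<Phi> z) * deriv (deriv \<Phi>) z else 0)
     (\<lambda>z. if z \<in> \<Omega> then b (\<Phi> z) * of_real ((cmod (deriv \<Phi> z))\<^sup>2) else 0)"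
  by (rule wirtinger_test_pullback[OF \<Omega>(1) \<Phi>_holomorphic \<Psi>_continuous]) auto

text \<open>The quantitative form in which the normalisation of \<open>\<Phi>\<close> at infinity is used.\<close>

lemma near_infinity:
  obtains R\<^sub>1 where "0 < R\<^sub>1" "{z. R\<^sub>1 < cmod z} \<subseteq> \<Omega>"
    "\<And>z. R\<^sub>1 < cmod z \<Longrightarrow> cmod (\<Phi> z - z) \<le> 1 \<and> 1/2 \<le> cmod (deriv \<Phi> z)"
proof -
  have o1: "(\<lambda>z. \<Phi> z - z) \<in> O[at_infinity](\<lambda>z. 1 / z)" and o2: "(\<lambda>z. deriv \<Phi> z - 1) \<in> O[at_infinity](\<lambda>z. 1 / z ^ 2)"
    using map by (auto simp: exterior_riemann_map_def)
  have t1: "((\<lambda>z::complex. 1 / z) \<longlongrightarrow> 0) at_infinity" by (rule tendsto_divide_0[OF tendsto_const filterlim_ident])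
  have t2: "((\<lambda>z::complex. 1 / z ^ 2) \<longlongrightarrow> 0) at_infinity"
    using tendsto_mult_zero[OF t1 t1] by (simp add: power2_eq_square)
  have l1: "((\<lambda>z. \<Phi> z - z) \<longlongrightarrow> 0) at_infinity" by (rule bigo_tendsto_0[OF o1 t1])
  have l2: "((\<lambda>z. deriv \<Phi> z - 1) \<longlongrightarrow> 0) at_infinity" by (rule bigo_tendsto_0[OF o2 t2])
  have "\<forall>\<^sub>F z in at_infinity. cmod (\<Phi> z - z) \<le> 1 \<and> 1/2 \<le> cmod (deriv \<Phi> z)"
    using tendstoD[OF l1, of 1, simplified] tendstoD[OF l2, of "1/2", simplified]
  proof eventually_elim
    case (elim z)
    have "1 \<le> cmod (deriv \<Phi> z) + cmod (deriv \<Phi> z - 1)"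
      using norm_triangle_ineq4[of "deriv \<Phi> z" "deriv \<Phi> z - 1"] by simp
    with elim show ?case by simp
  qed
  then obtain b where b: "\<And>z. b \<le> cmod z \<Longrightarrow> cmod (\<Phi> z - z) \<le> 1 \<and> 1/2 \<le> cmod (deriv \<Phi> z)"
    by (auto simp: eventually_at_infinity)
  obtain c where c: "\<And>z. z \<notin> \<Omega> \<Longrightarrow> cmod z \<le> c" using \<Omega>(2) by (auto simp: bounded_iff)
  show ?thesis
  proof (rule that[of "max 1 (max b c)"])
    show "{z. max 1 (max b c) < cmod z} \<subseteq> \<Omega>" using c by force
  qed (use b in auto)
qed

end

section \<open>Divergence and curl as one complex equation\<close>

lemma ex_borel_version:
  fixes g :: "complex \<Rightarrow> complex"
  assumes "g \<in> borel_measurable lebesgue"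
  obtains g' where "g' \<in> borel_measurable borel" "AE x in lborel. g x = g' x"
proof -
  have "(\<lambda>x. Re (g x)) \<in> borel_measurable lebesgue" "(\<lambda>x. Im (g x)) \<in> borel_measurable lebesgue"
    using assms by auto
  then obtain p q where p: "p \<in> borel_measurable lborel" "AE x in lborel. Re (g x) = p x"
    and q: "q \<in> borel_measurable lborel" "AE x in lborel. Im (g x) = q x"
    by (metis completion_ex_borel_measurable_real)
  show ?thesis
  proof (rule that)
    show "(\<lambda>x. of_real (p x) + \<i> * of_real (q x)) \<in> borel_measurable borel"
      using p(1) q(1) by (simp add: borel_measurable_of_real)
    show "AE x in lborel. g x = of_real (p x) + \<i> * of_real (q x)"
      using p(2) q(2) by eventually_elim (simp add: complex_eq_iff)
  qed
qed

lemma integrable_lebesgue_iff_borel_version: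
  fixes g g' :: "'a::euclidean_space \<Rightarrow> complex"
  assumes g': "g' \<in> borel_measurable borel" and ae: "AE x in lborel. g x = g' x"
  shows "integrable lebesgue g \<longleftrightarrow> integrable lborel g'" "(LINT x|lebesgue. g x) = (LINT x|lborel. g' x)"
proof -
  have g'l: "g' \<in> borel_measurable lebesgue" using g' by (simp add: measurable_completion)
  have ae': "AE x in lebesgue. g' x = g x" using AE_completion[OF ae] by eventually_elim simp
  have gl: "g \<in> borel_measurable lebesgue"
    by (rule borel_measurable_AE[OF g'l ae'])
  have "integrable lebesgue g \<longleftrightarrow> integrable lebesgue g'"
    by (rule integrable_cong_AE[OF gl g'l]) (use ae' in eventually_elim, simp)
  also have "\<dots> \<longleftrightarrow> integrable lborel g'" using g' by (intro integrable_completion) simp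
  finally show "integrable lebesgue g \<longleftrightarrow> integrable lborel g'" .
  have "(LINT x|lebesgue. g x) = (LINT x|lebesgue. g' x)"
    by (rule integral_cong_AE[OF gl g'l]) (use ae' in eventually_elim, simp)
  also have "\<dots> = (LINT x|lborel. g' x)" using g' by (intro integral_completion) simp
  finally show "(LINT x|lebesgue. g x) = (LINT x|lborel. g' x)" .
qed

lemma set_integrable_continuous_mult:
  fixes f g :: "complex \<Rightarrow> complex"
  assumes f: "set_integrable lebesgue K f" and K: "compact K" and g: "continuous_on K g"
  shows "set_integrable lebesgue K (\<lambda>x. g x * f x)"
proof -
  have "bounded (g ` K)" using compact_continuous_image[OF g K] by (rule compact_imp_bounded)
  then obtain B where B: "\<And>x. x \<in> K \<Longrightarrow> cmod (g x) \<le> B" "B > 0" by (auto simp: bounded_pos)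
  have "K \<in> sets borel" using K by (simp add: borel_compact)
  then have "(\<lambda>x. indicator K x *\<^sub>R g x) \<in> borel_measurable borel" using g by (rule borel_measurable_continuous_on_indicator)
  then have m: "(\<lambda>x. indicator K x *\<^sub>R g x) \<in> borel_measurable lebesgue" by (simp add: measurable_completion)
  show ?thesis unfolding set_integrable_def
  proof (rule Bochner_Integration.integrable_bound[of _ "\<lambda>x. B * cmod (indicator K x *\<^sub>R f x)"])
    show "integrable lebesgue (\<lambda>x. B * cmod (indicator K x *\<^sub>R f x))"
      using f unfolding set_integrable_def by (intro integrable_mult_right integrable_norm)
    have "(\<lambda>x. (indicator K x *\<^sub>R g x) * (indicator K x *\<^sub>R f x)) \<in> borel_measurable lebesgue"
      using m borel_measurable_integrable[OF f[unfolded set_integrable_def]] by (rule borel_measurable_times)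
    then show "(\<lambda>x. indicator K x *\<^sub>R (g x * f x)) \<in> borel_measurable lebesgue"
      by (rule measurable_cong[THEN iffD1, rotated]) (simp add: indicator_def)
    show "AE x in lebesgue. norm (indicator K x *\<^sub>R (g x * f x)) \<le> norm (B * cmod (indicator K x *\<^sub>R f x))"
      using B by (intro AE_I2) (auto simp: indicator_def norm_mult abs_mult intro!: mult_right_mono)
  qed
qed

text \<open>Apply the Cauchy-Pompeiu formula at \<open>0\<close> to \<open>\<eta>(z) z\<close>.\<close>

lemma integral_dbar_eq_0:
  fixes \<eta> a b :: "complex \<Rightarrow> complex"
  assumes t: "wirtinger_test S \<eta> a b"
  shows "integrable lborel b" "(LINT z|lborel. b z) = 0"
proof -
  obtain K where K: "compact K" "K \<subseteq> S" "\<And>x. x \<notin> K \<Longrightarrow> \<eta> x = 0" using t by (auto simp: wirtinger_test_def)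
  have ca: "continuous_on UNIV a" and cb: "continuous_on UNIV b" using t by (auto simp: wirtinger_test_def)
  have ce: "continuous_on UNIV \<eta>" using t by (rule wirtinger_test_continuous)
  have t': "wirtinger_test S (\<lambda>z. \<eta> z * z) (\<lambda>z. a z * z + \<eta> z) (\<lambda>z. b z * z)"
    unfolding wirtinger_test_def
  proof (intro conjI allI)
    fix x
    have "(\<eta> has_derivative (\<lambda>h. a x * h + b x * cnj h)) (at x)" using t by (simp add: wirtinger_test_def)
    from has_derivative_mult[OF this has_derivative_ident]
    show "((\<lambda>z. \<eta> z * z) has_derivative (\<lambda>h. (a x * x + \<eta> x) * h + b x * x * cnj h)) (at x)"
      by (rule has_derivative_eq_rhs) (simp add: algebra_simps)
    show "\<exists>K. compact K \<and> K \<subseteq> S \<and> (\<forall>x. x \<notin> K \<longrightarrow> \<eta> x * x = 0)" using K by auto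
  qed (intro continuous_intros ca cb ce)+
  have ae: "AE z in lborel. b z * z / (z - 0) = b z" using AE_lborel_singleton[of 0] by eventually_elim auto
  have [measurable]: "b \<in> borel_measurable borel" using cb by (rule borel_measurable_continuous_onI)
  show "integrable lborel b"
    by (rule integrable_cong_AE[THEN iffD1, OF _ _ ae cauchy_pompeiu(1)[OF t']]) measurable
  have "(LINT z|lborel. b z) = (LINT z|lborel. b z * z / (z - 0))"
    by (rule integral_cong_AE, measurable, use ae in eventually_elim, simp only:)
  then show "(LINT z|lborel. b z) = 0" using cauchy_pompeiu(2)[OF t', of 0] by simp
qed

lemma test_function_wirtinger:
  assumes "test_function S \<eta> g"
  shows "wirtinger_test S (\<lambda>z. of_real (\<eta> z)) (\<lambda>z. cnj (g z) / 2) (\<lambda>z. g z / 2)"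
  unfolding wirtinger_test_def
proof (intro conjI allI)
  have g: "continuous_on UNIV g" using assms by (simp add: test_function_def)
  show "continuous_on UNIV (\<lambda>z. cnj (g z) / 2)" "continuous_on UNIV (\<lambda>z. g z / 2)"
    by (intro continuous_intros g; simp)+
  fix x
  have "(\<eta> has_derivative (\<lambda>h. h \<bullet> g x)) (at x)" using assms by (simp add: test_function_def gderiv_def)
  from has_derivative_of_real[OF this]
  have "((\<lambda>z. complex_of_real (\<eta> z)) has_derivative (\<lambda>h. of_real (h \<bullet> g x))) (at x)" .
  then show "((\<lambda>z. complex_of_real (\<eta> z)) has_derivative (\<lambda>h. cnj (g x) / 2 * h + g x / 2 * cnj h)) (at x)"
    by (rule has_derivative_eq_rhs) (auto simp: fun_eq_iff complex_eq_iff inner_complex_def field_simps)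
  show "\<exists>K. compact K \<and> K \<subseteq> S \<and> (\<forall>x. x \<notin> K \<longrightarrow> complex_of_real (\<eta> x) = 0)"
    using assms by (auto simp: test_function_def)
qed

lemma wirtinger_test_real_parts:
  assumes t: "wirtinger_test S \<eta> a b"
  shows "test_function S (\<lambda>z. Re (\<eta> z)) (\<lambda>z. cnj (a z) + b z)"
    and "test_function S (\<lambda>z. Im (\<eta> z)) (\<lambda>z. \<i> * (cnj (a z) - b z))"
proof -
  have ca: "continuous_on UNIV a" and cb: "continuous_on UNIV b" using t by (auto simp: wirtinger_test_def)
  have d: "(\<eta> has_derivative (\<lambda>h. a x * h + b x * cnj h)) (at x)" for x using t by (simp add: wirtinger_test_def)
  show "test_function S (\<lambda>z. Re (\<eta> z)) (\<lambda>z. cnj (a z) + b z)"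
    unfolding test_function_def gderiv_def
  proof (intro conjI allI)
    fix x
    from has_derivative_Re[OF d[of x]]
    show "((\<lambda>z. Re (\<eta> z)) has_derivative (\<lambda>h. h \<bullet> (cnj (a x) + b x))) (at x)"
      by (rule has_derivative_eq_rhs) (auto simp: fun_eq_iff inner_complex_def algebra_simps)
  next
    show "\<exists>K. compact K \<and> K \<subseteq> S \<and> (\<forall>x. x \<notin> K \<longrightarrow> Re (\<eta> x) = 0)" using t by (auto simp: wirtinger_test_def)
  qed (intro continuous_intros ca cb)
  show "test_function S (\<lambda>z. Im (\<eta> z)) (\<lambda>z. \<i> * (cnj (a z) - b z))"
    unfolding test_function_def gderiv_def
  proof (intro conjI allI)
    fix x
    from has_derivative_Im[OF d[of x]]
    show "((\<lambda>z. Im (\<eta> z)) has_derivative (\<lambda>h. h \<bullet> (\<i> * (cnj (a x) - b x)))) (at x)"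
      by (rule has_derivative_eq_rhs) (auto simp: fun_eq_iff inner_complex_def algebra_simps)
  next
    show "\<exists>K. compact K \<and> K \<subseteq> S \<and> (\<forall>x. x \<notin> K \<longrightarrow> Im (\<eta> x) = 0)" using t by (auto simp: wirtinger_test_def)
  qed (intro continuous_intros ca cb)
qed

lemma locally_integrable_mult_test:
  fixes v b :: "complex \<Rightarrow> complex"
  assumes v: "locally_integrable S v" and K: "compact K" "K \<subseteq> S" and b: "continuous_on UNIV b" "\<And>x. x \<notin> K \<Longrightarrow> b x = 0"
  shows "set_integrable lebesgue S (\<lambda>x. b x * v x)"
proof -
  have "set_integrable lebesgue K (\<lambda>x. b x * v x)"
    using v K b(1) by (intro set_integrable_continuous_mult) (auto simp: locally_integrable_def intro: continuous_on_subset)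
  moreover have "indicator K x *\<^sub>R (b x * v x) = indicator S x *\<^sub>R (b x * v x)" for x
    using b(2)[of x] K(2) by (auto simp: indicator_def)
  ultimately show ?thesis by (simp add: set_integrable_def)
qed

lemma locally_integrable_cnj: "locally_integrable S v \<Longrightarrow> locally_integrable S (\<lambda>x. cnj (v x))"
  unfolding locally_integrable_def set_integrable_def
proof (intro allI impI)
  fix K assume *: "\<forall>K. compact K \<and> K \<subseteq> S \<longrightarrow> integrable lebesgue (\<lambda>x. indicator K x *\<^sub>R v x)" "compact K \<and> K \<subseteq> S"
  then have "integrable lebesgue (\<lambda>x. cnj (indicator K x *\<^sub>R v x))" by (intro integrable_cnj) auto
  then show "integrable lebesgue (\<lambda>x. indicator K x *\<^sub>R cnj (v x))" by simp
qed

text \<open>The distributional form of \<open>dbar (cnj v) = - (i/2) w\<close>.\<close>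

definition weak_dbar_eq :: "complex set \<Rightarrow> (complex \<Rightarrow> complex) \<Rightarrow> (complex \<Rightarrow> real) \<Rightarrow> bool" where
  "weak_dbar_eq S v w \<longleftrightarrow> (\<forall>\<eta> a b. wirtinger_test S \<eta> a b \<longrightarrow>
     (LINT z:S|lebesgue. b z * cnj (v z)) = \<i> / 2 * (LINT z:S|lebesgue. of_real (w z) * \<eta> z))"

lemma test_function_integrable:
  assumes v: "locally_integrable S v" and t: "test_function S \<eta> g"
  shows "set_integrable lebesgue S (\<lambda>x. g x * cnj (v x))"
proof -
  obtain K where K: "compact K" "K \<subseteq> S" "\<And>x. x \<notin> K \<Longrightarrow> \<eta> x = 0" using t by (auto simp: test_function_def)
  have "g x = 0" if "x \<notin> K" for x
    using wirtinger_test_vanish(2)[OF test_function_wirtinger[OF t] K(1) _ that] K(3) by simp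
  then show ?thesis
    using locally_integrable_mult_test[OF locally_integrable_cnj[OF v] K(1,2)] t by (simp add: test_function_def)
qed

text \<open>For a real test function with gradient \<open>g\<close>, the two pairings that define the weak divergence and the weak curl are
parts of one complex integral.\<close>

lemma div_curl_integral:
  assumes v: "locally_integrable S v" and t: "test_function S \<eta> g"
  shows "(LINT x:S|lebesgue. Re (v x) * Re (g x) + Im (v x) * Im (g x)) = Re (LINT x:S|lebesgue. g x * cnj (v x))"
    and "(LINT x:S|lebesgue. Im (v x) * Re (g x) - Re (v x) * Im (g x)) = - Im (LINT x:S|lebesgue. g x * cnj (v x))"
proof -
  have i: "integrable lebesgue (\<lambda>x. indicator S x *\<^sub>R (g x * cnj (v x)))"
    using test_function_integrable[OF v t] by (simp add: set_integrable_def)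
  show "(LINT x:S|lebesgue. Re (v x) * Re (g x) + Im (v x) * Im (g x)) = Re (LINT x:S|lebesgue. g x * cnj (v x))"
    unfolding set_lebesgue_integral_def integral_Re[OF i, symmetric] by (simp add: algebra_simps)
  have eq: "indicator S x *\<^sub>R (Im (v x) * Re (g x) - Re (v x) * Im (g x)) = - Im (indicator S x *\<^sub>R (g x * cnj (v x)))" for x
    by (simp add: algebra_simps)
  show "(LINT x:S|lebesgue. Im (v x) * Re (g x) - Re (v x) * Im (g x)) = - Im (LINT x:S|lebesgue. g x * cnj (v x))"
    unfolding set_lebesgue_integral_def integral_Im[OF i, symmetric] eq by (rule Bochner_Integration.integral_minus)
qed

lemma weak_dbar_imp_div_curl:
  assumes v: "locally_integrable S v" and e: "weak_dbar_eq S v w"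
  shows "has_weak_div S v (\<lambda>_. 0)" "has_weak_curl S v w"
proof -
  have key: "(LINT x:S|lebesgue. g x * cnj (v x)) = \<i> * of_real (LINT x:S|lebesgue. w x * \<eta> x)" if t: "test_function S \<eta> g" for \<eta> g
  proof -
    have "(LINT z:S|lebesgue. g z / 2 * cnj (v z)) = \<i> / 2 * (LINT z:S|lebesgue. of_real (w z) * of_real (\<eta> z))"
      using e test_function_wirtinger[OF t] unfolding weak_dbar_eq_def by blast
    moreover have "(LINT z:S|lebesgue. g z / 2 * cnj (v z)) = 1/2 * (LINT z:S|lebesgue. g z * cnj (v z))"
      by (simp flip: set_integral_mult_right)
    moreover have "(LINT z:S|lebesgue. complex_of_real (w z) * of_real (\<eta> z)) = of_real (LINT x:S|lebesgue. w x * \<eta> x)"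
      unfolding set_lebesgue_integral_def by (simp add: scaleR_conv_of_real flip: of_real_mult integral_complex_of_real)
    ultimately show ?thesis by simp
  qed
  show "has_weak_div S v (\<lambda>_. 0)"
    unfolding has_weak_div_def using div_curl_integral(1)[OF v] key by (simp add: set_lebesgue_integral_def[of _ _ "\<lambda>_. 0"])
  show "has_weak_curl S v w"
    unfolding has_weak_curl_def using div_curl_integral(2)[OF v] key by simp
qed

lemma div_curl_imp_weak_dbar:
  assumes v: "locally_integrable S v" and w: "locally_integrable S (\<lambda>x. of_real (w x))"
    and d: "has_weak_div S v (\<lambda>_. 0)" and c: "has_weak_curl S v w"
  shows "weak_dbar_eq S v w"
  unfolding weak_dbar_eq_def
proof (intro allI impI)
  fix \<eta> a b assume t: "wirtinger_test S \<eta> a b"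
  have key: "(LINT x:S|lebesgue. g x * cnj (v x)) = \<i> * of_real (LINT x:S|lebesgue. w x * \<theta> x)" if t: "test_function S \<theta> g" for \<theta> g
    using div_curl_integral[OF v t] d[unfolded has_weak_div_def, rule_format, OF t] c[unfolded has_weak_curl_def, rule_format, OF t]
    by (simp add: complex_eq_iff set_lebesgue_integral_def[of _ _ "\<lambda>_. 0"])
  note t1 = wirtinger_test_real_parts(1)[OF t] and t2 = wirtinger_test_real_parts(2)[OF t]
  obtain K where K: "compact K" "K \<subseteq> S" "\<And>x. x \<notin> K \<Longrightarrow> \<eta> x = 0" using t by (auto simp: wirtinger_test_def)
  have "set_integrable lebesgue S (\<lambda>x. \<eta> x * of_real (w x))"
    by (rule locally_integrable_mult_test[OF w K(1,2) wirtinger_test_continuous[OF t] K(3)])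
  then have wi: "integrable lebesgue (\<lambda>x. indicator S x *\<^sub>R (of_real (w x) * \<eta> x))" by (simp add: set_integrable_def mult.commute)
  have "(LINT z:S|lebesgue. b z * cnj (v z)) = (LINT z:S|lebesgue. 1/2 * ((cnj (a z) + b z) * cnj (v z)) + \<i>/2 * (\<i> * (cnj (a z) - b z) * cnj (v z)))"
    by (rule arg_cong[where f = "set_lebesgue_integral lebesgue S"]) (auto simp: fun_eq_iff field_simps)
  also have "\<dots> = 1/2 * (LINT z:S|lebesgue. (cnj (a z) + b z) * cnj (v z)) + \<i>/2 * (LINT z:S|lebesgue. \<i> * (cnj (a z) - b z) * cnj (v z))"
    using test_function_integrable[OF v t1] test_function_integrable[OF v t2]
    by (subst set_integral_add) (simp_all only: set_integral_mult_right set_integrable_mult_right simp_thms)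
  also have "\<dots> = 1/2 * (\<i> * of_real (LINT x:S|lebesgue. w x * Re (\<eta> x))) + \<i>/2 * (\<i> * of_real (LINT x:S|lebesgue. w x * Im (\<eta> x)))"
    unfolding key[OF t1] key[OF t2] ..
  also have "(LINT x:S|lebesgue. w x * Re (\<eta> x)) = Re (LINT z:S|lebesgue. of_real (w z) * \<eta> z)"
    unfolding set_lebesgue_integral_def integral_Re[OF wi, symmetric] by simp
  also have "(LINT x:S|lebesgue. w x * Im (\<eta> x)) = Im (LINT z:S|lebesgue. of_real (w z) * \<eta> z)"
    unfolding set_lebesgue_integral_def integral_Im[OF wi, symmetric] by simp
  finally show "(LINT z:S|lebesgue. b z * cnj (v z)) = \<i> / 2 * (LINT z:S|lebesgue. of_real (w z) * \<eta> z)"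
    by (simp add: complex_eq_iff)
qed

section \<open>Construction of the solution\<close>

context exterior_conformal_map
begin

lemma locally_integrable_pushforward:
  assumes U: "locally_integrable E (\<lambda>\<zeta>. h (\<Psi> \<zeta>))"
  shows "locally_integrable \<Omega> h"
  unfolding locally_integrable_def
proof (intro allI impI)
  fix K assume K: "compact K \<and> K \<subseteq> \<Omega>"
  have K': "compact (\<Phi> ` K)" "\<Phi> ` K \<subseteq> E"
    using compact_continuous_image[OF continuous_on_subset[OF \<Phi>_continuous]] K by (auto simp: subset_iff)
  have im: "\<Psi> ` \<Phi> ` K = K" using K by (force simp: image_image)
  have "set_integrable lebesgue (\<Phi> ` K) (\<lambda>\<zeta>. of_real ((cmod (deriv \<Psi> \<zeta>))\<^sup>2) * h (\<Psi> \<zeta>))"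
    using U K' by (intro set_integrable_continuous_mult continuous_intros continuous_on_subset[OF deriv_\<Psi>_continuous]) (auto simp: locally_integrable_def)
  moreover have "\<Phi> ` K \<in> sets lebesgue" using K'(1) by (simp add: borel_compact)
  ultimately show "set_integrable lebesgue K h"
    using change_of_variables(1)[OF _ K'(2)] im by simp
qed

lemma locally_integrable_pullback:
  assumes U: "locally_integrable \<Omega> h"
  shows "locally_integrable E (\<lambda>\<zeta>. h (\<Psi> \<zeta>))"
  unfolding locally_integrable_def
proof (intro allI impI)
  fix K assume K: "compact K \<and> K \<subseteq> E"
  have K': "compact (\<Psi> ` K)" "\<Psi> ` K \<subseteq> \<Omega>"
    using compact_continuous_image[OF continuous_on_subset[OF \<Psi>_continuous]] K by (auto simp: subset_iff)
  have "K \<in> sets lebesgue" using K by (simp add: borel_compact)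
  then have "set_integrable lebesgue K (\<lambda>\<zeta>. of_real ((cmod (deriv \<Psi> \<zeta>))\<^sup>2) * h (\<Psi> \<zeta>))"
    using change_of_variables(1)[of K h] K U K' by (auto simp: locally_integrable_def)
  then have "set_integrable lebesgue K (\<lambda>\<zeta>. inverse (of_real ((cmod (deriv \<Psi> \<zeta>))\<^sup>2)) * (of_real ((cmod (deriv \<Psi> \<zeta>))\<^sup>2) * h (\<Psi> \<zeta>)))"
  proof (rule set_integrable_continuous_mult)
    show "continuous_on K (\<lambda>\<zeta>. inverse (complex_of_real ((cmod (deriv \<Psi> \<zeta>))\<^sup>2)))"
      using K deriv_\<Psi>_nonzero by (intro continuous_intros continuous_on_subset[OF deriv_\<Psi>_continuous]) auto
  qed (use K in simp)
  moreover have "indicator K \<zeta> *\<^sub>R (inverse (of_real ((cmod (deriv \<Psi> \<zeta>))\<^sup>2)) * (of_real ((cmod (deriv \<Psi> \<zeta>))\<^sup>2) * h (\<Psi> \<zeta>))) = indicator K \<zeta> *\<^sub>R h (\<Psi> \<zeta>)" for \<zeta>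
    using K deriv_\<Psi>_nonzero[of \<zeta>] by (auto simp: indicator_def)
  ultimately show "set_integrable lebesgue K (\<lambda>\<zeta>. h (\<Psi> \<zeta>))" by (simp only: set_integrable_def)
qed

text \<open>On \<open>A\<close> the Jacobian of \<open>\<Psi>\<close> is at most \<open>4\<close>. The change of variables applies to integrable complex
functions; therefore \<open>h\<close>, which is finite almost everywhere on \<open>A\<close>, is first replaced by a complex function.\<close>

lemma nn_integral_comp_\<Phi>_le:
  fixes h :: "complex \<Rightarrow> ennreal"
  assumes h: "h \<in> borel_measurable borel" and A: "open A" "A \<subseteq> E"
    and small: "\<And>\<zeta>. \<zeta> \<in> A \<Longrightarrow> cmod (deriv \<Psi> \<zeta>) \<le> 2" and fin: "(\<integral>\<^sup>+\<zeta>\<in>A. h \<zeta> \<partial>lborel) < \<infinity>"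
  shows "(\<integral>\<^sup>+z\<in>\<Psi> ` A. h (\<Phi> z) \<partial>lborel) \<le> 4 * (\<integral>\<^sup>+\<zeta>\<in>A. h \<zeta> \<partial>lborel)"
proof -
  note h [measurable]
  have Am [measurable]: "A \<in> sets borel" using A by simp
  define g where "g \<zeta> = complex_of_real (enn2real (h \<zeta>))" for \<zeta>
  have gm [measurable]: "g \<in> borel_measurable borel" unfolding g_def[abs_def] by measurable
  have aeA: "AE \<zeta> in lborel. h \<zeta> * indicator A \<zeta> \<noteq> \<infinity>"
    by (rule nn_integral_PInf_AE) (use fin in \<open>auto intro!: borel_measurable_times_ennreal borel_measurable_indicator\<close>)
  then have ae: "AE \<zeta> in lborel. \<zeta> \<in> A \<longrightarrow> h \<zeta> = ennreal (cmod (g \<zeta>))"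
    by eventually_elim (auto simp: g_def less_top)
  define J where "J \<zeta> = indicator A \<zeta> *\<^sub>R complex_of_real ((cmod (deriv \<Psi> \<zeta>))\<^sup>2)" for \<zeta>
  have Jm [measurable]: "J \<in> borel_measurable borel" unfolding J_def[abs_def]
    by (rule borel_measurable_continuous_on_indicator[OF Am]) (intro continuous_intros continuous_on_subset[OF deriv_\<Psi>_continuous A(2)])
  have Jle: "cmod (J \<zeta>) \<le> 4" for \<zeta>
  proof (cases "\<zeta> \<in> A")
    case True
    have "(cmod (deriv \<Psi> \<zeta>))\<^sup>2 \<le> 2\<^sup>2" using small[OF True] by (intro power_mono) auto
    then show ?thesis using True by (simp add: J_def norm_power)
  qed (simp add: J_def)
  have bd: "(\<integral>\<^sup>+\<zeta>. ennreal (cmod (J \<zeta> * g \<zeta>)) \<partial>lborel) \<le> 4 * (\<integral>\<^sup>+\<zeta>\<in>A. h \<zeta> \<partial>lborel)"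
  proof -
    have "(\<integral>\<^sup>+\<zeta>. ennreal (cmod (J \<zeta> * g \<zeta>)) \<partial>lborel) \<le> (\<integral>\<^sup>+\<zeta>. 4 * (h \<zeta> * indicator A \<zeta>) \<partial>lborel)"
    proof (rule nn_integral_mono_AE, use ae in eventually_elim)
      case (elim \<zeta>)
      show ?case
      proof (cases "\<zeta> \<in> A")
        case True
        have "ennreal (cmod (J \<zeta> * g \<zeta>)) \<le> ennreal (4 * cmod (g \<zeta>))"
          unfolding norm_mult by (intro ennreal_leI mult_right_mono Jle) simp
        also have "\<dots> = 4 * ennreal (cmod (g \<zeta>))" by (simp add: ennreal_mult)
        finally show ?thesis using elim True by simp
      qed (simp add: J_def)
    qed
    also have "\<dots> = 4 * (\<integral>\<^sup>+\<zeta>\<in>A. h \<zeta> \<partial>lborel)" by (rule nn_integral_cmult) measurable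
    finally show ?thesis .
  qed
  have gi: "integrable lborel (\<lambda>\<zeta>. J \<zeta> * g \<zeta>)"
  proof (rule integrableI_bounded)
    have "4 * (\<integral>\<^sup>+\<zeta>\<in>A. h \<zeta> \<partial>lborel) < \<infinity>" using fin by (simp add: ennreal_mult_less_top)
    with bd show "(\<integral>\<^sup>+\<zeta>. ennreal (norm (J \<zeta> * g \<zeta>)) \<partial>lborel) < \<infinity>" by (rule order_le_less_trans)
  qed measurable
  have eqJ: "indicator A \<zeta> *\<^sub>R (of_real ((cmod (deriv \<Psi> \<zeta>))\<^sup>2) * g (\<Phi> (\<Psi> \<zeta>))) = J \<zeta> * g \<zeta>" for \<zeta>
    using A(2) by (auto simp: J_def indicator_def)
  have "integrable lebesgue (\<lambda>\<zeta>. J \<zeta> * g \<zeta>)" using gi by (subst integrable_completion) (auto intro!: borel_measurable_times)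
  then have "set_integrable lebesgue A (\<lambda>\<zeta>. of_real ((cmod (deriv \<Psi> \<zeta>))\<^sup>2) * g (\<Phi> (\<Psi> \<zeta>)))"
    unfolding set_integrable_def eqJ .
  then have si: "set_integrable lebesgue (\<Psi> ` A) (\<lambda>z. g (\<Phi> z))"
    using change_of_variables(1)[of A "\<lambda>z. g (\<Phi> z)"] A by simp
  have e2: "(LINT z:\<Psi> ` A|lebesgue. g (\<Phi> z)) = (LINT \<zeta>|lborel. J \<zeta> * g \<zeta>)"
  proof -
    have "(LINT z:\<Psi> ` A|lebesgue. g (\<Phi> z)) = (LINT \<zeta>|lebesgue. J \<zeta> * g \<zeta>)"
      using change_of_variables(2)[of A "\<lambda>z. g (\<Phi> z)"] A unfolding set_lebesgue_integral_def eqJ by simp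
    also have "\<dots> = (LINT \<zeta>|lborel. J \<zeta> * g \<zeta>)" by (rule integral_completion) (auto intro!: borel_measurable_times)
    finally show ?thesis .
  qed
  have ae2: "AE z in lborel. z \<in> \<Psi> ` A \<longrightarrow> h (\<Phi> z) = ennreal (cmod (g (\<Phi> z)))"
  proof -
    have "AE \<zeta> in lebesgue. \<zeta> \<in> E \<longrightarrow> (\<Psi> \<zeta> \<in> \<Psi> ` A \<longrightarrow> h (\<Phi> (\<Psi> \<zeta>)) = ennreal (cmod (g (\<Phi> (\<Psi> \<zeta>)))))"
      using AE_completion[OF ae]
    proof eventually_elim
      case (elim \<zeta>)
      then show ?case using inj_on_image_mem_iff[OF \<Psi>_inj _ A(2)] by auto
    qed
    then have "AE z in lebesgue. z \<in> \<Omega> \<longrightarrow> (z \<in> \<Psi> ` A \<longrightarrow> h (\<Phi> z) = ennreal (cmod (g (\<Phi> z))))"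
      unfolding AE_transfer[of "\<lambda>z. z \<in> \<Psi> ` A \<longrightarrow> h (\<Phi> z) = ennreal (cmod (g (\<Phi> z)))"] .
    then have "AE z in lebesgue. z \<in> \<Psi> ` A \<longrightarrow> h (\<Phi> z) = ennreal (cmod (g (\<Phi> z)))"
      by eventually_elim (use A(2) in auto)
    then show ?thesis by (simp add: AE_completion_iff)
  qed
  have "(\<integral>\<^sup>+z\<in>\<Psi> ` A. h (\<Phi> z) \<partial>lborel) = (\<integral>\<^sup>+z. ennreal (cmod (indicator (\<Psi> ` A) z *\<^sub>R g (\<Phi> z))) \<partial>lborel)"
    by (rule nn_integral_cong_AE, use ae2 in eventually_elim) (auto simp: indicator_def)
  also have "\<dots> = (\<integral>\<^sup>+z. ennreal (cmod (indicator (\<Psi> ` A) z *\<^sub>R g (\<Phi> z))) \<partial>lebesgue)"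
    by (rule nn_integral_completion[symmetric])
  also have "\<dots> = ennreal (LINT z|lebesgue. cmod (indicator (\<Psi> ` A) z *\<^sub>R g (\<Phi> z)))"
    using si unfolding set_integrable_def by (intro nn_integral_eq_integral integrable_norm) auto
  also have "(LINT z|lebesgue. cmod (indicator (\<Psi> ` A) z *\<^sub>R g (\<Phi> z))) = Re (LINT z:\<Psi> ` A|lebesgue. g (\<Phi> z))"
  proof -
    have "cmod (indicator (\<Psi> ` A) z *\<^sub>R g (\<Phi> z)) = Re (indicator (\<Psi> ` A) z *\<^sub>R g (\<Phi> z))" for z
      by (simp add: g_def indicator_def)
    then show ?thesis using si unfolding set_integrable_def set_lebesgue_integral_def by (simp only: integral_Re)
  qed
  also have "\<dots> \<le> cmod (LINT \<zeta>|lborel. J \<zeta> * g \<zeta>)" unfolding e2 by (rule complex_Re_le_cmod)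
  also have "ennreal \<dots> \<le> (\<integral>\<^sup>+\<zeta>. ennreal (cmod (J \<zeta> * g \<zeta>)) \<partial>lborel)" by (rule integral_norm_bound_ennreal[OF gi])
  also note bd
  finally show ?thesis by (simp add: ennreal_leI)
qed

end

locale vorticity = exterior_conformal_map +
  fixes w :: "complex \<Rightarrow> real" and v_inf :: complex
  assumes M: "(\<lambda>z. complex_of_real (w (\<Psi> z))) \<in> M_space r0 \<Psi> v_inf"
begin

definition w_star :: "complex \<Rightarrow> complex" where
  "w_star \<zeta> = cnj (deriv \<Psi> \<zeta>) * of_real (w (\<Psi> \<zeta>))"

lemma w_star_integrable: "set_integrable lebesgue E w_star"
proof -
  have "set_integrable lebesgue E (\<lambda>z. cnj (deriv \<Psi> z) * (complex_of_real (w (\<Psi> z)) / z ^ 0))"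
    using M unfolding M_space_def by blast
  then show ?thesis by (simp add: w_star_def[abs_def])
qed

text \<open>A Borel function, vanishing outside \<open>E\<close>, that represents the class of \<open>- i/(2 \<pi>) w_star\<close>: the vorticity
is only Lebesgue measurable, while the Cauchy transform uses the Borel Lebesgue measure.\<close>

definition source :: "complex \<Rightarrow> complex" where
  "source = (SOME f. f \<in> borel_measurable borel \<and> (\<forall>\<zeta>. \<zeta> \<notin> E \<longrightarrow> f \<zeta> = 0) \<and>
     (AE \<zeta> in lborel. \<zeta> \<in> E \<longrightarrow> f \<zeta> = - \<i> / (2 * pi) * w_star \<zeta>))"

lemma source: "source \<in> borel_measurable borel" "\<And>\<zeta>. \<zeta> \<notin> E \<Longrightarrow> source \<zeta> = 0"
  "AE \<zeta> in lborel. \<zeta> \<in> E \<longrightarrow> source \<zeta> = - \<i> / (2 * pi) * w_star \<zeta>"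
proof -
  have "(\<lambda>\<zeta>. indicator E \<zeta> *\<^sub>R w_star \<zeta>) \<in> borel_measurable lebesgue"
    using w_star_integrable unfolding set_integrable_def by (rule borel_measurable_integrable)
  then obtain g where g: "g \<in> borel_measurable borel" "AE x in lborel. indicator E x *\<^sub>R w_star x = g x"
    using ex_borel_version by blast
  have "\<exists>f. f \<in> borel_measurable borel \<and> (\<forall>\<zeta>. \<zeta> \<notin> E \<longrightarrow> f \<zeta> = 0) \<and>
     (AE \<zeta> in lborel. \<zeta> \<in> E \<longrightarrow> f \<zeta> = - \<i> / (2 * pi) * w_star \<zeta>)"
  proof (intro exI[of _ "\<lambda>\<zeta>. indicator E \<zeta> *\<^sub>R (- \<i> / (2 * pi) * g \<zeta>)"] conjI)
    show "(\<lambda>\<zeta>. indicator E \<zeta> *\<^sub>R (- \<i> / (2 * pi) * g \<zeta>)) \<in> borel_measurable borel"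
      using g(1) by measurable
    show "AE \<zeta> in lborel. \<zeta> \<in> E \<longrightarrow> indicator E \<zeta> *\<^sub>R (- \<i> / (2 * pi) * g \<zeta>) = - \<i> / (2 * pi) * w_star \<zeta>"
      using g(2) by eventually_elim auto
  qed auto
  from someI_ex[OF this, folded source_def]
  show "source \<in> borel_measurable borel" "\<And>\<zeta>. \<zeta> \<notin> E \<Longrightarrow> source \<zeta> = 0"
    "AE \<zeta> in lborel. \<zeta> \<in> E \<longrightarrow> source \<zeta> = - \<i> / (2 * pi) * w_star \<zeta>" by blast+
qed

lemma source_AE: "AE \<zeta> in lborel. - \<i> / (2 * pi) * (indicator E \<zeta> *\<^sub>R w_star \<zeta>) = source \<zeta>"
  using source(3) by eventually_elim (auto simp: indicator_def source(2))

lemma source_integrable: "integrable lborel source"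
proof -
  have "integrable lebesgue (\<lambda>\<zeta>. - \<i> / (2 * pi) * (indicator E \<zeta> *\<^sub>R w_star \<zeta>))"
    using w_star_integrable unfolding set_integrable_def by (rule integrable_mult_right)
  then show ?thesis using integrable_lebesgue_iff_borel_version(1)[OF source(1) source_AE] by simp
qed

lemma source_supp: "cmod \<xi> \<le> r0 \<Longrightarrow> source \<xi> = 0" by (rule source(2)) (simp add: disc_exterior_def)

text \<open>The affine space \<open>M\<close> prescribes exactly these moments; \<open>k = 1\<close> is the only order at which the coefficient
\<open>v_inf_r\<close> gives a contribution.\<close>

lemma source_moment: "(LINT \<xi>|lborel. source \<xi> / \<xi> ^ k) = (if k = 1 then cnj v_inf else 0)"
proof -
  have m: "(\<lambda>\<xi>. source \<xi> / \<xi> ^ k) \<in> borel_measurable borel" using source(1) by measurable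
  have ae: "AE \<xi> in lborel. - \<i> / (2 * pi) * (indicator E \<xi> *\<^sub>R (cnj (deriv \<Psi> \<xi>) * (of_real (w (\<Psi> \<xi>)) / \<xi> ^ k))) = source \<xi> / \<xi> ^ k"
    using source_AE
  proof eventually_elim
    case (elim \<xi>)
    show ?case unfolding elim[symmetric] by (simp add: w_star_def scaleR_conv_of_real)
  qed
  have "(LINT \<xi>|lborel. source \<xi> / \<xi> ^ k) = (LINT \<xi>|lebesgue. - \<i> / (2 * pi) * (indicator E \<xi> *\<^sub>R (cnj (deriv \<Psi> \<xi>) * (of_real (w (\<Psi> \<xi>)) / \<xi> ^ k))))"
    using integrable_lebesgue_iff_borel_version(2)[OF m ae] by simp
  also have "\<dots> = - \<i> / (2 * pi) * (LINT z:E|lebesgue. cnj (deriv \<Psi> z) * (complex_of_real (w (\<Psi> z)) / z ^ k))"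
    unfolding set_lebesgue_integral_def by (rule integral_mult_right_zero)
  also have "(LINT z:E|lebesgue. cnj (deriv \<Psi> z) * (complex_of_real (w (\<Psi> z)) / z ^ k)) = 4 * of_real pi * \<i> * of_nat k * v_inf_r v_inf (int k)"
    using M unfolding M_space_def by blast
  finally show ?thesis by (auto simp: v_inf_r_def complex_eq_iff)
qed

lemma
  assumes "cmod \<zeta> < r0"
  shows cauchy_source_inside: "cauchy_transform source \<zeta> = - cnj v_inf"
    and cauchy_source_inside_integrable: "integrable lborel (\<lambda>\<xi>. source \<xi> / (\<zeta> - \<xi>))"
  using cauchy_transform_inside_disc[OF source_integrable r0 source_supp _ assms] source_moment source_moment[of 1] by auto

definition solution :: "complex \<Rightarrow> complex" where
  "solution x = cnj (cauchy_transform source (\<Phi> x)) + v_inf"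

lemma solution_\<Psi>: "\<zeta> \<in> E \<Longrightarrow> solution (\<Psi> \<zeta>) = cnj (cauchy_transform source \<zeta>) + v_inf"
  by (simp add: solution_def)

lemma solution_locally_integrable: "locally_integrable \<Omega> solution"
proof (rule locally_integrable_pushforward)
  show "locally_integrable E (\<lambda>\<zeta>. solution (\<Psi> \<zeta>))"
    unfolding locally_integrable_def
  proof (intro allI impI)
    fix K assume K: "compact K \<and> K \<subseteq> E"
    have Kb: "K \<in> sets borel" "bounded K" using K by (auto simp: borel_compact compact_imp_bounded)
    have c: "set_integrable lborel K (\<lambda>_. cnj v_inf)"
      unfolding set_integrable_def
      by (rule integrable_scaleR_left) (use Kb emeasure_bounded_finite[OF Kb(2)] in \<open>simp add: integrable_indicator_iff\<close>)
    have "set_integrable lborel K (\<lambda>\<zeta>. cauchy_transform source \<zeta> + cnj v_inf)"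
      using cauchy_transform_set_integrable[OF source_integrable Kb] c by (rule set_integral_add(1))
    then have "integrable lborel (\<lambda>\<zeta>. cnj (indicator K \<zeta> *\<^sub>R (cauchy_transform source \<zeta> + cnj v_inf)))"
      unfolding set_integrable_def by (rule integrable_cnj)
    moreover have "cnj (indicator K \<zeta> *\<^sub>R (cauchy_transform source \<zeta> + cnj v_inf)) = indicator K \<zeta> *\<^sub>R solution (\<Psi> \<zeta>)" for \<zeta>
      using K solution_\<Psi>[of \<zeta>] by (auto simp: indicator_def)
    ultimately have "integrable lborel (\<lambda>\<zeta>. indicator K \<zeta> *\<^sub>R solution (\<Psi> \<zeta>))" by (simp only:)
    then show "set_integrable lebesgue K (\<lambda>\<zeta>. solution (\<Psi> \<zeta>))"
      unfolding set_integrable_def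
      by (subst integrable_completion) (auto dest: borel_measurable_integrable)
  qed
qed

lemma vorticity_locally_integrable: "locally_integrable \<Omega> (\<lambda>x. of_real (w x))"
proof (rule locally_integrable_pushforward)
  have i: "set_integrable lebesgue E (\<lambda>\<zeta>. complex_of_real (w (\<Psi> \<zeta>)))" using M unfolding M_space_def by blast
  show "locally_integrable E (\<lambda>\<zeta>. complex_of_real (w (\<Psi> \<zeta>)))"
    unfolding locally_integrable_def
    by (auto intro!: set_integrable_subset[OF i] simp: borel_compact)
qed

text \<open>Test functions on \<open>\<Omega>\<close> are pulled back to \<open>E\<close>, where the equation for the Cauchy transform applies; the
Jacobian \<open>|deriv \<Psi>|\<^sup>2 = deriv \<Psi> * cnj (deriv \<Psi>)\<close> is shared between \<open>\<eta>'\<close> and \<open>w_star\<close>.\<close>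

lemma solution_weak_dbar: "weak_dbar_eq \<Omega> solution w"
  unfolding weak_dbar_eq_def
proof (intro allI impI)
  fix \<eta> a b assume t: "wirtinger_test \<Omega> \<eta> a b"
  define \<eta>' where "\<eta>' = (\<lambda>z. if z \<in> E then \<eta> (\<Psi> z) * deriv \<Psi> z else 0)"
  define b' where "b' = (\<lambda>z. if z \<in> E then b (\<Psi> z) * of_real ((cmod (deriv \<Psi> z))\<^sup>2) else 0)"
  obtain a' where t': "wirtinger_test E \<eta>' a' b'"
    using test_pullback_\<Psi>[OF t] unfolding \<eta>'_def b'_def by blast
  have [measurable]: "\<eta>' \<in> borel_measurable borel" "b' \<in> borel_measurable borel"
    using wirtinger_test_continuous[OF t', of UNIV] t' by (auto simp: wirtinger_test_def intro: borel_measurable_continuous_onI)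
  note source(1) [measurable]
  have El: "E \<in> sets lebesgue" using open_E by simp
  have "(LINT z:\<Omega>|lebesgue. b z * cnj (solution z)) = (LINT \<zeta>:E|lebesgue. of_real ((cmod (deriv \<Psi> \<zeta>))\<^sup>2) * (b (\<Psi> \<zeta>) * cnj (solution (\<Psi> \<zeta>))))"
    using change_of_variables(2)[OF El order_refl, of "\<lambda>z. b z * cnj (solution z)"] by (simp add: \<Psi>_image)
  also have "\<dots> = (LINT \<zeta>|lebesgue. b' \<zeta> * cauchy_transform source \<zeta> + b' \<zeta> * cnj v_inf)"
    unfolding set_lebesgue_integral_def
    by (rule Bochner_Integration.integral_cong) (auto simp: b'_def solution_\<Psi> indicator_def algebra_simps)
  also have "\<dots> = (LINT \<zeta>|lborel. b' \<zeta> * cauchy_transform source \<zeta> + b' \<zeta> * cnj v_inf)"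
    by (rule integral_completion) measurable
  also have "\<dots> = (LINT \<zeta>|lborel. b' \<zeta> * cauchy_transform source \<zeta>) + (LINT \<zeta>|lborel. b' \<zeta> * cnj v_inf)"
    using cauchy_transform_weak_dbar(1)[OF source_integrable t'] integral_dbar_eq_0(1)[OF t']
    by (intro Bochner_Integration.integral_add integrable_mult_left) auto
  also have "\<dots> = - pi * (LINT \<zeta>|lborel. source \<zeta> * \<eta>' \<zeta>)"
    using cauchy_transform_weak_dbar(2)[OF source_integrable t'] integral_dbar_eq_0(2)[OF t'] by simp
  also have "(LINT \<zeta>|lborel. source \<zeta> * \<eta>' \<zeta>) = (LINT \<zeta>|lebesgue. - \<i> / (2 * pi) * (indicator E \<zeta> *\<^sub>R w_star \<zeta>) * \<eta>' \<zeta>)"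
    by (rule integrable_lebesgue_iff_borel_version(2)[symmetric], measurable, use source_AE in eventually_elim) simp
  also have "\<dots> = (LINT \<zeta>|lebesgue. - \<i> / (2 * pi) * (indicator E \<zeta> *\<^sub>R (of_real ((cmod (deriv \<Psi> \<zeta>))\<^sup>2) * (of_real (w (\<Psi> \<zeta>)) * \<eta> (\<Psi> \<zeta>)))))"
    unfolding complex_norm_square
    by (rule Bochner_Integration.integral_cong) (auto simp: \<eta>'_def w_star_def indicator_def)
  also have "\<dots> = - \<i> / (2 * pi) * (LINT \<zeta>:E|lebesgue. of_real ((cmod (deriv \<Psi> \<zeta>))\<^sup>2) * (of_real (w (\<Psi> \<zeta>)) * \<eta> (\<Psi> \<zeta>)))"
    unfolding set_lebesgue_integral_def by (rule integral_mult_right_zero)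
  also have "(LINT \<zeta>:E|lebesgue. of_real ((cmod (deriv \<Psi> \<zeta>))\<^sup>2) * (of_real (w (\<Psi> \<zeta>)) * \<eta> (\<Psi> \<zeta>))) = (LINT z:\<Omega>|lebesgue. of_real (w z) * \<eta> z)"
    using change_of_variables(2)[OF El order_refl, of "\<lambda>z. of_real (w z) * \<eta> z"] by (simp add: \<Psi>_image)
  finally show "(LINT z:\<Omega>|lebesgue. b z * cnj (solution z)) = \<i> / 2 * (LINT z:\<Omega>|lebesgue. of_real (w z) * \<eta> z)"
    by simp
qed

lemma solution_trace: "zero_boundary_trace r0 \<Psi> solution"
proof -
  have "(\<integral>\<^sup>+z\<in>{z. r0 < cmod z \<and> cmod z < r0 + \<delta>}. ennreal (cmod (solution (\<Psi> z))) \<partial>lebesgue)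
      = (\<integral>\<^sup>+\<zeta>\<in>annulus r0 (r0 + \<delta>). ennreal (cmod (cauchy_transform source \<zeta> - (- cnj v_inf))) \<partial>lborel)" for \<delta>
  proof -
    have "cmod (solution (\<Psi> z)) = cmod (cauchy_transform source z - (- cnj v_inf))" if "z \<in> E" for z
      unfolding solution_\<Psi>[OF that] by (metis complex_cnj_add complex_cnj_cnj complex_mod_cnj diff_minus_eq_add)
    then show ?thesis
      unfolding nn_integral_completion annulus_def by (intro nn_integral_cong) (auto simp: indicator_def disc_exterior_def)
  qed
  then show ?thesis unfolding zero_boundary_trace_def
    using cauchy_transform_boundary_trace[OF source_integrable r0 source_supp cauchy_source_inside_integrable cauchy_source_inside] by simp
qed

end

section \<open>Behaviour of the solution at infinity\<close>

context exterior_conformal_map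
begin

lemma \<Phi>_kernel_at_infinity:
  assumes R1: "0 < R\<^sub>1" and near: "\<And>z. R\<^sub>1 < cmod z \<Longrightarrow> cmod (\<Phi> z - z) \<le> 1"
  shows "((\<lambda>z. z * (1 / (\<Phi> z - \<xi>))) \<longlongrightarrow> 1) at_infinity"
proof -
  have inf: "filterlim (\<lambda>z::complex. norm z) at_top at_infinity" by (rule filterlim_norm_at_top)
  have ev: "\<forall>\<^sub>F z in at_infinity. R\<^sub>1 < cmod (z::complex)"
    using filterlim_iff[THEN iffD1, OF inf, rule_format, OF eventually_gt_at_top[of R\<^sub>1]] .
  have "((\<lambda>z. (\<Phi> z - z - \<xi>) / z) \<longlongrightarrow> 0) at_infinity"
  proof (rule Lim_null_comparison)
    show "\<forall>\<^sub>F z in at_infinity. norm ((\<Phi> z - z - \<xi>) / z) \<le> (1 + cmod \<xi>) / norm z"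
      using ev
    proof eventually_elim
      case (elim z)
      have "cmod (\<Phi> z - z - \<xi>) \<le> 1 + cmod \<xi>" using near[OF elim] norm_triangle_ineq4[of "\<Phi> z - z" \<xi>] by simp
      then show ?case by (simp add: norm_divide divide_right_mono)
    qed
    show "((\<lambda>z::complex. (1 + cmod \<xi>) / norm z) \<longlongrightarrow> 0) at_infinity"
      by (rule tendsto_divide_0[OF tendsto_const filterlim_at_top_imp_at_infinity[OF inf]])
  qed
  then have "((\<lambda>z. inverse (1 + (\<Phi> z - z - \<xi>) / z)) \<longlongrightarrow> inverse (1 + 0)) at_infinity"
    by (intro tendsto_intros) auto
  then have "((\<lambda>z. inverse (1 + (\<Phi> z - z - \<xi>) / z)) \<longlongrightarrow> 1) at_infinity" by simp
  moreover have "\<forall>\<^sub>F z in at_infinity. inverse (1 + (\<Phi> z - z - \<xi>) / z) = z * (1 / (\<Phi> z - \<xi>))"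
    using ev
  proof eventually_elim
    case (elim z)
    then have "z \<noteq> 0" using R1 by auto
    then have "1 + (\<Phi> z - z - \<xi>) / z = (\<Phi> z - \<xi>) / z" by (simp add: field_simps)
    then show ?case by simp
  qed
  ultimately show ?thesis by (rule Lim_transform_eventually)
qed

text \<open>As a function of \<open>z\<close>, the kernel \<open>1/(\<Phi>(z) - \<xi>)\<close> is holomorphic in \<open>\<Omega>\<close> except for a simple pole at
\<open>\<Psi>(\<xi>)\<close> with residue \<open>deriv \<Psi> \<xi>\<close>, and behaves like \<open>1/z\<close> at infinity. The principal part at a pole
outside the circle is subtracted; this changes the limit at infinity, while its own integral over the circle is \<open>0\<close>.\<close>

lemma circle_integral_\<Phi>_kernel:
  assumes R1: "0 < R\<^sub>1" and sub: "{z. R\<^sub>1 < cmod z} \<subseteq> \<Omega>" and near: "\<And>z. R\<^sub>1 < cmod z \<Longrightarrow> cmod (\<Phi> z - z) \<le> 1"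
    and R: "R\<^sub>1 < R" and x: "\<xi> \<in> E" and ne: "cmod (\<Psi> \<xi>) \<noteq> R"
  shows "(LINT \<phi>:{0..2*pi}|lborel. rcis R \<phi> / (\<Phi> (rcis R \<phi>) - \<xi>)) = 2 * pi * (1 - of_bool (R < cmod (\<Psi> \<xi>)) * deriv \<Psi> \<xi>)"
proof -
  define p where "p = \<Psi> \<xi>"
  have p: "p \<in> \<Omega>" "\<Phi> p = \<xi>" using x by (auto simp: p_def)
  have R0: "0 < R" using R1 R by simp
  have neq: "\<Phi> z \<noteq> \<xi>" if "z \<in> \<Omega>" "z \<noteq> p" for z using that p \<Phi>_inj by (metis inj_onD)
  note lim = \<Phi>_kernel_at_infinity[OF R1 near, of \<xi>]
  have hol: "(\<lambda>z. 1 / (\<Phi> z - \<xi>)) holomorphic_on S" if "S \<subseteq> \<Omega>" "p \<notin> S" for S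
    using that neq by (intro holomorphic_intros holomorphic_on_subset[OF \<Phi>_holomorphic]) auto
  show ?thesis
  proof (cases "R < cmod p")
    case False
    define R' where "R' = max R\<^sub>1 (cmod p)"
    have R': "0 < R'" "R' < R" using R1 R ne False by (auto simp: R'_def p_def)
    have "(\<lambda>z. 1 / (\<Phi> z - \<xi>)) holomorphic_on {z. R' < cmod z}" using sub by (intro hol) (auto simp: R'_def)
    from circle_integral_exterior[OF this R' lim] False show ?thesis by (simp add: p_def)
  next
    case True
    define S where "S = {z. R\<^sub>1 < cmod z}"
    (* the pole at p is removed by subtracting the principal part *)
    define h where "h z = 1 / (\<Phi> z - \<xi>) - deriv \<Psi> \<xi> / (z - p)" for z
    have pS: "p \<in> S" using True R by (simp add: S_def)
    have oS: "open S" unfolding S_def by (intro open_Collect_less continuous_intros)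
    have holh: "h holomorphic_on S - {p}" unfolding h_def
      using sub by (intro holomorphic_on_diff hol holomorphic_intros) (auto simp: S_def)
    have "((\<lambda>z. (z - p) * h z) \<longlongrightarrow> 0) (at p)"
    proof -
      have d: "deriv \<Phi> p * deriv \<Psi> \<xi> = 1" using deriv_mult[OF p(1)] p(2) by simp
      have "(\<Phi> has_field_derivative deriv \<Phi> p) (at p)" by (rule holomorphic_derivI[OF \<Phi>_holomorphic \<Omega>(1) p(1)])
      then have "((\<lambda>z. (\<Phi> z - \<Phi> p) / (z - p)) \<longlongrightarrow> deriv \<Phi> p) (at p)" by (simp add: has_field_derivative_iff)
      from tendsto_inverse[OF this] have "((\<lambda>z. inverse ((\<Phi> z - \<Phi> p) / (z - p))) \<longlongrightarrow> inverse (deriv \<Phi> p)) (at p)"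
        using deriv_\<Phi>_nonzero[OF p(1)] by simp
      also have "inverse (deriv \<Phi> p) = deriv \<Psi> \<xi>" using d by (simp add: inverse_unique)
      finally have "((\<lambda>z. inverse ((\<Phi> z - \<Phi> p) / (z - p)) - deriv \<Psi> \<xi>) \<longlongrightarrow> deriv \<Psi> \<xi> - deriv \<Psi> \<xi>) (at p)"
        by (intro tendsto_intros)
      then have l: "((\<lambda>z. inverse ((\<Phi> z - \<Phi> p) / (z - p)) - deriv \<Psi> \<xi>) \<longlongrightarrow> 0) (at p)" by simp
      have "\<forall>\<^sub>F z in at p. inverse ((\<Phi> z - \<Phi> p) / (z - p)) - deriv \<Psi> \<xi> = (z - p) * h z"
        unfolding eventually_at_filter by (auto intro!: always_eventually simp: h_def p(2) right_diff_distrib)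
      from Lim_transform_eventually[OF l this] show ?thesis .
    qed
    then obtain g where g: "g holomorphic_on S" "\<And>z. z \<in> S - {p} \<Longrightarrow> g z = h z"
      using holomorphic_on_extend_lim[OF holh] pS oS by (auto simp: interior_open)
    have lg: "((\<lambda>z. z * g z) \<longlongrightarrow> 1 - deriv \<Psi> \<xi>) at_infinity"
    proof -
      have inf: "filterlim (\<lambda>z::complex. norm z) at_top at_infinity" by (rule filterlim_norm_at_top)
      have ev: "\<forall>\<^sub>F z in at_infinity. max R\<^sub>1 (cmod p) < cmod (z::complex)"
        using filterlim_iff[THEN iffD1, OF inf, rule_format, OF eventually_gt_at_top] .
      have "((\<lambda>z::complex. p / z) \<longlongrightarrow> 0) at_infinity" by (rule tendsto_divide_0[OF tendsto_const filterlim_ident])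
      then have "((\<lambda>z. z * (1 / (\<Phi> z - \<xi>)) - deriv \<Psi> \<xi> * inverse (1 - p / z)) \<longlongrightarrow> 1 - deriv \<Psi> \<xi> * inverse (1 - 0)) at_infinity"
        by (intro tendsto_diff tendsto_mult tendsto_inverse lim tendsto_const) auto
      then have "((\<lambda>z. z * (1 / (\<Phi> z - \<xi>)) - deriv \<Psi> \<xi> * inverse (1 - p / z)) \<longlongrightarrow> 1 - deriv \<Psi> \<xi>) at_infinity" by simp
      moreover have "\<forall>\<^sub>F z in at_infinity. z * (1 / (\<Phi> z - \<xi>)) - deriv \<Psi> \<xi> * inverse (1 - p / z) = z * g z"
        using ev
      proof eventually_elim
        case (elim z)
        then have z: "z \<noteq> 0" "z \<noteq> p" "z \<in> S" using R1 by (auto simp: S_def)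
        then have "1 - p / z = (z - p) / z" by (simp add: field_simps)
        then have "inverse (1 - p / z) = z / (z - p)" by simp
        then show ?case using g(2)[of z] z by (simp add: h_def right_diff_distrib)
      qed
      ultimately show ?thesis by (rule Lim_transform_eventually)
    qed
    have A: "(LINT \<phi>:{0..2*pi}|lborel. g (rcis R \<phi>) * rcis R \<phi>) = 2 * pi * (1 - deriv \<Psi> \<xi>)"
      by (rule circle_integral_exterior[OF g(1)[unfolded S_def] R1 R lg])
    have B: "(LINT \<phi>:{0..2*pi}|lborel. rcis R \<phi> / (rcis R \<phi> - p)) = 2 * pi * (0 / (0 - p))"
      by (rule circle_mean_value[OF R0]) (use True in \<open>auto intro!: continuous_intros holomorphic_intros\<close>)
    have onS: "rcis R \<phi> \<in> S" "rcis R \<phi> \<noteq> p" for \<phi> using True R R0 by (auto simp: S_def)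
    have eq: "rcis R \<phi> / (\<Phi> (rcis R \<phi>) - \<xi>) = g (rcis R \<phi>) * rcis R \<phi> + deriv \<Psi> \<xi> * (rcis R \<phi> / (rcis R \<phi> - p))" for \<phi>
    proof -
      have "rcis R \<phi> / (\<Phi> (rcis R \<phi>) - \<xi>) = rcis R \<phi> * (1 / (\<Phi> (rcis R \<phi>) - \<xi>))" by simp
      also have "1 / (\<Phi> (rcis R \<phi>) - \<xi>) = g (rcis R \<phi>) + deriv \<Psi> \<xi> / (rcis R \<phi> - p)"
        using g(2)[of "rcis R \<phi>"] onS[of \<phi>] by (simp add: h_def)
      finally show ?thesis by (simp add: algebra_simps)
    qed
    have "(LINT \<phi>:{0..2*pi}|lborel. rcis R \<phi> / (\<Phi> (rcis R \<phi>) - \<xi>))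
      = (LINT \<phi>:{0..2*pi}|lborel. g (rcis R \<phi>) * rcis R \<phi>) + (LINT \<phi>:{0..2*pi}|lborel. deriv \<Psi> \<xi> * (rcis R \<phi> / (rcis R \<phi> - p)))"
      unfolding eq
    proof (rule set_integral_add(2))
      show "set_integrable lborel {0..2*pi} (\<lambda>\<phi>. g (rcis R \<phi>) * rcis R \<phi>)"
        using onS by (intro borel_integrable_atLeastAtMost' continuous_intros continuous_on_compose2[OF holomorphic_on_imp_continuous_on[OF g(1)]]) auto
      show "set_integrable lborel {0..2*pi} (\<lambda>\<phi>. deriv \<Psi> \<xi> * (rcis R \<phi> / (rcis R \<phi> - p)))"
        using onS by (intro borel_integrable_atLeastAtMost' continuous_intros) auto
    qed
    also have "\<dots> = 2 * pi * (1 - deriv \<Psi> \<xi>)" unfolding A set_integral_mult_right B by simp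
    finally show ?thesis using True by (simp add: p_def)
  qed
qed

lemma deriv_\<Psi>_le_2:
  assumes "\<zeta> \<in> E" "1/2 \<le> cmod (deriv \<Phi> (\<Psi> \<zeta>))"
  shows "cmod (deriv \<Psi> \<zeta>) \<le> 2"
proof -
  have "cmod (deriv \<Phi> (\<Psi> \<zeta>)) * cmod (deriv \<Psi> \<zeta>) = 1" using deriv_\<Psi>_mult[OF assms(1)] by (metis norm_mult norm_one)
  moreover have "1/2 * cmod (deriv \<Psi> \<zeta>) \<le> cmod (deriv \<Phi> (\<Psi> \<zeta>)) * cmod (deriv \<Psi> \<zeta>)" using assms(2) by (rule mult_right_mono) simp
  ultimately show ?thesis by simp
qed

lemma nn_integral_majorant_\<Phi>_le:
  assumes f: "integrable lborel f" and S: "open S" "bounded S" "S \<subseteq> \<Omega>"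
    and near: "\<And>z. z \<in> S \<Longrightarrow> cmod (\<Phi> z - z) \<le> 1 \<and> 1/2 \<le> cmod (deriv \<Phi> z)"
  shows "(\<integral>\<^sup>+z\<in>S. cauchy_majorant f (\<Phi> z) \<partial>lborel) \<le> 4 * (\<integral>\<^sup>+\<zeta>\<in>\<Phi> ` S. cauchy_majorant f \<zeta> \<partial>lborel)"
    and "(\<integral>\<^sup>+\<zeta>\<in>\<Phi> ` S. cauchy_majorant f \<zeta> \<partial>lborel) < \<infinity>"
proof -
  have fm: "f \<in> borel_measurable borel" using borel_measurable_integrable[OF f] by simp
  have op: "open (\<Phi> ` S)"
    using open_mapping_thm3[OF holomorphic_on_subset[OF \<Phi>_holomorphic S(3)] S(1) inj_on_subset[OF \<Phi>_inj S(3)]] .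
  have sub: "\<Phi> ` S \<subseteq> E" using S(3) by auto
  obtain B where B: "\<And>z. z \<in> S \<Longrightarrow> cmod z \<le> B" using S(2) by (auto simp: bounded_iff)
  have "cmod (\<Phi> z) \<le> B + 1" if "z \<in> S" for z
    using B[OF that] near[OF that] norm_triangle_sub[of "\<Phi> z" z] by simp
  then have bd: "bounded (\<Phi> ` S)" by (auto simp: bounded_iff)
  show fin: "(\<integral>\<^sup>+\<zeta>\<in>\<Phi> ` S. cauchy_majorant f \<zeta> \<partial>lborel) < \<infinity>"
    using op by (intro nn_integral_cauchy_majorant_bounded[OF f _ bd]) simp
  have im: "\<Psi> ` \<Phi> ` S = S" using S(3) by (force simp: image_image)
  have "(\<integral>\<^sup>+z\<in>\<Psi> ` \<Phi> ` S. cauchy_majorant f (\<Phi> z) \<partial>lborel) \<le> 4 * (\<integral>\<^sup>+\<zeta>\<in>\<Phi> ` S. cauchy_majorant f \<zeta> \<partial>lborel)"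
    by (rule nn_integral_comp_\<Phi>_le[OF cauchy_majorant_measurable[OF fm] op sub _ fin])
       (use near S(3) in \<open>auto intro!: deriv_\<Psi>_le_2\<close>)
  then show "(\<integral>\<^sup>+z\<in>S. cauchy_majorant f (\<Phi> z) \<partial>lborel) \<le> 4 * (\<integral>\<^sup>+\<zeta>\<in>\<Phi> ` S. cauchy_majorant f \<zeta> \<partial>lborel)"
    unfolding im .
qed

end

context vorticity
begin

text \<open>Near infinity \<open>\<Phi>\<close> maps a unit ball into the concentric ball of radius \<open>2\<close>, with a bounded
distortion of area.\<close>

lemma solution_at_infinity: "tends_at_infinity solution v_inf"
proof -
  obtain R\<^sub>1 where R1: "0 < R\<^sub>1" "{z. R\<^sub>1 < cmod z} \<subseteq> \<Omega>"
    "\<And>z. R\<^sub>1 < cmod z \<Longrightarrow> cmod (\<Phi> z - z) \<le> 1 \<and> 1/2 \<le> cmod (deriv \<Phi> z)" using near_infinity by blast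
  have ev: "\<forall>\<^sub>F x in at_infinity. R\<^sub>1 + 1 < cmod (x::complex)"
    using filterlim_iff[THEN iffD1, OF filterlim_norm_at_top, rule_format, OF eventually_gt_at_top[of "R\<^sub>1 + 1"]] .
  have lim: "((\<lambda>x. 4 * (\<integral>\<^sup>+\<zeta>\<in>ball x 2. cauchy_majorant source \<zeta> \<partial>lborel)) \<longlongrightarrow> 0) at_infinity"
    using ennreal_tendsto_cmult[OF _ cauchy_majorant_tendsto_0_at_infinity[OF source_integrable], of 4] by simp
  show ?thesis unfolding tends_at_infinity_def
  proof (rule tendsto_sandwich[OF _ _ tendsto_const lim])
    show "\<forall>\<^sub>F x in at_infinity. (\<integral>\<^sup>+y\<in>ball x 1. ennreal (cmod (solution y - v_inf)) \<partial>lebesgue) \<le> 4 * (\<integral>\<^sup>+\<zeta>\<in>ball x 2. cauchy_majorant source \<zeta> \<partial>lborel)"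
      using ev
    proof eventually_elim
      case (elim x)
      have far: "R\<^sub>1 < cmod y" if "y \<in> ball x 1" for y
      proof -
        have "cmod x \<le> cmod (x - y) + cmod y" using norm_triangle_ineq[of "x - y" y] by simp
        then show ?thesis using that elim by (simp add: dist_norm)
      qed
      have bS: "ball x 1 \<subseteq> \<Omega>" using far R1(2) by auto
      have "(\<integral>\<^sup>+y\<in>ball x 1. ennreal (cmod (solution y - v_inf)) \<partial>lebesgue) = (\<integral>\<^sup>+y\<in>ball x 1. ennreal (cmod (cauchy_transform source (\<Phi> y))) \<partial>lborel)"
        by (simp add: nn_integral_completion solution_def)
      also have "\<dots> \<le> (\<integral>\<^sup>+y\<in>ball x 1. cauchy_majorant source (\<Phi> y) \<partial>lborel)"
        by (intro nn_integral_mono mult_right_mono cauchy_transform_le_majorant) simp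
      also have "\<dots> \<le> 4 * (\<integral>\<^sup>+\<zeta>\<in>\<Phi> ` ball x 1. cauchy_majorant source \<zeta> \<partial>lborel)"
        by (rule nn_integral_majorant_\<Phi>_le(1)[OF source_integrable _ _ bS]) (use far R1(3) in auto)
      also have "\<dots> \<le> 4 * (\<integral>\<^sup>+\<zeta>\<in>ball x 2. cauchy_majorant source \<zeta> \<partial>lborel)"
      proof (rule mult_left_mono, rule nn_integral_mono)
        have "\<Phi> ` ball x 1 \<subseteq> ball x 2"
        proof clarify
          fix y assume y: "y \<in> ball x 1"
          have "cmod (x - \<Phi> y) \<le> cmod (x - y) + cmod (\<Phi> y - y)" using norm_triangle_ineq4[of "x - y" "\<Phi> y - y"] by simp
          also have "\<dots> < 2" using y R1(3)[OF far[OF y]] by (simp add: dist_norm)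
          finally show "\<Phi> y \<in> ball x 2" by (simp add: dist_norm)
        qed
        then show "cauchy_majorant source \<zeta> * indicator (\<Phi> ` ball x 1) \<zeta> \<le> cauchy_majorant source \<zeta> * indicator (ball x 2) \<zeta>" for \<zeta>
          by (intro mult_left_mono) (auto simp: indicator_def)
      qed auto
      finally show ?case .
    qed
  qed simp
qed

text \<open>The circulation is the real part of the integral of \<open>cnj v\<close> against \<open>dz\<close>. By Fubini it is an integral
of the source against the circle integrals of the kernel; these are bounded and, for each \<open>\<xi>\<close>, equal to \<open>2 \<pi> i\<close>
as soon as the circle surrounds \<open>\<Psi>(\<xi>)\<close>. The limit is therefore a multiple of the moment of order \<open>0\<close>, which vanishes.\<close>

lemma solution_circulation: "zero_circulation_at_infinity solution"
proof -
  obtain R\<^sub>1 where R1: "0 < R\<^sub>1" "{z. R\<^sub>1 < cmod z} \<subseteq> \<Omega>"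
    "\<And>z. R\<^sub>1 < cmod z \<Longrightarrow> cmod (\<Phi> z - z) \<le> 1 \<and> 1/2 \<le> cmod (deriv \<Phi> z)" using near_infinity by blast
  have near: "\<And>z. R\<^sub>1 < cmod z \<Longrightarrow> cmod (\<Phi> z - z) \<le> 1" using R1(3) by blast
  note source(1) [measurable]
  define S where "S = {z::complex. R\<^sub>1 < cmod z}"
  have oS: "open S" unfolding S_def by (intro open_Collect_less continuous_intros)
  (* \<Phi> is arbitrary outside \<Omega>; the truncation is Borel on the whole plane *)
  define \<Phi>' where "\<Phi>' z = indicator S z *\<^sub>R \<Phi> z" for z
  have \<Phi>'m [measurable]: "\<Phi>' \<in> borel_measurable borel" unfolding \<Phi>'_def[abs_def]
    by (rule borel_measurable_continuous_on_indicator) (use oS R1(2) continuous_on_subset[OF \<Phi>_continuous] in \<open>auto simp: S_def\<close>)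
  have \<Phi>': "\<Phi>' z = \<Phi> z" if "R\<^sub>1 < cmod z" for z using that by (simp add: \<Phi>'_def S_def)
  have ae_fin: "AE R in lborel. R\<^sub>1 < R \<longrightarrow> (\<integral>\<^sup>+\<phi>\<in>{0..2*pi}. cauchy_majorant source (\<Phi>' (rcis R \<phi>)) \<partial>lborel) < \<infinity>"
  proof (rule AE_circle_nn_integral_finite)
    fix n :: nat
    have oA: "open (annulus R\<^sub>1 (real n))" unfolding annulus_def by (intro open_Collect_conj open_Collect_less continuous_intros)
    have bA: "bounded (annulus R\<^sub>1 (real n))" by (rule bounded_subset[of "ball 0 (real n)"]) (auto simp: annulus_def)
    have sA: "annulus R\<^sub>1 (real n) \<subseteq> \<Omega>" using R1(2) by (auto simp: annulus_def)
    have "(\<integral>\<^sup>+z\<in>annulus R\<^sub>1 (real n). cauchy_majorant source (\<Phi>' z) \<partial>lborel) = (\<integral>\<^sup>+z\<in>annulus R\<^sub>1 (real n). cauchy_majorant source (\<Phi> z) \<partial>lborel)"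
      by (rule nn_integral_cong) (auto simp: annulus_def indicator_def \<Phi>')
    also have "\<dots> \<le> 4 * (\<integral>\<^sup>+\<zeta>\<in>\<Phi> ` annulus R\<^sub>1 (real n). cauchy_majorant source \<zeta> \<partial>lborel)"
      by (rule nn_integral_majorant_\<Phi>_le(1)[OF source_integrable oA bA sA]) (use R1(3) in \<open>auto simp: annulus_def\<close>)
    also have "\<dots> < \<infinity>"
      using nn_integral_majorant_\<Phi>_le(2)[OF source_integrable oA bA sA] R1(3) by (auto simp: annulus_def ennreal_mult_less_top)
    finally show "(\<integral>\<^sup>+z\<in>annulus R\<^sub>1 (real n). cauchy_majorant source (\<Phi>' z) \<partial>lborel) < \<infinity>" .
  qed (use R1 in auto)
  (* the contribution of the poles \<Psi> \<xi> outside the circle of radius R *)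
  define D where "D R \<xi> = indicator {\<zeta> \<in> E. max R\<^sub>1 R < cmod (\<Psi> \<zeta>)} \<xi> *\<^sub>R deriv \<Psi> \<xi>" for R \<xi>
  have Dm [measurable]: "D R \<in> borel_measurable borel" for R
  proof -
    have "open {\<zeta> \<in> E. max R\<^sub>1 R < cmod (\<Psi> \<zeta>)}"
      using continuous_open_preimage[OF continuous_on_norm[OF \<Psi>_continuous] open_E, of "{max R\<^sub>1 R<..}"]
      by (simp add: vimage_def Int_def)
    then show ?thesis unfolding D_def[abs_def]
      by (intro borel_measurable_continuous_on_indicator continuous_on_subset[OF deriv_\<Psi>_continuous]) auto
  qed
  have Dle: "cmod (D R \<xi>) \<le> 2" for R \<xi>
    using R1(3)[of "\<Psi> \<xi>"] deriv_\<Psi>_le_2[of \<xi>] by (auto simp: D_def indicator_def)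
  define G where "G R = (LINT \<xi>|lborel. source \<xi> * (2 * pi * \<i> * (1 - D R \<xi>)))" for R
  have kle: "cmod (source \<xi> * (2 * pi * \<i> * (1 - D R \<xi>))) \<le> 6 * pi * cmod (source \<xi>)" for R \<xi>
  proof -
    have "cmod (1 - D R \<xi>) \<le> 3" using norm_triangle_ineq4[of 1 "D R \<xi>"] Dle[of R \<xi>] by simp
    then have "cmod (source \<xi>) * (2 * pi * cmod (1 - D R \<xi>)) \<le> cmod (source \<xi>) * (2 * pi * 3)" by (intro mult_left_mono) auto
    moreover have "cmod (2 * complex_of_real pi * \<i>) = 2 * pi" by (simp add: norm_mult)
    ultimately show ?thesis unfolding norm_mult[of "source \<xi>"] norm_mult[of _ "1 - D R \<xi>"] by (simp add: mult_ac)
  qed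
  have "(G \<longlongrightarrow> (LINT \<xi>|lborel. source \<xi> * (2 * pi * \<i>))) at_top"
    unfolding G_def
  proof (rule integral_dominated_convergence_at_top[where s = "\<lambda>R \<xi>. source \<xi> * (2 * pi * \<i> * (1 - D R \<xi>))" and f = "\<lambda>\<xi>. source \<xi> * (2 * pi * \<i>)" and M = lborel and w = "\<lambda>\<xi>. 6 * pi * cmod (source \<xi>)"])
    show "AE \<xi> in lborel. ((\<lambda>R. source \<xi> * (2 * pi * \<i> * (1 - D R \<xi>))) \<longlongrightarrow> source \<xi> * (2 * pi * \<i>)) at_top"
    proof (rule AE_I2)
      fix \<xi>
      have "\<forall>\<^sub>F R in at_top. source \<xi> * (2 * pi * \<i> * (1 - D R \<xi>)) = source \<xi> * (2 * pi * \<i>)"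
        using eventually_ge_at_top[of "cmod (\<Psi> \<xi>)"] by eventually_elim (auto simp: D_def)
      then show "((\<lambda>R. source \<xi> * (2 * pi * \<i> * (1 - D R \<xi>))) \<longlongrightarrow> source \<xi> * (2 * pi * \<i>)) at_top"
        by (rule tendsto_eventually)
    qed
  qed (use source_integrable kle in auto)
  moreover have "(LINT \<xi>|lborel. source \<xi> * (2 * pi * \<i>)) = 0" using source_moment[of 0] by simp
  ultimately have "(G \<longlongrightarrow> 0) at_top" by simp
  then have limG: "((\<lambda>R. Re (G R)) \<longlongrightarrow> 0) at_top" using tendsto_Re[of G 0] by simp
  have circ: "AE R in lborel. R\<^sub>1 < R \<longrightarrow> circulation solution R = Re (G R)"
    using ae_fin
  proof eventually_elim
    case (elim R)
    show ?case
    proof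
      assume R: "R\<^sub>1 < R"
      then have R0: "0 < R" using R1(1) by simp
      define e where "e \<phi> = indicator {0..2*pi} \<phi> *\<^sub>R (\<i> * rcis R \<phi>)" for \<phi> :: real
      have em [measurable]: "e \<in> borel_measurable lborel" unfolding e_def[abs_def]
        by (intro borel_measurable_scaleR borel_measurable_indicator) (auto intro!: borel_measurable_continuous_onI continuous_intros)
      have gm [measurable]: "(\<lambda>\<phi>. \<Phi>' (rcis R \<phi>)) \<in> borel_measurable lborel" by measurable
      have eR: "e \<phi> * X = indicator {0..2*pi} \<phi> *\<^sub>R (\<i> * rcis R \<phi> * X)" for \<phi> X by (simp add: e_def)
      have "(\<integral>\<^sup>+\<phi>. ennreal (cmod (e \<phi>)) * cauchy_majorant source (\<Phi>' (rcis R \<phi>)) \<partial>lborel)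
        = (\<integral>\<^sup>+\<phi>. ennreal R * (cauchy_majorant source (\<Phi>' (rcis R \<phi>)) * indicator {0..2*pi} \<phi>) \<partial>lborel)"
        by (rule nn_integral_cong) (use R0 in \<open>simp add: e_def norm_mult indicator_def\<close>)
      also have "\<dots> = ennreal R * (\<integral>\<^sup>+\<phi>\<in>{0..2*pi}. cauchy_majorant source (\<Phi>' (rcis R \<phi>)) \<partial>lborel)"
        by (rule nn_integral_cmult) measurable
      also have "\<dots> < \<infinity>" using elim R by (simp add: ennreal_mult_less_top)
      finally have fin: "(\<integral>\<^sup>+\<phi>. ennreal (cmod (e \<phi>)) * cauchy_majorant source (\<Phi>' (rcis R \<phi>)) \<partial>lborel) < \<infinity>" .
      note F = cauchy_transform_Fubini[OF source(1) em gm sigma_finite_lborel fin]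
      have sol: "indicator {0..2*pi} \<phi> *\<^sub>R (solution (rcis R \<phi>) \<bullet> (\<i> * rcis R \<phi>)) = Re (e \<phi> * cauchy_transform source (\<Phi>' (rcis R \<phi>)) + e \<phi> * cnj v_inf)" for \<phi>
      proof -
        have "\<Phi>' (rcis R \<phi>) = \<Phi> (rcis R \<phi>)" using R R0 by (intro \<Phi>') simp
        then show ?thesis by (simp add: e_def solution_def inner_complex_def indicator_def algebra_simps)
      qed
      have ei: "integrable lborel (\<lambda>\<phi>. e \<phi> * cnj v_inf)"
      proof (rule integrable_mult_left)
        have "set_integrable lborel {0..2*pi} (\<lambda>\<phi>. \<i> * rcis R \<phi>)" by (intro borel_integrable_atLeastAtMost' continuous_intros)
        then show "integrable lborel e" by (simp add: set_integrable_def e_def[abs_def])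
      qed
      have e0: "(LINT \<phi>|lborel. e \<phi>) = 0"
      proof -
        have "(LINT \<phi>:{0..2*pi}|lborel. rcis R \<phi>) = 2 * pi * 0"
          using circle_mean_value[OF R0, of "\<lambda>z. z"] by (simp add: continuous_on_id holomorphic_on_ident)
        moreover have "(LINT \<phi>|lborel. e \<phi>) = \<i> * (LINT \<phi>:{0..2*pi}|lborel. rcis R \<phi>)"
          unfolding e_def set_lebesgue_integral_def[symmetric] by (rule set_integral_mult_right)
        ultimately show ?thesis by simp
      qed
      have "circulation solution R = (LINT \<phi>|lebesgue. Re (e \<phi> * cauchy_transform source (\<Phi>' (rcis R \<phi>)) + e \<phi> * cnj v_inf))"
        unfolding circulation_def set_lebesgue_integral_def sol ..
      also have "\<dots> = (LINT \<phi>|lborel. Re (e \<phi> * cauchy_transform source (\<Phi>' (rcis R \<phi>)) + e \<phi> * cnj v_inf))"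
        by (rule integral_completion) (use F(1) ei in \<open>auto intro!: borel_measurable_integrable\<close>)
      also have "\<dots> = Re (LINT \<phi>|lborel. e \<phi> * cauchy_transform source (\<Phi>' (rcis R \<phi>)) + e \<phi> * cnj v_inf)"
        by (rule integral_Re[OF Bochner_Integration.integrable_add[OF F(1) ei]])
      also have "(LINT \<phi>|lborel. e \<phi> * cauchy_transform source (\<Phi>' (rcis R \<phi>)) + e \<phi> * cnj v_inf)
        = (LINT \<phi>|lborel. e \<phi> * cauchy_transform source (\<Phi>' (rcis R \<phi>)))"
        using e0 by (subst Bochner_Integration.integral_add[OF F(1) ei]) simp
      also have "\<dots> = (LINT \<xi>|lborel. source \<xi> * (LINT \<phi>|lborel. e \<phi> / (\<Phi>' (rcis R \<phi>) - \<xi>)))" by (rule F(2))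
      also have "\<dots> = G R" unfolding G_def
      proof (rule integral_cong_AE)
        have "AE z in lebesgue. z \<in> \<Omega> \<longrightarrow> cmod z \<noteq> R" using AE_completion[OF AE_norm_neq[of R]] by eventually_elim simp
        then have "AE \<zeta> in lborel. \<zeta> \<in> E \<longrightarrow> cmod (\<Psi> \<zeta>) \<noteq> R" using AE_transfer[of "\<lambda>z. cmod z \<noteq> R"] by (simp add: AE_completion_iff)
        then show "AE \<xi> in lborel. source \<xi> * (LINT \<phi>|lborel. e \<phi> / (\<Phi>' (rcis R \<phi>) - \<xi>)) = source \<xi> * (2 * pi * \<i> * (1 - D R \<xi>))"
        proof eventually_elim
          case (elim \<xi>)
          show ?case
          proof (cases "\<xi> \<in> E")
            case True
            have "(LINT \<phi>|lborel. e \<phi> / (\<Phi>' (rcis R \<phi>) - \<xi>)) = \<i> * (LINT \<phi>:{0..2*pi}|lborel. rcis R \<phi> / (\<Phi> (rcis R \<phi>) - \<xi>))"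
            proof -
              have "e \<phi> / (\<Phi>' (rcis R \<phi>) - \<xi>) = indicator {0..2*pi} \<phi> *\<^sub>R (\<i> * (rcis R \<phi> / (\<Phi> (rcis R \<phi>) - \<xi>)))" for \<phi>
                using R R0 by (simp add: e_def \<Phi>' scaleR_conv_of_real)
              then show ?thesis
                by (simp only: set_lebesgue_integral_def[symmetric] set_integral_mult_right)
            qed
            also have "\<dots> = 2 * pi * \<i> * (1 - D R \<xi>)"
              using circle_integral_\<Phi>_kernel[OF R1(1,2) near R True] elim True R by (simp add: D_def indicator_def of_bool_def)
            finally show ?thesis by simp
          qed (simp add: source(2))
        qed
      qed measurable
      finally show "circulation solution R = Re (G R)" .
    qed
  qed
  show ?thesis unfolding zero_circulation_at_infinity_def
  proof (rule Lim_transform_eventually)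
    show "((\<lambda>R. Re (G R)) \<longlongrightarrow> 0) (inf at_top (ae_filter lebesgue))"
      using limG by (rule tendsto_mono[rotated]) simp
    have "\<forall>\<^sub>F R in ae_filter lebesgue. R\<^sub>1 < R \<longrightarrow> circulation solution R = Re (G R)"
      using AE_completion[OF circ] .
    then show "\<forall>\<^sub>F R in inf at_top (ae_filter lebesgue). Re (G R) = circulation solution R"
      unfolding eventually_inf using eventually_gt_at_top[of R\<^sub>1]
      by (intro exI[of _ "\<lambda>R. R\<^sub>1 < R"] exI[of _ "\<lambda>R. R\<^sub>1 < R \<longrightarrow> circulation solution R = Re (G R)"]) auto
  qed
qed

theorem solution_is_solution: "is_solution \<Omega> r0 \<Psi> w v_inf solution"
  unfolding is_solution_def
  using solution_locally_integrable weak_dbar_imp_div_curl[OF solution_locally_integrable solution_weak_dbar]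
    solution_trace solution_at_infinity solution_circulation by blast

end

section \<open>Uniqueness of Fourier coefficients\<close>

text \<open>Half lines form a generator of the Borel sets that is stable under intersections.\<close>

lemma AE_eq_0_if_initial_integrals_0:
  fixes g :: "real \<Rightarrow> complex"
  assumes g: "integrable lborel g" and 0: "\<And>x. (LINT t:{..x}|lborel. g t) = 0"
  shows "AE t in lborel. g t = 0"
proof (rule sigma_finite_measure.density_zero[OF sigma_finite_lborel g])
  fix A :: "real set" assume "A \<in> sets lborel"
  then have A: "A \<in> sigma_sets UNIV (range (\<lambda>x. {..x}))" by (simp add: borel_eq_atMost)
  have sub: "sigma_sets UNIV (range (\<lambda>x::real. {..x})) = sets borel" by (simp add: borel_eq_atMost)
  have ig: "set_integrable lborel B g" if "B \<in> sets borel" for B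
    unfolding set_integrable_def using g that by (intro integrable_mult_indicator) auto
  have tot: "(LINT t|lborel. g t) = 0"
  proof -
    have "(\<lambda>n::nat. LINT t:{..real n}|lborel. g t) \<longlonglongrightarrow> (LINT t|lborel. g t)"
      unfolding set_lebesgue_integral_def
    proof (rule integral_dominated_convergence[where w = "\<lambda>t. norm (g t)"])
      show "AE t in lborel. (\<lambda>n. indicator {..real n} t *\<^sub>R g t) \<longlonglongrightarrow> g t"
      proof (rule AE_I2)
        fix t
        have "\<forall>\<^sub>F n in sequentially. t \<le> real n" using eventually_ge_at_top[of "nat \<lceil>t\<rceil>"] by eventually_elim linarith
        then have "\<forall>\<^sub>F n in sequentially. indicator {..real n} t *\<^sub>R g t = g t" by eventually_elim simp
        then show "(\<lambda>n. indicator {..real n} t *\<^sub>R g t) \<longlonglongrightarrow> g t" by (rule tendsto_eventually)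
      qed
    qed (use g in \<open>auto simp: indicator_def\<close>)
    then show ?thesis by (simp add: 0 LIMSEQ_const_iff)
  qed
  show "(LINT t:A|lborel. g t) = 0"
  proof (rule sigma_sets_induct_disjoint[OF _ _ A])
    show "Int_stable (range (\<lambda>x::real. {..x}))" by (auto simp: Int_stable_def)
    show "range (\<lambda>x::real. {..x}) \<subseteq> Pow UNIV" by simp
    show "(LINT t:B|lborel. g t) = 0" if "B \<in> range (\<lambda>x. {..x})" for B using that 0 by auto
    show "(LINT t:{}|lborel. g t) = 0" by (simp add: set_lebesgue_integral_def)
    show "(LINT t:UNIV - B|lborel. g t) = 0" if B: "B \<in> sigma_sets UNIV (range (\<lambda>x. {..x}))" "(LINT t:B|lborel. g t) = 0" for B
    proof -
      have Bb: "B \<in> sets borel" using B(1) sub by simp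
      have "(LINT t:B \<union> (UNIV - B)|lborel. g t) = (LINT t:B|lborel. g t) + (LINT t:UNIV - B|lborel. g t)"
        using Bb by (intro set_integral_Un ig) auto
      then show ?thesis using tot B(2) by (simp add: set_lebesgue_integral_def)
    qed
    show "(LINT t:(\<Union>i. B i)|lborel. g t) = 0" if B: "disjoint_family B" "range B \<subseteq> sigma_sets UNIV (range (\<lambda>x. {..x}))" "\<And>i. (LINT t:B i|lborel. g t) = 0" for B :: "nat \<Rightarrow> real set"
    proof -
      have Bb: "B i \<in> sets borel" for i using B(2) sub by auto
      have "(LINT t:(\<Union>i. B i)|lborel. g t) = (\<Sum>i. (LINT t:B i|lborel. g t))"
        using Bb B(1) by (intro lebesgue_integral_countable_add ig) (auto simp: disjoint_family_on_def)
      then show ?thesis using B(3) by simp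
    qed
  qed
qed

definition zero_fourier :: "(real \<Rightarrow> complex) \<Rightarrow> bool" where
  "zero_fourier f \<longleftrightarrow> set_integrable lborel {0..2*pi} f \<and>
     (\<forall>k::int. (LINT \<phi>:{0..2*pi}|lborel. f \<phi> * exp (- \<i> * of_int k * of_real \<phi>)) = 0)"

lemma set_integrable_mult_continuous:
  fixes f g :: "real \<Rightarrow> complex"
  assumes f: "set_integrable lborel {a..b} f" and g: "continuous_on {a..b} g"
  shows "set_integrable lborel {a..b} (\<lambda>x. f x * g x)"
proof -
  have "bounded (g ` {a..b})" using compact_continuous_image[OF g compact_Icc] by (rule compact_imp_bounded)
  then obtain B where "B > 0" "\<forall>x\<in>g ` {a..b}. cmod x \<le> B" using bounded_pos by blast
  then have B: "\<And>x. x \<in> {a..b} \<Longrightarrow> cmod (g x) \<le> B" "B > 0" by blast+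
  have m: "(\<lambda>x. indicator {a..b} x *\<^sub>R g x) \<in> borel_measurable borel"
    by (rule borel_measurable_continuous_on_indicator[OF _ g]) simp
  show ?thesis unfolding set_integrable_def
  proof (rule Bochner_Integration.integrable_bound[of _ "\<lambda>x. B * cmod (indicator {a..b} x *\<^sub>R f x)"])
    show "integrable lborel (\<lambda>x. B * cmod (indicator {a..b} x *\<^sub>R f x))"
      using f unfolding set_integrable_def by (intro integrable_mult_right integrable_norm)
    have "(\<lambda>x. (indicator {a..b} x *\<^sub>R f x) * (indicator {a..b} x *\<^sub>R g x)) \<in> borel_measurable lborel"
      using borel_measurable_integrable[OF f[unfolded set_integrable_def]] m by (intro borel_measurable_times) auto
    moreover have "(\<lambda>x. (indicator {a..b} x *\<^sub>R f x) * (indicator {a..b} x *\<^sub>R g x)) = (\<lambda>x. indicator {a..b} x *\<^sub>R (f x * g x))"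
      by (auto simp: indicator_def)
    ultimately show "(\<lambda>x. indicator {a..b} x *\<^sub>R (f x * g x)) \<in> borel_measurable lborel" by simp
    show "AE x in lborel. norm (indicator {a..b} x *\<^sub>R (f x * g x)) \<le> norm (B * cmod (indicator {a..b} x *\<^sub>R f x))"
      using B by (intro AE_I2) (auto simp: indicator_def norm_mult abs_mult mult.commute[of B] intro!: mult_left_mono)
  qed
qed

lemma zero_fourier_add: "zero_fourier f \<Longrightarrow> zero_fourier g \<Longrightarrow> zero_fourier (\<lambda>\<phi>. f \<phi> + g \<phi>)"
proof -
  assume f: "zero_fourier f" and g: "zero_fourier g"
  have c: "continuous_on {0..2*pi} (\<lambda>\<phi>::real. exp (- \<i> * of_int k * of_real \<phi>))" for k :: int by (intro continuous_intros)
  have i: "set_integrable lborel {0..2*pi} (\<lambda>\<phi>. f \<phi> * exp (- \<i> * of_int k * of_real \<phi>))"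
    "set_integrable lborel {0..2*pi} (\<lambda>\<phi>. g \<phi> * exp (- \<i> * of_int k * of_real \<phi>))" for k :: int
    using f g set_integrable_mult_continuous[OF _ c] by (auto simp: zero_fourier_def)
  have "(LINT \<phi>:{0..2*pi}|lborel. (f \<phi> + g \<phi>) * exp (- \<i> * of_int k * of_real \<phi>)) = 0" for k :: int
    using set_integral_add(2)[OF i] f g by (simp add: zero_fourier_def distrib_right)
  then show ?thesis using f g by (auto simp: zero_fourier_def)
qed

lemma zero_fourier_mult_exp: "zero_fourier f \<Longrightarrow> zero_fourier (\<lambda>\<phi>. f \<phi> * (c * exp (\<i> * of_int m * of_real \<phi>)))"
proof -
  assume f: "zero_fourier f"
  have "continuous_on {0..2*pi} (\<lambda>\<phi>::real. c * exp (\<i> * of_int m * of_real \<phi>))" by (intro continuous_intros)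
  then have i: "set_integrable lborel {0..2*pi} (\<lambda>\<phi>. f \<phi> * (c * exp (\<i> * of_int m * of_real \<phi>)))"
    using f by (intro set_integrable_mult_continuous) (auto simp: zero_fourier_def)
  have eq: "f \<phi> * (c * exp (\<i> * of_int m * of_real \<phi>)) * exp (- \<i> * of_int k * of_real \<phi>) = c * (f \<phi> * exp (- \<i> * of_int (k - m) * of_real \<phi>))" for \<phi> k
  proof -
    have "exp (\<i> * of_int m * of_real \<phi>) * exp (- \<i> * of_int k * of_real \<phi>) = exp (- \<i> * of_int (k - m) * of_real \<phi>)"
      by (simp add: exp_add[symmetric] algebra_simps)
    moreover have "f \<phi> * (c * x) * y = c * (f \<phi> * z)" if "x * y = z" for x y z
      by (simp add: that[symmetric] mult_ac)
    ultimately show ?thesis by blast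
  qed
  have "(LINT \<phi>:{0..2*pi}|lborel. f \<phi> * (c * exp (\<i> * of_int m * of_real \<phi>)) * exp (- \<i> * of_int k * of_real \<phi>)) = 0" for k
    unfolding eq set_integral_mult_right using f by (simp only: zero_fourier_def mult_zero_right)
  then show ?thesis using i by (simp add: zero_fourier_def)
qed

text \<open>Real polynomials in \<open>cos \<phi>\<close> and \<open>sin \<phi>\<close> are trigonometric polynomials: a linear form is a combination of
\<open>exp (i \<phi>)\<close> and \<open>exp (- i \<phi>)\<close>, and multiplication by these shifts Fourier coefficients.\<close>

lemma zero_fourier_mult_polynomial:
  "real_polynomial_function p \<Longrightarrow> zero_fourier f \<Longrightarrow> zero_fourier (\<lambda>\<phi>. f \<phi> * of_real (p (cis \<phi>)))"
proof (induction p arbitrary: f rule: real_polynomial_function.induct)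
  case (linear p)
  have p: "p z = Re z * p 1 + Im z * p \<i>" for z
  proof -
    have "z = Re z *\<^sub>R 1 + Im z *\<^sub>R \<i>" by (simp add: complex_eq_iff)
    then have "p z = p (Re z *\<^sub>R 1 + Im z *\<^sub>R \<i>)" by (rule arg_cong)
    also have "\<dots> = Re z *\<^sub>R p 1 + Im z *\<^sub>R p \<i>"
      using linear(1) by (simp add: bounded_linear.linear linear_add linear_scale)
    finally show ?thesis by simp
  qed
  define c where "c = (p 1 - \<i> * p \<i>) / 2"
  define d where "d = (p 1 + \<i> * p \<i>) / 2"
  have "of_real (p (cis \<phi>)) = c * exp (\<i> * of_int 1 * of_real \<phi>) + d * exp (\<i> * of_int (-1) * of_real \<phi>)" for \<phi>
  proof -
    have "exp (\<i> * of_int 1 * of_real \<phi>) = cis \<phi>" "exp (\<i> * of_int (-1) * of_real \<phi>) = cis (- \<phi>)" by (simp_all add: cis_conv_exp)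
    then show ?thesis unfolding p[of "cis \<phi>"] c_def d_def by (simp add: complex_eq_iff field_simps)
  qed
  then have "(\<lambda>\<phi>. f \<phi> * of_real (p (cis \<phi>))) = (\<lambda>\<phi>. f \<phi> * (c * exp (\<i> * of_int 1 * of_real \<phi>)) + f \<phi> * (d * exp (\<i> * of_int (-1) * of_real \<phi>)))"
    by (simp only: distrib_left)
  then show ?case using zero_fourier_add[OF zero_fourier_mult_exp[OF linear(2), of c 1] zero_fourier_mult_exp[OF linear(2), of d "-1"]] by simp
next
  case (const c)
  then show ?case using zero_fourier_mult_exp[OF const, of "of_real c" 0] by simp
next
  case (add p q)
  then show ?case using zero_fourier_add[OF add.IH(1) add.IH(2)] by (simp add: distrib_left)
next
  case (mult p q)
  then show ?case using mult.IH(2)[OF mult.IH(1)] by (simp add: mult.assoc)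
qed

text \<open>By Stone-Weierstrass on the circle, \<open>f\<close> is orthogonal to all continuous functions of \<open>exp (i \<phi>)\<close>; by dominated
convergence, to the indicators of closed sets, in particular of arcs starting at \<open>1\<close>. So the primitive of
\<open>f\<close> vanishes.\<close>

theorem fourier_uniqueness:
  assumes f: "zero_fourier f"
  shows "AE \<phi> in lborel. \<phi> \<in> {0..2*pi} \<longrightarrow> f \<phi> = 0"
proof -
  let ?S = "sphere (0::complex) 1"
  have fi: "integrable lborel (\<lambda>\<phi>. indicator {0..2*pi} \<phi> *\<^sub>R f \<phi>)" using f by (simp add: zero_fourier_def set_integrable_def)
  define N where "N = (LINT \<phi>|lborel. cmod (indicator {0..2*pi} \<phi> *\<^sub>R f \<phi>))"
  have cont: "(LINT \<phi>:{0..2*pi}|lborel. f \<phi> * of_real (g (cis \<phi>))) = 0" if g: "continuous_on ?S g" for g :: "complex \<Rightarrow> real"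
  proof -
    have cg: "continuous_on {0..2*pi} (\<lambda>\<phi>. complex_of_real (g (cis \<phi>)))"
      by (intro continuous_intros continuous_on_compose2[OF g]) auto
    have "cmod (LINT \<phi>:{0..2*pi}|lborel. f \<phi> * of_real (g (cis \<phi>))) \<le> e * N" if e: "e > 0" for e
    proof -
      obtain p where p: "real_polynomial_function p" "\<And>z. z \<in> ?S \<Longrightarrow> \<bar>g z - p z\<bar> < e"
        using Stone_Weierstrass_real_polynomial_function[OF compact_sphere g e] by blast
      have z: "zero_fourier (\<lambda>\<phi>. f \<phi> * of_real (p (cis \<phi>)))" by (rule zero_fourier_mult_polynomial[OF p(1) f])
      then have zp: "(LINT \<phi>:{0..2*pi}|lborel. f \<phi> * of_real (p (cis \<phi>))) = 0"
      proof -
        have "(LINT \<phi>:{0..2*pi}|lborel. f \<phi> * of_real (p (cis \<phi>)) * exp (- \<i> * of_int 0 * of_real \<phi>)) = 0"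
          using z unfolding zero_fourier_def by blast
        then show ?thesis by simp
      qed
      have i1: "set_integrable lborel {0..2*pi} (\<lambda>\<phi>. f \<phi> * of_real (g (cis \<phi>)))"
        using f cg by (intro set_integrable_mult_continuous) (auto simp: zero_fourier_def)
      have i2: "set_integrable lborel {0..2*pi} (\<lambda>\<phi>. f \<phi> * of_real (p (cis \<phi>)))" using z by (simp add: zero_fourier_def)
      have i3: "set_integrable lborel {0..2*pi} (\<lambda>\<phi>. f \<phi> * of_real (g (cis \<phi>)) - f \<phi> * of_real (p (cis \<phi>)))"
        by (rule set_integral_diff(1)[OF i1 i2])
      have "(LINT \<phi>:{0..2*pi}|lborel. f \<phi> * of_real (g (cis \<phi>))) = (LINT \<phi>:{0..2*pi}|lborel. f \<phi> * of_real (g (cis \<phi>)) - f \<phi> * of_real (p (cis \<phi>)))"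
        using set_integral_diff(2)[OF i1 i2] zp by simp
      also have "cmod \<dots> \<le> (LINT \<phi>|lborel. e * cmod (indicator {0..2*pi} \<phi> *\<^sub>R f \<phi>))"
        unfolding set_lebesgue_integral_def
      proof (rule Bochner_Integration.integral_norm_bound_integral)
        show "integrable lborel (\<lambda>\<phi>. indicator {0..2*pi} \<phi> *\<^sub>R (f \<phi> * of_real (g (cis \<phi>)) - f \<phi> * of_real (p (cis \<phi>))))"
          using i3 by (simp add: set_integrable_def)
        show "integrable lborel (\<lambda>\<phi>. e * cmod (indicator {0..2*pi} \<phi> *\<^sub>R f \<phi>))" using fi by (intro integrable_mult_right integrable_norm)
        fix \<phi>
        have "cmod (f \<phi> * of_real (g (cis \<phi>)) - f \<phi> * of_real (p (cis \<phi>))) = cmod (f \<phi>) * \<bar>g (cis \<phi>) - p (cis \<phi>)\<bar>"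
          by (metis norm_mult norm_of_real of_real_diff right_diff_distrib)
        also have "\<dots> \<le> cmod (f \<phi>) * e" using p(2)[of "cis \<phi>"] by (intro mult_left_mono) auto
        finally show "norm (indicator {0..2*pi} \<phi> *\<^sub>R (f \<phi> * of_real (g (cis \<phi>)) - f \<phi> * of_real (p (cis \<phi>)))) \<le> e * cmod (indicator {0..2*pi} \<phi> *\<^sub>R f \<phi>)"
          by (auto simp: indicator_def mult.commute)
      qed
      finally show ?thesis by (simp add: N_def)
    qed note le = this
    have N0: "N \<ge> 0" by (simp add: N_def)
    have "cmod (LINT \<phi>:{0..2*pi}|lborel. f \<phi> * of_real (g (cis \<phi>))) \<le> 0 + e" if "e > 0" for e
    proof -
      have "e / (N + 1) * N \<le> e" using N0 that by (simp add: field_simps)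
      then show ?thesis using le[of "e / (N + 1)"] N0 that by simp
    qed
    then have "cmod (LINT \<phi>:{0..2*pi}|lborel. f \<phi> * of_real (g (cis \<phi>))) \<le> 0" by (rule field_le_epsilon)
    then show ?thesis by simp
  qed
  have closed: "(LINT \<phi>:{0..2*pi}|lborel. indicator C (cis \<phi>) *\<^sub>R f \<phi>) = 0" if C: "closed C" "C \<noteq> {}" for C
  proof -
    (* continuous functions decreasing to the indicator of C *)
    define g where "g n z = max 0 (1 - real n * infdist z C)" for n :: nat and z :: complex
    have gc: "continuous_on S (g n)" for S n unfolding g_def by (intro continuous_intros)
    have lim: "(\<lambda>n. g n z) \<longlonglongrightarrow> indicator C z" for z
    proof (cases "z \<in> C")
      case False
      then have d: "infdist z C > 0" using C in_closed_iff_infdist_zero[of C z] infdist_nonneg[of z C] by auto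
      obtain m :: nat where m: "1 / infdist z C < real m" using reals_Archimedean2 by blast
      have "\<forall>\<^sub>F n in sequentially. g n z = 0"
        using eventually_ge_at_top[of m]
      proof eventually_elim
        case (elim n)
        have "1 < real m * infdist z C" using m d by (simp add: field_simps)
        also have "\<dots> \<le> real n * infdist z C" using elim d by (intro mult_right_mono) auto
        finally show ?case by (simp add: g_def)
      qed
      then show ?thesis using False by (simp add: tendsto_eventually)
    qed (simp add: g_def)
    have "(\<lambda>n. LINT \<phi>|lborel. indicator {0..2*pi} \<phi> *\<^sub>R (f \<phi> * of_real (g n (cis \<phi>)))) \<longlonglongrightarrow> (LINT \<phi>|lborel. indicator {0..2*pi} \<phi> *\<^sub>R (indicator C (cis \<phi>) *\<^sub>R f \<phi>))"
    proof (rule integral_dominated_convergence[where w = "\<lambda>\<phi>. cmod (indicator {0..2*pi} \<phi> *\<^sub>R f \<phi>)"])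
      have fm [measurable]: "(\<lambda>\<phi>. indicator {0..2*pi} \<phi> *\<^sub>R f \<phi>) \<in> borel_measurable lborel" using fi by (rule borel_measurable_integrable)
      have Cm [measurable]: "C \<in> sets borel" using C(1) by simp
      have cm: "(\<lambda>\<phi>. indicator C (cis \<phi>) :: real) \<in> borel_measurable lborel"
      proof -
        have "cis \<in> borel_measurable lborel" by (simp add: borel_measurable_continuous_onI continuous_on_cis)
        then show ?thesis by measurable
      qed
      have "(\<lambda>\<phi>. indicator C (cis \<phi>) *\<^sub>R (indicator {0..2*pi} \<phi> *\<^sub>R f \<phi>)) \<in> borel_measurable lborel"
        using cm fm by (rule borel_measurable_scaleR)
      then show "(\<lambda>\<phi>. indicator {0..2*pi} \<phi> *\<^sub>R (indicator C (cis \<phi>) *\<^sub>R f \<phi>)) \<in> borel_measurable lborel"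
        by (simp add: mult.commute)
      show "integrable lborel (\<lambda>\<phi>. cmod (indicator {0..2*pi} \<phi> *\<^sub>R f \<phi>))" using fi by (rule integrable_norm)
      show "AE \<phi> in lborel. (\<lambda>n. indicator {0..2*pi} \<phi> *\<^sub>R (f \<phi> * of_real (g n (cis \<phi>)))) \<longlonglongrightarrow> indicator {0..2*pi} \<phi> *\<^sub>R (indicator C (cis \<phi>) *\<^sub>R f \<phi>)"
      proof (rule AE_I2)
        fix \<phi>
        have "(\<lambda>n. indicator {0..2*pi} \<phi> *\<^sub>R (f \<phi> * of_real (g n (cis \<phi>)))) \<longlonglongrightarrow> indicator {0..2*pi} \<phi> *\<^sub>R (f \<phi> * of_real (indicator C (cis \<phi>)))"
          by (intro tendsto_intros lim)
        then show "(\<lambda>n. indicator {0..2*pi} \<phi> *\<^sub>R (f \<phi> * of_real (g n (cis \<phi>)))) \<longlonglongrightarrow> indicator {0..2*pi} \<phi> *\<^sub>R (indicator C (cis \<phi>) *\<^sub>R f \<phi>)"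
          by (simp add: scaleR_conv_of_real mult.commute)
      qed
      fix n
      have "set_integrable lborel {0..2*pi} (\<lambda>\<phi>. f \<phi> * of_real (g n (cis \<phi>)))"
        using f by (intro set_integrable_mult_continuous continuous_intros continuous_on_compose2[OF gc[of UNIV]]) (auto simp: zero_fourier_def)
      then show "(\<lambda>\<phi>. indicator {0..2*pi} \<phi> *\<^sub>R (f \<phi> * of_real (g n (cis \<phi>)))) \<in> borel_measurable lborel"
        unfolding set_integrable_def by (rule borel_measurable_integrable)
      have "\<bar>g n z\<bar> \<le> 1" for z by (auto simp: g_def infdist_nonneg)
      then show "AE \<phi> in lborel. norm (indicator {0..2*pi} \<phi> *\<^sub>R (f \<phi> * of_real (g n (cis \<phi>)))) \<le> cmod (indicator {0..2*pi} \<phi> *\<^sub>R f \<phi>)"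
        by (intro AE_I2) (auto simp: indicator_def norm_mult mult_left_le)
    qed
    moreover have "(LINT \<phi>|lborel. indicator {0..2*pi} \<phi> *\<^sub>R (f \<phi> * of_real (g n (cis \<phi>)))) = 0" for n
      using cont[OF gc[of ?S n]] by (simp add: set_lebesgue_integral_def)
    ultimately show ?thesis by (simp add: set_lebesgue_integral_def LIMSEQ_const_iff)
  qed
  have "AE \<phi> in lborel. indicator {0..2*pi} \<phi> *\<^sub>R f \<phi> = 0"
  proof (rule AE_eq_0_if_initial_integrals_0[OF fi])
    fix x :: real
    consider "x < 0" | "0 \<le> x" "x < 2 * pi" | "2 * pi \<le> x" by linarith
    then show "(LINT t:{..x}|lborel. indicator {0..2*pi} t *\<^sub>R f t) = 0"
    proof cases
      case 1
      have "(LINT t:{..x}|lborel. indicator {0..2*pi} t *\<^sub>R f t) = (LINT t|lborel. (0::real) *\<^sub>R f t)"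
        unfolding set_lebesgue_integral_def
        by (rule Bochner_Integration.integral_cong) (use 1 in \<open>auto simp: indicator_def\<close>)
      then show ?thesis by simp
    next
      case 2
      have "closed (cis ` {0..x})" by (rule compact_imp_closed[OF compact_continuous_image[OF _ compact_Icc]]) (intro continuous_intros)
      then have z: "(LINT \<phi>:{0..2*pi}|lborel. indicator (cis ` {0..x}) (cis \<phi>) *\<^sub>R f \<phi>) = 0" using 2 by (intro closed) auto
      have inj: "\<phi> \<le> x" if "cis \<phi> \<in> cis ` {0..x}" "0 \<le> \<phi>" "\<phi> < 2 * pi" for \<phi>
      proof -
        from that obtain \<psi> where p: "cis \<phi> = cis \<psi>" "0 \<le> \<psi>" "\<psi> \<le> x" by auto
        have "Arg2pi (cis \<phi>) = \<phi>"
          by (rule Arg2pi_unique[of 1]) (use that(2,3) in \<open>simp_all add: cis_conv_exp\<close>)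
        moreover have "Arg2pi (cis \<psi>) = \<psi>"
          by (rule Arg2pi_unique[of 1]) (use p(2,3) 2 in \<open>simp_all add: cis_conv_exp\<close>)
        ultimately show ?thesis using p(1,3) by metis
      qed
      have "(LINT t:{..x}|lborel. indicator {0..2*pi} t *\<^sub>R f t) = (LINT \<phi>:{0..2*pi}|lborel. indicator (cis ` {0..x}) (cis \<phi>) *\<^sub>R f \<phi>)"
        unfolding set_lebesgue_integral_def
      proof (rule integral_cong_AE)
        have fm: "(\<lambda>\<phi>. indicator {0..2*pi} \<phi> *\<^sub>R f \<phi>) \<in> borel_measurable lborel" using fi by (rule borel_measurable_integrable)
        show "(\<lambda>t. indicator {..x} t *\<^sub>R (indicator {0..2*pi} t *\<^sub>R f t)) \<in> borel_measurable lborel"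
          by (rule borel_measurable_scaleR[OF borel_measurable_indicator fm]) simp
        have "cis -` (cis ` {0..x}) \<in> sets borel"
          using \<open>closed (cis ` {0..x})\<close> by (rule borel_closed[OF closed_vimage]) (intro continuous_intros)
        then have "(\<lambda>\<phi>. indicator (cis -` (cis ` {0..x})) \<phi> *\<^sub>R (indicator {0..2*pi} \<phi> *\<^sub>R f \<phi>)) \<in> borel_measurable lborel"
          by (intro borel_measurable_scaleR[OF borel_measurable_indicator fm]) simp
        then show "(\<lambda>\<phi>. indicator {0..2*pi} \<phi> *\<^sub>R (indicator (cis ` {0..x}) (cis \<phi>) *\<^sub>R f \<phi>)) \<in> borel_measurable lborel"
          by (simp add: mult.commute indicator_def)
        show "AE t in lborel. indicator {..x} t *\<^sub>R (indicator {0..2*pi} t *\<^sub>R f t) = indicator {0..2*pi} t *\<^sub>R (indicator (cis ` {0..x}) (cis t) *\<^sub>R f t)"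
          using AE_lborel_singleton[of "2*pi"]
        proof eventually_elim
          case (elim t)
          show ?case
          proof (cases "t \<in> {0..2*pi}")
            case True
            have "t \<le> x" if "cis t \<in> cis ` {0..x}" by (rule inj[OF that]) (use True elim in auto)
            moreover have "cis t \<in> cis ` {0..x}" if "t \<le> x" using that True by (intro imageI) auto
            ultimately have "cis t \<in> cis ` {0..x} \<longleftrightarrow> t \<le> x" by blast
            then show ?thesis using True by (auto simp: indicator_def)
          qed simp
        qed
      qed
      then show ?thesis using z by simp
    next
      case 3
      have "(LINT t:{..x}|lborel. indicator {0..2*pi} t *\<^sub>R f t) = (LINT t:{0..2*pi}|lborel. f t)"
        unfolding set_lebesgue_integral_def
        by (rule Bochner_Integration.integral_cong) (use 3 in \<open>auto simp: indicator_def\<close>)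
      also have "\<dots> = (LINT t:{0..2*pi}|lborel. f t * exp (- \<i> * of_int 0 * of_real t))" by simp
      also have "\<dots> = 0" using f unfolding zero_fourier_def by blast
      finally show ?thesis .
    qed
  qed
  then show ?thesis by eventually_elim auto
qed

section \<open>Uniqueness for the boundary value problem\<close>

text \<open>The test function is \<open>\<eta>(z) = G(|z|) z\<^sup>m\<close> with \<open>G\<close> the primitive of \<open>p\<close>; as \<open>p\<close> has integral \<open>0\<close>, its support
is compact. Only the radial factor contributes to the derivative with respect to \<open>cnj z\<close>.\<close>

lemma radial_test:
  fixes p :: "real \<Rightarrow> real" and m :: int
  assumes r0: "0 < r0" and cd: "r0 < c" "c < d" and p: "continuous_on UNIV p"
    and supp: "\<And>r. r \<notin> {c..d} \<Longrightarrow> p r = 0" and int: "integral {c..d} p = 0"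
  obtains \<eta> a where "wirtinger_test (disc_exterior r0) \<eta> a (\<lambda>z. of_real (p (cmod z) / (2 * cmod z)) * z powi (m + 1))"
proof -
  define G where "G r = integral {0..r} p" for r
  have pc: "continuous_on S p" for S using p by (rule continuous_on_subset) simp
  have pint: "p integrable_on {x..y}" for x y by (rule integrable_continuous_real[OF pc])
  have dG: "(G has_real_derivative p r) (at r)" if "0 < r" for r
  proof -
    have "(G has_real_derivative p r) (at r within {0..r + 1})"
      unfolding G_def[abs_def] by (rule integral_has_real_derivative[OF pc]) (use that in auto)
    then show ?thesis using that by (simp add: at_within_Icc_at)
  qed
  have G1: "G r = 0" if "r \<le> c" for r
  proof -
    have "p x = 0" if "x \<in> {0..r} - {c}" for x using that \<open>r \<le> c\<close> by (intro supp) auto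
    then have "(p has_integral 0) {0..r}" by (intro has_integral_spike_finite[of "{c}" _ p "\<lambda>_. 0"]) auto
    then show ?thesis by (simp add: G_def integral_unique)
  qed
  have G2: "G r = 0" if "d \<le> r" for r
  proof -
    have "p x = 0" if "x \<in> {d..r} - {d}" for x using that by (intro supp) auto
    then have "(p has_integral 0) {d..r}" by (intro has_integral_spike_finite[of "{d}" _ p "\<lambda>_. 0"]) auto
    then have "integral {d..r} p = 0" by (rule integral_unique)
    moreover have "integral {0..c} p + integral {c..d} p = integral {0..d} p"
      using cd r0 by (intro Henstock_Kurzweil_Integration.integral_combine pint) auto
    moreover have "integral {0..d} p + integral {d..r} p = integral {0..r} p"
      using cd r0 that by (intro Henstock_Kurzweil_Integration.integral_combine pint) auto
    ultimately show ?thesis using G1[of c] int by (simp add: G_def)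
  qed
  define \<eta> where "\<eta> z = of_real (G (cmod z)) * z powi m" for z :: complex
  define a where "a z = of_real (p (cmod z) / (2 * cmod z)) * cnj z * z powi m + of_real (G (cmod z)) * (of_int m * z powi (m - 1))" for z :: complex
  define b where "b z = of_real (p (cmod z) / (2 * cmod z)) * z powi (m + 1)" for z :: complex
  have pz: "p x = 0" if "x < c" for x using that by (intro supp) auto
  have near0: "\<eta> z = 0 \<and> a z = 0 \<and> b z = 0" if "z \<in> ball 0 c" for z
    using that by (simp add: \<eta>_def a_def b_def pz G1)
  have un: "- {0} \<union> ball (0::complex) c = UNIV" using cd r0 by auto
  have dGn: "((\<lambda>z. G (cmod z)) has_derivative (\<lambda>h. (h \<bullet> sgn z) * p (cmod z))) (at z)" if "z \<noteq> 0" for z :: complex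
  proof -
    have "((\<lambda>z. cmod z) has_derivative (\<lambda>h. h \<bullet> sgn z)) (at z)" using GDERIV_norm[OF that] by (simp add: gderiv_def)
    from has_derivative_compose[OF this dG[of "cmod z", unfolded has_field_derivative_def]] that
    show ?thesis by (simp add: mult.commute)
  qed
  have Gc: "continuous_on (- {0}) (\<lambda>z::complex. G (cmod z))"
    by (intro continuous_at_imp_continuous_on ballI has_derivative_continuous[OF dGn]) auto
  have der: "(\<eta> has_derivative (\<lambda>h. a z * h + b z * cnj h)) (at z)" for z
  proof (cases "z = 0")
    case True
    then have z: "z \<in> ball 0 c" using cd r0 by simp
    have "((\<lambda>_. 0) has_derivative (\<lambda>h. a z * h + b z * cnj h)) (at z)" using near0[OF z] by simp
    then show ?thesis by (rule has_derivative_transform_within_open[OF _ open_ball z]) (use near0 in auto)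
  next
    case False
    have "((\<lambda>z. z powi m) has_field_derivative of_int m * z powi (m - 1) * 1) (at z)"
      by (rule DERIV_power_int[OF DERIV_ident]) (use False in simp)
    then have pw: "((\<lambda>z. z powi m) has_derivative (\<lambda>h. of_int m * z powi (m - 1) * h)) (at z)"
      by (simp add: has_field_derivative_def)
    from has_derivative_mult[OF has_derivative_of_real[OF dGn[OF False]] pw]
    have "(\<eta> has_derivative (\<lambda>h. of_real (G (cmod z)) * (of_int m * z powi (m - 1) * h) + of_real ((h \<bullet> sgn z) * p (cmod z)) * z powi m)) (at z)"
      by (simp add: \<eta>_def[abs_def])
    then show ?thesis
    proof (rule has_derivative_eq_rhs)
      have s: "of_real (h \<bullet> sgn z) = (cnj z * h + z * cnj h) / of_real (2 * cmod z)" for h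
        using False by (simp add: inner_complex_def sgn_div_norm complex_eq_iff field_simps)
      have "z powi (m + 1) = z * z powi m" using False by (simp add: power_int_add)
      then show "(\<lambda>h. of_real (G (cmod z)) * (of_int m * z powi (m - 1) * h) + of_real ((h \<bullet> sgn z) * p (cmod z)) * z powi m) = (\<lambda>h. a z * h + b z * cnj h)"
        unfolding of_real_mult s a_def b_def using False by (auto simp: fun_eq_iff field_simps)
    qed
  qed
  have c1: "continuous_on (- {0}) a" unfolding a_def
    by (intro continuous_intros Gc continuous_on_compose2[OF p]) auto
  have c2: "continuous_on (- {0}) b" unfolding b_def
    by (intro continuous_intros continuous_on_compose2[OF p]) auto
  have c3: "continuous_on (ball 0 c) a" "continuous_on (ball 0 c) b"
    using near0 by (auto intro!: continuous_on_eq[OF continuous_on_const[of _ 0]])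
  have "continuous_on UNIV a" "continuous_on UNIV b"
    using continuous_on_open_Un[OF _ open_ball c1 c3(1)] continuous_on_open_Un[OF _ open_ball c2 c3(2)] un by (simp_all add: open_Compl)
  moreover have "\<exists>K. compact K \<and> K \<subseteq> disc_exterior r0 \<and> (\<forall>x. x \<notin> K \<longrightarrow> \<eta> x = 0)"
  proof (intro exI conjI)
    have "closed {z::complex. c \<le> cmod z}" by (intro closed_Collect_le continuous_intros)
    then show "compact (cball 0 d \<inter> {z::complex. c \<le> cmod z})" by (intro compact_Int_closed) auto
    show "cball 0 d \<inter> {z. c \<le> cmod z} \<subseteq> disc_exterior r0" using cd by (auto simp: disc_exterior_def)
    show "\<forall>x. x \<notin> cball 0 d \<inter> {z. c \<le> cmod z} \<longrightarrow> \<eta> x = 0" using G1 G2 by (auto simp: \<eta>_def)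
  qed
  ultimately have "wirtinger_test (disc_exterior r0) \<eta> a b" using der by (simp add: wirtinger_test_def)
  then show ?thesis using that unfolding b_def[abs_def] by blast
qed

context
  fixes U :: "complex \<Rightarrow> complex" and r0 :: real
  assumes r0: "0 < r0" and Um [measurable]: "U \<in> borel_measurable borel"
    and Ui: "\<And>K. compact K \<Longrightarrow> K \<subseteq> disc_exterior r0 \<Longrightarrow> set_integrable lborel K U"
    and weak: "\<And>\<eta> a b. wirtinger_test (disc_exterior r0) \<eta> a b \<Longrightarrow> (LINT \<zeta>|lborel. b \<zeta> * U \<zeta>) = 0"
    and trace: "((\<lambda>\<delta>. (\<integral>\<^sup>+\<zeta>\<in>annulus r0 (r0 + \<delta>). ennreal (cmod (U \<zeta>)) \<partial>lborel) / ennreal \<delta>) \<longlongrightarrow> 0) (at_right 0)"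
begin

text \<open>For \<open>U\<close> holomorphic this is a constant function of the radius, namely \<open>2 \<pi>\<close> times a Laurent coefficient.\<close>

private definition D :: "int \<Rightarrow> real \<Rightarrow> complex" where
  "D k r = of_real (r powi (- k)) * circle_coeff U k r"

private lemma ring_integrable:
  assumes "r0 < c"
  shows "integrable lborel (\<lambda>z. indicator {z. c \<le> cmod z \<and> cmod z \<le> d} z *\<^sub>R U z)"
proof -
  have "closed {z::complex. c \<le> cmod z}" by (intro closed_Collect_le continuous_intros)
  then have "compact (cball 0 d \<inter> {z::complex. c \<le> cmod z})" by (intro compact_Int_closed) auto
  moreover have "cball 0 d \<inter> {z::complex. c \<le> cmod z} \<subseteq> disc_exterior r0" using assms by (auto simp: disc_exterior_def)
  ultimately have "set_integrable lborel (cball 0 d \<inter> {z::complex. c \<le> cmod z}) U" by (rule Ui)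
  moreover have "cball 0 d \<inter> {z::complex. c \<le> cmod z} = {z. c \<le> cmod z \<and> cmod z \<le> d}" by auto
  ultimately show ?thesis by (simp add: set_integrable_def)
qed

private lemma circle_coeff_ring:
  "r \<in> {c..d} \<Longrightarrow> 0 < r \<Longrightarrow> circle_coeff (\<lambda>z. indicator {z. c \<le> cmod z \<and> cmod z \<le> d} z *\<^sub>R U z) k r = circle_coeff U k r"
  by (simp add: circle_coeff_def)

private lemma D_integrable:
  assumes c: "r0 < c"
  shows "set_integrable lborel {c..d} (D k)"
proof (cases "c \<le> d")
  case True
  have c0: "0 < c" using r0 c by simp
  have "continuous_on {c..d} (\<lambda>x. x powi (- k))" using c0 by (intro continuous_intros) auto
  from compact_imp_bounded[OF compact_continuous_image[OF this compact_Icc]]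
  obtain B where "\<forall>x\<in>(\<lambda>x. x powi (- k)) ` {c..d}. norm x \<le> B" unfolding bounded_iff by blast
  then have B: "\<And>x. x \<in> {c..d} \<Longrightarrow> \<bar>x powi (- k)\<bar> \<le> B" by auto
  have "set_integrable lborel {c..d} (\<lambda>s. of_real (s powi (- k + 1)) * circle_coeff (\<lambda>z. indicator {z. c \<le> cmod z \<and> cmod z \<le> d} z *\<^sub>R U z) (- (- k)) s)"
  proof (rule radial_integral(2)[OF ring_integrable[OF c]])
    show "cmod \<xi> powi (- k) \<le> B" if "cmod \<xi> \<in> {c..d}" for \<xi> :: complex using B[OF that] by linarith
  qed (use c0 in auto)
  then have "set_integrable lborel {c..d} (\<lambda>s. of_real (s powi (- k + 1)) * circle_coeff U k s)"
    by (rule set_integrable_cong[THEN iffD1, rotated -1]) (use circle_coeff_ring[of _ c d k] c0 in auto)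
  then have "set_integrable lborel {c..d} (\<lambda>s. of_real (s powi (- k + 1)) * circle_coeff U k s * of_real (inverse s))"
    by (rule set_integrable_mult_continuous) (use c0 in \<open>auto intro!: continuous_intros\<close>)
  then show ?thesis
  proof (rule set_integrable_cong[THEN iffD1, rotated -1])
    fix s assume "s \<in> {c..d}"
    then have s0: "s \<noteq> 0" using c0 by auto
    have "s powi (- k + 1) = s powi (- k) * s powi 1" by (rule power_int_add) (use s0 in simp)
    then have "s powi (- k + 1) * inverse s = s powi (- k)" using s0 by simp
    then show "of_real (s powi (- k + 1)) * circle_coeff U k s * of_real (inverse s) = D k s"
      unfolding D_def by (metis (no_types, lifting) mult.assoc mult.commute of_real_mult)
  qed auto
qed (simp add: set_integrable_def)

text \<open>The weak form of \<open>D k\<close> being constant. It is the homogeneous equation, tested with the functions of \<open>radial_test\<close> and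
written in polar coordinates.\<close>

private lemma D_test:
  assumes c: "r0 < c" "c < d" and p: "continuous_on UNIV p" and supp: "\<And>r. r \<notin> {c..d} \<Longrightarrow> p r = 0" and int: "integral {c..d} p = 0"
  shows "(LINT r:{c..d}|lborel. D k r * of_real (p r)) = 0"
proof -
  have c0: "0 < c" using r0 c by simp
  define b where "b z = of_real (p (cmod z) / (2 * cmod z)) * z powi (- k)" for z :: complex
  obtain \<eta> a where t: "wirtinger_test (disc_exterior r0) \<eta> a b"
    using radial_test[OF r0 c p supp int, of "- k - 1"] unfolding b_def[abs_def] by auto
  have cb: "continuous_on UNIV b" using t by (simp add: wirtinger_test_def)
  then have bm [measurable]: "b \<in> borel_measurable borel" by (rule borel_measurable_continuous_onI)
  have "bounded (b ` cball 0 d)" using cb by (intro compact_imp_bounded compact_continuous_image) (auto intro: continuous_on_subset)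
  then obtain B where "\<forall>x\<in>b ` cball 0 d. cmod x \<le> B" by (auto simp: bounded_iff)
  then have B: "cmod (b z) \<le> B" if "cmod z \<le> d" for z using that by auto
  have b0: "b z = 0" if "cmod z \<notin> {c..d}" for z using supp[OF that] by (simp add: b_def)
  have fi: "integrable lborel (\<lambda>z. b z * U z)"
  proof (rule Bochner_Integration.integrable_bound[of _ "\<lambda>z. B * cmod (indicator {z. c \<le> cmod z \<and> cmod z \<le> d} z *\<^sub>R U z)"])
    show "integrable lborel (\<lambda>z. B * cmod (indicator {z. c \<le> cmod z \<and> cmod z \<le> d} z *\<^sub>R U z))"
      by (intro integrable_mult_right integrable_norm ring_integrable c)
    show "AE z in lborel. norm (b z * U z) \<le> norm (B * cmod (indicator {z. c \<le> cmod z \<and> cmod z \<le> d} z *\<^sub>R U z))"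
    proof (rule AE_I2)
      fix z
      show "norm (b z * U z) \<le> norm (B * cmod (indicator {z. c \<le> cmod z \<and> cmod z \<le> d} z *\<^sub>R U z))"
      proof (cases "cmod z \<in> {c..d}")
        case True
        then have "cmod (b z) * cmod (U z) \<le> \<bar>B\<bar> * cmod (U z)" using B[of z] by (intro mult_right_mono) auto
        then show ?thesis using True by (simp add: norm_mult abs_mult)
      qed (simp add: b0)
    qed
  qed measurable
  have circ: "r *\<^sub>R (LINT \<phi>:{0..2*pi}|lborel. b (rcis r \<phi>) * U (rcis r \<phi>)) = 1/2 * (D k r * of_real (p r))" if "0 < r" for r
  proof -
    have e: "b (rcis r \<phi>) * U (rcis r \<phi>) = of_real (p r / (2 * r) * r powi (- k)) * (U (rcis r \<phi>) * exp (- \<i> * of_int k * of_real \<phi>))" for \<phi>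
      using that by (simp add: b_def rcis_power_int mult_ac)
    have "r *\<^sub>R (LINT \<phi>:{0..2*pi}|lborel. b (rcis r \<phi>) * U (rcis r \<phi>)) = r *\<^sub>R (of_real (p r / (2 * r) * r powi (- k)) * circle_coeff U k r)"
      unfolding e set_integral_mult_right circle_coeff_def ..
    then show ?thesis using that by (simp add: D_def scaleR_conv_of_real)
  qed
  have "0 = (LINT z|lborel. b z * U z)" using weak[OF t] by simp
  also have "\<dots> = (LINT r:{0<..}|lborel. r *\<^sub>R (LINT \<phi>:{0..2*pi}|lborel. b (rcis r \<phi>) * U (rcis r \<phi>)))"
    by (rule integral_polar(3)[OF _ fi]) measurable
  also have "\<dots> = (LINT r:{c..d}|lborel. 1/2 * (D k r * of_real (p r)))"
    unfolding set_lebesgue_integral_def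
  proof (rule Bochner_Integration.integral_cong[OF refl])
    fix r
    show "indicator {0<..} r *\<^sub>R r *\<^sub>R (LINT x|lborel. indicator {0..2*pi} x *\<^sub>R (b (rcis r x) * U (rcis r x))) = indicator {c..d} r *\<^sub>R (1/2 * (D k r * of_real (p r)))"
      using circ[of r, unfolded set_lebesgue_integral_def] supp[of r] c0 by (cases "0 < r") (auto simp: indicator_def)
  qed
  finally show ?thesis by simp
qed

text \<open>A tent of height \<open>1\<close> centred at \<open>r0 + \<delta>/2\<close>, supported where \<open>r - r0\<close> is between \<open>\<delta>/4\<close> and \<open>3\<delta>/4\<close>.\<close>

private definition hat :: "real \<Rightarrow> real \<Rightarrow> real" where "hat \<delta> r = max 0 (1 - 4 * \<bar>(r - r0) / \<delta> - 1/2\<bar>)"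

private lemma hat_props:
  assumes d: "0 < \<delta>"
  shows "continuous_on UNIV (hat \<delta>)" "0 \<le> hat \<delta> r" "hat \<delta> r \<le> 1" "r \<notin> {r0 + \<delta>/4..r0 + \<delta>} \<Longrightarrow> hat \<delta> r = 0"
    "\<delta> / 8 \<le> integral {r0 + \<delta>/4..r0 + \<delta>} (hat \<delta>)"
proof -
  show c: "continuous_on UNIV (hat \<delta>)" unfolding hat_def[abs_def] using d by (intro continuous_intros) auto
  show "0 \<le> hat \<delta> r" "hat \<delta> r \<le> 1" for r by (auto simp: hat_def)
  show "hat \<delta> r = 0" if "r \<notin> {r0 + \<delta>/4..r0 + \<delta>}" for r
  proof -
    have "(r - r0) / \<delta> < 1/4 \<or> 1 < (r - r0) / \<delta>" using that d by (auto simp: field_simps)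
    then have "1/4 \<le> \<bar>(r - r0) / \<delta> - 1/2\<bar>" by linarith
    moreover have "1 - 4 * u \<le> 0" if "1/4 \<le> u" for u :: real using that by linarith
    ultimately have "1 - 4 * \<bar>(r - r0) / \<delta> - 1/2\<bar> \<le> 0" by blast
    then show ?thesis unfolding hat_def by (rule max_absorb1)
  qed
  have ci: "hat \<delta> integrable_on {x..y}" for x y by (rule integrable_continuous_real[OF continuous_on_subset[OF c]]) simp
  have "\<delta> / 8 = integral {r0 + 3/8 * \<delta>..r0 + 5/8 * \<delta>} (\<lambda>_. 1/2)" using d by simp
  also have "\<dots> \<le> integral {r0 + 3/8 * \<delta>..r0 + 5/8 * \<delta>} (hat \<delta>)"
  proof (rule integral_le)
    fix x assume "x \<in> {r0 + 3/8 * \<delta>..r0 + 5/8 * \<delta>}"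
    then have "3/8 \<le> (x - r0) / \<delta>" "(x - r0) / \<delta> \<le> 5/8" using d by (auto simp: field_simps)
    moreover have "1/2 \<le> max 0 (1 - 4 * \<bar>u - 1/2\<bar>)" if "3/8 \<le> u" "u \<le> 5/8" for u :: real
      using that by (auto simp: abs_if)
    ultimately show "1/2 \<le> hat \<delta> x" unfolding hat_def by blast
  qed (auto intro: ci)
  also have "\<dots> \<le> integral {r0 + \<delta>/4..r0 + \<delta>} (hat \<delta>)"
    by (rule integral_subset_le) (use d ci in \<open>auto simp: hat_def\<close>)
  finally show "\<delta> / 8 \<le> integral {r0 + \<delta>/4..r0 + \<delta>} (hat \<delta>)" .
qed

text \<open>This is where the boundary condition enters: near the circle, the integral of \<open>D k\<close> against the tent is controlled by
the integral of \<open>|U|\<close> over the annulus.\<close>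

private lemma D_near_boundary:
  "\<exists>C\<ge>0. \<forall>\<delta>. 0 < \<delta> \<and> \<delta> < 1 \<longrightarrow> ennreal (cmod (LINT r:{r0 + \<delta>/4..r0 + \<delta>}|lborel. D k r * of_real (hat \<delta> r)))
      \<le> ennreal C * (\<integral>\<^sup>+\<zeta>\<in>annulus r0 (r0 + \<delta>). ennreal (cmod (U \<zeta>)) \<partial>lborel)"
proof -
  have "continuous_on {r0..r0+1} (\<lambda>x. x powi (- k - 1))" using r0 by (intro continuous_intros) auto
  from compact_imp_bounded[OF compact_continuous_image[OF this compact_Icc]]
  obtain C where "\<forall>x\<in>(\<lambda>x. x powi (- k - 1)) ` {r0..r0+1}. norm x \<le> C" unfolding bounded_iff by blast
  then have C: "\<And>x. x \<in> {r0..r0+1} \<Longrightarrow> \<bar>x powi (- k - 1)\<bar> \<le> C" by auto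
  have C0: "C \<ge> 0" using C[of r0] by auto
  have pw: "x powi (- k) \<le> C * x" if "x \<in> {r0..r0+1}" for x
  proof -
    have "x powi (- k - 1 + 1) = x powi (- k - 1) * x" using that r0 by (subst power_int_add) auto
    then have "x powi (- k) = x powi (- k - 1) * x" by simp
    also have "\<dots> \<le> C * x" using C[OF that] that r0 by (intro mult_right_mono) auto
    finally show ?thesis .
  qed
  show ?thesis
  proof (intro exI[of _ C] conjI allI impI C0)
    fix \<delta> :: real assume d: "0 < \<delta> \<and> \<delta> < 1"
    have hc: "continuous_on {r0 + \<delta>/4..r0 + \<delta>} (\<lambda>r. complex_of_real (hat \<delta> r))"
      using hat_props(1)[of \<delta>] d by (intro continuous_intros) (auto intro: continuous_on_subset)
    have i: "set_integrable lborel {r0 + \<delta>/4..r0 + \<delta>} (\<lambda>r. D k r * of_real (hat \<delta> r))"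
      by (rule set_integrable_mult_continuous[OF D_integrable hc]) (use d in simp)
    have "ennreal (cmod (LINT r:{r0 + \<delta>/4..r0 + \<delta>}|lborel. D k r * of_real (hat \<delta> r)))
       \<le> (\<integral>\<^sup>+r. ennreal (cmod (indicator {r0 + \<delta>/4..r0 + \<delta>} r *\<^sub>R (D k r * of_real (hat \<delta> r)))) \<partial>lborel)"
      using i unfolding set_lebesgue_integral_def set_integrable_def by (rule integral_norm_bound_ennreal)
    also have "\<dots> \<le> (\<integral>\<^sup>+r. ennreal C * (ennreal r * (\<integral>\<^sup>+\<phi>\<in>{0..2*pi}. (ennreal (cmod (U (rcis r \<phi>))) * indicator (annulus r0 (r0 + \<delta>)) (rcis r \<phi>)) \<partial>lborel) * indicator {0<..} r) \<partial>lborel)"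
    proof (rule nn_integral_mono_AE, use AE_lborel_singleton[of "r0 + \<delta>"] in eventually_elim)
      case (elim r)
      show ?case
      proof (cases "r \<in> {r0 + \<delta>/4..r0 + \<delta>}")
        case True
        then have r: "r0 < r" "r < r0 + \<delta>" "r \<in> {r0..r0+1}" "0 < r" using d elim r0 by auto
        have "ennreal (cmod (circle_coeff U k r)) \<le> (\<integral>\<^sup>+\<phi>\<in>{0..2*pi}. ennreal (cmod (U (rcis r \<phi>))) \<partial>lborel)"
        proof (cases "set_integrable lborel {0..2*pi} (\<lambda>\<phi>. U (rcis r \<phi>) * exp (- \<i> * of_int k * of_real \<phi>))")
          case True
          have "ennreal (cmod (circle_coeff U k r)) \<le> (\<integral>\<^sup>+\<phi>. ennreal (cmod (indicator {0..2*pi} \<phi> *\<^sub>R (U (rcis r \<phi>) * exp (- \<i> * of_int k * of_real \<phi>)))) \<partial>lborel)"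
            unfolding circle_coeff_def set_lebesgue_integral_def
            by (rule integral_norm_bound_ennreal[OF True[unfolded set_integrable_def]])
          also have "\<dots> = (\<integral>\<^sup>+\<phi>\<in>{0..2*pi}. ennreal (cmod (U (rcis r \<phi>))) \<partial>lborel)"
            by (rule nn_integral_cong) (auto simp: indicator_def norm_mult)
          finally show ?thesis .
        next
          case False
          then show ?thesis unfolding circle_coeff_def set_lebesgue_integral_def set_integrable_def by (simp add: not_integrable_integral_eq)
        qed
        also have "\<dots> = (\<integral>\<^sup>+\<phi>\<in>{0..2*pi}. (ennreal (cmod (U (rcis r \<phi>))) * indicator (annulus r0 (r0 + \<delta>)) (rcis r \<phi>)) \<partial>lborel)"
          by (rule nn_integral_cong) (use r in \<open>auto simp: annulus_def\<close>)
        finally have le: "ennreal (cmod (circle_coeff U k r)) \<le> (\<integral>\<^sup>+\<phi>\<in>{0..2*pi}. (ennreal (cmod (U (rcis r \<phi>))) * indicator (annulus r0 (r0 + \<delta>)) (rcis r \<phi>)) \<partial>lborel)" .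
        have "cmod (D k r * of_real (hat \<delta> r)) \<le> (C * r) * cmod (circle_coeff U k r)"
        proof -
          have "cmod (D k r * of_real (hat \<delta> r)) \<le> cmod (D k r) * 1"
            using hat_props(2,3)[of \<delta> r] d unfolding norm_mult by (intro mult_left_mono) auto
          also have "\<dots> = r powi (- k) * cmod (circle_coeff U k r)" using r by (simp add: D_def norm_mult norm_power_int)
          also have "\<dots> \<le> (C * r) * cmod (circle_coeff U k r)" by (intro mult_right_mono pw r) simp
          finally show ?thesis .
        qed
        then have "ennreal (cmod (D k r * of_real (hat \<delta> r))) \<le> ennreal C * (ennreal r * ennreal (cmod (circle_coeff U k r)))"
          using C0 r by (simp add: ennreal_mult[symmetric] mult.assoc ennreal_leI)
        also have "\<dots> \<le> ennreal C * (ennreal r * (\<integral>\<^sup>+\<phi>\<in>{0..2*pi}. (ennreal (cmod (U (rcis r \<phi>))) * indicator (annulus r0 (r0 + \<delta>)) (rcis r \<phi>)) \<partial>lborel))"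
          by (rule mult_left_mono[OF mult_left_mono[OF le]]) auto
        finally show ?thesis using True r by simp
      qed simp
    qed
    also have "\<dots> = ennreal C * (\<integral>\<^sup>+\<zeta>\<in>annulus r0 (r0 + \<delta>). ennreal (cmod (U \<zeta>)) \<partial>lborel)"
      by (subst nn_integral_polar[of "\<lambda>z. ennreal (cmod (U z)) * indicator (annulus r0 (r0 + \<delta>)) z"], measurable, rule nn_integral_cmult) measurable
    finally show "ennreal (cmod (LINT r:{r0 + \<delta>/4..r0 + \<delta>}|lborel. D k r * of_real (hat \<delta> r)))
      \<le> ennreal C * (\<integral>\<^sup>+\<zeta>\<in>annulus r0 (r0 + \<delta>). ennreal (cmod (U \<zeta>)) \<partial>lborel)" .
  qed
qed

text \<open>Subtracting from \<open>t\<close> a multiple \<open>q\<close> of the tent gives a function with integral \<open>0\<close>, which \<open>D k\<close> annihilates. The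
multiple grows at most like \<open>1/\<delta>\<close>, and the trace condition says precisely that the integral of \<open>|U|\<close> over the annulus is of
smaller order than \<open>\<delta>\<close>.\<close>

private lemma D_test_compact_support:
  assumes c: "r0 < c" "c < d" and t: "continuous_on UNIV t" and supp: "\<And>r. r \<notin> {c..d} \<Longrightarrow> t r = 0"
  shows "(LINT r:{c..d}|lborel. D k r * of_real (t r)) = 0"
proof -
  define T where "T = \<bar>integral {c..d} t\<bar>"
  obtain C where C: "C \<ge> 0" "\<And>\<delta>. 0 < \<delta> \<Longrightarrow> \<delta> < 1 \<Longrightarrow> ennreal (cmod (LINT r:{r0 + \<delta>/4..r0 + \<delta>}|lborel. D k r * of_real (hat \<delta> r)))
      \<le> ennreal C * (\<integral>\<^sup>+\<zeta>\<in>annulus r0 (r0 + \<delta>). ennreal (cmod (U \<zeta>)) \<partial>lborel)" using D_near_boundary[of k] by blast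
  have le: "ennreal (cmod (LINT r:{c..d}|lborel. D k r * of_real (t r))) \<le> ennreal (8 * T * C) * ((\<integral>\<^sup>+\<zeta>\<in>annulus r0 (r0 + \<delta>). ennreal (cmod (U \<zeta>)) \<partial>lborel) / ennreal \<delta>)"
    if dl: "0 < \<delta>" "\<delta> < 1" "r0 + \<delta> < c" for \<delta>
  proof -
    define A where "A = integral {r0 + \<delta>/4..r0 + \<delta>} (hat \<delta>)"
    define q where "q = integral {c..d} t / A"
    have A: "\<delta> / 8 \<le> A" "0 < A" using hat_props(5)[OF dl(1)] dl(1) by (auto simp: A_def)
    define p where "p r = t r - q * hat \<delta> r" for r
    let ?c = "r0 + \<delta>/4"
    note h = hat_props[OF dl(1)]
    have ti: "t integrable_on {x..y}" for x y by (rule integrable_continuous_real[OF continuous_on_subset[OF t]]) simp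
    have hi: "hat \<delta> integrable_on {x..y}" for x y by (rule integrable_continuous_real[OF continuous_on_subset[OF h(1)]]) simp
    have sub: "{c..d} \<subseteq> {?c..d}" "{?c..r0 + \<delta>} \<subseteq> {?c..d}" using dl c by auto
    have It: "integral {?c..d} t = integral {c..d} t"
      by (rule integral_unique[OF has_integral_on_superset[OF integrable_integral[OF ti] supp sub(1)]])
    have Ih: "integral {?c..d} (hat \<delta>) = A" unfolding A_def
      by (rule integral_unique[OF has_integral_on_superset[OF integrable_integral[OF hi] h(4) sub(2)]])
    have pz: "(LINT r:{?c..d}|lborel. D k r * of_real (p r)) = 0"
    proof (rule D_test)
      show "continuous_on UNIV p" unfolding p_def[abs_def] by (intro continuous_intros t h(1))
      show "p r = 0" if "r \<notin> {?c..d}" for r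
      proof -
        have "r \<notin> {c..d}" "r \<notin> {?c..r0 + \<delta>}" using that sub by auto
        then show ?thesis using supp h(4) by (simp add: p_def)
      qed
      have "integral {?c..d} p = integral {?c..d} t - q * integral {?c..d} (hat \<delta>)"
      proof -
        have "(\<lambda>r. q * hat \<delta> r) integrable_on {?c..d}"
          by (intro integrable_continuous_real continuous_intros continuous_on_subset[OF h(1)]) simp
        then show ?thesis unfolding p_def[abs_def] by (subst Henstock_Kurzweil_Integration.integral_diff[OF ti]) simp_all
      qed
      then show "integral {?c..d} p = 0" using It Ih A by (simp add: q_def)
    qed (use dl c in auto)
    have Di: "set_integrable lborel {?c..d} (D k)" by (rule D_integrable) (use dl in simp)
    have i1: "set_integrable lborel {?c..d} (\<lambda>r. D k r * of_real (t r))"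
      by (rule set_integrable_mult_continuous[OF Di]) (intro continuous_intros continuous_on_subset[OF t], simp)
    have i2: "set_integrable lborel {?c..d} (\<lambda>r. of_real q * (D k r * of_real (hat \<delta> r)))"
      by (rule set_integrable_mult_right, rule set_integrable_mult_continuous[OF Di]) (intro continuous_intros continuous_on_subset[OF h(1)], simp)
    have "(LINT r:{?c..d}|lborel. D k r * of_real (t r)) - (LINT r:{?c..d}|lborel. of_real q * (D k r * of_real (hat \<delta> r))) = (LINT r:{?c..d}|lborel. D k r * of_real (p r))"
      unfolding set_integral_diff(2)[OF i1 i2, symmetric] by (simp add: p_def algebra_simps)
    then have e: "(LINT r:{?c..d}|lborel. D k r * of_real (t r)) = of_real q * (LINT r:{?c..d}|lborel. D k r * of_real (hat \<delta> r))"
      using pz by (simp only: set_integral_mult_right right_minus_eq)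
    have e1: "(LINT r:{?c..d}|lborel. D k r * of_real (t r)) = (LINT r:{c..d}|lborel. D k r * of_real (t r))"
      unfolding set_lebesgue_integral_def using sub(1) supp by (intro Bochner_Integration.integral_cong) (auto simp: indicator_def)
    have e2: "(LINT r:{?c..d}|lborel. D k r * of_real (hat \<delta> r)) = (LINT r:{?c..r0+\<delta>}|lborel. D k r * of_real (hat \<delta> r))"
      unfolding set_lebesgue_integral_def using sub(2) h(4) by (intro Bochner_Integration.integral_cong) (auto simp: indicator_def)
    have "\<bar>q\<bar> = T / A" using A by (simp add: q_def T_def)
    also have "\<dots> \<le> T / (\<delta> / 8)" using A dl by (intro divide_left_mono) (auto simp: T_def)
    finally have q: "\<bar>q\<bar> \<le> 8 * T / \<delta>" by (simp add: mult.commute)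
    have T0: "T \<ge> 0" by (simp add: T_def)
    have "ennreal (cmod (LINT r:{c..d}|lborel. D k r * of_real (t r))) = ennreal (\<bar>q\<bar> * cmod (LINT r:{?c..r0+\<delta>}|lborel. D k r * of_real (hat \<delta> r)))"
      using e e1 e2 by (simp add: norm_mult)
    also have "\<dots> = ennreal \<bar>q\<bar> * ennreal (cmod (LINT r:{?c..r0+\<delta>}|lborel. D k r * of_real (hat \<delta> r)))" by (simp add: ennreal_mult)
    also have "\<dots> \<le> ennreal (8 * T / \<delta>) * (ennreal C * (\<integral>\<^sup>+\<zeta>\<in>annulus r0 (r0 + \<delta>). ennreal (cmod (U \<zeta>)) \<partial>lborel))"
      by (intro mult_mono ennreal_leI q C dl) auto
    also have "ennreal (8 * T / \<delta>) = ennreal (8 * T) / ennreal \<delta>" using T0 dl by (simp add: divide_ennreal)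
    also have "ennreal (8 * T) / ennreal \<delta> * (ennreal C * X) = ennreal (8 * T * C) * (X / ennreal \<delta>)" for X
      using T0 C(1) by (simp add: ennreal_mult divide_ennreal_def mult_ac)
    finally show ?thesis .
  qed
  have lim: "((\<lambda>\<delta>. ennreal (8 * T * C) * ((\<integral>\<^sup>+\<zeta>\<in>annulus r0 (r0 + \<delta>). ennreal (cmod (U \<zeta>)) \<partial>lborel) / ennreal \<delta>)) \<longlongrightarrow> ennreal (8 * T * C) * 0) (at_right 0)"
    by (rule ennreal_tendsto_cmult[OF _ trace]) simp
  have "0 < min 1 (c - r0)" using c by simp
  from eventually_at_right_real[OF this]
  have "\<forall>\<^sub>F \<delta> in at_right 0. ennreal (cmod (LINT r:{c..d}|lborel. D k r * of_real (t r))) \<le> ennreal (8 * T * C) * ((\<integral>\<^sup>+\<zeta>\<in>annulus r0 (r0 + \<delta>). ennreal (cmod (U \<zeta>)) \<partial>lborel) / ennreal \<delta>)"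
    by eventually_elim (rule le, auto)
  from tendsto_lowerbound[OF lim this] show ?thesis by simp
qed

private lemma D_interval:
  assumes c: "r0 < c" "c < d"
  shows "(LINT r:{c<..<d}|lborel. D k r) = 0"
proof -
  (* trapezoids increasing to the indicator of the interval *)
  define t where "t n r = max 0 (min 1 (min (real n * (r - c)) (real n * (d - r))))" for n :: nat and r
  have tc: "continuous_on UNIV (t n)" for n unfolding t_def[abs_def] by (intro continuous_intros)
  have ts: "t n r = 0" if "r \<notin> {c..d}" for n r
  proof -
    have "real n * (r - c) \<le> 0 \<or> real n * (d - r) \<le> 0" using that by (auto simp: mult_nonneg_nonpos)
    then show ?thesis by (auto simp: t_def)
  qed
  have tl: "(\<lambda>n. t n r) \<longlonglongrightarrow> indicator {c<..<d} r" for r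
  proof (cases "r \<in> {c<..<d}")
    case True
    define e where "e = min (r - c) (d - r)"
    have e: "e > 0" using True by (simp add: e_def)
    obtain m :: nat where m: "1 / e < real m" using reals_Archimedean2 by blast
    have "\<forall>\<^sub>F n in sequentially. t n r = 1"
      using eventually_ge_at_top[of m]
    proof eventually_elim
      case (elim n)
      have "1 < real m * e" using m e by (simp add: field_simps)
      also have "\<dots> \<le> real n * e" using elim e by (intro mult_right_mono) auto
      finally have "1 < real n * e" .
      moreover have "real n * e \<le> real n * (r - c)" "real n * e \<le> real n * (d - r)" by (auto simp: e_def intro!: mult_left_mono)
      ultimately show ?case by (simp add: t_def)
    qed
    then show ?thesis using True by (simp add: tendsto_eventually)
  next
    case False
    have z: "real n * (r - c) \<le> 0 \<or> real n * (d - r) \<le> 0" for n using False by (auto simp: mult_nonneg_nonpos)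
    have "t n r = 0" for n using z[of n] by (auto simp: t_def)
    then show ?thesis using False by simp
  qed
  have Di: "integrable lborel (\<lambda>r. indicator {c..d} r *\<^sub>R D k r)" using D_integrable[OF c(1), of d k] by (simp add: set_integrable_def)
  have "(\<lambda>n. LINT r|lborel. indicator {c..d} r *\<^sub>R (D k r * of_real (t n r))) \<longlonglongrightarrow> (LINT r|lborel. indicator {c<..<d} r *\<^sub>R D k r)"
  proof (rule integral_dominated_convergence[where w = "\<lambda>r. cmod (indicator {c..d} r *\<^sub>R D k r)"])
    show "integrable lborel (\<lambda>r. cmod (indicator {c..d} r *\<^sub>R D k r))" using Di by (rule integrable_norm)
    have "set_integrable lborel {c<..<d} (D k)"
      by (rule set_integrable_subset[OF D_integrable[OF c(1), of d k]]) auto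
    then show "(\<lambda>r. indicator {c<..<d} r *\<^sub>R D k r) \<in> borel_measurable lborel" unfolding set_integrable_def by (rule borel_measurable_integrable)
    fix n
    have "set_integrable lborel {c..d} (\<lambda>r. D k r * of_real (t n r))"
      by (rule set_integrable_mult_continuous[OF D_integrable[OF c(1)]]) (intro continuous_intros continuous_on_subset[OF tc], simp)
    then show "(\<lambda>r. indicator {c..d} r *\<^sub>R (D k r * of_real (t n r))) \<in> borel_measurable lborel" unfolding set_integrable_def by (rule borel_measurable_integrable)
    have "\<bar>t n r\<bar> \<le> 1" for r by (auto simp: t_def)
    then show "AE r in lborel. norm (indicator {c..d} r *\<^sub>R (D k r * of_real (t n r))) \<le> cmod (indicator {c..d} r *\<^sub>R D k r)"
      by (intro AE_I2) (auto simp: indicator_def norm_mult mult_left_le)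
  next
    show "AE r in lborel. (\<lambda>n. indicator {c..d} r *\<^sub>R (D k r * of_real (t n r))) \<longlonglongrightarrow> indicator {c<..<d} r *\<^sub>R D k r"
    proof (rule AE_I2)
      fix r
      have "(\<lambda>n. indicator {c..d} r *\<^sub>R (D k r * of_real (t n r))) \<longlonglongrightarrow> indicator {c..d} r *\<^sub>R (D k r * of_real (indicator {c<..<d} r))"
        by (intro tendsto_intros tl)
      moreover have "indicator {c..d} r *\<^sub>R (D k r * of_real (indicator {c<..<d} r)) = indicator {c<..<d} r *\<^sub>R D k r" by (auto simp: indicator_def)
      ultimately show "(\<lambda>n. indicator {c..d} r *\<^sub>R (D k r * of_real (t n r))) \<longlonglongrightarrow> indicator {c<..<d} r *\<^sub>R D k r" by simp
    qed
  qed
  moreover have "(LINT r|lborel. indicator {c..d} r *\<^sub>R (D k r * of_real (t n r))) = 0" for n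
    using D_test_compact_support[OF c tc ts] by (simp add: set_lebesgue_integral_def)
  ultimately show ?thesis by (simp add: set_lebesgue_integral_def LIMSEQ_const_iff)
qed

private lemma D_AE_0: "AE r in lborel. r0 < r \<longrightarrow> D k r = 0"
proof -
  have "AE r in lborel. indicator {r0 + 1 / real (Suc n)<..<r0 + real (Suc n)} r *\<^sub>R D k r = 0" for n
  proof (rule AE_eq_0_if_initial_integrals_0)
    let ?c = "r0 + 1 / real (Suc n)" and ?d = "r0 + real (Suc n)"
    have c: "r0 < ?c" by simp
    have i: "set_integrable lborel {?c<..<?d} (D k)"
      by (rule set_integrable_subset[OF D_integrable[OF c, of ?d k]]) auto
    then show ii: "integrable lborel (\<lambda>r. indicator {?c<..<?d} r *\<^sub>R D k r)" by (simp add: set_integrable_def)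
    fix x
    have "(LINT r:{..x}|lborel. indicator {?c<..<?d} r *\<^sub>R D k r) = (LINT r:{?c<..<min x ?d}|lborel. D k r)"
      unfolding set_lebesgue_integral_def
    proof (rule integral_cong_AE)
      show "(\<lambda>r. indicator {..x} r *\<^sub>R (indicator {?c<..<?d} r *\<^sub>R D k r)) \<in> borel_measurable lborel"
        by (rule borel_measurable_scaleR[OF borel_measurable_indicator borel_measurable_integrable[OF ii]]) simp
      have "set_integrable lborel {?c<..<min x ?d} (D k)" by (rule set_integrable_subset[OF i]) auto
      then show "(\<lambda>r. indicator {?c<..<min x ?d} r *\<^sub>R D k r) \<in> borel_measurable lborel" unfolding set_integrable_def by (rule borel_measurable_integrable)
      show "AE r in lborel. indicator {..x} r *\<^sub>R (indicator {?c<..<?d} r *\<^sub>R D k r) = indicator {?c<..<min x ?d} r *\<^sub>R D k r"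
        using AE_lborel_singleton[of x] by eventually_elim (auto simp: indicator_def)
    qed
    also have "\<dots> = 0"
    proof (cases "?c < min x ?d")
      case True
      then show ?thesis by (intro D_interval c)
    next
      case False
      then have "{?c<..<min x ?d} = {}" unfolding not_less by (rule greaterThanLessThan_empty)
      then show ?thesis by (simp only: set_lebesgue_integral_def) simp
    qed
    finally show "(LINT r:{..x}|lborel. indicator {?c<..<?d} r *\<^sub>R D k r) = 0" .
  qed
  then have "AE r in lborel. \<forall>n. indicator {r0 + 1 / real (Suc n)<..<r0 + real (Suc n)} r *\<^sub>R D k r = 0" by (simp only: AE_all_countable) simp
  then show ?thesis
  proof eventually_elim
    case (elim r)
    show ?case
    proof
      assume r: "r0 < r"
      obtain n :: nat where n: "max (r - r0) (1 / (r - r0)) < real n" using reals_Archimedean2 by blast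
      then have "r < r0 + real (Suc n)" by simp
      moreover have "1 < real (Suc n) * (r - r0)"
      proof -
        have "1 < real n * (r - r0)" using n r by (simp add: field_simps)
        also have "\<dots> \<le> real (Suc n) * (r - r0)" using r by (intro mult_right_mono) auto
        finally show ?thesis .
      qed
      then have "r0 + 1 / real (Suc n) < r" by (simp add: field_simps)
      ultimately show "D k r = 0" using elim[rule_format, of n] by simp
    qed
  qed
qed

text \<open>There are countably many orders, so on almost every circle all Fourier coefficients of \<open>U\<close> vanish at once,
and their uniqueness applies.\<close>

theorem dbar_zero_trace_uniqueness: "AE \<zeta> in lborel. \<zeta> \<in> disc_exterior r0 \<longrightarrow> U \<zeta> = 0"
proof (rule AE_polarI)
  have E: "disc_exterior r0 \<in> sets borel" unfolding disc_exterior_def by (intro borel_open open_Collect_less continuous_intros)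
  then show "{\<zeta>. \<not> (\<zeta> \<in> disc_exterior r0 \<longrightarrow> U \<zeta> = 0)} \<in> sets borel" by measurable
  have a: "AE r in lborel. \<forall>k. r0 < r \<longrightarrow> D k r = 0" unfolding AE_all_countable using D_AE_0 by blast
  have b: "AE r in lborel. \<forall>n. 0 < r \<longrightarrow> set_integrable lborel {0..2*pi} (\<lambda>\<phi>. indicator {z. r0 + 1 / real (Suc n) \<le> cmod z \<and> cmod z \<le> r0 + real (Suc n)} (rcis r \<phi>) *\<^sub>R U (rcis r \<phi>))"
    unfolding AE_all_countable
  proof
    fix n
    have i: "integrable lborel (\<lambda>z. indicator {z. r0 + 1 / real (Suc n) \<le> cmod z \<and> cmod z \<le> r0 + real (Suc n)} z *\<^sub>R U z)" by (rule ring_integrable) simp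
    then have "(\<lambda>z. indicator {z. r0 + 1 / real (Suc n) \<le> cmod z \<and> cmod z \<le> r0 + real (Suc n)} z *\<^sub>R U z) \<in> borel_measurable borel"
      using borel_measurable_integrable[OF i] by simp
    from integral_polar(1)[OF this i]
    show "AE r in lborel. 0 < r \<longrightarrow> set_integrable lborel {0..2*pi} (\<lambda>\<phi>. indicator {z. r0 + 1 / real (Suc n) \<le> cmod z \<and> cmod z \<le> r0 + real (Suc n)} (rcis r \<phi>) *\<^sub>R U (rcis r \<phi>))" .
  qed
  show "AE r in lborel. 0 < r \<longrightarrow> (AE \<phi> in lborel. \<phi> \<in> {0..2*pi} \<longrightarrow> rcis r \<phi> \<in> disc_exterior r0 \<longrightarrow> U (rcis r \<phi>) = 0)"
    using a b
  proof eventually_elim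
    case (elim r)
    show ?case
    proof (cases "r0 < r")
      case True
      then have r: "0 < r" using r0 by simp
      obtain n :: nat where n: "max (r - r0) (1 / (r - r0)) < real n" using reals_Archimedean2 by blast
      have 1: "r \<le> r0 + real (Suc n)" using n by simp
      have "1 < real n * (r - r0)" using n True by (simp add: field_simps)
      also have "\<dots> \<le> real (Suc n) * (r - r0)" using True by (intro mult_right_mono) auto
      finally have 2: "r0 + 1 / real (Suc n) \<le> r" by (simp add: field_simps)
      have "set_integrable lborel {0..2*pi} (\<lambda>\<phi>. U (rcis r \<phi>))"
        using elim(2)[rule_format, OF r, of n] 1 2 r by simp
      moreover have "circle_coeff U k r = 0" for k using elim(1) True r by (simp add: D_def)
      ultimately have "zero_fourier (\<lambda>\<phi>. U (rcis r \<phi>))" by (simp add: zero_fourier_def circle_coeff_def)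
      from fourier_uniqueness[OF this] show ?thesis by auto
    qed (auto simp: disc_exterior_def)
  qed
qed

end

context exterior_conformal_map
begin

lemma locally_integrable_measurable:
  fixes h :: "complex \<Rightarrow> complex"
  assumes h: "locally_integrable E h"
  shows "(\<lambda>z. indicator E z *\<^sub>R h z) \<in> borel_measurable lebesgue"
proof (rule borel_measurable_LIMSEQ_metric)
  fix n
  define K where "K n = cball 0 (r0 + real (Suc n)) \<inter> {z::complex. r0 + 1 / real (Suc n) \<le> cmod z}" for n
  have "closed {z::complex. r0 + 1 / real (Suc n) \<le> cmod z}" by (intro closed_Collect_le continuous_intros)
  then have "compact (K n)" unfolding K_def by (intro compact_Int_closed) auto
  moreover have "K n \<subseteq> E"
  proof
    fix z assume "z \<in> K n"
    then have "r0 + 1 / real (Suc n) \<le> cmod z" by (simp add: K_def)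
    moreover have "0 < 1 / real (Suc n)" by simp
    ultimately have "r0 < cmod z" by linarith
    then show "z \<in> E" by (simp add: disc_exterior_def)
  qed
  ultimately show "(\<lambda>z. indicator (cball 0 (r0 + real (Suc n)) \<inter> {z::complex. r0 + 1 / real (Suc n) \<le> cmod z}) z *\<^sub>R h z) \<in> borel_measurable lebesgue"
    using h borel_measurable_integrable unfolding locally_integrable_def set_integrable_def K_def by blast
next
  fix z
  show "(\<lambda>n. indicator (cball 0 (r0 + real (Suc n)) \<inter> {z::complex. r0 + 1 / real (Suc n) \<le> cmod z}) z *\<^sub>R h z) \<longlonglongrightarrow> indicator E z *\<^sub>R h z"
  proof (cases "z \<in> E")
    case True
    then have r: "r0 < cmod z" by (simp add: disc_exterior_def)
    obtain m :: nat where m: "max (cmod z - r0) (1 / (cmod z - r0)) < real m" using reals_Archimedean2 by blast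
    have "\<forall>\<^sub>F n in sequentially. z \<in> cball 0 (r0 + real (Suc n)) \<inter> {z::complex. r0 + 1 / real (Suc n) \<le> cmod z}"
      using eventually_ge_at_top[of m]
    proof eventually_elim
      case (elim n)
      have "1 < real m * (cmod z - r0)" using m r by (simp add: field_simps)
      also have "\<dots> \<le> real (Suc n) * (cmod z - r0)" using r elim by (intro mult_right_mono) auto
      finally have "1 / real (Suc n) \<le> cmod z - r0" by (simp add: field_simps)
      then show ?case using m elim by auto
    qed
    then have "\<forall>\<^sub>F n in sequentially. indicator (cball 0 (r0 + real (Suc n)) \<inter> {z::complex. r0 + 1 / real (Suc n) \<le> cmod z}) z *\<^sub>R h z = indicator E z *\<^sub>R h z"
      by eventually_elim (use True in simp)
    then show ?thesis by (rule tendsto_eventually)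
  next
    case False
    then have "cmod z \<le> r0" by (simp add: disc_exterior_def)
    have "z \<notin> {z::complex. r0 + 1 / real (Suc n) \<le> cmod z}" for n
    proof -
      have "0 < 1 / real (Suc n)" by simp
      then have "\<not> r0 + 1 / real (Suc n) \<le> cmod z" using \<open>cmod z \<le> r0\<close> by linarith
      then show ?thesis by blast
    qed
    then have "(\<lambda>n. indicator (cball 0 (r0 + real (Suc n)) \<inter> {z::complex. r0 + 1 / real (Suc n) \<le> cmod z}) z *\<^sub>R h z) = (\<lambda>n. 0)"
      by (auto simp: indicator_def)
    then show ?thesis using False by simp
  qed
qed

lemma trace_diff:
  assumes u: "locally_integrable E (\<lambda>\<zeta>. u (\<Psi> \<zeta>))" and v: "locally_integrable E (\<lambda>\<zeta>. v (\<Psi> \<zeta>))"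
    and tu: "zero_boundary_trace r0 \<Psi> u" and tv: "zero_boundary_trace r0 \<Psi> v"
  shows "((\<lambda>\<delta>. (\<integral>\<^sup>+\<zeta>\<in>annulus r0 (r0 + \<delta>). ennreal (cmod (u (\<Psi> \<zeta>) - v (\<Psi> \<zeta>))) \<partial>lebesgue) / ennreal \<delta>) \<longlongrightarrow> 0) (at_right 0)"
proof -
  let ?I = "\<lambda>u \<delta>. (\<integral>\<^sup>+\<zeta>\<in>annulus r0 (r0 + \<delta>). ennreal (cmod (u (\<Psi> \<zeta>))) \<partial>lebesgue)"
  have "((\<lambda>\<delta>. ?I u \<delta> / ennreal \<delta> + ?I v \<delta> / ennreal \<delta>) \<longlongrightarrow> 0 + 0) (at_right 0)"
    using tu tv unfolding zero_boundary_trace_def annulus_def by (rule tendsto_add)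
  then have lim: "((\<lambda>\<delta>. ?I u \<delta> / ennreal \<delta> + ?I v \<delta> / ennreal \<delta>) \<longlongrightarrow> 0) (at_right 0)" by simp
  have le: "(\<integral>\<^sup>+\<zeta>\<in>annulus r0 (r0 + \<delta>). ennreal (cmod (u (\<Psi> \<zeta>) - v (\<Psi> \<zeta>))) \<partial>lebesgue) \<le> ?I u \<delta> + ?I v \<delta>" for \<delta>
  proof -
    have m: "(\<lambda>\<zeta>. ennreal (cmod (h (\<Psi> \<zeta>))) * indicator (annulus r0 (r0 + \<delta>)) \<zeta>) \<in> borel_measurable lebesgue"
      if "locally_integrable E (\<lambda>\<zeta>. h (\<Psi> \<zeta>))" for h
    proof -
      have "(\<lambda>\<zeta>. ennreal (cmod (indicator E \<zeta> *\<^sub>R h (\<Psi> \<zeta>))) * indicator (annulus r0 (r0 + \<delta>)) \<zeta>) \<in> borel_measurable lebesgue"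
      proof (rule borel_measurable_times_ennreal)
        show "(\<lambda>\<zeta>. ennreal (cmod (indicator E \<zeta> *\<^sub>R h (\<Psi> \<zeta>)))) \<in> borel_measurable lebesgue"
          by (rule measurable_compose[OF measurable_compose[OF locally_integrable_measurable[OF that] borel_measurable_norm] measurable_ennreal])
      qed (auto intro!: borel_measurable_indicator)
      moreover have "ennreal (cmod (indicator E \<zeta> *\<^sub>R h (\<Psi> \<zeta>))) * indicator (annulus r0 (r0 + \<delta>)) \<zeta> = ennreal (cmod (h (\<Psi> \<zeta>))) * indicator (annulus r0 (r0 + \<delta>)) \<zeta>" for \<zeta>
        by (auto simp: annulus_def disc_exterior_def indicator_def)
      ultimately show ?thesis by simp
    qed
    have "(\<integral>\<^sup>+\<zeta>\<in>annulus r0 (r0 + \<delta>). ennreal (cmod (u (\<Psi> \<zeta>) - v (\<Psi> \<zeta>))) \<partial>lebesgue)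
      \<le> (\<integral>\<^sup>+\<zeta>. ennreal (cmod (u (\<Psi> \<zeta>))) * indicator (annulus r0 (r0 + \<delta>)) \<zeta> + ennreal (cmod (v (\<Psi> \<zeta>))) * indicator (annulus r0 (r0 + \<delta>)) \<zeta> \<partial>lebesgue)"
    proof (rule nn_integral_mono)
      fix \<zeta>
      have "ennreal (cmod (u (\<Psi> \<zeta>) - v (\<Psi> \<zeta>))) \<le> ennreal (cmod (u (\<Psi> \<zeta>))) + ennreal (cmod (v (\<Psi> \<zeta>)))"
        by (simp add: ennreal_plus[symmetric] ennreal_leI norm_triangle_ineq4 del: ennreal_plus)
      then show "ennreal (cmod (u (\<Psi> \<zeta>) - v (\<Psi> \<zeta>))) * indicator (annulus r0 (r0 + \<delta>)) \<zeta>
         \<le> ennreal (cmod (u (\<Psi> \<zeta>))) * indicator (annulus r0 (r0 + \<delta>)) \<zeta> + ennreal (cmod (v (\<Psi> \<zeta>))) * indicator (annulus r0 (r0 + \<delta>)) \<zeta>"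
        by (simp add: indicator_def)
    qed
    also have "\<dots> = ?I u \<delta> + ?I v \<delta>" by (rule nn_integral_add[OF m[OF u] m[OF v]])
    finally show ?thesis .
  qed
  show ?thesis
  proof (rule tendsto_sandwich[OF _ _ tendsto_const lim])
    show "\<forall>\<^sub>F \<delta> in at_right 0. (\<integral>\<^sup>+\<zeta>\<in>annulus r0 (r0 + \<delta>). ennreal (cmod (u (\<Psi> \<zeta>) - v (\<Psi> \<zeta>))) \<partial>lebesgue) / ennreal \<delta> \<le> ?I u \<delta> / ennreal \<delta> + ?I v \<delta> / ennreal \<delta>"
    proof (rule always_eventually, rule allI)
      fix \<delta>
      have "(\<integral>\<^sup>+\<zeta>\<in>annulus r0 (r0 + \<delta>). ennreal (cmod (u (\<Psi> \<zeta>) - v (\<Psi> \<zeta>))) \<partial>lebesgue) / ennreal \<delta> \<le> (?I u \<delta> + ?I v \<delta>) / ennreal \<delta>"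
        by (rule divide_right_mono_ennreal[OF le])
      also have "\<dots> = ?I u \<delta> / ennreal \<delta> + ?I v \<delta> / ennreal \<delta>" by (simp add: divide_ennreal_def distrib_right)
      finally show "(\<integral>\<^sup>+\<zeta>\<in>annulus r0 (r0 + \<delta>). ennreal (cmod (u (\<Psi> \<zeta>) - v (\<Psi> \<zeta>))) \<partial>lebesgue) / ennreal \<delta> \<le> ?I u \<delta> / ennreal \<delta> + ?I v \<delta> / ennreal \<delta>" .
    qed
  qed simp
qed

text \<open>The conjugate of the difference, transplanted to \<open>E\<close> and replaced by a Borel version, satisfies the
homogeneous equation; test functions on \<open>E\<close> are transplanted to \<open>\<Omega>\<close>.\<close>

theorem div_curl_uniqueness:
  assumes u: "locally_integrable \<Omega> u" "weak_dbar_eq \<Omega> u w" "zero_boundary_trace r0 \<Psi> u"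
    and v: "locally_integrable \<Omega> v" "weak_dbar_eq \<Omega> v w" "zero_boundary_trace r0 \<Psi> v"
  shows "AE x in lebesgue. x \<in> \<Omega> \<longrightarrow> u x = v x"
proof -
  define h where "h \<zeta> = cnj (u (\<Psi> \<zeta>)) - cnj (v (\<Psi> \<zeta>))" for \<zeta>
  note uE = locally_integrable_pullback[OF u(1)] and vE = locally_integrable_pullback[OF v(1)]
  have hE: "locally_integrable E h"
    unfolding locally_integrable_def
  proof (intro allI impI)
    fix K assume K: "compact K \<and> K \<subseteq> E"
    show "set_integrable lebesgue K h" unfolding h_def[abs_def]
      by (rule set_integral_diff(1); rule locally_integrable_cnj[unfolded locally_integrable_def, rule_format, OF _ K])
        (use uE vE in \<open>auto simp: locally_integrable_def\<close>)
  qed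
  obtain U where U: "U \<in> borel_measurable borel" "AE \<zeta> in lborel. indicator E \<zeta> *\<^sub>R h \<zeta> = U \<zeta>"
    using ex_borel_version[OF locally_integrable_measurable[OF hE]] by blast
  note U(1) [measurable]
  have "AE \<zeta> in lborel. \<zeta> \<in> disc_exterior r0 \<longrightarrow> U \<zeta> = 0"
  proof (rule dbar_zero_trace_uniqueness[OF r0 U(1)])
    fix K assume K: "compact K" "K \<subseteq> E"
    have Km: "K \<in> sets borel" using K by (simp add: borel_compact)
    have "integrable lebesgue (\<lambda>\<zeta>. indicator K \<zeta> *\<^sub>R h \<zeta>)" using hE K by (auto simp: locally_integrable_def set_integrable_def)
    moreover have "(\<lambda>\<zeta>. indicator K \<zeta> *\<^sub>R U \<zeta>) \<in> borel_measurable borel" using Km by measurable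
    moreover have "AE \<zeta> in lborel. indicator K \<zeta> *\<^sub>R h \<zeta> = indicator K \<zeta> *\<^sub>R U \<zeta>"
      using U(2) by eventually_elim (use K in \<open>auto simp: indicator_def split: if_splits\<close>)
    ultimately show "set_integrable lborel K U"
      using integrable_lebesgue_iff_borel_version(1)[of "\<lambda>\<zeta>. indicator K \<zeta> *\<^sub>R U \<zeta>" "\<lambda>\<zeta>. indicator K \<zeta> *\<^sub>R h \<zeta>"]
      unfolding set_integrable_def by blast
  next
    fix \<eta> a b assume t: "wirtinger_test E \<eta> a b"
    define b' where "b' z = (if z \<in> \<Omega> then b (\<Phi> z) * of_real ((cmod (deriv \<Phi> z))\<^sup>2) else 0)" for z
    obtain \<eta>' a' where t': "wirtinger_test \<Omega> \<eta>' a' b'" using test_pullback_\<Phi>[OF t] unfolding b'_def[abs_def] by blast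
    obtain K where K: "compact K" "K \<subseteq> \<Omega>" "\<And>x. x \<notin> K \<Longrightarrow> \<eta>' x = 0" using t' by (auto simp: wirtinger_test_def)
    have cb': "continuous_on UNIV b'" using t' by (simp add: wirtinger_test_def)
    have b'0: "b' x = 0" if "x \<notin> K" for x using wirtinger_test_vanish(2)[OF t' K(1) _ that] K(3) by blast
    have iu: "set_integrable lebesgue \<Omega> (\<lambda>z. b' z * cnj (u z))" and iv: "set_integrable lebesgue \<Omega> (\<lambda>z. b' z * cnj (v z))"
      using locally_integrable_mult_test[OF locally_integrable_cnj[OF u(1)] K(1,2) cb' b'0]
        locally_integrable_mult_test[OF locally_integrable_cnj[OF v(1)] K(1,2) cb' b'0] by auto
    have "(LINT z:\<Omega>|lebesgue. b' z * cnj (u z) - b' z * cnj (v z)) = 0"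
      using set_integral_diff(2)[OF iu iv] u(2)[unfolded weak_dbar_eq_def, rule_format, OF t'] v(2)[unfolded weak_dbar_eq_def, rule_format, OF t'] by simp
    moreover have "(LINT \<zeta>:E|lebesgue. of_real ((cmod (deriv \<Psi> \<zeta>))\<^sup>2) * (b' (\<Psi> \<zeta>) * cnj (u (\<Psi> \<zeta>)) - b' (\<Psi> \<zeta>) * cnj (v (\<Psi> \<zeta>)))) = (LINT z:\<Omega>|lebesgue. b' z * cnj (u z) - b' z * cnj (v z))"
      using change_of_variables(2)[of E "\<lambda>z. b' z * cnj (u z) - b' z * cnj (v z)"] by (simp add: \<Psi>_image)
    moreover have "(LINT \<zeta>:E|lebesgue. of_real ((cmod (deriv \<Psi> \<zeta>))\<^sup>2) * (b' (\<Psi> \<zeta>) * cnj (u (\<Psi> \<zeta>)) - b' (\<Psi> \<zeta>) * cnj (v (\<Psi> \<zeta>)))) = (LINT \<zeta>|lebesgue. b \<zeta> * (indicator E \<zeta> *\<^sub>R h \<zeta>))"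
      unfolding set_lebesgue_integral_def
    proof (rule Bochner_Integration.integral_cong[OF refl])
      fix \<zeta>
      show "indicator E \<zeta> *\<^sub>R (of_real ((cmod (deriv \<Psi> \<zeta>))\<^sup>2) * (b' (\<Psi> \<zeta>) * cnj (u (\<Psi> \<zeta>)) - b' (\<Psi> \<zeta>) * cnj (v (\<Psi> \<zeta>)))) = b \<zeta> * (indicator E \<zeta> *\<^sub>R h \<zeta>)"
      proof (cases "\<zeta> \<in> E")
        case True
        have "cmod (deriv \<Phi> (\<Psi> \<zeta>)) * cmod (deriv \<Psi> \<zeta>) = 1" using deriv_\<Psi>_mult[OF True] unfolding norm_mult[symmetric] by simp
        then have 1: "(cmod (deriv \<Psi> \<zeta>))\<^sup>2 * (cmod (deriv \<Phi> (\<Psi> \<zeta>)))\<^sup>2 = 1" by (simp add: power_mult_distrib[symmetric] mult.commute)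
        have "of_real ((cmod (deriv \<Psi> \<zeta>))\<^sup>2) * b' (\<Psi> \<zeta>) = b \<zeta> * of_real ((cmod (deriv \<Psi> \<zeta>))\<^sup>2 * (cmod (deriv \<Phi> (\<Psi> \<zeta>)))\<^sup>2)"
          using True by (simp add: b'_def)
        then have e: "of_real ((cmod (deriv \<Psi> \<zeta>))\<^sup>2) * b' (\<Psi> \<zeta>) = b \<zeta>" unfolding 1 by simp
        have "of_real ((cmod (deriv \<Psi> \<zeta>))\<^sup>2) * (b' (\<Psi> \<zeta>) * cnj (u (\<Psi> \<zeta>)) - b' (\<Psi> \<zeta>) * cnj (v (\<Psi> \<zeta>))) = (of_real ((cmod (deriv \<Psi> \<zeta>))\<^sup>2) * b' (\<Psi> \<zeta>)) * h \<zeta>"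
          by (simp add: h_def algebra_simps)
        then show ?thesis using True unfolding e by simp
      qed simp
    qed
    moreover have "(LINT \<zeta>|lebesgue. b \<zeta> * (indicator E \<zeta> *\<^sub>R h \<zeta>)) = (LINT \<zeta>|lborel. b \<zeta> * U \<zeta>)"
    proof (rule integrable_lebesgue_iff_borel_version(2))
      have "b \<in> borel_measurable borel" using t by (auto simp: wirtinger_test_def intro: borel_measurable_continuous_onI)
      then show "(\<lambda>\<zeta>. b \<zeta> * U \<zeta>) \<in> borel_measurable borel" by measurable
      show "AE \<zeta> in lborel. b \<zeta> * (indicator E \<zeta> *\<^sub>R h \<zeta>) = b \<zeta> * U \<zeta>" using U(2) by eventually_elim simp
    qed
    ultimately show "(LINT \<zeta>|lborel. b \<zeta> * U \<zeta>) = 0" by simp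
  next
    have "(\<integral>\<^sup>+\<zeta>\<in>annulus r0 (r0 + \<delta>). ennreal (cmod (U \<zeta>)) \<partial>lborel) = (\<integral>\<^sup>+\<zeta>\<in>annulus r0 (r0 + \<delta>). ennreal (cmod (u (\<Psi> \<zeta>) - v (\<Psi> \<zeta>))) \<partial>lebesgue)" for \<delta>
      unfolding nn_integral_completion
    proof (rule nn_integral_cong_AE, use U(2) in eventually_elim)
      case (elim \<zeta>)
      have "cmod (h \<zeta>) = cmod (u (\<Psi> \<zeta>) - v (\<Psi> \<zeta>))" unfolding h_def complex_cnj_diff[symmetric] by (rule complex_mod_cnj)
      moreover have "U \<zeta> = h \<zeta>" if "\<zeta> \<in> annulus r0 (r0 + \<delta>)" using elim that by (simp add: annulus_def disc_exterior_def)
      ultimately show ?case by (simp add: indicator_def)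
    qed
    then show "((\<lambda>\<delta>. (\<integral>\<^sup>+\<zeta>\<in>annulus r0 (r0 + \<delta>). ennreal (cmod (U \<zeta>)) \<partial>lborel) / ennreal \<delta>) \<longlongrightarrow> 0) (at_right 0)"
      using trace_diff[OF uE vE u(3) v(3)] by simp
  qed
  then have "AE \<zeta> in lborel. \<zeta> \<in> E \<longrightarrow> u (\<Psi> \<zeta>) = v (\<Psi> \<zeta>)"
    using U(2)
  proof eventually_elim
    case (elim \<zeta>)
    then show ?case by (auto simp: h_def)
  qed
  then show ?thesis using AE_transfer[of "\<lambda>x. u x = v x"] by (simp add: AE_completion_iff)
qed

end

context vorticity
begin

lemma solution_unique:
  assumes "is_solution \<Omega> r0 \<Psi> w v_inf u"
  shows "AE x in lebesgue. x \<in> \<Omega> \<longrightarrow> u x = solution x"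
proof -
  have l: "locally_integrable \<Omega> u" and d: "has_weak_div \<Omega> u (\<lambda>_. 0)" and c: "has_weak_curl \<Omega> u w"
    and t: "zero_boundary_trace r0 \<Psi> u" using assms unfolding is_solution_def by blast+
  show ?thesis
    by (rule div_curl_uniqueness[OF l div_curl_imp_weak_dbar[OF l vorticity_locally_integrable d c] t
      solution_locally_integrable solution_weak_dbar solution_trace])
qed

end

section \<open>Fourier coefficients of the polar components\<close>

lemma circle_coeff_measurable [measurable]:
  assumes [measurable]: "f \<in> borel_measurable borel"
  shows "circle_coeff f k \<in> borel_measurable borel"
  unfolding circle_coeff_def[abs_def] set_lebesgue_integral_def by measurable

lemma fourier_coeff_eq_circle_coeff:
  assumes [measurable]: "g \<in> borel_measurable borel"
    and ae: "AE \<phi> in lborel. \<phi> \<in> {0..2*pi} \<longrightarrow> f (rcis r \<phi>) = g (rcis r \<phi>)"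
  shows "fourier_coeff f k r = circle_coeff g k r / (2 * pi)"
proof -
  have "(LINT \<phi>|lebesgue. indicator {0..2*pi} \<phi> *\<^sub>R (f (rcis r \<phi>) * exp (- \<i> * of_int k * of_real \<phi>)))
      = (LINT \<phi>|lborel. indicator {0..2*pi} \<phi> *\<^sub>R (g (rcis r \<phi>) * exp (- \<i> * of_int k * of_real \<phi>)))"
  proof (rule integrable_lebesgue_iff_borel_version(2))
    show "(\<lambda>\<phi>. indicator {0..2*pi} \<phi> *\<^sub>R (g (rcis r \<phi>) * exp (- \<i> * of_int k * of_real \<phi>))) \<in> borel_measurable borel" by measurable
    show "AE \<phi> in lborel. indicator {0..2*pi} \<phi> *\<^sub>R (f (rcis r \<phi>) * exp (- \<i> * of_int k * of_real \<phi>))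
        = indicator {0..2*pi} \<phi> *\<^sub>R (g (rcis r \<phi>) * exp (- \<i> * of_int k * of_real \<phi>))"
      using ae by eventually_elim (auto simp: indicator_def)
  qed
  then show ?thesis by (simp add: fourier_coeff_def circle_coeff_def set_lebesgue_integral_def)
qed

lemma circle_coeff_cnj: "circle_coeff (\<lambda>z. cnj (g z)) k r = cnj (circle_coeff g (- k) r)"
proof -
  have "cnj (g (rcis r \<phi>)) * exp (- \<i> * of_int k * of_real \<phi>) = cnj (g (rcis r \<phi>) * exp (- \<i> * of_int (- k) * of_real \<phi>))" for \<phi>
    by (simp add: exp_cnj)
  then have "indicator {0..2*pi} \<phi> *\<^sub>R (cnj (g (rcis r \<phi>)) * exp (- \<i> * of_int k * of_real \<phi>))
     = cnj (indicator {0..2*pi} \<phi> *\<^sub>R (g (rcis r \<phi>) * exp (- \<i> * of_int (- k) * of_real \<phi>)))" for \<phi>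
    by (simp only: complex_cnj_scaleR)
  then show ?thesis unfolding circle_coeff_def set_lebesgue_integral_def by (simp only: Bochner_Integration.integral_cnj)
qed

lemma circle_coeff_Re_Im:
  assumes g: "set_integrable lborel {0..2*pi} (\<lambda>\<phi>. g (rcis r \<phi>))"
  shows "circle_coeff (\<lambda>z. of_real (Re (g z))) k r = (circle_coeff g k r + cnj (circle_coeff g (- k) r)) / 2"
    and "circle_coeff (\<lambda>z. of_real (Im (g z))) k r = (circle_coeff g k r - cnj (circle_coeff g (- k) r)) / (2 * \<i>)"
proof -
  have i: "set_integrable lborel {0..2*pi} (\<lambda>\<phi>. g (rcis r \<phi>) * exp (- \<i> * of_int k * of_real \<phi>))" for k
    by (rule set_integrable_mult_continuous[OF g]) (intro continuous_intros)
  have "set_integrable lborel {0..2*pi} (\<lambda>\<phi>. cnj (g (rcis r \<phi>)))"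
    using integrable_cnj[OF g[unfolded set_integrable_def]] by (simp add: set_integrable_def)
  then have ic: "set_integrable lborel {0..2*pi} (\<lambda>\<phi>. cnj (g (rcis r \<phi>)) * exp (- \<i> * of_int k * of_real \<phi>))" for k
    by (rule set_integrable_mult_continuous) (intro continuous_intros)
  have "circle_coeff (\<lambda>z. of_real (Re (g z))) k r = (LINT \<phi>:{0..2*pi}|lborel. (1/2) * (g (rcis r \<phi>) * exp (- \<i> * of_int k * of_real \<phi>) + cnj (g (rcis r \<phi>)) * exp (- \<i> * of_int k * of_real \<phi>)))"
    unfolding circle_coeff_def by (simp add: complex_add_cnj distrib_right[symmetric])
  also have "\<dots> = (circle_coeff g k r + circle_coeff (\<lambda>z. cnj (g z)) k r) / 2"
    unfolding set_integral_mult_right set_integral_add(2)[OF i ic] circle_coeff_def by simp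
  finally show "circle_coeff (\<lambda>z. of_real (Re (g z))) k r = (circle_coeff g k r + cnj (circle_coeff g (- k) r)) / 2"
    unfolding circle_coeff_cnj .
  have im: "of_real (Im a) * e = 1 / (2 * \<i>) * (a * e - cnj a * e)" for a e :: complex
  proof -
    have "a - cnj a = 2 * \<i> * of_real (Im a)" by (simp add: complex_eq_iff)
    then have "a * e - cnj a * e = 2 * \<i> * of_real (Im a) * e" by (metis left_diff_distrib)
    then show ?thesis by simp
  qed
  have "circle_coeff (\<lambda>z. of_real (Im (g z))) k r = (LINT \<phi>:{0..2*pi}|lborel. (1/(2*\<i>)) * (g (rcis r \<phi>) * exp (- \<i> * of_int k * of_real \<phi>) - cnj (g (rcis r \<phi>)) * exp (- \<i> * of_int k * of_real \<phi>)))"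
    unfolding circle_coeff_def im ..
  also have "\<dots> = (circle_coeff g k r - circle_coeff (\<lambda>z. cnj (g z)) k r) / (2 * \<i>)"
    unfolding set_integral_mult_right set_integral_diff(2)[OF i ic] circle_coeff_def by simp
  finally show "circle_coeff (\<lambda>z. of_real (Im (g z))) k r = (circle_coeff g k r - cnj (circle_coeff g (- k) r)) / (2 * \<i>)"
    unfolding circle_coeff_cnj .
qed

text \<open>Multiplication by \<open>sgn z = exp (i \<phi>)\<close> rotates to the polar frame.\<close>

lemma circle_coeff_mult_sgn:
  assumes "0 < r"
  shows "circle_coeff (\<lambda>z. g z * sgn z) k r = circle_coeff g (k - 1) r"
proof -
  have "sgn (rcis r \<phi>) = exp (\<i> * of_real \<phi>)" for \<phi>
    using assms by (simp add: rcis_def sgn_mult sgn_of_real cis_conv_exp[symmetric])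
  then have e: "g (rcis r \<phi>) * sgn (rcis r \<phi>) * exp (- \<i> * of_int k * of_real \<phi>) = g (rcis r \<phi>) * exp (- \<i> * of_int (k - 1) * of_real \<phi>)" for \<phi>
    by (simp add: mult.assoc exp_add[symmetric]) (simp add: algebra_simps)
  show ?thesis unfolding circle_coeff_def e ..
qed

lemma cauchy_transform_circle_integrable:
  assumes f: "integrable lborel f"
  shows "AE r in lborel. 0 < r \<longrightarrow> set_integrable lborel {0..2*pi} (\<lambda>\<phi>. cauchy_transform f (rcis r \<phi>))"
proof -
  have fm [measurable]: "f \<in> borel_measurable borel" using borel_measurable_integrable[OF f] by simp
  show ?thesis
    using AE_circle_cauchy_majorant_finite[OF f]
  proof eventually_elim
    case (elim r)
    show ?case
    proof
      assume "0 < r"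
      show "set_integrable lborel {0..2*pi} (\<lambda>\<phi>. cauchy_transform f (rcis r \<phi>))" unfolding set_integrable_def
      proof (rule integrableI_bounded)
        have "(\<integral>\<^sup>+\<phi>. ennreal (norm (indicator {0..2*pi} \<phi> *\<^sub>R cauchy_transform f (rcis r \<phi>))) \<partial>lborel)
            \<le> (\<integral>\<^sup>+\<phi>\<in>{0..2*pi}. cauchy_majorant f (rcis r \<phi>) \<partial>lborel)"
          by (rule nn_integral_mono) (auto simp: indicator_def cauchy_transform_le_majorant)
        then show "(\<integral>\<^sup>+\<phi>. ennreal (norm (indicator {0..2*pi} \<phi> *\<^sub>R cauchy_transform f (rcis r \<phi>))) \<partial>lborel) < \<infinity>"
          using elim \<open>0 < r\<close> by (auto intro: order_le_less_trans)
      qed measurable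
    qed
  qed
qed

text \<open>In both cases of the formula for the coefficients, \<open>r\<^sup>k |\<xi>|\<^sup>-\<^sup>k\<^sup>-\<^sup>1\<close> is at most \<open>1/r\<close> or \<open>1/|\<xi>|\<close>, hence at most
\<open>1/r0\<close>.\<close>

lemma cauchy_transform_circle_coeff_bounded:
  assumes f: "integrable lborel f" and r0: "0 < r0"
  shows "\<exists>C. AE r in lborel. r0 < r \<longrightarrow> (\<forall>k. cmod (circle_coeff (cauchy_transform f) k r) \<le> C)"
proof (intro exI)
  let ?C = "2 * pi / r0 * (LINT \<xi>|lborel. cmod (f \<xi>))"
  have bd: "cmod (of_real (r powi k) * (LINT \<xi>:S|lborel. f \<xi> * \<xi> powi (- k - 1))) \<le> (LINT \<xi>|lborel. cmod (f \<xi>)) / r0"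
    if r: "r0 < r" and S: "\<And>\<xi>. \<xi> \<in> S \<Longrightarrow> f \<xi> \<noteq> 0 \<Longrightarrow> r powi k * cmod \<xi> powi (- k - 1) \<le> 1 / r0" for r S and k :: int
  proof -
    have "of_real (r powi k) * (LINT \<xi>:S|lborel. f \<xi> * \<xi> powi (- k - 1)) = (LINT \<xi>:S|lborel. of_real (r powi k) * (f \<xi> * \<xi> powi (- k - 1)))"
      by simp
    also have "cmod \<dots> \<le> (LINT \<xi>|lborel. cmod (indicator S \<xi> *\<^sub>R (of_real (r powi k) * (f \<xi> * \<xi> powi (- k - 1)))))"
      unfolding set_lebesgue_integral_def by (rule integral_norm_bound)
    also have "\<dots> \<le> (LINT \<xi>|lborel. cmod (f \<xi>) / r0)"
    proof (rule integral_mono')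
      show "integrable lborel (\<lambda>\<xi>. cmod (f \<xi>) / r0)" using f by simp
      fix \<xi>
      show "cmod (indicator S \<xi> *\<^sub>R (of_real (r powi k) * (f \<xi> * \<xi> powi (- k - 1)))) \<le> cmod (f \<xi>) / r0"
      proof (cases "\<xi> \<in> S \<and> f \<xi> \<noteq> 0")
        case True
        have "cmod (of_real (r powi k) * (f \<xi> * \<xi> powi (- k - 1))) = cmod (f \<xi>) * (r powi k * cmod \<xi> powi (- k - 1))"
          using r r0 by (simp add: norm_mult norm_power_int power_int_abs)
        also have "\<dots> \<le> cmod (f \<xi>) * (1 / r0)" using S True by (intro mult_left_mono) auto
        finally show ?thesis using True by simp
      qed (use r0 in \<open>auto simp: indicator_def\<close>)
    qed (use r0 in simp)
    finally show ?thesis by simp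
  qed
  show "AE r in lborel. r0 < r \<longrightarrow> (\<forall>k. cmod (circle_coeff (cauchy_transform f) k r) \<le> ?C)"
    using cauchy_transform_circle_coeff_disc[OF f]
  proof eventually_elim
    case (elim r)
    show ?case
    proof (intro impI allI)
      fix k :: int assume r: "r0 < r"
      define S where "S = (if 0 \<le> k then {\<xi>. r < cmod \<xi>} else {\<xi>. cmod \<xi> < r})"
      have rp: "0 < r" using r r0 by simp
      have c: "cmod (circle_coeff (cauchy_transform f) k r) = 2 * pi * cmod (of_real (r powi k) * (LINT \<xi>:S|lborel. f \<xi> * \<xi> powi (- k - 1)))"
        using elim[rule_format, OF rp, of k] by (simp add: S_def norm_mult)
      have "cmod (of_real (r powi k) * (LINT \<xi>:S|lborel. f \<xi> * \<xi> powi (- k - 1))) \<le> (LINT \<xi>|lborel. cmod (f \<xi>)) / r0"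
      proof (rule bd[OF r])
        fix \<xi> assume \<xi>: "\<xi> \<in> S"
        show "r powi k * cmod \<xi> powi (- k - 1) \<le> 1 / r0"
        proof (cases "0 \<le> k")
          case True
          then have x: "r < cmod \<xi>" using \<xi> by (simp add: S_def)
          have "r powi k * cmod \<xi> powi (- k - 1) \<le> cmod \<xi> powi k * cmod \<xi> powi (- k - 1)"
            using x rp True by (intro mult_right_mono power_int_mono) auto
          also have "\<dots> = 1 / cmod \<xi>" using x rp by (simp add: power_int_add[symmetric] power_int_minus divide_inverse)
          also have "\<dots> \<le> 1 / r0" using x r r0 by (intro divide_left_mono mult_pos_pos) auto
          finally show ?thesis .
        next
          case False
          then have x: "cmod \<xi> < r" using \<xi> by (simp add: S_def)
          have "r powi k * cmod \<xi> powi (- k - 1) \<le> r powi k * r powi (- k - 1)"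
            using x rp False by (intro mult_left_mono power_int_mono) auto
          also have "\<dots> = 1 / r" using rp by (simp add: power_int_add[symmetric] power_int_minus divide_inverse)
          also have "\<dots> \<le> 1 / r0" using r r0 by (intro divide_left_mono) auto
          finally show ?thesis .
        qed
      qed
      then have "2 * pi * cmod (of_real (r powi k) * (LINT \<xi>:S|lborel. f \<xi> * \<xi> powi (- k - 1))) \<le> 2 * pi * ((LINT \<xi>|lborel. cmod (f \<xi>)) / r0)"
        by (intro mult_left_mono) auto
      then show "cmod (circle_coeff (cauchy_transform f) k r) \<le> ?C" unfolding c by simp
    qed
  qed
qed

context vorticity
begin

text \<open>The source is \<open>- i/(2 \<pi>)\<close> times \<open>w_star\<close>, and \<open>q\<close>, \<open>r\<close> are the coefficients of the real and the imaginary part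
of \<open>w_star\<close>.\<close>

lemma AE_source_circle:
  "AE s in lborel. r0 < s \<longrightarrow> (\<forall>k. q_coeff \<Psi> w k s + \<i> * r_coeff \<Psi> w k s = \<i> * circle_coeff source k s
     \<and> q_coeff \<Psi> w k s - \<i> * r_coeff \<Psi> w k s = - \<i> * cnj (circle_coeff source (- k) s))"
proof -
  note source(1)[measurable]
  (* a Borel version of w_star *)
  define W where "W \<zeta> = 2 * pi * \<i> * source \<zeta>" for \<zeta>
  have [measurable]: "W \<in> borel_measurable borel" unfolding W_def[abs_def] by measurable
  have "AE \<zeta> in lborel. \<zeta> \<in> E \<longrightarrow> w_star \<zeta> = W \<zeta>"
    using source(3) by eventually_elim (simp add: W_def)
  from AE_polar[OF this] integral_polar(1)[OF source(1) source_integrable]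
  show ?thesis
  proof eventually_elim
    case (elim s)
    show ?case
    proof (intro impI allI)
      fix k assume s: "r0 < s"
      then have sp: "0 < s" using r0 by simp
      have ae: "AE \<phi> in lborel. \<phi> \<in> {0..2*pi} \<longrightarrow> w_star (rcis s \<phi>) = W (rcis s \<phi>)"
        using elim(1)[rule_format, OF sp] by eventually_elim (use s r0 in \<open>simp add: disc_exterior_def\<close>)
      have i: "set_integrable lborel {0..2*pi} (\<lambda>\<phi>. W (rcis s \<phi>))"
        using elim(2) sp by (simp add: W_def)
      have e1: "(2 * of_real pi * \<i> * a + cnj (2 * of_real pi * \<i> * b)) / 2 / (2 * of_real pi) = \<i> / 2 * (a - cnj b)" for a b :: complex
        by (simp add: field_simps)
      have e2: "(2 * of_real pi * \<i> * a - cnj (2 * of_real pi * \<i> * b)) / (2 * \<i>) / (2 * of_real pi) = 1 / 2 * (a + cnj b)" for a b :: complex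
        by (simp add: field_simps)
      have cW: "circle_coeff W k s = 2 * pi * \<i> * circle_coeff source k s" for k
        unfolding circle_coeff_def W_def by (simp add: mult.assoc)
      have "q_coeff \<Psi> w k s = circle_coeff (\<lambda>z. of_real (Re (W z))) k s / (2 * pi)"
        unfolding q_coeff_def
      proof (rule fourier_coeff_eq_circle_coeff)
        show "AE \<phi> in lborel. \<phi> \<in> {0..2*pi} \<longrightarrow> complex_of_real (Re (cnj (deriv \<Psi> (rcis s \<phi>))) * w (\<Psi> (rcis s \<phi>))) = of_real (Re (W (rcis s \<phi>)))"
          using ae
        proof eventually_elim
          case (elim \<phi>)
          show ?case
          proof
            assume "\<phi> \<in> {0..2*pi}"
            with elim have "W (rcis s \<phi>) = w_star (rcis s \<phi>)" by simp
            then show "complex_of_real (Re (cnj (deriv \<Psi> (rcis s \<phi>))) * w (\<Psi> (rcis s \<phi>))) = of_real (Re (W (rcis s \<phi>)))"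
              by (simp add: w_star_def)
          qed
        qed
      qed measurable
      then have q: "q_coeff \<Psi> w k s = \<i> / 2 * (circle_coeff source k s - cnj (circle_coeff source (- k) s))"
        using e1[of "circle_coeff source k s" "circle_coeff source (- k) s"] unfolding circle_coeff_Re_Im(1)[OF i] cW by simp
      have "r_coeff \<Psi> w k s = circle_coeff (\<lambda>z. of_real (Im (W z))) k s / (2 * pi)"
        unfolding r_coeff_def
      proof (rule fourier_coeff_eq_circle_coeff)
        show "AE \<phi> in lborel. \<phi> \<in> {0..2*pi} \<longrightarrow> complex_of_real (Im (cnj (deriv \<Psi> (rcis s \<phi>))) * w (\<Psi> (rcis s \<phi>))) = of_real (Im (W (rcis s \<phi>)))"
          using ae
        proof eventually_elim
          case (elim \<phi>)
          show ?case
          proof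
            assume "\<phi> \<in> {0..2*pi}"
            with elim have "W (rcis s \<phi>) = w_star (rcis s \<phi>)" by simp
            then show "complex_of_real (Im (cnj (deriv \<Psi> (rcis s \<phi>))) * w (\<Psi> (rcis s \<phi>))) = of_real (Im (W (rcis s \<phi>)))"
              by (simp add: w_star_def)
          qed
        qed
      qed measurable
      then have r: "r_coeff \<Psi> w k s = 1 / 2 * (circle_coeff source k s + cnj (circle_coeff source (- k) s))"
        using e2[of "circle_coeff source k s" "circle_coeff source (- k) s"] unfolding circle_coeff_Re_Im(2)[OF i] cW by simp
      show "q_coeff \<Psi> w k s + \<i> * r_coeff \<Psi> w k s = \<i> * circle_coeff source k s
        \<and> q_coeff \<Psi> w k s - \<i> * r_coeff \<Psi> w k s = - \<i> * cnj (circle_coeff source (- k) s)"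
        unfolding q r by (simp add: algebra_simps)
    qed
  qed
qed

text \<open>With \<open>U = C + cnj v_inf\<close>, the polar components are the real part and minus the imaginary part of
\<open>G(z) = U(z) exp (i \<phi>)\<close>. The constant \<open>cnj v_inf\<close> has only a coefficient of order \<open>0\<close>, which the rotation moves to order
\<open>1\<close>; this produces the terms \<open>v_inf_r\<close> and \<open>v_inf_phi\<close>.\<close>

lemma polar_coefficients:
  assumes u: "is_solution \<Omega> r0 \<Psi> w v_inf u"
  shows "AE r in lborel. r0 < r \<longrightarrow> (\<forall>k.
      v_r \<Psi> u k r = 1 / (4 * pi) * (circle_coeff (cauchy_transform source) (k - 1) r + cnj (circle_coeff (cauchy_transform source) (- k - 1) r)) + v_inf_r v_inf k
    \<and> v_phi \<Psi> u k r = \<i> / (4 * pi) * (circle_coeff (cauchy_transform source) (k - 1) r - cnj (circle_coeff (cauchy_transform source) (- k - 1) r)) + v_inf_phi v_inf k)"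
proof -
  note source(1)[measurable]
  define U where "U z = cauchy_transform source z + cnj v_inf" for z
  define G where "G z = U z * sgn z" for z
  have Um [measurable]: "U \<in> borel_measurable borel" unfolding U_def[abs_def] by measurable
  have Gm [measurable]: "G \<in> borel_measurable borel" unfolding G_def[abs_def] sgn_div_norm by measurable
  have "AE \<zeta> in lborel. \<zeta> \<in> E \<longrightarrow> u (\<Psi> \<zeta>) = solution (\<Psi> \<zeta>)"
    using solution_unique[OF u] AE_transfer[of "\<lambda>x. u x = solution x"] by (simp add: AE_completion_iff)
  then have "AE \<zeta> in lborel. \<zeta> \<in> E \<longrightarrow> u (\<Psi> \<zeta>) = cnj (U \<zeta>)"
    by eventually_elim (simp add: U_def solution_\<Psi>)
  from AE_polar[OF this] cauchy_transform_circle_integrable[OF source_integrable]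
  show ?thesis
  proof eventually_elim
    case (elim r)
    show ?case
    proof (intro impI allI)
      fix k assume r: "r0 < r"
      then have rp: "0 < r" using r0 by simp
      have ae: "AE \<phi> in lborel. \<phi> \<in> {0..2*pi} \<longrightarrow> u (\<Psi> (rcis r \<phi>)) = cnj (U (rcis r \<phi>))"
        using elim(1)[rule_format, OF rp] by eventually_elim (use r r0 in \<open>simp add: disc_exterior_def\<close>)
      have iC: "set_integrable lborel {0..2*pi} (\<lambda>\<phi>. cauchy_transform source (rcis r \<phi>))" using elim(2) rp by blast
      have ic: "set_integrable lborel {0..2*pi} (\<lambda>\<phi>::real. c)" for c :: complex
        by (rule borel_integrable_atLeastAtMost'[of 0 "2*pi" "\<lambda>\<phi>. c"]) simp
      have iU: "set_integrable lborel {0..2*pi} (\<lambda>\<phi>. U (rcis r \<phi>))"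
        unfolding U_def by (rule set_integral_add(1)[OF iC ic])
      have sg: "sgn (rcis r \<phi>) = cis \<phi>" for \<phi>
        using rp by (simp add: sgn_div_norm rcis_def scaleR_conv_of_real norm_mult)
      have iG: "set_integrable lborel {0..2*pi} (\<lambda>\<phi>. G (rcis r \<phi>))"
        unfolding G_def sg by (rule set_integrable_mult_continuous[OF iU]) (intro continuous_intros)
      have cU: "circle_coeff U j r = circle_coeff (cauchy_transform source) j r + (if j = 0 then 2 * pi * cnj v_inf else 0)" for j
      proof -
        have "circle_coeff U j r = (LINT \<phi>:{0..2*pi}|lborel. cauchy_transform source (rcis r \<phi>) * exp (- \<i> * of_int j * of_real \<phi>) + cnj v_inf * exp (- \<i> * of_int j * of_real \<phi>))"
          unfolding circle_coeff_def U_def distrib_right ..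
        also have "\<dots> = circle_coeff (cauchy_transform source) j r + (LINT \<phi>:{0..2*pi}|lborel. cnj v_inf * exp (- \<i> * of_int j * of_real \<phi>))"
          unfolding circle_coeff_def
          by (rule set_integral_add(2)[OF set_integrable_mult_continuous[OF iC] set_integrable_mult_continuous[OF ic]]) (intro continuous_intros)+
        also have "(LINT \<phi>:{0..2*pi}|lborel. cnj v_inf * exp (- \<i> * of_int j * of_real \<phi>)) = (if j = 0 then 2 * pi * cnj v_inf else 0)"
          unfolding set_integral_mult_right integral_exp_int by simp
        finally show ?thesis .
      qed
      have cG: "circle_coeff G j r = circle_coeff (cauchy_transform source) (j - 1) r + (if j = 1 then 2 * pi * cnj v_inf else 0)" for j
        using circle_coeff_mult_sgn[OF rp, of U j] cU[of "j - 1"] by (simp add: G_def[abs_def])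
      have parts: "AE \<phi> in lborel. \<phi> \<in> {0..2*pi} \<longrightarrow>
          radial_part (\<lambda>\<zeta>. u (\<Psi> \<zeta>)) (rcis r \<phi>) = Re (G (rcis r \<phi>)) \<and> angular_part (\<lambda>\<zeta>. u (\<Psi> \<zeta>)) (rcis r \<phi>) = - Im (G (rcis r \<phi>))"
        using ae
      proof eventually_elim
        case (elim \<phi>)
        show ?case
        proof
          assume "\<phi> \<in> {0..2*pi}"
          with elim have e: "u (\<Psi> (rcis r \<phi>)) = cnj (U (rcis r \<phi>))" by simp
          have "rcis r \<phi> \<noteq> 0" using rp by (simp add: rcis_def)
          then have "cis (Arg (rcis r \<phi>)) = sgn (rcis r \<phi>)" by (rule cis_Arg)
          then have c: "cos (Arg (rcis r \<phi>)) = Re (sgn (rcis r \<phi>))" and s: "sin (Arg (rcis r \<phi>)) = Im (sgn (rcis r \<phi>))"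
            by (metis cis.sel(1), metis cis.sel(2))
          show "radial_part (\<lambda>\<zeta>. u (\<Psi> \<zeta>)) (rcis r \<phi>) = Re (G (rcis r \<phi>)) \<and> angular_part (\<lambda>\<zeta>. u (\<Psi> \<zeta>)) (rcis r \<phi>) = - Im (G (rcis r \<phi>))"
            unfolding radial_part_def angular_part_def e c s G_def by simp
        qed
      qed
      have "v_r \<Psi> u k r = circle_coeff (\<lambda>z. of_real (Re (G z))) k r / (2 * pi)"
        unfolding v_r_def
      proof (rule fourier_coeff_eq_circle_coeff)
        show "AE \<phi> in lborel. \<phi> \<in> {0..2*pi} \<longrightarrow> complex_of_real (radial_part (\<lambda>\<zeta>. u (\<Psi> \<zeta>)) (rcis r \<phi>)) = of_real (Re (G (rcis r \<phi>)))"
          using parts by eventually_elim simp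
      qed measurable
      then have vr: "v_r \<Psi> u k r = 1 / (4 * pi) * (circle_coeff G k r + cnj (circle_coeff G (- k) r))"
        unfolding circle_coeff_Re_Im(1)[OF iG] by simp
      have "v_phi \<Psi> u k r = circle_coeff (\<lambda>z. - of_real (Im (G z))) k r / (2 * pi)"
        unfolding v_phi_def
      proof (rule fourier_coeff_eq_circle_coeff)
        show "AE \<phi> in lborel. \<phi> \<in> {0..2*pi} \<longrightarrow> complex_of_real (angular_part (\<lambda>\<zeta>. u (\<Psi> \<zeta>)) (rcis r \<phi>)) = - of_real (Im (G (rcis r \<phi>)))"
          using parts by eventually_elim simp
      qed measurable
      also have "circle_coeff (\<lambda>z. - of_real (Im (G z))) k r = - circle_coeff (\<lambda>z. of_real (Im (G z))) k r"
        unfolding circle_coeff_def by (simp add: set_lebesgue_integral_def)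
      finally have vp0: "v_phi \<Psi> u k r = - circle_coeff (\<lambda>z. of_real (Im (G z))) k r / (2 * pi)" .
      have vp: "v_phi \<Psi> u k r = \<i> / (4 * pi) * (circle_coeff G k r - cnj (circle_coeff G (- k) r))"
      proof -
        have "- ((a - b) / (2 * \<i>)) / (2 * of_real pi) = \<i> / (4 * of_real pi) * (a - b)" for a b :: complex
          by (simp add: field_simps)
        then show ?thesis unfolding vp0 circle_coeff_Re_Im(2)[OF iG] by simp
      qed
      consider "k = 1" | "k = -1" | "k \<noteq> 1" "k \<noteq> -1" by blast
      then show "v_r \<Psi> u k r = 1 / (4 * pi) * (circle_coeff (cauchy_transform source) (k - 1) r + cnj (circle_coeff (cauchy_transform source) (- k - 1) r)) + v_inf_r v_inf k
        \<and> v_phi \<Psi> u k r = \<i> / (4 * pi) * (circle_coeff (cauchy_transform source) (k - 1) r - cnj (circle_coeff (cauchy_transform source) (- k - 1) r)) + v_inf_phi v_inf k"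
      proof cases
        case 1
        show ?thesis unfolding vr vp cG unfolding 1 by (simp add: v_inf_r_def v_inf_phi_def complex_eq_iff field_simps)
      next
        case 2
        show ?thesis unfolding vr vp cG unfolding 2 by (simp add: v_inf_r_def v_inf_phi_def complex_eq_iff field_simps)
      next
        case 3
        then have "\<bar>k\<bar> \<noteq> 1" "- k \<noteq> 1" by auto
        then show ?thesis unfolding vr vp cG using 3 by (simp add: v_inf_r_def v_inf_phi_def)
      qed
    qed
  qed
qed

text \<open>The coefficient of \<open>C\<close> of order \<open>k - 1\<close> is an integral over \<open>s > r\<close> for \<open>k \<ge> 1\<close> and over \<open>s < r\<close> for
\<open>k \<le> 0\<close>. At \<open>k = 0\<close> both forms hold, since the total integral of the source vanishes.\<close>

lemma outer_coefficient:
  "AE r in lborel. r0 < r \<longrightarrow> (\<forall>k\<ge>0. circle_coeff (cauchy_transform source) (k - 1) r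
     = - 2 * pi * of_real (r powi (k - 1)) * (LINT s:{r<..}|lborel. of_real (s powi (1 - k)) * circle_coeff source k s))"
  (is "AE r in lborel. r0 < r \<longrightarrow> ?P r")
  and inner_coefficient:
  "AE r in lborel. r0 < r \<longrightarrow> (\<forall>k\<le>0. circle_coeff (cauchy_transform source) (k - 1) r
     = 2 * pi * of_real (r powi (k - 1)) * (LINT s:{r0<..<r}|lborel. of_real (s powi (1 - k)) * circle_coeff source k s))"
  (is "AE r in lborel. r0 < r \<longrightarrow> ?Q r")
proof -
  have z: "circle_coeff source k s = 0" if "0 < s" "s \<le> r0" for k s
    using that by (simp add: circle_coeff_def source_supp)
  have inner: "(LINT s:{0<..<r}|lborel. of_real (s powi m) * circle_coeff source k s) = (LINT s:{r0<..<r}|lborel. of_real (s powi m) * circle_coeff source k s)" for r m k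
    unfolding set_lebesgue_integral_def
    by (rule Bochner_Integration.integral_cong) (use r0 z in \<open>auto simp: indicator_def\<close>)
  have tot: "(LINT s:{r<..}|lborel. of_real s * circle_coeff source 0 s) = - (LINT s:{r0<..<r}|lborel. of_real s * circle_coeff source 0 s)" if r: "r0 < r" for r
  proof -
    have i: "set_integrable lborel S (\<lambda>s. of_real s * circle_coeff source 0 s)" if "S \<in> sets borel" "S \<subseteq> {0<..}" for S
      using radial_integral(2)[OF source_integrable that, of 0 1] by simp
    have "{\<xi>. source \<xi> \<noteq> 0} \<subseteq> {\<xi>. cmod \<xi> \<in> {0<..}}"
      using source_supp r0 by (force simp: not_le[symmetric])
    then have "(LINT \<xi>:{\<xi>. cmod \<xi> \<in> {0<..}}|lborel. source \<xi>) = (LINT \<xi>|lborel. source \<xi>)"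
      unfolding set_lebesgue_integral_def by (intro Bochner_Integration.integral_cong) (auto simp: indicator_def)
    then have "(LINT s:{0<..}|lborel. of_real s * circle_coeff source 0 s) = 0"
      using radial_integral(1)[OF source_integrable _ order_refl, of 0 1] source_moment[of 0] by simp
    also have "{0<..} = {0<..<r} \<union> {r} \<union> {r<..}" using r r0 by auto
    also have "(LINT s:{0<..<r} \<union> {r} \<union> {r<..}|lborel. of_real s * circle_coeff source 0 s)
      = (LINT s:{0<..<r} \<union> {r}|lborel. of_real s * circle_coeff source 0 s) + (LINT s:{r<..}|lborel. of_real s * circle_coeff source 0 s)"
      by (rule set_integral_Un) (use r r0 in \<open>auto intro!: i\<close>)
    also have "(LINT s:{0<..<r} \<union> {r}|lborel. of_real s * circle_coeff source 0 s) = (LINT s:{0<..<r}|lborel. of_real s * circle_coeff source 0 s)"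
      unfolding set_lebesgue_integral_def
    proof (rule integral_cong_AE)
      show "(\<lambda>s. indicator ({0<..<r} \<union> {r}) s *\<^sub>R (of_real s * circle_coeff source 0 s)) \<in> borel_measurable lborel"
        by (rule borel_measurable_integrable[OF i[unfolded set_integrable_def]]) (use r r0 in auto)
      show "(\<lambda>s. indicator {0<..<r} s *\<^sub>R (of_real s * circle_coeff source 0 s)) \<in> borel_measurable lborel"
        by (rule borel_measurable_integrable[OF i[unfolded set_integrable_def]]) (use r r0 in auto)
      show "AE s in lborel. indicator ({0<..<r} \<union> {r}) s *\<^sub>R (of_real s * circle_coeff source 0 s) = indicator {0<..<r} s *\<^sub>R (of_real s * circle_coeff source 0 s)"
        using AE_lborel_singleton[of r] by eventually_elim (simp add: indicator_def)
    qed
    finally show ?thesis using inner[where m=1] by (simp add: eq_neg_iff_add_eq_0 add.commute)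
  qed
  have "AE r in lborel. r0 < r \<longrightarrow> ?P r \<and> ?Q r"
    using cauchy_transform_circle_coeff[OF source_integrable]
  proof eventually_elim
    case (elim r)
    show ?case
    proof (intro impI conjI allI)
      fix k :: int assume r: "r0 < r" and k: "0 \<le> k"
      then have rp: "0 < r" using r0 by simp
      note c = elim[rule_format, OF rp, of "k - 1"]
      show "circle_coeff (cauchy_transform source) (k - 1) r
        = - 2 * pi * of_real (r powi (k - 1)) * (LINT s:{r<..}|lborel. of_real (s powi (1 - k)) * circle_coeff source k s)"
      proof (cases "k = 0")
        case True
        then show ?thesis using c tot[OF r] inner[where m=1] by simp
      next
        case False
        then have "0 \<le> k - 1" using k by simp
        then show ?thesis using c by simp
      qed
    next
      fix k :: int assume r: "r0 < r" and k: "k \<le> 0"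
      then have rp: "0 < r" using r0 by simp
      show "circle_coeff (cauchy_transform source) (k - 1) r
        = 2 * pi * of_real (r powi (k - 1)) * (LINT s:{r0<..<r}|lborel. of_real (s powi (1 - k)) * circle_coeff source k s)"
        using elim[rule_format, OF rp, of "k - 1"] k inner[where m="1 - k"] by simp
    qed
  qed
  then show "AE r in lborel. r0 < r \<longrightarrow> ?P r" "AE r in lborel. r0 < r \<longrightarrow> ?Q r" by auto
qed

lemma radial_integral_q_r:
  assumes S: "S \<in> sets borel" "S \<subseteq> {r0<..}"
  shows "(LINT s:S|lebesgue. of_real (s powi m) * (q_coeff \<Psi> w k s + \<i> * r_coeff \<Psi> w k s))
      = \<i> * (LINT s:S|lborel. of_real (s powi m) * circle_coeff source k s)"
    and "(LINT s:S|lebesgue. of_real (s powi m) * (q_coeff \<Psi> w k s - \<i> * r_coeff \<Psi> w k s))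
      = - \<i> * cnj (LINT s:S|lborel. of_real (s powi m) * circle_coeff source (- k) s)"
proof -
  note source(1)[measurable] S(1)[measurable]
  have [measurable]: "(\<lambda>s::real. s powi m) \<in> borel_measurable borel" unfolding power_int_def by measurable
  have "(LINT s|lebesgue. indicator S s *\<^sub>R (of_real (s powi m) * (q_coeff \<Psi> w k s + \<i> * r_coeff \<Psi> w k s)))
      = (LINT s|lborel. indicator S s *\<^sub>R (\<i> * (of_real (s powi m) * circle_coeff source k s)))"
  proof (rule integrable_lebesgue_iff_borel_version(2))
    show "(\<lambda>s. indicator S s *\<^sub>R (\<i> * (of_real (s powi m) * circle_coeff source k s))) \<in> borel_measurable borel" by measurable
    show "AE s in lborel. indicator S s *\<^sub>R (of_real (s powi m) * (q_coeff \<Psi> w k s + \<i> * r_coeff \<Psi> w k s))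
       = indicator S s *\<^sub>R (\<i> * (of_real (s powi m) * circle_coeff source k s))"
      using AE_source_circle by eventually_elim (use S(2) in \<open>auto simp: indicator_def\<close>)
  qed
  also have "\<dots> = \<i> * (LINT s:S|lborel. of_real (s powi m) * circle_coeff source k s)"
    by (simp only: set_lebesgue_integral_def[symmetric] set_integral_mult_right)
  finally show "(LINT s:S|lebesgue. of_real (s powi m) * (q_coeff \<Psi> w k s + \<i> * r_coeff \<Psi> w k s))
      = \<i> * (LINT s:S|lborel. of_real (s powi m) * circle_coeff source k s)" by (simp add: set_lebesgue_integral_def)
  have "(LINT s|lebesgue. indicator S s *\<^sub>R (of_real (s powi m) * (q_coeff \<Psi> w k s - \<i> * r_coeff \<Psi> w k s)))
      = (LINT s|lborel. cnj (indicator S s *\<^sub>R (\<i> * (of_real (s powi m) * circle_coeff source (- k) s))))"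
  proof (rule integrable_lebesgue_iff_borel_version(2))
    have "(\<lambda>s. indicator S s *\<^sub>R (\<i> * (of_real (s powi m) * circle_coeff source (- k) s))) \<in> borel_measurable borel" by measurable
    then show "(\<lambda>s. cnj (indicator S s *\<^sub>R (\<i> * (of_real (s powi m) * circle_coeff source (- k) s)))) \<in> borel_measurable borel"
      by (rule borel_measurable_continuous_on[of cnj, rotated]) (intro continuous_intros)
    show "AE s in lborel. indicator S s *\<^sub>R (of_real (s powi m) * (q_coeff \<Psi> w k s - \<i> * r_coeff \<Psi> w k s))
       = cnj (indicator S s *\<^sub>R (\<i> * (of_real (s powi m) * circle_coeff source (- k) s)))"
      using AE_source_circle by eventually_elim (use S(2) in \<open>auto simp: indicator_def\<close>)
  qed
  also have "\<dots> = cnj (\<i> * (LINT s:S|lborel. of_real (s powi m) * circle_coeff source (- k) s))"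
    by (simp only: Bochner_Integration.integral_cnj set_lebesgue_integral_def[symmetric] set_integral_mult_right)
  finally show "(LINT s:S|lebesgue. of_real (s powi m) * (q_coeff \<Psi> w k s - \<i> * r_coeff \<Psi> w k s))
      = - \<i> * cnj (LINT s:S|lborel. of_real (s powi m) * circle_coeff source (- k) s)" by (simp add: set_lebesgue_integral_def)
qed

text \<open>For \<open>k \<ge> 0\<close> the coefficient of order \<open>k - 1\<close> is taken in its outer and that of order \<open>- k - 1\<close> in its inner form; for
\<open>k < 0\<close> the roles are exchanged.\<close>

lemma fourier_formulas:
  assumes u: "is_solution \<Omega> r0 \<Psi> w v_inf u"
  shows "AE r in lborel. r0 < r \<longrightarrow>
                 v_r \<Psi> u k r =
                   sign1 k * (\<i> * of_real (r powi (- \<bar>k\<bar> - 1)) / 2) *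
                     (LINT s:{r0<..<r}|lebesgue. of_real (s powi (\<bar>k\<bar> + 1)) *
                        (q_coeff \<Psi> w k s - \<i> * sign1 k * r_coeff \<Psi> w k s))
                   + sign1 k * (\<i> * of_real (r powi (\<bar>k\<bar> - 1)) / 2) *
                     (LINT s:{r<..}|lebesgue. of_real (s powi (- \<bar>k\<bar> + 1)) *
                        (q_coeff \<Psi> w k s + \<i> * sign1 k * r_coeff \<Psi> w k s))
                   + v_inf_r v_inf k \<and>
                 v_phi \<Psi> u k r =
                   of_real (r powi (- \<bar>k\<bar> - 1)) / 2 *
                     (LINT s:{r0<..<r}|lebesgue. of_real (s powi (\<bar>k\<bar> + 1)) *
                        (q_coeff \<Psi> w k s - \<i> * sign1 k * r_coeff \<Psi> w k s))
                   - of_real (r powi (\<bar>k\<bar> - 1)) / 2 *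
                     (LINT s:{r<..}|lebesgue. of_real (s powi (- \<bar>k\<bar> + 1)) *
                        (q_coeff \<Psi> w k s + \<i> * sign1 k * r_coeff \<Psi> w k s))
                   + v_inf_phi v_inf k"
  using polar_coefficients[OF u] outer_coefficient inner_coefficient
proof eventually_elim
  case (elim r)
  show ?case
  proof
    assume r: "r0 < r"
    have S: "{r0<..<r} \<subseteq> {r0<..}" "{r<..} \<subseteq> {r0<..}" using r by auto
    note pc = elim(1)[rule_format, OF r, of k]
    note out = elim(2)[rule_format, OF r] and inn = elim(3)[rule_format, OF r]
    note Q = radial_integral_q_r[OF _ S(1), simplified] radial_integral_q_r[OF _ S(2), simplified]
    show "v_r \<Psi> u k r =
                   sign1 k * (\<i> * of_real (r powi (- \<bar>k\<bar> - 1)) / 2) *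
                     (LINT s:{r0<..<r}|lebesgue. of_real (s powi (\<bar>k\<bar> + 1)) *
                        (q_coeff \<Psi> w k s - \<i> * sign1 k * r_coeff \<Psi> w k s))
                   + sign1 k * (\<i> * of_real (r powi (\<bar>k\<bar> - 1)) / 2) *
                     (LINT s:{r<..}|lebesgue. of_real (s powi (- \<bar>k\<bar> + 1)) *
                        (q_coeff \<Psi> w k s + \<i> * sign1 k * r_coeff \<Psi> w k s))
                   + v_inf_r v_inf k \<and>
                 v_phi \<Psi> u k r =
                   of_real (r powi (- \<bar>k\<bar> - 1)) / 2 *
                     (LINT s:{r0<..<r}|lebesgue. of_real (s powi (\<bar>k\<bar> + 1)) *
                        (q_coeff \<Psi> w k s - \<i> * sign1 k * r_coeff \<Psi> w k s))
                   - of_real (r powi (\<bar>k\<bar> - 1)) / 2 *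
                     (LINT s:{r<..}|lebesgue. of_real (s powi (- \<bar>k\<bar> + 1)) *
                        (q_coeff \<Psi> w k s + \<i> * sign1 k * r_coeff \<Psi> w k s))
                   + v_inf_phi v_inf k"
    proof (cases "0 \<le> k")
      case True
      define A where "A = (LINT s:{r<..}|lborel. complex_of_real (s powi (1 - k)) * circle_coeff source k s)"
      define B where "B = (LINT s:{r0<..<r}|lborel. complex_of_real (s powi (k + 1)) * circle_coeff source (- k) s)"
      have cA: "circle_coeff (cauchy_transform source) (k - 1) r = - 2 * pi * of_real (r powi (k - 1)) * A"
        using out[OF True] by (simp add: A_def)
      have cB: "circle_coeff (cauchy_transform source) (- k - 1) r = 2 * pi * of_real (r powi (- k - 1)) * B"
        using inn[of "- k"] True by (simp add: B_def add.commute)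
      have s: "sign1 k = 1" "\<bar>k\<bar> = k" using True by (auto simp: sign1_def)
      have 1: "(LINT s:{r0<..<r}|lebesgue. of_real (s powi (k + 1)) * (q_coeff \<Psi> w k s - \<i> * r_coeff \<Psi> w k s)) = - \<i> * cnj B"
        unfolding B_def using Q(2)[of "k + 1" k] by simp
      have 2: "(LINT s:{r<..}|lebesgue. of_real (s powi (- k + 1)) * (q_coeff \<Psi> w k s + \<i> * r_coeff \<Psi> w k s)) = \<i> * A"
        unfolding A_def using Q(3)[of "- k + 1" k] by simp
      show ?thesis unfolding s pc[THEN conjunct1] pc[THEN conjunct2] cA cB mult_1_right mult_1_left 1 2 by (simp add: field_simps)
    next
      case False
      define A where "A = (LINT s:{r<..}|lborel. complex_of_real (s powi (k + 1)) * circle_coeff source (- k) s)"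
      define B where "B = (LINT s:{r0<..<r}|lborel. complex_of_real (s powi (1 - k)) * circle_coeff source k s)"
      have cA: "circle_coeff (cauchy_transform source) (- k - 1) r = - 2 * pi * of_real (r powi (- k - 1)) * A"
        using out[of "- k"] False by (simp add: A_def add.commute)
      have cB: "circle_coeff (cauchy_transform source) (k - 1) r = 2 * pi * of_real (r powi (k - 1)) * B"
        using inn[of k] False by (simp add: B_def)
      have s: "sign1 k = - 1" "\<bar>k\<bar> = - k" using False by (auto simp: sign1_def)
      have 1: "(LINT s:{r0<..<r}|lebesgue. of_real (s powi (- k + 1)) * (q_coeff \<Psi> w k s - \<i> * - 1 * r_coeff \<Psi> w k s)) = \<i> * B"
        unfolding B_def using Q(1)[of "- k + 1" k] by simp
      have 2: "(LINT s:{r<..}|lebesgue. of_real (s powi (- (- k) + 1)) * (q_coeff \<Psi> w k s + \<i> * - 1 * r_coeff \<Psi> w k s)) = - \<i> * cnj A"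
        unfolding A_def using Q(4)[of "k + 1" k] by simp
      have 3: "- (- k) - 1 = k - 1" by simp
      show ?thesis unfolding s pc[THEN conjunct1] pc[THEN conjunct2] cA cB 1 2 3 by (simp add: field_simps)
    qed
  qed
qed

lemma L_infinityI:
  assumes c: "c \<in> borel_measurable borel" and ae: "AE r in lborel. r0 < r \<longrightarrow> f r = c r \<and> cmod (c r) \<le> C"
  shows "L_infinity r0 f"
proof -
  have ae': "AE r in lebesgue. r0 < r \<longrightarrow> f r = c r \<and> cmod (c r) \<le> C" by (rule AE_completion[OF ae])
  have "(\<lambda>r. indicator {r0<..} r *\<^sub>R c r) \<in> borel_measurable lebesgue"
    using c by (intro borel_measurable_scaleR borel_measurable_indicator measurable_completion) auto
  moreover have "AE r in lebesgue. indicator {r0<..} r *\<^sub>R c r = indicator {r0<..} r *\<^sub>R f r"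
    using ae' by eventually_elim (auto simp: indicator_def)
  ultimately have "(\<lambda>r. indicator {r0<..} r *\<^sub>R f r) \<in> borel_measurable lebesgue" by (rule borel_measurable_AE)
  then have "f \<in> borel_measurable (lebesgue_on {r0<..})" by (subst borel_measurable_restrict_space_iff) auto
  moreover have "AE r in lebesgue_on {r0<..}. cmod (f r) \<le> C"
    using ae' by (subst AE_restrict_space_iff) (auto elim: eventually_mono)
  ultimately show ?thesis unfolding L_infinity_def by blast
qed

lemma fourier_bounded:
  assumes u: "is_solution \<Omega> r0 \<Psi> w v_inf u"
  shows "L_infinity r0 (v_r \<Psi> u k)" "L_infinity r0 (v_phi \<Psi> u k)"
proof -
  note source(1)[measurable]
  define c where "c j r = circle_coeff (cauchy_transform source) j r" for j r
  have [measurable]: "c j \<in> borel_measurable borel" for j unfolding c_def[abs_def] by measurable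
  have [measurable]: "(\<lambda>r. cnj (c j r)) \<in> borel_measurable borel" for j
    by (rule borel_measurable_continuous_on[of cnj]) (intro continuous_intros, measurable)
  obtain C where C: "AE r in lborel. r0 < r \<longrightarrow> (\<forall>k. cmod (c k r) \<le> C)"
    using cauchy_transform_circle_coeff_bounded[OF source_integrable r0] unfolding c_def by blast
  have bd: "cmod (a * (x + y) + b) \<le> cmod a * (C + C) + cmod b" "cmod (a * (x - y) + b) \<le> cmod a * (C + C) + cmod b"
    if "cmod x \<le> C" "cmod y \<le> C" for a b x y
  proof -
    have "cmod (x + y) \<le> C + C" "cmod (x - y) \<le> C + C"
      using that norm_triangle_ineq[of x y] norm_triangle_ineq4[of x y] by linarith+
    then have "cmod a * cmod (x + y) \<le> cmod a * (C + C)" "cmod a * cmod (x - y) \<le> cmod a * (C + C)"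
      by (intro mult_left_mono; simp)+
    then show "cmod (a * (x + y) + b) \<le> cmod a * (C + C) + cmod b" "cmod (a * (x - y) + b) \<le> cmod a * (C + C) + cmod b"
      using norm_triangle_ineq[of "a * (x + y)" b] norm_triangle_ineq[of "a * (x - y)" b] by (simp_all add: norm_mult)
  qed
  show "L_infinity r0 (v_r \<Psi> u k)"
  proof (rule L_infinityI)
    show "(\<lambda>r. 1 / (4 * pi) * (c (k - 1) r + cnj (c (- k - 1) r)) + v_inf_r v_inf k) \<in> borel_measurable borel" by measurable
    show "AE r in lborel. r0 < r \<longrightarrow> v_r \<Psi> u k r = 1 / (4 * pi) * (c (k - 1) r + cnj (c (- k - 1) r)) + v_inf_r v_inf k
      \<and> cmod (1 / (4 * pi) * (c (k - 1) r + cnj (c (- k - 1) r)) + v_inf_r v_inf k) \<le> cmod (1 / (4 * pi)) * (C + C) + cmod (v_inf_r v_inf k)"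
      using polar_coefficients[OF u, folded c_def] C
    proof eventually_elim
      case (elim r)
      show ?case using elim bd(1)[of "c (k - 1) r" "cnj (c (- k - 1) r)"] by (simp only: complex_mod_cnj) blast
    qed
  qed
  show "L_infinity r0 (v_phi \<Psi> u k)"
  proof (rule L_infinityI)
    show "(\<lambda>r. \<i> / (4 * pi) * (c (k - 1) r - cnj (c (- k - 1) r)) + v_inf_phi v_inf k) \<in> borel_measurable borel" by measurable
    show "AE r in lborel. r0 < r \<longrightarrow> v_phi \<Psi> u k r = \<i> / (4 * pi) * (c (k - 1) r - cnj (c (- k - 1) r)) + v_inf_phi v_inf k
      \<and> cmod (\<i> / (4 * pi) * (c (k - 1) r - cnj (c (- k - 1) r)) + v_inf_phi v_inf k) \<le> cmod (\<i> / (4 * pi)) * (C + C) + cmod (v_inf_phi v_inf k)"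
      using polar_coefficients[OF u, folded c_def] C
    proof eventually_elim
      case (elim r)
      show ?case using elim bd(2)[of "c (k - 1) r" "cnj (c (- k - 1) r)"] by (simp only: complex_mod_cnj) blast
    qed
  qed
qed

end

theorem theorem3p1:
  fixes B \<Omega> :: "complex set" and r0 :: real and \<Phi> \<Psi> :: "complex \<Rightarrow> complex"
    and w :: "complex \<Rightarrow> real" and v_inf :: complex
  assumes "r0 > 0"
    and "sc_domain_piecewise_smooth B"
    and "\<Omega> = - closure B"
    and "exterior_riemann_map \<Omega> r0 \<Phi>"
    and "\<Psi> = inv_into \<Omega> \<Phi>"
    and "(\<lambda>z. complex_of_real (w (\<Psi> z))) \<in> M_space r0 \<Psi> v_inf"
  shows "(\<exists>v. is_solution \<Omega> r0 \<Psi> w v_inf v \<and>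
              (\<forall>u. is_solution \<Omega> r0 \<Psi> w v_inf u \<longrightarrow> (AE x in lebesgue_on \<Omega>. u x = v x))) \<and>
         (\<forall>v. is_solution \<Omega> r0 \<Psi> w v_inf v \<longrightarrow>
           (\<forall>k::int.
              L_infinity r0 (v_r \<Psi> v k) \<and> L_infinity r0 (v_phi \<Psi> v k) \<and>
              (AE r in lebesgue_on {r0<..}.
                 v_r \<Psi> v k r =
                   sign1 k * (\<i> * of_real (r powi (- \<bar>k\<bar> - 1)) / 2) *
                     (LINT s:{r0<..<r}|lebesgue. of_real (s powi (\<bar>k\<bar> + 1)) *
                        (q_coeff \<Psi> w k s - \<i> * sign1 k * r_coeff \<Psi> w k s))
                   + sign1 k * (\<i> * of_real (r powi (\<bar>k\<bar> - 1)) / 2) *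
                     (LINT s:{r<..}|lebesgue. of_real (s powi (- \<bar>k\<bar> + 1)) *
                        (q_coeff \<Psi> w k s + \<i> * sign1 k * r_coeff \<Psi> w k s))
                   + v_inf_r v_inf k \<and>
                 v_phi \<Psi> v k r =
                   of_real (r powi (- \<bar>k\<bar> - 1)) / 2 *
                     (LINT s:{r0<..<r}|lebesgue. of_real (s powi (\<bar>k\<bar> + 1)) *
                        (q_coeff \<Psi> w k s - \<i> * sign1 k * r_coeff \<Psi> w k s))
                   - of_real (r powi (\<bar>k\<bar> - 1)) / 2 *
                     (LINT s:{r<..}|lebesgue. of_real (s powi (- \<bar>k\<bar> + 1)) *
                        (q_coeff \<Psi> w k s + \<i> * sign1 k * r_coeff \<Psi> w k s))
                   + v_inf_phi v_inf k)))"
proof -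
  have "bounded B" using assms(2) by (simp add: sc_domain_piecewise_smooth_def)
  then interpret vorticity \<Omega> r0 \<Phi> \<Psi> w v_inf
    by unfold_locales (use assms in \<open>auto simp: open_Compl\<close>)
  have \<Omega>_sets: "\<Omega> \<inter> space lebesgue \<in> sets lebesgue" using \<Omega> by auto
  have r0_sets: "{r0<..} \<inter> space lebesgue \<in> sets lebesgue" by simp
  have unique: "AE x in lebesgue_on \<Omega>. u x = solution x" if "is_solution \<Omega> r0 \<Psi> w v_inf u" for u
    using solution_unique[OF that] by (simp only: AE_restrict_space_iff[OF \<Omega>_sets])
  show ?thesis
  proof (intro conjI exI[of _ solution] allI impI)
    show "is_solution \<Omega> r0 \<Psi> w v_inf solution" by (rule solution_is_solution)
  next
    fix u assume "is_solution \<Omega> r0 \<Psi> w v_inf u"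
    then show "AE x in lebesgue_on \<Omega>. u x = solution x" by (rule unique)
  next
    fix v k assume v: "is_solution \<Omega> r0 \<Psi> w v_inf v"
    show "L_infinity r0 (v_r \<Psi> v k)" "L_infinity r0 (v_phi \<Psi> v k)" by (rule fourier_bounded[OF v])+
  next
    fix v k assume v: "is_solution \<Omega> r0 \<Psi> w v_inf v"
    show "AE r in lebesgue_on {r0<..}.
                 v_r \<Psi> v k r =
                   sign1 k * (\<i> * of_real (r powi (- \<bar>k\<bar> - 1)) / 2) *
                     (LINT s:{r0<..<r}|lebesgue. of_real (s powi (\<bar>k\<bar> + 1)) *
                        (q_coeff \<Psi> w k s - \<i> * sign1 k * r_coeff \<Psi> w k s))
                   + sign1 k * (\<i> * of_real (r powi (\<bar>k\<bar> - 1)) / 2) *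
                     (LINT s:{r<..}|lebesgue. of_real (s powi (- \<bar>k\<bar> + 1)) *
                        (q_coeff \<Psi> w k s + \<i> * sign1 k * r_coeff \<Psi> w k s))
                   + v_inf_r v_inf k \<and>
                 v_phi \<Psi> v k r =
                   of_real (r powi (- \<bar>k\<bar> - 1)) / 2 *
                     (LINT s:{r0<..<r}|lebesgue. of_real (s powi (\<bar>k\<bar> + 1)) *
                        (q_coeff \<Psi> w k s - \<i> * sign1 k * r_coeff \<Psi> w k s))
                   - of_real (r powi (\<bar>k\<bar> - 1)) / 2 *
                     (LINT s:{r<..}|lebesgue. of_real (s powi (- \<bar>k\<bar> + 1)) *
                        (q_coeff \<Psi> w k s + \<i> * sign1 k * r_coeff \<Psi> w k s))
                   + v_inf_phi v_inf k"
      unfolding AE_restrict_space_iff[OF r0_sets] greaterThan_iff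
      by (rule AE_completion[OF fourier_formulas[OF v]])
  qed
qed

end
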